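(* Let $\Gamma$ be a BM group with data $(A,B,\mathcal R)$ and let $\mathcal A(\Gamma)=C(\Omega)\rtimes\Gamma$ be the full crossed product of its boundary action. Then $\mathcal A(\Gamma)$ is isomorphic to the rank-2 Cuntz–Krieger algebra $\mathcal A$ associated with the alphabet $\mathcal R$ and the transition matrices $M_1,M_2$.
   Context: **BM data and BM groups.** Let $A,B$ be sets with $|A|=m$, $|B|=n$, where $m,n\ge 4$ are even integers, equipped with fixed point free involutions $a\mapsto a^{-1}$, $b\mapsto b^{-1}$. Let $\mathcal R\subset A\times B\times B\times A$ satisfy: (i) if $(a,b,b',a')\in\mathcal R$ then $(a^{-1},b',b,a'^{-1})$, $(a'^{-1},b'^{-1},b^{-1},a^{-1})$ and $(a',b^{-1},b'^{-1},a)$ belong to $\mathcal R$; (ii) the four 4-tuples in (i) are distinct; equivalently $(a,b,b^{-1},a^{-1})\notin\mathcal R$ for all $a\in A,b\in B$; (iii) each of the four projections of $\mathcal R$ to a subproduct of the form $A\times B$ or $B\times A$ is bijective (equivalently, at least one is). The associated BM group is $\Gamma=\langle A\cup B\mid ab=b'a' \text{ whenever }(a,b,b',a')\in\mathcal R\rangle$, where the involutions give inverses in $\Gamma$. The Cayley graph of $\Gamma$ with respect to $A\cup B$ (edges $(g,gx)$) is the 1-skeleton of a product $\Delta=T_1\times T_2$ of homogeneous trees of degrees $m$ and $n$ (edges labelled by $A$ lie in the $T_1$ direction, those labelled by $B$ in the $T_2$ direction), and $\Gamma$ acts on $\Delta$ by left multiplication, freely and transitively on vertices, as a subgroup of $\operatorname{Aut}(T_1)\times\operatorname{Aut}(T_2)$.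 **Boundary.** $\Delta$ is regarded as a square complex. An apartment is a subcomplex isomorphic to the plane tessellated by unit squares; a sector is a $\frac{\pi}{2}$-angled sector (quarter plane with base vertex) in some apartment; two sectors are equivalent if their intersection contains a sector. $\Omega$ is the set of equivalence classes of sectors. Fix a vertex $x$; each $\omega\in\Omega$ has a unique representative sector $[x,\omega)$ based at $x$. $\Omega$ has the compact, totally disconnected Hausdorff topology with basis the sets $\Omega(v)=\{\omega: v\in[x,\omega)\}$, $v$ a vertex (so $\Omega$ is homeomorphic to $\partial T_1\times\partial T_2$). $\Gamma$ acts on $\Omega$, hence on $C(\Omega)$ by $(\alpha_\gamma f)(\omega)=f(\gamma^{-1}\omega)$. **Transition matrices.** $M_1,M_2$ are the $\{0,1\}$-matrices indexed by $\mathcal R\times\mathcal R$ such that, for $r=(a,b,b',a')$ and $s=(c,d,d',c')$: $M_1(s,r)=1$ iff $d'=b$ and $c\ne a^{-1}$; $M_2(s,r)=1$ iff $c=a'$ and $d\neq b^{-1}$. **Words.** For $k\in\mathbb Z^2$ with $k\ge 0$ coordinatewise, let $[0,k]=\{l\in\mathbb Z^2: 0\le l\le k\}$ and let $W_k$ be the set of maps $w:[0,k]\to\mathcal R$ with $M_j(w(l+e_j),w(l))=1$ whenever $l,l+e_j\in[0,k]$, $j=1,2$ ($e_1,e_2$ the standard basis). Let $W=\bigcup_k W_k$; for $w\in W_k$ write $\sigma(w)=k$, $o(w)=w(0)$, $t(w)=w(k)$. If $u\in W_k$, $w\in W_{e_j}$ and $t(u)=o(w)$, then $uw\in W_{k+e_j}$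 denotes the unique word whose restriction to $[0,k]$ is $u$ and whose values at $k,k+e_j$ are $w(0),w(e_j)$. **Rank-2 Cuntz–Krieger algebra.** $\mathcal A$ is the universal $C^*$-algebra generated by partial isometries $\{s_{u,v}: u,v\in W,\ t(u)=t(v)\}$ subject to: $s_{u,v}^*=s_{v,u}$; $s_{u,v}s_{v,w}=s_{u,w}$; $s_{u,v}=\sum_{w\in W,\ \sigma(w)=e_j,\ o(w)=t(u)=t(v)} s_{uw,vw}$ for $j=1,2$; and $s_{u,u}s_{v,v}=0$ for $u,v\in W_0$, $u\ne v$. *)

theory Defs
  imports "HOL-Analysis.Analysis" "HOL-Library.Product_Plus" "HOL-Library.Product_Order"
    "HOL-Algebra.Group"
begin

section \<open>Star-algebras, C*-algebras and enveloping C*-algebras\<close>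

text \<open>
  Complex star-algebras are given on a carrier set and need not be unital.
\<close>

record 'x star_algebra = "'x partial_object" +
  splus :: "'x \<Rightarrow> 'x \<Rightarrow> 'x"
  sscale :: "complex \<Rightarrow> 'x \<Rightarrow> 'x"
  stimes :: "'x \<Rightarrow> 'x \<Rightarrow> 'x"
  sstar :: "'x \<Rightarrow> 'x"

record 'x cstar_algebra = "'x star_algebra" +
  cnorm :: "'x \<Rightarrow> real"

definition sdiff :: "('x, 'm) star_algebra_scheme \<Rightarrow> 'x \<Rightarrow> 'x \<Rightarrow> 'x" where
  "sdiff A x y = splus A x (sscale A (-1) y)"

definition cstar_seminorm :: "('x, 'm) star_algebra_scheme \<Rightarrow> ('x \<Rightarrow> real) \<Rightarrow> bool" where
  "cstar_seminorm A p \<longleftrightarrow>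
     (\<forall>x\<in>carrier A. 0 \<le> p x) \<and>
     (\<forall>x\<in>carrier A. \<forall>y\<in>carrier A. p (splus A x y) \<le> p x + p y) \<and>
     (\<forall>c. \<forall>x\<in>carrier A. p (sscale A c x) = cmod c * p x) \<and>
     (\<forall>x\<in>carrier A. \<forall>y\<in>carrier A. p (stimes A x y) \<le> p x * p y) \<and>
     (\<forall>x\<in>carrier A. p (stimes A (sstar A x) x) = (p x)\<^sup>2)"

text \<open>
  A star-homomorphism from \<open>A\<close> into some C*-algebra that respects the relations
  \<open>x = y\<close>, for \<open>(x, y) \<in> E\<close>, is the same, up to the choice of the target, as a C*-seminorm
  vanishing on all differences \<open>x - y\<close>: one direction pulls back the norm, the other completes.
  The supremum of these seminorms is therefore the supremum of the norms of \<open>x\<close> in all such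
  representations, with no quantification over types.
\<close>

definition universal_seminorm ::
    "('x, 'm) star_algebra_scheme \<Rightarrow> ('x \<times> 'x) set \<Rightarrow> 'x \<Rightarrow> real" where
  "universal_seminorm A E x =
     (SUP p\<in>{p. cstar_seminorm A p \<and> (\<forall>(y, z)\<in>E. p (sdiff A y z) = 0)}. p x)"

definition cauchy_seqs :: "('x, 'm) star_algebra_scheme \<Rightarrow> ('x \<Rightarrow> real) \<Rightarrow> (nat \<Rightarrow> 'x) set" where
  "cauchy_seqs A p = {f. (\<forall>n. f n \<in> carrier A) \<and>
     (\<forall>e>0. \<exists>N. \<forall>m\<ge>N. \<forall>n\<ge>N. p (sdiff A (f m) (f n)) < e)}"

definition cauchy_equiv ::
    "('x, 'm) star_algebra_scheme \<Rightarrow> ('x \<Rightarrow> real) \<Rightarrow> ((nat \<Rightarrow> 'x) \<times> (nat \<Rightarrow> 'x)) set" where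
  "cauchy_equiv A p = {(f, g). f \<in> cauchy_seqs A p \<and> g \<in> cauchy_seqs A p \<and>
     (\<lambda>n. p (sdiff A (f n) (g n))) \<longlonglongrightarrow> 0}"

text \<open>
  The Hausdorff completion of a star-algebra in a C*-seminorm: Cauchy sequences modulo null
  sequences, with the operations defined on representatives.
\<close>

definition cstar_completion ::
    "('x, 'm) star_algebra_scheme \<Rightarrow> ('x \<Rightarrow> real) \<Rightarrow> (nat \<Rightarrow> 'x) set cstar_algebra" where
  "cstar_completion A p =
     \<lparr>carrier = cauchy_seqs A p // cauchy_equiv A p,
      splus = (\<lambda>X Y. \<Union>f\<in>X. \<Union>g\<in>Y. cauchy_equiv A p `` {\<lambda>n. splus A (f n) (g n)}),
      sscale = (\<lambda>c X. \<Union>f\<in>X. cauchy_equiv A p `` {\<lambda>n. sscale A c (f n)}),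
      stimes = (\<lambda>X Y. \<Union>f\<in>X. \<Union>g\<in>Y. cauchy_equiv A p `` {\<lambda>n. stimes A (f n) (g n)}),
      sstar = (\<lambda>X. \<Union>f\<in>X. cauchy_equiv A p `` {\<lambda>n. sstar A (f n)}),
      cnorm = (\<lambda>X. lim (\<lambda>n. p ((SOME f. f \<in> X) n)))\<rparr>"

definition enveloping_cstar_algebra ::
    "('x, 'm) star_algebra_scheme \<Rightarrow> ('x \<times> 'x) set \<Rightarrow> (nat \<Rightarrow> 'x) set cstar_algebra" where
  "enveloping_cstar_algebra A E = cstar_completion A (universal_seminorm A E)"

text \<open>
  For C*-algebras the norm condition is automatic for a bijective star-homomorphism.
\<close>

definition cstar_isomorphic ::
    "('x, 'm) cstar_algebra_scheme \<Rightarrow> ('y, 'n) cstar_algebra_scheme \<Rightarrow> bool" where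
  "cstar_isomorphic A B \<longleftrightarrow> (\<exists>\<phi>. bij_betw \<phi> (carrier A) (carrier B) \<and>
     (\<forall>x\<in>carrier A. \<forall>y\<in>carrier A. \<phi> (splus A x y) = splus B (\<phi> x) (\<phi> y)) \<and>
     (\<forall>c. \<forall>x\<in>carrier A. \<phi> (sscale A c x) = sscale B c (\<phi> x)) \<and>
     (\<forall>x\<in>carrier A. \<forall>y\<in>carrier A. \<phi> (stimes A x y) = stimes B (\<phi> x) (\<phi> y)) \<and>
     (\<forall>x\<in>carrier A. \<phi> (sstar A x) = sstar B (\<phi> x)) \<and>
     (\<forall>x\<in>carrier A. cnorm B (\<phi> x) = cnorm A x))"

text \<open>
  The free non-unital star-algebra on the generators \<open>S\<close>: finitely supported functions on nonempty
  words in the letters \<open>(s, False)\<close>, standing for \<open>s\<close>, and \<open>(s, True)\<close>, standing for the formal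
  adjoint of \<open>s\<close>. There is no formal unit, so relations may make the quotient unital in their
  own way.
\<close>

type_synonym 's free_elt = "('s \<times> bool) list \<Rightarrow> complex"

definition free_star_algebra :: "'s set \<Rightarrow> 's free_elt star_algebra" where
  "free_star_algebra S =
     \<lparr>carrier = {x. finite {z. x z \<noteq> 0} \<and> {z. x z \<noteq> 0} \<subseteq> lists (S \<times> UNIV) - {[]}},
      splus = (\<lambda>x y z. x z + y z),
      sscale = (\<lambda>c x z. c * x z),
      stimes = (\<lambda>x y z. \<Sum>i\<le>length z. x (take i z) * y (drop i z)),
      sstar = (\<lambda>x z. cnj (x (rev (map (\<lambda>(s, b). (s, \<not> b)) z))))\<rparr>"

definition free_gen :: "'s \<Rightarrow> 's free_elt" where
  "free_gen s = (\<lambda>z. if z = [(s, False)] then 1 else 0)"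


section \<open>Full crossed products of topological dynamical systems\<close>

text \<open>
  Functions on the space \<open>X\<close> are represented by their extension by zero outside \<open>topspace X\<close>.
\<close>

definition cont_fun :: "'p topology \<Rightarrow> ('p \<Rightarrow> complex) set" where
  "cont_fun X = {f. continuous_map X euclidean f \<and> (\<forall>\<omega>. \<omega> \<notin> topspace X \<longrightarrow> f \<omega> = 0)}"

text \<open>
  The star-algebra of finitely supported functions \<open>F\<close> from the discrete group \<open>G\<close> to \<open>C(X)\<close>,
  where \<open>X\<close> is compact Hausdorff and \<open>G\<close> acts on it by \<open>act\<close>, so that
  \<open>(\<alpha>\<^sub>g f)(\<omega>) = f(g\<inverse>\<omega>)\<close>. The product is
  \<open>(F * H)(g) = \<Sum>h. F(h) \<alpha>\<^sub>h(H(h\<inverse>g))\<close> and the involution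
  is \<open>F\<^sup>*(g) = \<alpha>\<^sub>g(F(g\<inverse>)\<^sup>*)\<close>.
\<close>

definition algebraic_crossed_product ::
    "('g, 'm) monoid_scheme \<Rightarrow> 'p topology \<Rightarrow> ('g \<Rightarrow> 'p \<Rightarrow> 'p) \<Rightarrow> ('g \<Rightarrow> 'p \<Rightarrow> complex) star_algebra" where
  "algebraic_crossed_product G X act =
     \<lparr>carrier = {F. (\<forall>g\<in>carrier G. F g \<in> cont_fun X) \<and>
                    (\<forall>g. g \<notin> carrier G \<longrightarrow> F g = (\<lambda>_. 0)) \<and>
                    finite {g. F g \<noteq> (\<lambda>_. 0)}},
      splus = (\<lambda>F H g \<omega>. F g \<omega> + H g \<omega>),
      sscale = (\<lambda>c F g \<omega>. c * F g \<omega>),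
      stimes = (\<lambda>F H g \<omega>. if g \<in> carrier G \<and> \<omega> \<in> topspace X
         then \<Sum>h\<in>{h\<in>carrier G. F h \<noteq> (\<lambda>_. 0)}.
                F h \<omega> * H (inv\<^bsub>G\<^esub> h \<otimes>\<^bsub>G\<^esub> g) (act (inv\<^bsub>G\<^esub> h) \<omega>)
         else 0),
      sstar = (\<lambda>F g \<omega>. if g \<in> carrier G \<and> \<omega> \<in> topspace X
         then cnj (F (inv\<^bsub>G\<^esub> g) (act (inv\<^bsub>G\<^esub> g) \<omega>)) else 0)\<rparr>"

text \<open>
  The star-representations of the algebraic crossed product correspond to the covariant
  representations of the system and are automatically bounded, so no \<open>\<ell>\<^sup>1\<close> condition is
  imposed on the seminorms.
\<close>

definition full_crossed_product ::
    "('g, 'm) monoid_scheme \<Rightarrow> 'p topology \<Rightarrow> ('g \<Rightarrow> 'p \<Rightarrow> 'p)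
       \<Rightarrow> (nat \<Rightarrow> 'g \<Rightarrow> 'p \<Rightarrow> complex) set cstar_algebra" where
  "full_crossed_product G X act = enveloping_cstar_algebra (algebraic_crossed_product G X act) {}"


section \<open>BM data and BM groups\<close>

type_synonym ('a, 'b) tile = "'a \<times> 'b \<times> 'b \<times> 'a"

record ('a, 'b) bm_data =
  Aset :: "'a set"
  Bset :: "'b set"
  invA :: "'a \<Rightarrow> 'a"
  invB :: "'b \<Rightarrow> 'b"
  Rset :: "('a, 'b) tile set"

locale BM_data =
  fixes D :: "('a, 'b) bm_data"
  assumes finite_A: "finite (Aset D)"
    and finite_B: "finite (Bset D)"
    and card_A: "card (Aset D) \<ge> 4" "even (card (Aset D))"
    and card_B: "card (Bset D) \<ge> 4" "even (card (Bset D))"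
    and invA: "\<And>a. a \<in> Aset D \<Longrightarrow> invA D a \<in> Aset D \<and> invA D (invA D a) = a \<and> invA D a \<noteq> a"
    and invB: "\<And>b. b \<in> Bset D \<Longrightarrow> invB D b \<in> Bset D \<and> invB D (invB D b) = b \<and> invB D b \<noteq> b"
    and R_subset: "Rset D \<subseteq> Aset D \<times> Bset D \<times> Bset D \<times> Aset D"
    and R_symmetric: "\<And>a b b' a'. (a, b, b', a') \<in> Rset D \<Longrightarrow>
          (invA D a, b', b, invA D a') \<in> Rset D \<and>
          (invA D a', invB D b', invB D b, invA D a) \<in> Rset D \<and>
          (a', invB D b, invB D b', a) \<in> Rset D"
    and R_distinct: "\<And>a b b' a'. (a, b, b', a') \<in> Rset D \<Longrightarrow>
          distinct [(a, b, b', a'),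
                    (invA D a, b', b, invA D a'),
                    (invA D a', invB D b', invB D b, invA D a),
                    (a', invB D b, invB D b', a)]"
    and R_projections:
          "bij_betw (\<lambda>(a, b, b', a'). (a, b)) (Rset D) (Aset D \<times> Bset D)"
          "bij_betw (\<lambda>(a, b, b', a'). (a, b')) (Rset D) (Aset D \<times> Bset D)"
          "bij_betw (\<lambda>(a, b, b', a'). (b, a')) (Rset D) (Bset D \<times> Aset D)"
          "bij_betw (\<lambda>(a, b, b', a'). (b', a')) (Rset D) (Bset D \<times> Aset D)"

definition letters :: "('a, 'b) bm_data \<Rightarrow> ('a + 'b) set" where
  "letters D = Aset D <+> Bset D"

definition letter_inv :: "('a, 'b) bm_data \<Rightarrow> 'a + 'b \<Rightarrow> 'a + 'b" where
  "letter_inv D = map_sum (invA D) (invB D)"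

text \<open>
  The generating set is closed under formal inversion, so the group presented by
  \<open>\<langle>A \<union> B | ab = b'a'\<rangle>\<close> consists of the words in \<open>A \<union> B\<close> modulo the congruence
  generated by \<open>x x\<inverse> = 1\<close> and \<open>a b = b' a'\<close>.
\<close>

inductive bm_cong :: "('a, 'b) bm_data \<Rightarrow> ('a + 'b) list \<Rightarrow> ('a + 'b) list \<Rightarrow> bool" for D where
  refl: "u \<in> lists (letters D) \<Longrightarrow> bm_cong D u u"
| sym: "bm_cong D u v \<Longrightarrow> bm_cong D v u"
| trans: "bm_cong D u v \<Longrightarrow> bm_cong D v w \<Longrightarrow> bm_cong D u w"
| cancel: "x \<in> letters D \<Longrightarrow> u \<in> lists (letters D) \<Longrightarrow> v \<in> lists (letters D) \<Longrightarrow>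
    bm_cong D (u @ [x, letter_inv D x] @ v) (u @ v)"
| tile: "(a, b, b', a') \<in> Rset D \<Longrightarrow> u \<in> lists (letters D) \<Longrightarrow> v \<in> lists (letters D) \<Longrightarrow>
    bm_cong D (u @ [Inl a, Inr b] @ v) (u @ [Inr b', Inl a'] @ v)"

type_synonym ('a, 'b) bm_elt = "('a + 'b) list set"

definition bm_class :: "('a, 'b) bm_data \<Rightarrow> ('a + 'b) list \<Rightarrow> ('a, 'b) bm_elt" where
  "bm_class D u = {(u, v). bm_cong D u v} `` {u}"

definition bm_group :: "('a, 'b) bm_data \<Rightarrow> ('a, 'b) bm_elt monoid" where
  "bm_group D =
     \<lparr>carrier = lists (letters D) // {(u, v). bm_cong D u v},
      mult = (\<lambda>X Y. \<Union>u\<in>X. \<Union>v\<in>Y. bm_class D (u @ v)),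
      one = bm_class D []\<rparr>"

definition bm_gen :: "('a, 'b) bm_data \<Rightarrow> 'a + 'b \<Rightarrow> ('a, 'b) bm_elt" where
  "bm_gen D x = bm_class D [x]"


section \<open>The square complex and its boundary\<close>

text \<open>
  Cells (vertices, edges, squares) are identified with their sets of vertices, and a subcomplex
  with its set of cells. The complex has the Cayley graph of \<open>\<Gamma>\<close> as 1-skeleton; its squares
  are those with vertices \<open>g\<close>, \<open>ga\<close>, \<open>gb'\<close> and \<open>gab = gb'a'\<close> for \<open>(a, b, b', a') \<in> \<R>\<close>. Since the
  1-skeleton is that of \<open>T\<^sub>1 \<times> T\<^sub>2\<close>, these are exactly the products of an edge of \<open>T\<^sub>1\<close> and
  an edge of \<open>T\<^sub>2\<close>.
\<close>

definition complex_cells :: "('a, 'b) bm_data \<Rightarrow> ('a, 'b) bm_elt set set" where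
  "complex_cells D =
     {{g} | g. g \<in> carrier (bm_group D)} \<union>
     {{g, g \<otimes>\<^bsub>bm_group D\<^esub> bm_gen D x} | g x. g \<in> carrier (bm_group D) \<and> x \<in> letters D} \<union>
     {{g, g \<otimes>\<^bsub>bm_group D\<^esub> bm_gen D (Inl a), g \<otimes>\<^bsub>bm_group D\<^esub> bm_gen D (Inr b'),
       g \<otimes>\<^bsub>bm_group D\<^esub> bm_gen D (Inl a) \<otimes>\<^bsub>bm_group D\<^esub> bm_gen D (Inr b)} | g a b b' a'.
       g \<in> carrier (bm_group D) \<and> (a, b, b', a') \<in> Rset D}"

definition plane_cells :: "(int \<times> int) set set" where
  "plane_cells = {{l..l + d} | l d. d \<in> {(0, 0), (1, 0), (0, 1), (1, 1)}}"

definition quadrant_cells :: "(int \<times> int) set set" where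
  "quadrant_cells = {c \<in> plane_cells. c \<subseteq> {(0, 0)..}}"

text \<open>
  An isomorphism of the tessellated plane onto a subcomplex (an apartment) is an injective map on
  vertices carrying cells to cells. Since it may be composed with any automorphism of
  the plane, every quarter plane of an apartment is the image of the standard one
  under some such map.
\<close>

definition apartment_map :: "('a, 'b) bm_data \<Rightarrow> (int \<times> int \<Rightarrow> ('a, 'b) bm_elt) \<Rightarrow> bool" where
  "apartment_map D \<phi> \<longleftrightarrow> inj \<phi> \<and> (\<forall>c\<in>plane_cells. \<phi> ` c \<in> complex_cells D)"

definition sector_at :: "('a, 'b) bm_data \<Rightarrow> ('a, 'b) bm_elt \<Rightarrow> ('a, 'b) bm_elt set set \<Rightarrow> bool" where
  "sector_at D v S \<longleftrightarrow>
     (\<exists>\<phi>. apartment_map D \<phi> \<and> \<phi> (0, 0) = v \<and> S = image \<phi> ` quadrant_cells)"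

definition sectors :: "('a, 'b) bm_data \<Rightarrow> ('a, 'b) bm_elt set set set" where
  "sectors D = {S. \<exists>v. sector_at D v S}"

definition sector_equiv ::
    "('a, 'b) bm_data \<Rightarrow> (('a, 'b) bm_elt set set \<times> ('a, 'b) bm_elt set set) set" where
  "sector_equiv D = {(S, S'). S \<in> sectors D \<and> S' \<in> sectors D \<and> (\<exists>S''\<in>sectors D. S'' \<subseteq> S \<inter> S')}"

type_synonym ('a, 'b) bm_end = "('a, 'b) bm_elt set set set"

definition boundary :: "('a, 'b) bm_data \<Rightarrow> ('a, 'b) bm_end set" where
  "boundary D = sectors D // sector_equiv D"

definition rep_sector ::
    "('a, 'b) bm_data \<Rightarrow> ('a, 'b) bm_elt \<Rightarrow> ('a, 'b) bm_end \<Rightarrow> ('a, 'b) bm_elt set set" where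
  "rep_sector D x \<omega> = (THE S. S \<in> \<omega> \<and> sector_at D x S)"

definition boundary_basic ::
    "('a, 'b) bm_data \<Rightarrow> ('a, 'b) bm_elt \<Rightarrow> ('a, 'b) bm_elt \<Rightarrow> ('a, 'b) bm_end set" where
  "boundary_basic D x v = {\<omega> \<in> boundary D. {v} \<in> rep_sector D x \<omega>}"

definition boundary_topology ::
    "('a, 'b) bm_data \<Rightarrow> ('a, 'b) bm_elt \<Rightarrow> ('a, 'b) bm_end topology" where
  "boundary_topology D x = topology_generated_by (boundary_basic D x ` carrier (bm_group D))"

definition boundary_action ::
    "('a, 'b) bm_data \<Rightarrow> ('a, 'b) bm_elt \<Rightarrow> ('a, 'b) bm_end \<Rightarrow> ('a, 'b) bm_end" where
  "boundary_action D g = image (image (image (\<lambda>h. g \<otimes>\<^bsub>bm_group D\<^esub> h)))"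

definition boundary_crossed_product ::
    "('a, 'b) bm_data \<Rightarrow> ('a, 'b) bm_elt
       \<Rightarrow> (nat \<Rightarrow> ('a, 'b) bm_elt \<Rightarrow> ('a, 'b) bm_end \<Rightarrow> complex) set cstar_algebra" where
  "boundary_crossed_product D x =
     full_crossed_product (bm_group D) (boundary_topology D x) (boundary_action D)"


section \<open>Transition matrices and rank-2 Cuntz--Krieger algebras\<close>

definition trans1 :: "('a, 'b) bm_data \<Rightarrow> ('a, 'b) tile \<Rightarrow> ('a, 'b) tile \<Rightarrow> nat" where
  "trans1 D = (\<lambda>(c, d, d', c') (a, b, b', a'). if d' = b \<and> c \<noteq> invA D a then 1 else 0)"

definition trans2 :: "('a, 'b) bm_data \<Rightarrow> ('a, 'b) tile \<Rightarrow> ('a, 'b) tile \<Rightarrow> nat" where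
  "trans2 D = (\<lambda>(c, d, d', c') (a, b, b', a'). if c = a' \<and> d \<noteq> invB D b then 1 else 0)"

text \<open>
  A word is a pair \<open>(k, w)\<close> of its shape \<open>\<sigma>(w) = k\<close> and the map \<open>w\<close>, made extensional outside
  \<open>[0, k]\<close>. Matrix entries are indexed as in \<open>M s r\<close>, with \<open>r\<close> followed by \<open>s\<close>.
\<close>

type_synonym 'r ck_word = "(nat \<times> nat) \<times> (nat \<times> nat \<Rightarrow> 'r)"

definition ck_words_of_shape ::
    "'r set \<Rightarrow> ('r \<Rightarrow> 'r \<Rightarrow> nat) \<Rightarrow> ('r \<Rightarrow> 'r \<Rightarrow> nat) \<Rightarrow> nat \<times> nat \<Rightarrow> 'r ck_word set" where
  "ck_words_of_shape R M1 M2 k = {k} \<times> {w \<in> {(0, 0)..k} \<rightarrow>\<^sub>E R.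
     \<forall>l. (l + (1, 0) \<le> k \<longrightarrow> M1 (w (l + (1, 0))) (w l) = 1) \<and>
         (l + (0, 1) \<le> k \<longrightarrow> M2 (w (l + (0, 1))) (w l) = 1)}"

definition ck_words ::
    "'r set \<Rightarrow> ('r \<Rightarrow> 'r \<Rightarrow> nat) \<Rightarrow> ('r \<Rightarrow> 'r \<Rightarrow> nat) \<Rightarrow> 'r ck_word set" where
  "ck_words R M1 M2 = (\<Union>k. ck_words_of_shape R M1 M2 k)"

definition word_shape :: "'r ck_word \<Rightarrow> nat \<times> nat" where
  "word_shape w = fst w"

definition word_origin :: "'r ck_word \<Rightarrow> 'r" where
  "word_origin w = snd w (0, 0)"

definition word_end :: "'r ck_word \<Rightarrow> 'r" where
  "word_end w = snd w (word_shape w)"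

text \<open>
  The product \<open>uw\<close>, used only when \<open>\<sigma>(w)\<close> is a standard basis vector and \<open>t(u) = o(w)\<close>.
\<close>

definition word_mult ::
    "'r set \<Rightarrow> ('r \<Rightarrow> 'r \<Rightarrow> nat) \<Rightarrow> ('r \<Rightarrow> 'r \<Rightarrow> nat) \<Rightarrow> 'r ck_word \<Rightarrow> 'r ck_word \<Rightarrow> 'r ck_word" where
  "word_mult R M1 M2 u w = (THE x. x \<in> ck_words_of_shape R M1 M2 (word_shape u + word_shape w) \<and>
     (\<forall>l\<in>{(0, 0)..word_shape u}. snd x l = snd u l) \<and>
     snd x (word_shape u) = word_origin w \<and>
     snd x (word_shape u + word_shape w) = word_end w)"

definition ck_generators ::
    "'r set \<Rightarrow> ('r \<Rightarrow> 'r \<Rightarrow> nat) \<Rightarrow> ('r \<Rightarrow> 'r \<Rightarrow> nat) \<Rightarrow> ('r ck_word \<times> 'r ck_word) set" where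
  "ck_generators R M1 M2 = {(u, v). u \<in> ck_words R M1 M2 \<and> v \<in> ck_words R M1 M2 \<and>
     word_end u = word_end v}"

definition ck_free ::
    "'r set \<Rightarrow> ('r \<Rightarrow> 'r \<Rightarrow> nat) \<Rightarrow> ('r \<Rightarrow> 'r \<Rightarrow> nat)
       \<Rightarrow> ('r ck_word \<times> 'r ck_word) free_elt star_algebra" where
  "ck_free R M1 M2 = free_star_algebra (ck_generators R M1 M2)"

text \<open>
  A pair \<open>(x, y)\<close> stands for the relation \<open>x = y\<close>. The first set says that the generators are
  partial isometries.
\<close>

definition ck_relations ::
    "'r set \<Rightarrow> ('r \<Rightarrow> 'r \<Rightarrow> nat) \<Rightarrow> ('r \<Rightarrow> 'r \<Rightarrow> nat)
       \<Rightarrow> (('r ck_word \<times> 'r ck_word) free_elt \<times> ('r ck_word \<times> 'r ck_word) free_elt) set" where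
  "ck_relations R M1 M2 =
    (let F = ck_free R M1 M2; S = ck_generators R M1 M2; W = ck_words R M1 M2;
         s = (\<lambda>u v. free_gen (u, v))
     in {(stimes F (stimes F (s u v) (sstar F (s u v))) (s u v), s u v) | u v. (u, v) \<in> S} \<union>
        {(sstar F (s u v), s v u) | u v. (u, v) \<in> S} \<union>
        {(stimes F (s u v) (s v w), s u w) | u v w. (u, v) \<in> S \<and> (v, w) \<in> S} \<union>
        {(s u v,
          (\<lambda>z. \<Sum>w\<in>{w \<in> W. word_shape w = e \<and> word_origin w = word_end u}.
                 s (word_mult R M1 M2 u w) (word_mult R M1 M2 v w) z)) | u v e.
          (u, v) \<in> S \<and> e \<in> {(1, 0), (0, 1)}} \<union>
        {(stimes F (s u u) (s v v), (\<lambda>_. 0)) | u v.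
          u \<in> ck_words_of_shape R M1 M2 (0, 0) \<and> v \<in> ck_words_of_shape R M1 M2 (0, 0) \<and> u \<noteq> v})"

definition rank2_cuntz_krieger ::
    "'r set \<Rightarrow> ('r \<Rightarrow> 'r \<Rightarrow> nat) \<Rightarrow> ('r \<Rightarrow> 'r \<Rightarrow> nat)
       \<Rightarrow> (nat \<Rightarrow> ('r ck_word \<times> 'r ck_word) free_elt) set cstar_algebra" where
  "rank2_cuntz_krieger R M1 M2 =
     enveloping_cstar_algebra (ck_free R M1 M2) (ck_relations R M1 M2)"

end

theory Submission
  imports Defs "HOL-Computational_Algebra.Polynomial"
begin

text \<open>
  An end of the product of trees is encoded as a pair of infinite reduced sequences, one over \<open>A\<close> and one over \<open>B\<close>,
  on which \<open>\<Gamma>\<close> acts by moving letters through tiles. From a vertex, the sector towards an end \<open>z\<close> is filled by tiles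
  one after the other, each determined by its bottom and left edges, and a finite rectangle of these tiles is a
  word. Put at the base vertex \<open>x\<close>, a word \<open>u\<close> cuts out a cylinder set \<open>U u\<close> of ends. Since \<open>\<Gamma>\<close> is simply transitive on
  vertices, there is for words \<open>u\<close>, \<open>v\<close> with the same last tile exactly one \<open>\<gamma> = quot u v\<close> that carries the last tile
  of \<open>v\<close> to that of \<open>u\<close>, and because the last tile determines the rectangle behind it, \<open>U u = \<gamma> U v\<close>. Hence
  \<open>s\<^bsub>u,v\<^esub> \<mapsto> V (u, v)\<close>, the indicator function of \<open>U u\<close> placed at \<open>\<gamma>\<close>, respects the relations of the Cuntz--Krieger
  algebra, and it remains to see that the map of enveloping C*-algebras is an isomorphism.

  Both sides are Hausdorff completions in a supremum of C*-seminorms, so it suffices to compare seminorms, and the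
  \<open>\<ell>\<^sup>1\<close>-norm \<open>N(F) = \<Sum>\<^bsub>\<gamma>\<^esub> \<parallel>F \<gamma>\<parallel>\<close> of the algebraic crossed product serves as a yardstick: every C*-seminorm there
  is at most \<open>N\<close> (\<open>cstar_seminorm_le_l1\<close>), and the image of the free algebra is \<open>N\<close>-dense (\<open>free_lift_dense\<close>), because
  functions constant on the cylinder sets \<open>U u\<close> with \<open>quot u v = \<gamma>\<close> and \<open>v\<close> large approximate every continuous function.
  By \<open>enveloping_iso_of_dominated\<close> everything follows from one estimate, \<open>seminorm_dominated\<close>: a C*-seminorm on the free
  algebra that kills the relations is at most \<open>N\<close> of the image.

  For this estimate an element is rewritten, modulo the relations, as a combination of generators \<open>s\<^bsub>u,v\<^esub>\<close>
  in which all words \<open>v\<close> have one shape. The part with \<open>quot u v = \<gamma>\<close> is then a sum of partial isometries with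
  pairwise orthogonal domains and ranges, so its seminorm is at most the largest coefficient, and
  the coefficients are values at disjoint cylinder sets of the image at \<open>\<gamma>\<close>. This needs the orthogonality of
  \<open>s\<^bsub>u,u\<^esub>\<close> and \<open>s\<^bsub>v,v\<^esub>\<close> for distinct words of any one shape, while the relations postulate it for shape \<open>0\<close>
  only. The rest is a property of C*-seminorms: the projections of the prolongations of \<open>u\<close> add up to the
  projection of \<open>u\<close>, and projections whose sum is a projection are mutually orthogonal
  (\<open>projections_orthogonal\<close>). With a seminorm on a non-complete algebra there is no positivity to invoke, so this rests on
  the fact that the unit is an extreme point of the unit ball, proved by a polynomial identity.
\<close>

section \<open>Star-algebras on a carrier and their C*-seminorms\<close>

locale star_alg =
  fixes A :: "('x, 'm) star_algebra_scheme"
  assumes carrier_nonempty: "carrier A \<noteq> {}"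
    and add_closed [simp]: "\<lbrakk>x \<in> carrier A; y \<in> carrier A\<rbrakk> \<Longrightarrow> splus A x y \<in> carrier A"
    and scale_closed [simp]: "x \<in> carrier A \<Longrightarrow> sscale A c x \<in> carrier A"
    and mult_closed [simp]: "\<lbrakk>x \<in> carrier A; y \<in> carrier A\<rbrakk> \<Longrightarrow> stimes A x y \<in> carrier A"
    and star_closed [simp]: "x \<in> carrier A \<Longrightarrow> sstar A x \<in> carrier A"
    and add_assoc: "\<lbrakk>x \<in> carrier A; y \<in> carrier A; z \<in> carrier A\<rbrakk>
      \<Longrightarrow> splus A (splus A x y) z = splus A x (splus A y z)"
    and add_comm: "\<lbrakk>x \<in> carrier A; y \<in> carrier A\<rbrakk> \<Longrightarrow> splus A x y = splus A y x"
    and add_zero: "\<lbrakk>x \<in> carrier A; y \<in> carrier A\<rbrakk> \<Longrightarrow> splus A x (sscale A 0 y) = x"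
    and scale_one: "x \<in> carrier A \<Longrightarrow> sscale A 1 x = x"
    and scale_scale: "x \<in> carrier A \<Longrightarrow> sscale A c (sscale A d x) = sscale A (c * d) x"
    and scale_add: "\<lbrakk>x \<in> carrier A; y \<in> carrier A\<rbrakk>
      \<Longrightarrow> sscale A c (splus A x y) = splus A (sscale A c x) (sscale A c y)"
    and add_scale: "x \<in> carrier A \<Longrightarrow> sscale A (c + d) x = splus A (sscale A c x) (sscale A d x)"
    and add_mult: "\<lbrakk>x \<in> carrier A; y \<in> carrier A; z \<in> carrier A\<rbrakk>
      \<Longrightarrow> stimes A (splus A x y) z = splus A (stimes A x z) (stimes A y z)"
    and mult_add: "\<lbrakk>x \<in> carrier A; y \<in> carrier A; z \<in> carrier A\<rbrakk>
      \<Longrightarrow> stimes A z (splus A x y) = splus A (stimes A z x) (stimes A z y)"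
    and scale_mult: "\<lbrakk>x \<in> carrier A; y \<in> carrier A\<rbrakk>
      \<Longrightarrow> stimes A (sscale A c x) y = sscale A c (stimes A x y)"
    and mult_scale: "\<lbrakk>x \<in> carrier A; y \<in> carrier A\<rbrakk>
      \<Longrightarrow> stimes A x (sscale A c y) = sscale A c (stimes A x y)"
    and star_add: "\<lbrakk>x \<in> carrier A; y \<in> carrier A\<rbrakk>
      \<Longrightarrow> sstar A (splus A x y) = splus A (sstar A x) (sstar A y)"
    and star_scale: "x \<in> carrier A \<Longrightarrow> sstar A (sscale A c x) = sscale A (cnj c) (sstar A x)"
    and star_star: "x \<in> carrier A \<Longrightarrow> sstar A (sstar A x) = x"
begin

lemma diff_closed [simp]: "\<lbrakk>x \<in> carrier A; y \<in> carrier A\<rbrakk> \<Longrightarrow> sdiff A x y \<in> carrier A"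
  by (simp add: sdiff_def)

lemma neg_add: "y \<in> carrier A \<Longrightarrow> splus A (sscale A (-1) y) y = sscale A 0 y"
  using add_scale[of y "-1" 1] by (simp add: scale_one)

lemma diff_self: "x \<in> carrier A \<Longrightarrow> sdiff A x x = sscale A 0 x"
  using add_scale[of x 1 "-1"] by (simp add: scale_one sdiff_def)

lemma zero_add: "\<lbrakk>x \<in> carrier A; y \<in> carrier A\<rbrakk> \<Longrightarrow> splus A (sscale A 0 y) x = x"
  by (metis add_comm add_zero scale_closed)

lemma diff_telescope:
  assumes [simp]: "x \<in> carrier A" "y \<in> carrier A" "z \<in> carrier A"
  shows "splus A (sdiff A x y) (sdiff A y z) = sdiff A x z"
proof -
  have "splus A (sdiff A x y) (sdiff A y z)
      = splus A x (splus A (splus A (sscale A (-1) y) y) (sscale A (-1) z))"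
    by (simp add: sdiff_def add_assoc)
  then show ?thesis by (simp add: neg_add zero_add sdiff_def)
qed

lemma diff_add_cancel:
  assumes [simp]: "x \<in> carrier A" "y \<in> carrier A"
  shows "splus A (sdiff A x y) y = x"
  by (simp add: sdiff_def add_assoc neg_add add_zero)

lemma add_diff_add:
  assumes [simp]: "x \<in> carrier A" "y \<in> carrier A" "x' \<in> carrier A" "y' \<in> carrier A"
  shows "sdiff A (splus A x y) (splus A x' y') = splus A (sdiff A x x') (sdiff A y y')"
proof -
  have "splus A y (splus A (sscale A (-1) x') (sscale A (-1) y'))
      = splus A (sscale A (-1) x') (splus A y (sscale A (-1) y'))"
    by (metis add_assoc add_comm assms(2,3,4) scale_closed)
  then show ?thesis by (simp add: sdiff_def add_assoc scale_add)
qed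

lemma scale_diff:
  assumes [simp]: "x \<in> carrier A" "y \<in> carrier A"
  shows "sscale A c (sdiff A x y) = sdiff A (sscale A c x) (sscale A c y)"
  by (simp add: sdiff_def scale_add scale_scale)

lemma diff_swap:
  assumes [simp]: "x \<in> carrier A" "y \<in> carrier A"
  shows "sdiff A y x = sscale A (-1) (sdiff A x y)"
  by (simp add: sdiff_def scale_add scale_scale scale_one add_comm)

lemma star_diff:
  assumes [simp]: "x \<in> carrier A" "y \<in> carrier A"
  shows "sstar A (sdiff A x y) = sdiff A (sstar A x) (sstar A y)"
  by (simp add: sdiff_def star_add star_scale)

lemma mult_diff_mult:
  assumes [simp]: "x \<in> carrier A" "y \<in> carrier A" "x' \<in> carrier A" "y' \<in> carrier A"
  shows "sdiff A (stimes A x y) (stimes A x' y')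
    = splus A (stimes A (sdiff A x x') y) (stimes A x' (sdiff A y y'))"
proof -
  have "stimes A (sdiff A x x') y = sdiff A (stimes A x y) (stimes A x' y)"
    by (simp add: sdiff_def add_mult scale_mult)
  moreover have "stimes A x' (sdiff A y y') = sdiff A (stimes A x' y) (stimes A x' y')"
    by (simp add: sdiff_def mult_add mult_scale)
  ultimately show ?thesis by (simp add: diff_telescope)
qed

end

text \<open>
  For a norm that is only used to measure approximation, such as the \<open>\<ell>\<^sup>1\<close>-norm of a
  crossed product, the C*-identity is too much to ask. What completions and limits need is this.
\<close>

locale star_seminorm = star_alg A for A :: "('x, 'm) star_algebra_scheme" +
  fixes p :: "'x \<Rightarrow> real"
  assumes nonneg: "x \<in> carrier A \<Longrightarrow> 0 \<le> p x"
    and triangle: "\<lbrakk>x \<in> carrier A; y \<in> carrier A\<rbrakk> \<Longrightarrow> p (splus A x y) \<le> p x + p y"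
    and homogeneous: "x \<in> carrier A \<Longrightarrow> p (sscale A c x) = cmod c * p x"
    and submult: "\<lbrakk>x \<in> carrier A; y \<in> carrier A\<rbrakk> \<Longrightarrow> p (stimes A x y) \<le> p x * p y"
    and star_isometric: "x \<in> carrier A \<Longrightarrow> p (sstar A x) = p x"
begin

lemma dist_self: "x \<in> carrier A \<Longrightarrow> p (sdiff A x x) = 0"
  by (simp add: diff_self homogeneous)

lemma dist_triangle:
  assumes "x \<in> carrier A" "y \<in> carrier A" "z \<in> carrier A"
  shows "p (sdiff A x z) \<le> p (sdiff A x y) + p (sdiff A y z)"
  using triangle[of "sdiff A x y" "sdiff A y z"] assms by (simp add: diff_telescope)

lemma dist_comm: "\<lbrakk>x \<in> carrier A; y \<in> carrier A\<rbrakk> \<Longrightarrow> p (sdiff A y x) = p (sdiff A x y)"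
  by (metis diff_swap diff_closed homogeneous norm_minus_cancel norm_one mult_1)

lemma norm_diff_le:
  assumes "x \<in> carrier A" "y \<in> carrier A"
  shows "\<bar>p x - p y\<bar> \<le> p (sdiff A x y)"
proof -
  have "p x \<le> p (sdiff A x y) + p y" "p y \<le> p (sdiff A y x) + p x"
    using triangle[of "sdiff A x y" y] triangle[of "sdiff A y x" x] assms
    by (simp_all add: diff_add_cancel)
  then show ?thesis using dist_comm[OF assms] by linarith
qed

lemma dist_add:
  assumes "x \<in> carrier A" "y \<in> carrier A" "x' \<in> carrier A" "y' \<in> carrier A"
  shows "p (sdiff A (splus A x y) (splus A x' y')) \<le> p (sdiff A x x') + p (sdiff A y y')"
  using triangle[of "sdiff A x x'" "sdiff A y y'"] assms by (simp add: add_diff_add)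

lemma dist_scale:
  assumes "x \<in> carrier A" "y \<in> carrier A"
  shows "p (sdiff A (sscale A c x) (sscale A c y)) = cmod c * p (sdiff A x y)"
  using assms by (metis scale_diff homogeneous diff_closed)

lemma dist_star:
  assumes "x \<in> carrier A" "y \<in> carrier A"
  shows "p (sdiff A (sstar A x) (sstar A y)) = p (sdiff A x y)"
  using assms by (metis star_diff star_isometric diff_closed)

lemma dist_mult:
  assumes "x \<in> carrier A" "y \<in> carrier A" "x' \<in> carrier A" "y' \<in> carrier A"
  shows "p (sdiff A (stimes A x y) (stimes A x' y'))
    \<le> p (sdiff A x x') * p y + p x' * p (sdiff A y y')"
proof -
  have "p (sdiff A (stimes A x y) (stimes A x' y'))
      \<le> p (stimes A (sdiff A x x') y) + p (stimes A x' (sdiff A y y'))"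
    using triangle assms by (simp add: mult_diff_mult)
  also have "\<dots> \<le> p (sdiff A x x') * p y + p x' * p (sdiff A y y')"
    using assms by (intro add_mono submult) auto
  finally show ?thesis .
qed

end

text \<open>
  The C*-identity gives \<open>p(x)\<^sup>2 = p(x\<^sup>* x) \<le> p(x\<^sup>*) p(x)\<close>, and applying this to \<open>x\<^sup>*\<close> as
  well shows that the star is isometric.
\<close>

lemma (in star_alg) cstar_seminorm_imp_star_seminorm:
  assumes "cstar_seminorm A p"
  shows "star_seminorm A p"
proof
  have nn: "0 \<le> p x" if "x \<in> carrier A" for x
    using assms that by (auto simp: cstar_seminorm_def)
  have le: "p x \<le> p (sstar A x)" if x: "x \<in> carrier A" for x
  proof -
    have "p x * p x = p (stimes A (sstar A x) x)"
      using assms x by (simp add: cstar_seminorm_def power2_eq_square)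
    also have "\<dots> \<le> p (sstar A x) * p x"
      using assms x star_closed[OF x] unfolding cstar_seminorm_def by blast
    finally show ?thesis
      using nn[OF x] nn[OF star_closed[OF x]] by (cases "p x = 0") auto
  qed
  show "p (sstar A x) = p x" if "x \<in> carrier A" for x
    using le[OF that] le[of "sstar A x"] that by (simp add: star_star)
qed (use assms in \<open>auto simp: cstar_seminorm_def\<close>)

section \<open>Universal seminorms\<close>

lemma (in star_alg) zero_cstar_seminorm: "cstar_seminorm A (\<lambda>_. 0)"
  by (simp add: cstar_seminorm_def)

context star_alg begin

definition admissible :: "('x \<times> 'x) set \<Rightarrow> ('x \<Rightarrow> real) set" where
  "admissible E = {p. cstar_seminorm A p \<and> (\<forall>(y, z)\<in>E. p (sdiff A y z) = 0)}"

lemma zero_admissible: "(\<lambda>_. 0) \<in> admissible E"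
  by (auto simp: admissible_def zero_cstar_seminorm)

lemma universal_upper:
  assumes "p \<in> admissible E" "bdd_above ((\<lambda>p. p x) ` admissible E)"
  shows "p x \<le> universal_seminorm A E x"
  unfolding universal_seminorm_def using assms
  by (auto simp: admissible_def intro!: cSUP_upper2)

lemma universal_least:
  assumes "\<And>p. p \<in> admissible E \<Longrightarrow> p x \<le> M"
  shows "universal_seminorm A E x \<le> M"
  unfolding universal_seminorm_def
  using assms zero_admissible[of E] by (intro cSUP_least) (auto simp: admissible_def)

lemma universal_cstar_seminorm:
  assumes bdd: "\<And>x. x \<in> carrier A \<Longrightarrow> bdd_above ((\<lambda>p. p x) ` admissible E)"
  shows "cstar_seminorm A (universal_seminorm A E)"
proof -
  let ?U = "universal_seminorm A E"
  note up = universal_upper[OF _ bdd]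
  have adm: "cstar_seminorm A p" if "p \<in> admissible E" for p
    using that by (simp add: admissible_def)
  have nn: "0 \<le> ?U x" if "x \<in> carrier A" for x
    using up[OF zero_admissible that] by simp
  have tri: "?U (splus A x y) \<le> ?U x + ?U y" if "x \<in> carrier A" "y \<in> carrier A" for x y
  proof (rule universal_least)
    fix p assume p: "p \<in> admissible E"
    have "p (splus A x y) \<le> p x + p y" using adm[OF p] that by (simp add: cstar_seminorm_def)
    then show "p (splus A x y) \<le> ?U x + ?U y" using up[OF p that(1)] up[OF p that(2)] by linarith
  qed
  have mult: "?U (stimes A x y) \<le> ?U x * ?U y" if "x \<in> carrier A" "y \<in> carrier A" for x y
  proof (rule universal_least)
    fix p assume p: "p \<in> admissible E"
    have "p (stimes A x y) \<le> p x * p y" using adm[OF p] that by (simp add: cstar_seminorm_def)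
    also have "\<dots> \<le> ?U x * ?U y"
      using up[OF p that(1)] up[OF p that(2)] nn that adm[OF p]
      by (intro mult_mono) (auto simp: cstar_seminorm_def)
    finally show "p (stimes A x y) \<le> ?U x * ?U y" .
  qed
  have hom_le: "?U (sscale A c x) \<le> cmod c * ?U x" if "x \<in> carrier A" for c x
  proof (rule universal_least)
    fix p assume p: "p \<in> admissible E"
    have "p (sscale A c x) = cmod c * p x" using adm[OF p] that by (simp add: cstar_seminorm_def)
    then show "p (sscale A c x) \<le> cmod c * ?U x"
      using up[OF p that] by (simp add: mult_left_mono)
  qed
  have hom: "?U (sscale A c x) = cmod c * ?U x" if x: "x \<in> carrier A" for c x
  proof (cases "c = 0")
    case True
    then show ?thesis using hom_le[OF x, of 0] nn[of "sscale A 0 x"] x by simp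
  next
    case False
    have "?U x \<le> cmod (1 / c) * ?U (sscale A c x)"
      using hom_le[of "sscale A c x" "1 / c"] x False by (simp add: scale_scale scale_one)
    then have "cmod c * ?U x \<le> ?U (sscale A c x)"
      using False by (simp add: norm_divide field_simps)
    then show ?thesis using hom_le[OF x, of c] by linarith
  qed
  have sq: "?U (stimes A (sstar A x) x) = (?U x)\<^sup>2" if x: "x \<in> carrier A" for x
  proof (rule antisym)
    show "?U (stimes A (sstar A x) x) \<le> (?U x)\<^sup>2"
    proof (rule universal_least)
      fix p assume p: "p \<in> admissible E"
      have "p (stimes A (sstar A x) x) = (p x)\<^sup>2" "0 \<le> p x"
        using adm[OF p] x by (auto simp: cstar_seminorm_def)
      then show "p (stimes A (sstar A x) x) \<le> (?U x)\<^sup>2"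
        using up[OF p x] by (simp add: power_mono)
    qed
    have "?U x \<le> sqrt (?U (stimes A (sstar A x) x))"
    proof (rule universal_least)
      fix p assume p: "p \<in> admissible E"
      have "p (stimes A (sstar A x) x) = (p x)\<^sup>2"
        using adm[OF p] x by (auto simp: cstar_seminorm_def)
      then have "(p x)\<^sup>2 \<le> ?U (stimes A (sstar A x) x)"
        using up[OF p, of "stimes A (sstar A x) x"] x by simp
      then show "p x \<le> sqrt (?U (stimes A (sstar A x) x))" by (rule real_le_rsqrt)
    qed
    then show "(?U x)\<^sup>2 \<le> ?U (stimes A (sstar A x) x)"
      using nn[OF x] nn[of "stimes A (sstar A x) x"] x
      by (metis mult_closed power_mono real_sqrt_pow2 star_closed)
  qed
  show ?thesis using nn tri mult hom sq by (simp add: cstar_seminorm_def)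
qed

end

section \<open>Completions along a dense isometric homomorphism\<close>

context star_seminorm begin

definition cls :: "(nat \<Rightarrow> 'x) \<Rightarrow> (nat \<Rightarrow> 'x) set" where
  "cls f = cauchy_equiv A p `` {f}"

lemma cauchyD: "f \<in> cauchy_seqs A p \<Longrightarrow> f n \<in> carrier A"
  by (simp add: cauchy_seqs_def)

lemma null_trans:
  assumes "f \<in> cauchy_seqs A p" "g \<in> cauchy_seqs A p" "h \<in> cauchy_seqs A p"
    and "(\<lambda>n. p (sdiff A (f n) (g n))) \<longlonglongrightarrow> 0" "(\<lambda>n. p (sdiff A (g n) (h n))) \<longlonglongrightarrow> 0"
  shows "(\<lambda>n. p (sdiff A (f n) (h n))) \<longlonglongrightarrow> 0"
proof (rule Lim_null_comparison)
  show "\<forall>\<^sub>F n in sequentially. norm (p (sdiff A (f n) (h n)))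
      \<le> p (sdiff A (f n) (g n)) + p (sdiff A (g n) (h n))"
    using assms(1-3)[THEN cauchyD] by (auto intro!: always_eventually dist_triangle simp: nonneg)
  show "(\<lambda>n. p (sdiff A (f n) (g n)) + p (sdiff A (g n) (h n))) \<longlonglongrightarrow> 0"
    using tendsto_add[OF assms(4,5)] by simp
qed

lemma equiv_cauchy: "equiv (cauchy_seqs A p) (cauchy_equiv A p)"
proof (rule equivI)
  show "cauchy_equiv A p \<subseteq> cauchy_seqs A p \<times> cauchy_seqs A p"
    by (auto simp: cauchy_equiv_def)
  show "refl_on (cauchy_seqs A p) (cauchy_equiv A p)"
    by (auto simp: refl_on_def cauchy_equiv_def dist_self cauchyD)
  have "p (sdiff A (f n) (g n)) = p (sdiff A (g n) (f n))"
    if "f \<in> cauchy_seqs A p" "g \<in> cauchy_seqs A p" for f g n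
    using that[THEN cauchyD] by (rule dist_comm[rotated])
  then show "sym (cauchy_equiv A p)" by (simp add: sym_def cauchy_equiv_def)
  show "trans (cauchy_equiv A p)"
    unfolding trans_def cauchy_equiv_def using null_trans by blast
qed

lemma cls_eq_iff:
  assumes "f \<in> cauchy_seqs A p" "g \<in> cauchy_seqs A p"
  shows "cls f = cls g \<longleftrightarrow> (\<lambda>n. p (sdiff A (f n) (g n))) \<longlonglongrightarrow> 0"
proof -
  have "cls f = cls g \<longleftrightarrow> (f, g) \<in> cauchy_equiv A p"
    unfolding cls_def using eq_equiv_class_iff[OF equiv_cauchy assms] by simp
  then show ?thesis using assms by (simp add: cauchy_equiv_def)
qed

lemma mem_cls: "g \<in> cls f \<longleftrightarrow> f \<in> cauchy_seqs A p \<and> g \<in> cauchy_seqs A p \<and> cls g = cls f"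
proof -
  have "g \<in> cls f \<longleftrightarrow> (f, g) \<in> cauchy_equiv A p" by (simp add: cls_def)
  also have "\<dots> \<longleftrightarrow> f \<in> cauchy_seqs A p \<and> g \<in> cauchy_seqs A p \<and> cls f = cls g"
    unfolding cls_def using eq_equiv_class_iff[OF equiv_cauchy] by (auto simp: cauchy_equiv_def)
  finally show ?thesis by auto
qed

lemma completion_carrier: "carrier (cstar_completion A p) = cls ` cauchy_seqs A p"
  by (auto simp: cstar_completion_def quotient_def cls_def)

lemma cauchy_add:
  assumes f: "f \<in> cauchy_seqs A p" and g: "g \<in> cauchy_seqs A p"
  shows "(\<lambda>n. splus A (f n) (g n)) \<in> cauchy_seqs A p"
  unfolding cauchy_seqs_def
proof (intro CollectI conjI allI impI)
  show "splus A (f n) (g n) \<in> carrier A" for n using f g by (simp add: cauchyD)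
  fix e :: real assume "e > 0"
  then obtain M N where M: "\<And>m n. m \<ge> M \<Longrightarrow> n \<ge> M \<Longrightarrow> p (sdiff A (f m) (f n)) < e / 2"
    and N: "\<And>m n. m \<ge> N \<Longrightarrow> n \<ge> N \<Longrightarrow> p (sdiff A (g m) (g n)) < e / 2"
    using f g unfolding cauchy_seqs_def mem_Collect_eq by (meson half_gt_zero)
  have "p (sdiff A (splus A (f m) (g m)) (splus A (f n) (g n))) < e"
    if "m \<ge> max M N" "n \<ge> max M N" for m n
    using M[of m n] N[of m n] that dist_add[of "f m" "g m" "f n" "g n"] cauchyD[OF f] cauchyD[OF g]
    by simp
  then show "\<exists>N. \<forall>m\<ge>N. \<forall>n\<ge>N. p (sdiff A (splus A (f m) (g m)) (splus A (f n) (g n))) < e"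
    by blast
qed

lemma cauchy_scale:
  assumes f: "f \<in> cauchy_seqs A p"
  shows "(\<lambda>n. sscale A c (f n)) \<in> cauchy_seqs A p"
  unfolding cauchy_seqs_def
proof (intro CollectI conjI allI impI)
  show "sscale A c (f n) \<in> carrier A" for n using f by (simp add: cauchyD)
  fix e :: real assume "e > 0"
  then have "e / (cmod c + 1) > 0" by (simp add: add_nonneg_pos)
  then obtain N where N: "\<And>m n. m \<ge> N \<Longrightarrow> n \<ge> N \<Longrightarrow> p (sdiff A (f m) (f n)) < e / (cmod c + 1)"
    using f unfolding cauchy_seqs_def mem_Collect_eq by meson
  have "p (sdiff A (sscale A c (f m)) (sscale A c (f n))) < e" if "m \<ge> N" "n \<ge> N" for m n
  proof -
    have "cmod c * p (sdiff A (f m) (f n)) \<le> (cmod c + 1) * p (sdiff A (f m) (f n))"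
      using nonneg[of "sdiff A (f m) (f n)"] f by (simp add: cauchyD distrib_right)
    also have "\<dots> < e"
      using N[OF that] by (simp add: pos_less_divide_eq add_nonneg_pos mult.commute)
    finally show ?thesis using f by (simp add: dist_scale cauchyD)
  qed
  then show "\<exists>N. \<forall>m\<ge>N. \<forall>n\<ge>N. p (sdiff A (sscale A c (f m)) (sscale A c (f n))) < e" by blast
qed

lemma cauchy_star:
  assumes f: "f \<in> cauchy_seqs A p"
  shows "(\<lambda>n. sstar A (f n)) \<in> cauchy_seqs A p"
proof -
  have "p (sdiff A (sstar A (f m)) (sstar A (f n))) = p (sdiff A (f m) (f n))" for m n
    using f by (simp add: dist_star cauchyD)
  then show ?thesis using f by (simp add: cauchy_seqs_def)
qed

lemma cauchy_norm_convergent: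
  assumes f: "f \<in> cauchy_seqs A p"
  shows "convergent (\<lambda>n. p (f n))"
proof -
  have "Cauchy (\<lambda>n. p (f n))"
  proof (rule CauchyI)
    fix e :: real assume "e > 0"
    then obtain N where N: "\<forall>m\<ge>N. \<forall>n\<ge>N. p (sdiff A (f m) (f n)) < e"
      using f unfolding cauchy_seqs_def mem_Collect_eq by meson
    have "norm (p (f m) - p (f n)) < e" if "m \<ge> N" "n \<ge> N" for m n
      using norm_diff_le[of "f m" "f n"] N that cauchyD[OF f] by fastforce
    then show "\<exists>M. \<forall>m\<ge>M. \<forall>n\<ge>M. norm (p (f m) - p (f n)) < e" by blast
  qed
  then show ?thesis by (rule Cauchy_convergent)
qed

lemma cauchy_bounded:
  assumes f: "f \<in> cauchy_seqs A p"
  obtains B where "B > 0" "\<And>n. p (f n) \<le> B"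
proof -
  have "Bseq (\<lambda>n. p (f n))" using cauchy_norm_convergent[OF f] by (rule convergent_imp_Bseq)
  then obtain B where "B > 0" "\<And>n. norm (p (f n)) \<le> B" by (auto elim: BseqE)
  then have "p (f n) \<le> B" for n using abs_le_D1 by (metis real_norm_def)
  then show thesis using that \<open>B > 0\<close> by blast
qed

lemma cauchy_mult:
  assumes f: "f \<in> cauchy_seqs A p" and g: "g \<in> cauchy_seqs A p"
  shows "(\<lambda>n. stimes A (f n) (g n)) \<in> cauchy_seqs A p"
  unfolding cauchy_seqs_def
proof (intro CollectI conjI allI impI)
  show "stimes A (f n) (g n) \<in> carrier A" for n using f g by (simp add: cauchyD)
  fix e :: real assume e: "e > 0"
  obtain B where B: "B > 0" "\<And>n. p (f n) \<le> B" using cauchy_bounded[OF f] by blast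
  obtain C where C: "C > 0" "\<And>n. p (g n) \<le> C" using cauchy_bounded[OF g] by blast
  have "e / (2 * C) > 0" "e / (2 * B) > 0" using e B C by auto
  then obtain M N
    where M: "\<And>m n. m \<ge> M \<Longrightarrow> n \<ge> M \<Longrightarrow> p (sdiff A (f m) (f n)) < e / (2 * C)"
      and N: "\<And>m n. m \<ge> N \<Longrightarrow> n \<ge> N \<Longrightarrow> p (sdiff A (g m) (g n)) < e / (2 * B)"
    using f g unfolding cauchy_seqs_def mem_Collect_eq by meson
  have "p (sdiff A (stimes A (f m) (g m)) (stimes A (f n) (g n))) < e"
    if mn: "m \<ge> max M N" "n \<ge> max M N" for m n
  proof -
    have "p (sdiff A (f m) (f n)) * p (g m) \<le> p (sdiff A (f m) (f n)) * C"
      using C(2) f by (intro mult_left_mono nonneg) (auto simp: cauchyD)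
    also have "\<dots> < e / (2 * C) * C" using M[of m n] mn C(1) by (intro mult_strict_right_mono) auto
    also have "\<dots> = e / 2" using C(1) by simp
    finally have 1: "p (sdiff A (f m) (f n)) * p (g m) < e / 2" .
    have "p (f n) * p (sdiff A (g m) (g n)) \<le> B * p (sdiff A (g m) (g n))"
      using B(2) g by (intro mult_right_mono nonneg) (auto simp: cauchyD)
    also have "\<dots> < B * (e / (2 * B))" using N[of m n] mn B(1) by (intro mult_strict_left_mono) auto
    also have "\<dots> = e / 2" using B(1) by simp
    finally show ?thesis
      using 1 dist_mult[of "f m" "g m" "f n" "g n"] cauchyD[OF f] cauchyD[OF g] by simp
  qed
  then show "\<exists>N. \<forall>m\<ge>N. \<forall>n\<ge>N. p (sdiff A (stimes A (f m) (g m)) (stimes A (f n) (g n))) < e"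
    by blast
qed

lemma completion_add:
  assumes f: "f \<in> cauchy_seqs A p" and g: "g \<in> cauchy_seqs A p"
  shows "splus (cstar_completion A p) (cls f) (cls g) = cls (\<lambda>n. splus A (f n) (g n))"
proof -
  have eq: "cls (\<lambda>n. splus A (f' n) (g' n)) = cls (\<lambda>n. splus A (f n) (g n))"
    if "f' \<in> cls f" "g' \<in> cls g" for f' g'
  proof -
    have fg: "f' \<in> cauchy_seqs A p" "g' \<in> cauchy_seqs A p"
      and lim: "(\<lambda>n. p (sdiff A (f' n) (f n))) \<longlonglongrightarrow> 0" "(\<lambda>n. p (sdiff A (g' n) (g n))) \<longlonglongrightarrow> 0"
      using that by (auto simp: mem_cls cls_eq_iff)
    have "(\<lambda>n. p (sdiff A (splus A (f' n) (g' n)) (splus A (f n) (g n)))) \<longlonglongrightarrow> 0"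
    proof (rule Lim_null_comparison)
      show "(\<lambda>n. p (sdiff A (f' n) (f n)) + p (sdiff A (g' n) (g n))) \<longlonglongrightarrow> 0"
        using tendsto_add[OF lim] by simp
      show "\<forall>\<^sub>F n in sequentially. norm (p (sdiff A (splus A (f' n) (g' n)) (splus A (f n) (g n))))
          \<le> p (sdiff A (f' n) (f n)) + p (sdiff A (g' n) (g n))"
        using fg f g by (auto intro!: always_eventually dist_add simp: cauchyD nonneg)
    qed
    then show ?thesis using fg f g by (simp add: cls_eq_iff cauchy_add)
  qed
  have "(\<Union>f'\<in>cls f. \<Union>g'\<in>cls g. cls (\<lambda>n. splus A (f' n) (g' n)))
      = (\<Union>f'\<in>cls f. \<Union>g'\<in>cls g. cls (\<lambda>n. splus A (f n) (g n)))"
    using eq by simp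
  moreover have "f \<in> cls f" "g \<in> cls g" using f g by (simp_all add: mem_cls)
  ultimately show ?thesis by (auto simp: cstar_completion_def cls_def)
qed

lemma completion_mult:
  assumes f: "f \<in> cauchy_seqs A p" and g: "g \<in> cauchy_seqs A p"
  shows "stimes (cstar_completion A p) (cls f) (cls g) = cls (\<lambda>n. stimes A (f n) (g n))"
proof -
  have eq: "cls (\<lambda>n. stimes A (f' n) (g' n)) = cls (\<lambda>n. stimes A (f n) (g n))"
    if "f' \<in> cls f" "g' \<in> cls g" for f' g'
  proof -
    have fg: "f' \<in> cauchy_seqs A p" "g' \<in> cauchy_seqs A p"
      and lim: "(\<lambda>n. p (sdiff A (f' n) (f n))) \<longlonglongrightarrow> 0" "(\<lambda>n. p (sdiff A (g' n) (g n))) \<longlonglongrightarrow> 0"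
      using that by (auto simp: mem_cls cls_eq_iff)
    obtain B where B: "\<And>n. p (f n) \<le> B" using cauchy_bounded[OF f] by blast
    obtain C where C: "\<And>n. p (g' n) \<le> C" using cauchy_bounded[OF fg(2)] by blast
    have "(\<lambda>n. p (sdiff A (stimes A (f' n) (g' n)) (stimes A (f n) (g n)))) \<longlonglongrightarrow> 0"
    proof (rule Lim_null_comparison)
      show "(\<lambda>n. p (sdiff A (f' n) (f n)) * C + B * p (sdiff A (g' n) (g n))) \<longlonglongrightarrow> 0"
        using tendsto_add[OF tendsto_mult_right[OF lim(1), of C] tendsto_mult_left[OF lim(2), of B]]
        by simp
      have "p (sdiff A (stimes A (f' n) (g' n)) (stimes A (f n) (g n)))
          \<le> p (sdiff A (f' n) (f n)) * C + B * p (sdiff A (g' n) (g n))" for n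
      proof (rule order_trans[OF dist_mult add_mono])
        show "p (sdiff A (f' n) (f n)) * p (g' n) \<le> p (sdiff A (f' n) (f n)) * C"
          using C fg f by (intro mult_left_mono nonneg) (auto simp: cauchyD)
        show "p (f n) * p (sdiff A (g' n) (g n)) \<le> B * p (sdiff A (g' n) (g n))"
          using B fg g by (intro mult_right_mono nonneg) (auto simp: cauchyD)
      qed (use fg f g in \<open>auto simp: cauchyD\<close>)
      then show "\<forall>\<^sub>F n in sequentially. norm (p (sdiff A (stimes A (f' n) (g' n)) (stimes A (f n) (g n))))
          \<le> p (sdiff A (f' n) (f n)) * C + B * p (sdiff A (g' n) (g n))"
        using fg f g by (auto intro!: always_eventually simp: cauchyD nonneg)
    qed
    then show ?thesis using fg f g by (simp add: cls_eq_iff cauchy_mult)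
  qed
  have "(\<Union>f'\<in>cls f. \<Union>g'\<in>cls g. cls (\<lambda>n. stimes A (f' n) (g' n)))
      = (\<Union>f'\<in>cls f. \<Union>g'\<in>cls g. cls (\<lambda>n. stimes A (f n) (g n)))"
    using eq by simp
  moreover have "f \<in> cls f" "g \<in> cls g" using f g by (simp_all add: mem_cls)
  ultimately show ?thesis by (auto simp: cstar_completion_def cls_def)
qed

lemma completion_scale:
  assumes f: "f \<in> cauchy_seqs A p"
  shows "sscale (cstar_completion A p) c (cls f) = cls (\<lambda>n. sscale A c (f n))"
proof -
  have eq: "cls (\<lambda>n. sscale A c (f' n)) = cls (\<lambda>n. sscale A c (f n))" if "f' \<in> cls f" for f'
  proof -
    have f': "f' \<in> cauchy_seqs A p" and lim: "(\<lambda>n. p (sdiff A (f' n) (f n))) \<longlonglongrightarrow> 0"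
      using that f by (auto simp: mem_cls cls_eq_iff)
    have "(\<lambda>n. p (sdiff A (sscale A c (f' n)) (sscale A c (f n)))) \<longlonglongrightarrow> 0"
      using tendsto_mult_left[OF lim, of "cmod c"] f f' by (simp add: dist_scale cauchyD)
    then show ?thesis using f f' by (simp add: cls_eq_iff cauchy_scale)
  qed
  have "(\<Union>f'\<in>cls f. cls (\<lambda>n. sscale A c (f' n))) = (\<Union>f'\<in>cls f. cls (\<lambda>n. sscale A c (f n)))"
    using eq by simp
  moreover have "f \<in> cls f" using f by (simp add: mem_cls)
  ultimately show ?thesis by (auto simp: cstar_completion_def cls_def)
qed

lemma completion_star:
  assumes f: "f \<in> cauchy_seqs A p"
  shows "sstar (cstar_completion A p) (cls f) = cls (\<lambda>n. sstar A (f n))"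
proof -
  have eq: "cls (\<lambda>n. sstar A (f' n)) = cls (\<lambda>n. sstar A (f n))" if "f' \<in> cls f" for f'
    using that f by (auto simp: mem_cls cls_eq_iff cauchy_star dist_star cauchyD)
  have "(\<Union>f'\<in>cls f. cls (\<lambda>n. sstar A (f' n))) = (\<Union>f'\<in>cls f. cls (\<lambda>n. sstar A (f n)))"
    using eq by simp
  moreover have "f \<in> cls f" using f by (simp add: mem_cls)
  ultimately show ?thesis by (auto simp: cstar_completion_def cls_def)
qed

lemma completion_norm:
  assumes f: "f \<in> cauchy_seqs A p"
  shows "cnorm (cstar_completion A p) (cls f) = lim (\<lambda>n. p (f n))"
proof -
  define f' where "f' = (SOME f'. f' \<in> cls f)"
  have "f' \<in> cls f" unfolding f'_def by (rule someI[of _ f]) (simp add: mem_cls f)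
  then have f': "f' \<in> cauchy_seqs A p" and lim: "(\<lambda>n. p (sdiff A (f' n) (f n))) \<longlonglongrightarrow> 0"
    using f by (auto simp: mem_cls cls_eq_iff)
  have "norm (p (f' n) - p (f n)) \<le> p (sdiff A (f' n) (f n))" for n
    using norm_diff_le[OF cauchyD[OF f'] cauchyD[OF f]] by simp
  then have "(\<lambda>n. p (f' n) - p (f n)) \<longlonglongrightarrow> 0"
    by (intro Lim_null_comparison[OF _ lim] always_eventually) simp
  moreover have "(\<lambda>n. p (f n)) \<longlonglongrightarrow> lim (\<lambda>n. p (f n))"
    using cauchy_norm_convergent[OF f] by (simp add: convergent_LIMSEQ_iff)
  ultimately have "(\<lambda>n. (p (f' n) - p (f n)) + p (f n)) \<longlonglongrightarrow> 0 + lim (\<lambda>n. p (f n))"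
    by (rule tendsto_add)
  then have "lim (\<lambda>n. (p (f' n) - p (f n)) + p (f n)) = 0 + lim (\<lambda>n. p (f n))" by (rule limI)
  then have "lim (\<lambda>n. p (f' n)) = lim (\<lambda>n. p (f n))" by simp
  then show ?thesis by (simp add: cstar_completion_def f'_def)
qed

end

definition star_hom ::
    "('x, 'm) star_algebra_scheme \<Rightarrow> ('y, 'n) star_algebra_scheme \<Rightarrow> ('x \<Rightarrow> 'y) \<Rightarrow> bool" where
  "star_hom A B \<phi> \<longleftrightarrow> (\<forall>x\<in>carrier A. \<phi> x \<in> carrier B) \<and>
     (\<forall>x\<in>carrier A. \<forall>y\<in>carrier A. \<phi> (splus A x y) = splus B (\<phi> x) (\<phi> y)) \<and>
     (\<forall>c. \<forall>x\<in>carrier A. \<phi> (sscale A c x) = sscale B c (\<phi> x)) \<and>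
     (\<forall>x\<in>carrier A. \<forall>y\<in>carrier A. \<phi> (stimes A x y) = stimes B (\<phi> x) (\<phi> y)) \<and>
     (\<forall>x\<in>carrier A. \<phi> (sstar A x) = sstar B (\<phi> x))"

lemma star_hom_closed: "\<lbrakk>star_hom A B \<phi>; x \<in> carrier A\<rbrakk> \<Longrightarrow> \<phi> x \<in> carrier B"
  and star_hom_add: "\<lbrakk>star_hom A B \<phi>; x \<in> carrier A; y \<in> carrier A\<rbrakk>
    \<Longrightarrow> \<phi> (splus A x y) = splus B (\<phi> x) (\<phi> y)"
  and star_hom_scale: "\<lbrakk>star_hom A B \<phi>; x \<in> carrier A\<rbrakk> \<Longrightarrow> \<phi> (sscale A c x) = sscale B c (\<phi> x)"
  and star_hom_mult: "\<lbrakk>star_hom A B \<phi>; x \<in> carrier A; y \<in> carrier A\<rbrakk>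
    \<Longrightarrow> \<phi> (stimes A x y) = stimes B (\<phi> x) (\<phi> y)"
  and star_hom_star: "\<lbrakk>star_hom A B \<phi>; x \<in> carrier A\<rbrakk> \<Longrightarrow> \<phi> (sstar A x) = sstar B (\<phi> x)"
  by (auto simp: star_hom_def)

lemma star_hom_diff:
  assumes "star_alg A" "star_hom A B \<phi>" "x \<in> carrier A" "y \<in> carrier A"
  shows "\<phi> (sdiff A x y) = sdiff B (\<phi> x) (\<phi> y)"
  using assms star_alg.scale_closed[OF assms(1), of y "-1"]
  by (simp add: sdiff_def star_hom_add star_hom_scale)

text \<open>
  A Cauchy sequence in the target is equivalent to the image of a Cauchy sequence in the source, so
  taking preimages of classes is a bijection of completions.
\<close>

lemma completion_iso_of_dense:
  assumes "star_seminorm A p" "star_seminorm B q" and hom: "star_hom A B \<phi>"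
    and iso: "\<And>x. x \<in> carrier A \<Longrightarrow> q (\<phi> x) = p x"
    and dense: "\<And>b e. b \<in> carrier B \<Longrightarrow> e > 0 \<Longrightarrow> \<exists>a\<in>carrier A. q (sdiff B b (\<phi> a)) < e"
  shows "cstar_isomorphic (cstar_completion B q) (cstar_completion A p)"
proof -
  interpret a: star_seminorm A p by fact
  interpret b: star_seminorm B q by fact
  note dif = star_hom_diff[OF a.star_alg_axioms hom]
  have dist: "q (sdiff B (\<phi> x) (\<phi> y)) = p (sdiff A x y)" if "x \<in> carrier A" "y \<in> carrier A" for x y
    using that by (simp flip: dif add: iso)
  have im: "(\<lambda>n. \<phi> (f n)) \<in> cauchy_seqs B q" if "f \<in> cauchy_seqs A p" for f
    using that by (simp add: cauchy_seqs_def dist star_hom_closed[OF hom])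
  define \<Phi> where "\<Phi> X = {f \<in> cauchy_seqs A p. (\<lambda>n. \<phi> (f n)) \<in> X}" for X
  have cls_iff: "b.cls (\<lambda>n. \<phi> (f n)) = b.cls (\<lambda>n. \<phi> (g n)) \<longleftrightarrow> a.cls f = a.cls g"
    if "f \<in> cauchy_seqs A p" "g \<in> cauchy_seqs A p" for f g
    using that by (simp add: a.cls_eq_iff b.cls_eq_iff im dist a.cauchyD)
  have \<Phi>_cls: "\<Phi> (b.cls (\<lambda>n. \<phi> (f n))) = a.cls f" if f: "f \<in> cauchy_seqs A p" for f
    using f by (auto simp: \<Phi>_def b.mem_cls a.mem_cls im cls_iff)
  have rep: "\<exists>f\<in>cauchy_seqs A p. X = b.cls (\<lambda>n. \<phi> (f n))"
    if X: "X \<in> carrier (cstar_completion B q)" for X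
  proof -
    obtain h where h: "h \<in> cauchy_seqs B q" and Xh: "X = b.cls h"
      using X by (auto simp: b.completion_carrier)
    have "\<forall>n. \<exists>a\<in>carrier A. q (sdiff B (h n) (\<phi> a)) < inverse (real (Suc n))"
      using dense b.cauchyD[OF h] by simp
    then obtain f where f: "\<And>n. f n \<in> carrier A"
      and fh: "\<And>n. q (sdiff B (h n) (\<phi> (f n))) < inverse (real (Suc n))" by metis
    have f\<phi>: "\<phi> (f n) \<in> carrier B" for n using f star_hom_closed[OF hom] by blast
    have lim: "(\<lambda>n. q (sdiff B (h n) (\<phi> (f n)))) \<longlonglongrightarrow> 0"
    proof (rule Lim_null_comparison[OF _ LIMSEQ_inverse_real_of_nat])
      show "\<forall>\<^sub>F n in sequentially. norm (q (sdiff B (h n) (\<phi> (f n)))) \<le> inverse (real (Suc n))"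
        using fh b.cauchyD[OF h] f\<phi> b.nonneg
        by (intro always_eventually) (simp add: less_imp_le del: of_nat_Suc)
    qed
    have fc: "f \<in> cauchy_seqs A p" unfolding cauchy_seqs_def
    proof (intro CollectI conjI allI impI)
      show "f n \<in> carrier A" for n by fact
      fix e :: real assume "e > 0"
      then have e3: "e / 3 > 0" by simp
      obtain M where M: "\<And>n. n \<ge> M \<Longrightarrow> q (sdiff B (h n) (\<phi> (f n))) < e / 3"
        using order_tendstoD(2)[OF lim e3] by (auto simp: eventually_sequentially)
      obtain N where N: "\<And>m n. m \<ge> N \<Longrightarrow> n \<ge> N \<Longrightarrow> q (sdiff B (h m) (h n)) < e / 3"
        using h e3 unfolding cauchy_seqs_def mem_Collect_eq by meson
      have "p (sdiff A (f m) (f n)) < e" if mn: "m \<ge> max M N" "n \<ge> max M N" for m n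
      proof -
        note hc = b.cauchyD[OF h]
        have "q (sdiff B (\<phi> (f m)) (\<phi> (f n)))
            \<le> q (sdiff B (\<phi> (f m)) (h m)) + (q (sdiff B (h m) (h n)) + q (sdiff B (h n) (\<phi> (f n))))"
          using b.dist_triangle[OF f\<phi>[of m] hc[of m] f\<phi>[of n]]
            b.dist_triangle[OF hc[of m] hc[of n] f\<phi>[of n]] by linarith
        moreover have "q (sdiff B (\<phi> (f m)) (h m)) < e / 3"
          using M[of m] mn b.dist_comm[OF hc f\<phi>, of m m] by simp
        ultimately show ?thesis using M[of n] N[of m n] mn f by (simp add: dist)
      qed
      then show "\<exists>N. \<forall>m\<ge>N. \<forall>n\<ge>N. p (sdiff A (f m) (f n)) < e" by blast
    qed
    have "X = b.cls (\<lambda>n. \<phi> (f n))" unfolding Xh using lim h im[OF fc] by (simp add: b.cls_eq_iff)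
    then show ?thesis using fc by blast
  qed
  have mem: "b.cls (\<lambda>n. \<phi> (f n)) \<in> carrier (cstar_completion B q)" if "f \<in> cauchy_seqs A p" for f
    using im[OF that] by (auto simp: b.completion_carrier)
  have bij: "bij_betw \<Phi> (carrier (cstar_completion B q)) (carrier (cstar_completion A p))"
    unfolding bij_betw_def
  proof (intro conjI)
    show "inj_on \<Phi> (carrier (cstar_completion B q))"
    proof (rule inj_onI)
      fix X Y
      assume "X \<in> carrier (cstar_completion B q)" "Y \<in> carrier (cstar_completion B q)" "\<Phi> X = \<Phi> Y"
      then show "X = Y" using rep[of X] rep[of Y] by (metis \<Phi>_cls cls_iff)
    qed
    show "\<Phi> ` carrier (cstar_completion B q) = carrier (cstar_completion A p)"
    proof
      show "\<Phi> ` carrier (cstar_completion B q) \<subseteq> carrier (cstar_completion A p)"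
        using rep by (force simp: \<Phi>_cls a.completion_carrier)
      show "carrier (cstar_completion A p) \<subseteq> \<Phi> ` carrier (cstar_completion B q)"
        using mem by (auto simp: a.completion_carrier image_iff intro!: bexI simp flip: \<Phi>_cls)
    qed
  qed
  have phi_ops: "(\<lambda>n. splus B (\<phi> (f n)) (\<phi> (g n))) = (\<lambda>n. \<phi> (splus A (f n) (g n)))"
    "(\<lambda>n. stimes B (\<phi> (f n)) (\<phi> (g n))) = (\<lambda>n. \<phi> (stimes A (f n) (g n)))"
    "(\<lambda>n. sscale B c (\<phi> (f n))) = (\<lambda>n. \<phi> (sscale A c (f n)))"
    "(\<lambda>n. sstar B (\<phi> (f n))) = (\<lambda>n. \<phi> (sstar A (f n)))"
    if "f \<in> cauchy_seqs A p" "g \<in> cauchy_seqs A p" for f g c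
    using that by (simp_all add: fun_eq_iff star_hom_add[OF hom] star_hom_mult[OF hom]
        star_hom_scale[OF hom] star_hom_star[OF hom] a.cauchyD)
  show ?thesis unfolding cstar_isomorphic_def
  proof (intro exI[of _ \<Phi>] conjI ballI allI)
    show "bij_betw \<Phi> (carrier (cstar_completion B q)) (carrier (cstar_completion A p))" by fact
  next
    fix X Y assume "X \<in> carrier (cstar_completion B q)" "Y \<in> carrier (cstar_completion B q)"
    then obtain f g where f: "f \<in> cauchy_seqs A p" "g \<in> cauchy_seqs A p"
      and XY: "X = b.cls (\<lambda>n. \<phi> (f n))" "Y = b.cls (\<lambda>n. \<phi> (g n))" using rep by blast
    show "\<Phi> (splus (cstar_completion B q) X Y) = splus (cstar_completion A p) (\<Phi> X) (\<Phi> Y)"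
      using f by (simp add: XY b.completion_add a.completion_add im \<Phi>_cls phi_ops a.cauchy_add)
    show "\<Phi> (stimes (cstar_completion B q) X Y) = stimes (cstar_completion A p) (\<Phi> X) (\<Phi> Y)"
      using f by (simp add: XY b.completion_mult a.completion_mult im \<Phi>_cls phi_ops a.cauchy_mult)
  next
    fix X assume "X \<in> carrier (cstar_completion B q)"
    then obtain f where f: "f \<in> cauchy_seqs A p" and X: "X = b.cls (\<lambda>n. \<phi> (f n))" using rep by blast
    show "\<Phi> (sscale (cstar_completion B q) c X) = sscale (cstar_completion A p) c (\<Phi> X)" for c
      using f by (simp add: X b.completion_scale a.completion_scale im \<Phi>_cls phi_ops a.cauchy_scale)
    show "\<Phi> (sstar (cstar_completion B q) X) = sstar (cstar_completion A p) (\<Phi> X)"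
      using f by (simp add: X b.completion_star a.completion_star im \<Phi>_cls phi_ops a.cauchy_star)
    show "cnorm (cstar_completion A p) (\<Phi> X) = cnorm (cstar_completion B q) X"
      using f by (simp add: X b.completion_norm a.completion_norm im \<Phi>_cls iso a.cauchyD)
  qed
qed

section \<open>Transporting universal seminorms along a dense homomorphism\<close>

text \<open>
  A C*-seminorm on \<open>A\<close> that is dominated by the pull-back of a norm \<open>N\<close> of \<open>B\<close> descends to the image
  of \<open>A\<close> and extends to \<open>B\<close> by continuity: its value at \<open>b\<close> is the limit of \<open>p(a\<^sub>n)\<close> for any
  \<open>a\<^sub>n\<close> with \<open>N(b - \<phi>(a\<^sub>n)) \<rightarrow> 0\<close>. All axioms pass to the limit.
\<close>

lemma extend_dominated_cstar_seminorm:
  assumes "star_alg A" "star_seminorm B N" and hom: "star_hom A B \<phi>"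
    and dense: "\<And>b e. b \<in> carrier B \<Longrightarrow> e > 0 \<Longrightarrow> \<exists>a\<in>carrier A. N (sdiff B b (\<phi> a)) < e"
    and p: "cstar_seminorm A p"
    and dom: "\<And>x. x \<in> carrier A \<Longrightarrow> p x \<le> N (\<phi> x)"
  obtains p' where "cstar_seminorm B p'" "\<And>x. x \<in> carrier A \<Longrightarrow> p' (\<phi> x) = p x"
proof -
  interpret a: star_alg A by fact
  interpret p: star_seminorm A p by (rule a.cstar_seminorm_imp_star_seminorm[OF p])
  interpret b: star_seminorm B N by fact
  have p2: "p (stimes A (sstar A x) x) = (p x)\<^sup>2" if "x \<in> carrier A" for x
    using p that by (simp add: cstar_seminorm_def)
  have cl: "\<phi> x \<in> carrier B" if "x \<in> carrier A" for x using star_hom_closed[OF hom that] .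
  have close: "\<bar>p x - p y\<bar> \<le> N (sdiff B (\<phi> x) (\<phi> y))" if "x \<in> carrier A" "y \<in> carrier A" for x y
    using p.norm_diff_le[OF that] dom[of "sdiff A x y"] that
    by (simp add: star_hom_diff[OF \<open>star_alg A\<close> hom])
  define appr where "appr b f \<longleftrightarrow> (\<forall>n. f n \<in> carrier A) \<and> (\<lambda>n. N (sdiff B b (\<phi> (f n)))) \<longlonglongrightarrow> 0"
    for b f
  have ex: "\<exists>f. appr b f" if b: "b \<in> carrier B" for b
  proof -
    have "\<forall>n. \<exists>a\<in>carrier A. N (sdiff B b (\<phi> a)) < inverse (real (Suc n))"
      using dense b by simp
    then obtain f where f: "\<And>n. f n \<in> carrier A"
      and fb: "\<And>n. N (sdiff B b (\<phi> (f n))) < inverse (real (Suc n))" by metis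
    have "(\<lambda>n. N (sdiff B b (\<phi> (f n)))) \<longlonglongrightarrow> 0"
      by (rule Lim_null_comparison[OF _ LIMSEQ_inverse_real_of_nat], rule always_eventually)
         (use fb f cl b b.nonneg in \<open>simp add: less_imp_le del: of_nat_Suc\<close>)
    then show ?thesis using f by (auto simp: appr_def)
  qed
  have bnd: "\<bar>p (f n) - p (g m)\<bar> \<le> N (sdiff B b (\<phi> (f n))) + N (sdiff B b (\<phi> (g m)))"
    if "appr b f" "appr b g" "b \<in> carrier B" for b f g n m
  proof -
    have fg: "f n \<in> carrier A" "g m \<in> carrier A" using that by (auto simp: appr_def)
    show ?thesis using close[OF fg] b.dist_triangle[OF cl[OF fg(1)] that(3) cl[OF fg(2)]]
        b.dist_comm[OF that(3) cl[OF fg(1)]] by linarith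
  qed
  have conv: "convergent (\<lambda>n. p (f n))" if f: "appr b f" and b: "b \<in> carrier B" for b f
  proof -
    have "Cauchy (\<lambda>n. p (f n))"
    proof (rule CauchyI)
      fix e :: real assume "e > 0"
      then have e2: "e / 2 > 0" by simp
      have lim: "(\<lambda>n. N (sdiff B b (\<phi> (f n)))) \<longlonglongrightarrow> 0" using f by (simp add: appr_def)
      obtain M where M: "\<And>n. n \<ge> M \<Longrightarrow> N (sdiff B b (\<phi> (f n))) < e / 2"
        using order_tendstoD(2)[OF lim e2] by (auto simp: eventually_sequentially)
      have "norm (p (f m) - p (f n)) < e" if "m \<ge> M" "n \<ge> M" for m n
        using bnd[OF f f b, of m n] M[OF that(1)] M[OF that(2)] by simp
      then show "\<exists>M. \<forall>m\<ge>M. \<forall>n\<ge>M. norm (p (f m) - p (f n)) < e" by blast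
    qed
    then show ?thesis by (rule Cauchy_convergent)
  qed
  define p' where "p' b = lim (\<lambda>n. p ((SOME f. appr b f) n))" for b
  have lim: "(\<lambda>n. p (f n)) \<longlonglongrightarrow> p' b" if f: "appr b f" and b: "b \<in> carrier B" for b f
  proof -
    define g where "g = (SOME f. appr b f)"
    have g: "appr b g" unfolding g_def using ex[OF b] by (rule someI_ex)
    have glim: "(\<lambda>n. p (g n)) \<longlonglongrightarrow> p' b"
      using conv[OF g b] by (simp add: p'_def g_def convergent_LIMSEQ_iff)
    have "(\<lambda>n. p (f n) - p (g n)) \<longlonglongrightarrow> 0"
    proof (rule Lim_null_comparison)
      show "(\<lambda>n. N (sdiff B b (\<phi> (f n))) + N (sdiff B b (\<phi> (g n)))) \<longlonglongrightarrow> 0"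
        using f g unfolding appr_def by (intro tendsto_add_zero) simp_all
      show "\<forall>\<^sub>F n in sequentially. norm (p (f n) - p (g n))
          \<le> N (sdiff B b (\<phi> (f n))) + N (sdiff B b (\<phi> (g n)))"
        using bnd[OF f g b] by (auto intro!: always_eventually)
    qed
    from tendsto_add[OF this glim] show ?thesis by simp
  qed
  have appr_add: "appr (splus B b c) (\<lambda>n. splus A (f n) (g n))"
    if f: "appr b f" and g: "appr c g" and bc: "b \<in> carrier B" "c \<in> carrier B" for b c f g
    unfolding appr_def
  proof (intro conjI allI)
    show "splus A (f n) (g n) \<in> carrier A" for n using f g by (auto simp: appr_def)
    show "(\<lambda>n. N (sdiff B (splus B b c) (\<phi> (splus A (f n) (g n))))) \<longlonglongrightarrow> 0"
    proof (rule Lim_null_comparison)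
      show "(\<lambda>n. N (sdiff B b (\<phi> (f n))) + N (sdiff B c (\<phi> (g n)))) \<longlonglongrightarrow> 0"
        using f g unfolding appr_def by (intro tendsto_add_zero) simp_all
      show "\<forall>\<^sub>F n in sequentially. norm (N (sdiff B (splus B b c) (\<phi> (splus A (f n) (g n)))))
          \<le> N (sdiff B b (\<phi> (f n))) + N (sdiff B c (\<phi> (g n)))"
        using f g bc by (auto intro!: always_eventually b.dist_add
            simp: appr_def star_hom_add[OF hom] cl b.nonneg)
    qed
  qed
  have appr_scale: "appr (sscale B k b) (\<lambda>n. sscale A k (f n))"
    if f: "appr b f" and b: "b \<in> carrier B" for k b f
  proof -
    have "N (sdiff B (sscale B k b) (\<phi> (sscale A k (f n)))) = cmod k * N (sdiff B b (\<phi> (f n)))" for n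
      using f b by (simp add: appr_def star_hom_scale[OF hom] b.dist_scale cl)
    moreover have "(\<lambda>n. cmod k * N (sdiff B b (\<phi> (f n)))) \<longlonglongrightarrow> 0"
      using f unfolding appr_def by (intro tendsto_mult_right_zero) simp
    ultimately show ?thesis using f by (simp add: appr_def)
  qed
  have appr_star: "appr (sstar B b) (\<lambda>n. sstar A (f n))"
    if f: "appr b f" and b: "b \<in> carrier B" for b f
    using f b by (simp add: appr_def star_hom_star[OF hom] b.dist_star cl)
  have appr_mult: "appr (stimes B b c) (\<lambda>n. stimes A (f n) (g n))"
    if f: "appr b f" and g: "appr c g" and bc: "b \<in> carrier B" "c \<in> carrier B" for b c f g
    unfolding appr_def
  proof (intro conjI allI)
    have fg: "f n \<in> carrier A" "g n \<in> carrier A" for n using f g by (auto simp: appr_def)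
    show "stimes A (f n) (g n) \<in> carrier A" for n using fg by simp
    have limf: "(\<lambda>n. N (sdiff B b (\<phi> (f n)))) \<longlonglongrightarrow> 0"
      and limg: "(\<lambda>n. N (sdiff B c (\<phi> (g n)))) \<longlonglongrightarrow> 0" using f g by (auto simp: appr_def)
    show "(\<lambda>n. N (sdiff B (stimes B b c) (\<phi> (stimes A (f n) (g n))))) \<longlonglongrightarrow> 0"
    proof (rule Lim_null_comparison)
      show "(\<lambda>n. N (sdiff B b (\<phi> (f n))) * N c
          + (N (sdiff B b (\<phi> (f n))) + N b) * N (sdiff B c (\<phi> (g n)))) \<longlonglongrightarrow> 0"
        using tendsto_add[OF tendsto_mult_right[OF limf, of "N c"]
            tendsto_mult[OF tendsto_add[OF limf tendsto_const[of "N b"]] limg]] by simp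
      have "N (sdiff B (stimes B b c) (\<phi> (stimes A (f n) (g n))))
          \<le> N (sdiff B b (\<phi> (f n))) * N c
            + (N (sdiff B b (\<phi> (f n))) + N b) * N (sdiff B c (\<phi> (g n)))" for n
      proof -
        have "N (\<phi> (f n)) \<le> N (sdiff B b (\<phi> (f n))) + N b"
          using b.norm_diff_le[OF bc(1) cl[OF fg(1)], of n] by linarith
        then have "N (\<phi> (f n)) * N (sdiff B c (\<phi> (g n)))
            \<le> (N (sdiff B b (\<phi> (f n))) + N b) * N (sdiff B c (\<phi> (g n)))"
          using bc fg cl by (intro mult_right_mono b.nonneg) auto
        then show ?thesis
          using b.dist_mult[OF bc cl[OF fg(1)] cl[OF fg(2)], of n n]
          by (simp add: star_hom_mult[OF hom] fg)
      qed
      then show "\<forall>\<^sub>F n in sequentially. norm (N (sdiff B (stimes B b c) (\<phi> (stimes A (f n) (g n)))))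
          \<le> N (sdiff B b (\<phi> (f n))) * N c
            + (N (sdiff B b (\<phi> (f n))) + N b) * N (sdiff B c (\<phi> (g n)))"
        using fg bc cl by (auto intro!: always_eventually simp: b.nonneg)
    qed
  qed
  have ext: "p' (\<phi> x) = p x" if x: "x \<in> carrier A" for x
  proof -
    have "appr (\<phi> x) (\<lambda>_. x)" using x cl by (simp add: appr_def b.dist_self)
    from LIMSEQ_unique[OF lim[OF this cl[OF x]] tendsto_const] show ?thesis by simp
  qed
  have "cstar_seminorm B p'" unfolding cstar_seminorm_def
  proof (intro conjI ballI allI)
    fix b assume b: "b \<in> carrier B"
    obtain f where f: "appr b f" using ex[OF b] by blast
    have fA: "f n \<in> carrier A" for n using f by (simp add: appr_def)
    show "0 \<le> p' b"
      by (rule LIMSEQ_le_const[OF lim[OF f b]]) (use p.nonneg fA in auto)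
    show "p' (sscale B k b) = cmod k * p' b" for k
      by (rule LIMSEQ_unique[OF lim[OF appr_scale[OF f b]]])
         (use tendsto_mult_left[OF lim[OF f b], of "cmod k"] b fA in \<open>simp_all add: p.homogeneous\<close>)
    show "p' (stimes B (sstar B b) b) = (p' b)\<^sup>2"
    proof (rule LIMSEQ_unique)
      show "(\<lambda>n. p (stimes A (sstar A (f n)) (f n))) \<longlonglongrightarrow> p' (stimes B (sstar B b) b)"
        using appr_mult[OF appr_star[OF f b] f] b by (intro lim) auto
      show "(\<lambda>n. p (stimes A (sstar A (f n)) (f n))) \<longlonglongrightarrow> (p' b)\<^sup>2"
        using tendsto_power[OF lim[OF f b], of 2] fA by (simp add: p2)
    qed
    fix c assume c: "c \<in> carrier B"
    obtain g where g: "appr c g" using ex[OF c] by blast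
    have gA: "g n \<in> carrier A" for n using g by (simp add: appr_def)
    show "p' (splus B b c) \<le> p' b + p' c"
      by (rule LIMSEQ_le[OF lim[OF appr_add[OF f g b c]] tendsto_add[OF lim[OF f b] lim[OF g c]]])
         (use b c fA gA p.triangle in auto)
    show "p' (stimes B b c) \<le> p' b * p' c"
      by (rule LIMSEQ_le[OF lim[OF appr_mult[OF f g b c]] tendsto_mult[OF lim[OF f b] lim[OF g c]]])
         (use b c fA gA p.submult in auto)
  qed
  then show thesis using that ext by blast
qed

text \<open>
  Under the hypotheses below the two families of C*-seminorms correspond under pull-back, so the
  universal seminorm of \<open>A\<close> is the pull-back of that of \<open>B\<close>; the completions then agree
  because \<open>\<phi>\<close> has dense range.
\<close>

theorem enveloping_iso_of_dominated:
  assumes A: "star_alg A" and N: "star_seminorm B N" and hom: "star_hom A B \<phi>"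
    and maximal: "\<And>q x. cstar_seminorm B q \<Longrightarrow> x \<in> carrier B \<Longrightarrow> q x \<le> N x"
    and dense: "\<And>b e. b \<in> carrier B \<Longrightarrow> e > 0 \<Longrightarrow> \<exists>a\<in>carrier A. N (sdiff B b (\<phi> a)) < e"
    and E: "E \<subseteq> carrier A \<times> carrier A" and rel: "\<And>y z. (y, z) \<in> E \<Longrightarrow> \<phi> y = \<phi> z"
    and dom: "\<And>p x. \<lbrakk>cstar_seminorm A p; \<forall>(y, z)\<in>E. p (sdiff A y z) = 0; x \<in> carrier A\<rbrakk>
      \<Longrightarrow> p x \<le> N (\<phi> x)"
  shows "cstar_isomorphic (enveloping_cstar_algebra B {}) (enveloping_cstar_algebra A E)"
proof -
  interpret a: star_alg A by fact
  interpret b: star_seminorm B N by fact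
  let ?U = "universal_seminorm A E" and ?V = "universal_seminorm B {}"
  have bddA: "bdd_above ((\<lambda>p. p x) ` a.admissible E)" if "x \<in> carrier A" for x
    using dom that by (intro bdd_aboveI[of _ "N (\<phi> x)"]) (auto simp: a.admissible_def)
  have bddB: "bdd_above ((\<lambda>p. p x) ` b.admissible {})" if "x \<in> carrier B" for x
    using maximal that by (intro bdd_aboveI[of _ "N x"]) (auto simp: b.admissible_def)
  have U: "cstar_seminorm A ?U" using a.universal_cstar_seminorm[OF bddA] .
  have V: "cstar_seminorm B ?V" using b.universal_cstar_seminorm[OF bddB] .
  interpret U: star_seminorm A ?U by (rule a.cstar_seminorm_imp_star_seminorm[OF U])
  interpret V: star_seminorm B ?V by (rule b.cstar_seminorm_imp_star_seminorm[OF V])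
  note cl = star_hom_closed[OF hom]
  have pull: "(\<lambda>x. ?V (\<phi> x)) \<in> a.admissible E" unfolding a.admissible_def
  proof (intro CollectI conjI)
    show "cstar_seminorm A (\<lambda>x. ?V (\<phi> x))"
      using V by (simp add: cstar_seminorm_def cl star_hom_add[OF hom] star_hom_scale[OF hom]
          star_hom_mult[OF hom] star_hom_star[OF hom])
    show "\<forall>(y, z)\<in>E. ?V (\<phi> (sdiff A y z)) = 0"
    proof safe
      fix y z assume yz: "(y, z) \<in> E"
      then have "y \<in> carrier A" "z \<in> carrier A" using E by auto
      then show "?V (\<phi> (sdiff A y z)) = 0"
        using rel[OF yz] by (simp add: star_hom_diff[OF A hom] V.dist_self cl)
    qed
  qed
  have iso: "?V (\<phi> x) = ?U x" if x: "x \<in> carrier A" for x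
  proof (rule antisym)
    show "?V (\<phi> x) \<le> ?U x" using a.universal_upper[OF pull bddA[OF x]] .
    show "?U x \<le> ?V (\<phi> x)"
    proof (rule a.universal_least)
      fix p assume p: "p \<in> a.admissible E"
      then have "cstar_seminorm A p" "\<And>x. x \<in> carrier A \<Longrightarrow> p x \<le> N (\<phi> x)"
        using dom by (auto simp: a.admissible_def)
      from extend_dominated_cstar_seminorm[OF A N hom dense this]
      obtain p' where p': "cstar_seminorm B p'" and ext: "\<And>x. x \<in> carrier A \<Longrightarrow> p' (\<phi> x) = p x"
        by blast
      have "p' \<in> b.admissible {}" using p' by (simp add: b.admissible_def)
      from b.universal_upper[OF this bddB[OF cl[OF x]]] show "p x \<le> ?V (\<phi> x)"
        using ext[OF x] by simp
    qed
  qed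
  show ?thesis unfolding enveloping_cstar_algebra_def
  proof (rule completion_iso_of_dense[OF U.star_seminorm_axioms V.star_seminorm_axioms hom iso])
    fix b and e :: real assume b: "b \<in> carrier B" and "e > 0"
    then obtain a where a: "a \<in> carrier A" "N (sdiff B b (\<phi> a)) < e" using dense by blast
    have "?V (sdiff B b (\<phi> a)) \<le> N (sdiff B b (\<phi> a))"
      using maximal[OF V] b cl[OF a(1)] by simp
    then show "\<exists>a\<in>carrier A. ?V (sdiff B b (\<phi> a)) < e" using a by force
  qed
qed

section \<open>Projections in a ring with a C*-seminorm\<close>

class star_ring = ring +
  fixes scC :: "complex \<Rightarrow> 'a \<Rightarrow> 'a" (infixr "*\<^sub>C" 75)
    and adj :: "'a \<Rightarrow> 'a"
  assumes scC_add: "c *\<^sub>C (x + y) = c *\<^sub>C x + c *\<^sub>C y"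
    and scC_left_add: "(c + d) *\<^sub>C x = c *\<^sub>C x + d *\<^sub>C x"
    and scC_scC: "c *\<^sub>C d *\<^sub>C x = (c * d) *\<^sub>C x"
    and scC_one: "1 *\<^sub>C x = x"
    and scC_mult: "(c *\<^sub>C x) * y = c *\<^sub>C (x * y)"
    and mult_scC: "x * (c *\<^sub>C y) = c *\<^sub>C (x * y)"
    and adj_add: "adj (x + y) = adj x + adj y"
    and adj_mult: "adj (x * y) = adj y * adj x"
    and adj_scC: "adj (c *\<^sub>C x) = cnj c *\<^sub>C adj x"
    and adj_adj: "adj (adj x) = x"
begin

lemma scC_zero_right [simp]: "c *\<^sub>C 0 = 0"
  using scC_add[of c 0 0] by simp

lemma scC_zero_left [simp]: "0 *\<^sub>C x = 0"
  using scC_left_add[of 0 0 x] by simp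

lemma scC_neg_one: "(-1) *\<^sub>C x = - x"
proof -
  have "(-1) *\<^sub>C x + x = 0" using scC_left_add[of "-1" 1 x] by (simp add: scC_one)
  then show ?thesis by (simp add: eq_neg_iff_add_eq_0)
qed

lemma scC_minus: "c *\<^sub>C (- x) = - (c *\<^sub>C x)"
  using scC_add[of c x "- x"] by (simp add: eq_neg_iff_add_eq_0 add.commute)

lemma scC_diff: "c *\<^sub>C (x - y) = c *\<^sub>C x - c *\<^sub>C y"
  using scC_add[of c x "- y"] by (simp add: scC_minus)

lemma scC_sum: "c *\<^sub>C sum f I = (\<Sum>i\<in>I. c *\<^sub>C f i)"
  by (induction I rule: infinite_finite_induct) (auto simp: scC_add)

lemma adj_zero [simp]: "adj 0 = 0"
  using adj_add[of 0 0] by simp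

lemma adj_minus: "adj (- x) = - adj x"
  using adj_add[of x "- x"] by (simp add: eq_neg_iff_add_eq_0 add.commute)

lemma adj_diff: "adj (x - y) = adj x - adj y"
  using adj_add[of x "- y"] by (simp add: adj_minus)

lemma adj_sum: "adj (sum f I) = (\<Sum>i\<in>I. adj (f i))"
  by (induction I rule: infinite_finite_induct) (auto simp: adj_add)

end

text \<open>
  The congruence \<open>\<simeq>\<close> is used for the null space of a C*-seminorm, for the kernel of a homomorphism, and for
  the intersection of the two.
\<close>

locale star_ideal =
  fixes J :: "'a::star_ring set"
  assumes zero_mem: "0 \<in> J"
    and add_mem: "\<lbrakk>x \<in> J; y \<in> J\<rbrakk> \<Longrightarrow> x + y \<in> J"
    and scC_mem: "x \<in> J \<Longrightarrow> c *\<^sub>C x \<in> J"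
    and mult_mem: "x \<in> J \<Longrightarrow> x * y \<in> J" "x \<in> J \<Longrightarrow> y * x \<in> J"
    and adj_mem: "x \<in> J \<Longrightarrow> adj x \<in> J"
begin

definition eqv :: "'a \<Rightarrow> 'a \<Rightarrow> bool" (infix "\<simeq>" 50) where
  "x \<simeq> y \<longleftrightarrow> x - y \<in> J"

lemma eqv_refl [simp]: "x \<simeq> x"
  by (simp add: eqv_def zero_mem)

lemma eqv_sym: "x \<simeq> y \<Longrightarrow> y \<simeq> x"
  using scC_mem[of "x - y" "-1"] by (simp add: eqv_def scC_neg_one)

lemma eqv_trans [trans]: "x \<simeq> y \<Longrightarrow> y \<simeq> z \<Longrightarrow> x \<simeq> z"
  using add_mem[of "x - y" "y - z"] by (simp add: eqv_def)

lemma eqv_add: "\<lbrakk>x \<simeq> x'; y \<simeq> y'\<rbrakk> \<Longrightarrow> x + y \<simeq> x' + y'"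
  using add_mem[of "x - x'" "y - y'"] by (simp add: eqv_def algebra_simps)

lemma eqv_scC: "x \<simeq> y \<Longrightarrow> c *\<^sub>C x \<simeq> c *\<^sub>C y"
  using scC_mem[of "x - y" c] by (simp add: eqv_def scC_diff)

lemma eqv_minus: "x \<simeq> y \<Longrightarrow> - x \<simeq> - y"
  using eqv_scC[of x y "-1"] by (simp add: scC_neg_one)

lemma eqv_diff: "\<lbrakk>x \<simeq> x'; y \<simeq> y'\<rbrakk> \<Longrightarrow> x - y \<simeq> x' - y'"
  using eqv_add[OF _ eqv_minus, of x x' y y'] by simp

lemma eqv_mult:
  assumes "x \<simeq> x'" "y \<simeq> y'"
  shows "x * y \<simeq> x' * y'"
proof -
  have "(x - x') * y + x' * (y - y') \<in> J"
    using assms by (intro add_mem mult_mem) (auto simp: eqv_def)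
  then show ?thesis by (simp add: eqv_def algebra_simps)
qed

lemma eqv_adj: "x \<simeq> y \<Longrightarrow> adj x \<simeq> adj y"
  using adj_mem[of "x - y"] by (simp add: eqv_def adj_diff)

lemma eqv_sum: "(\<And>i. i \<in> I \<Longrightarrow> f i \<simeq> g i) \<Longrightarrow> sum f I \<simeq> sum g I"
  by (induction I rule: infinite_finite_induct) (auto intro: eqv_add)

lemma eqv_zero_iff: "x \<simeq> 0 \<longleftrightarrow> x \<in> J"
  by (simp add: eqv_def)

end

lemma star_ideal_Int: "star_ideal J \<Longrightarrow> star_ideal J' \<Longrightarrow> star_ideal (J \<inter> J')"
proof -
  assume "star_ideal J" "star_ideal J'"
  then interpret a: star_ideal J + b: star_ideal J' by simp_all
  show ?thesis
    by unfold_locales (simp_all add: a.zero_mem b.zero_mem a.add_mem b.add_mem a.scC_mem b.scC_mem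
      a.mult_mem b.mult_mem a.adj_mem b.adj_mem)
qed

locale cstar_ring =
  fixes p :: "'a::star_ring \<Rightarrow> real"
  assumes nonneg: "0 \<le> p x"
    and triangle: "p (x + y) \<le> p x + p y"
    and homogeneous: "p (c *\<^sub>C x) = cmod c * p x"
    and submult: "p (x * y) \<le> p x * p y"
    and cstar: "p (adj x * x) = (p x)\<^sup>2"
begin

lemma p_zero [simp]: "p 0 = 0"
  using homogeneous[of 0 0] by simp

lemma p_adj: "p (adj x) = p x"
proof -
  have le: "p x \<le> p (adj x)" for x
  proof -
    have "p x * p x \<le> p (adj x) * p x"
      using submult[of "adj x" x] by (simp add: cstar power2_eq_square)
    then show ?thesis using nonneg[of x] nonneg[of "adj x"] by (cases "p x = 0") auto
  qed
  show ?thesis using le[of x] le[of "adj x"] by (simp add: adj_adj)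
qed

lemma p_minus: "p (- x) = p x"
  using homogeneous[of "-1" x] by (simp add: scC_neg_one)

lemma p_sum_le: "p (sum f I) \<le> (\<Sum>i\<in>I. p (f i))"
  by (induction I rule: infinite_finite_induct) (auto intro: order_trans[OF triangle])

sublocale null: star_ideal "{x. p x = 0}"
proof
  fix x y :: 'a and c
  assume x: "x \<in> {x. p x = 0}"
  show "x * y \<in> {x. p x = 0}" "y * x \<in> {x. p x = 0}"
    using x submult[of x y] submult[of y x] nonneg[of "x * y"] nonneg[of "y * x"] by auto
  show "c *\<^sub>C x \<in> {x. p x = 0}" "adj x \<in> {x. p x = 0}" using x by (auto simp: homogeneous p_adj)
  assume "y \<in> {x. p x = 0}"
  then show "x + y \<in> {x. p x = 0}" using x triangle[of x y] nonneg[of "x + y"] by auto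
qed simp

notation null.eqv (infix "\<simeq>" 50)

lemma p_cong: "x \<simeq> y \<Longrightarrow> p x = p y"
proof -
  assume "x \<simeq> y"
  then have 0: "p (x - y) = 0" by (simp add: null.eqv_def)
  have "p x \<le> p (x - y) + p y" "p y \<le> p (- (x - y)) + p x"
    using triangle[of "x - y" y] triangle[of "- (x - y)" x] by simp_all
  then show ?thesis using 0 by (simp only: p_minus)
qed

end

text \<open>
  The unit of a C*-algebra is an extreme point of the unit ball: if \<open>1 + X\<close> and \<open>1 - X\<close> are
  contractions with \<open>X\<close> self-adjoint, then \<open>X = 0\<close>. For real \<open>t\<close> and \<open>u = e\<^bsup>i\<pi>/3\<^esup>\<close> the C*-identity
  turns the contractions \<open>1 \<plusminus> tX\<close> into contractions \<open>1 \<plusminus> tuX\<close>, and the weighted average of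
  the cubes of \<open>1 + t\<zeta>X\<close> over the sixth roots of unity \<open>\<zeta>\<close>, with weights proportional to
  \<open>1 + Re \<zeta>\<close>, is \<open>1 + (3/2) t X\<close>. So \<open>t\<close> can be increased indefinitely. The computation lives in the
  polynomial ring, on which the seminorm is pulled back.
\<close>

lemma poly_seminorm_extreme_one:
  fixes q :: "complex poly \<Rightarrow> real"
  assumes q_nonneg: "\<And>f. 0 \<le> q f"
    and q_add: "\<And>f g. q (f + g) \<le> q f + q g"
    and q_smult: "\<And>c f. q (smult c f) = cmod c * q f"
    and q_mult: "\<And>f g. q (f * g) \<le> q f * q g"
    and q_cstar: "\<And>f. q (map_poly cnj f * f) = (q f)\<^sup>2"
    and plus: "q [:1, 1:] \<le> 1" and minus: "q [:1, -1:] \<le> 1"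
  shows "q [:0, 1:] = 0"
proof -
  have q_pow: "q (f * f * f) \<le> 1" if f: "q f \<le> 1" for f
  proof -
    have "q (f * f) \<le> 1" using q_mult[of f f] f q_nonneg[of f] mult_le_one by fastforce
    then show ?thesis
      using q_mult[of "f * f" f] f q_nonneg[of f] q_nonneg[of "f * f"] mult_le_one by fastforce
  qed
  define u :: complex where "u = Complex (1 / 2) (sqrt 3 / 2)"
  have cnj_u: "cnj u = 1 - u" and u2: "u * u = u - 1"
    by (simp_all add: u_def complex_eq_iff power2_eq_square)
  have u3: "u * (u * z) = u * z - z" for z by (simp add: u2 algebra_simps flip: mult.assoc)
  have third: "q [:1, complex_of_real t * u:] \<le> 1 \<and> q [:1, complex_of_real t * cnj u:] \<le> 1"
    if t: "q [:1, complex_of_real t:] \<le> 1" "q [:1, - complex_of_real t:] \<le> 1" for t :: real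
  proof -
    let ?s = "complex_of_real t"
    have sq: "q (f * f) \<le> 1" if "q f \<le> 1" for f
      using q_mult[of f f] that q_nonneg[of f] mult_le_one by fastforce
    have "q (smult (3/4) ([:1, ?s:] * [:1, ?s:]) + smult (1/4) ([:1, - ?s:] * [:1, - ?s:]))
        \<le> 3/4 * q ([:1, ?s:] * [:1, ?s:]) + 1/4 * q ([:1, - ?s:] * [:1, - ?s:])"
      by (rule order_trans[OF q_add]) (simp add: q_smult del: mult_pCons_left mult_pCons_right)
    also have "\<dots> \<le> 1" using sq[OF t(1)] sq[OF t(2)] by linarith
    also have "smult (3/4) ([:1, ?s:] * [:1, ?s:]) + smult (1/4) ([:1, - ?s:] * [:1, - ?s:])
        = [:1, ?s, ?s * ?s:]" by simp
    finally have le: "q [:1, ?s, ?s * ?s:] \<le> 1" .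
    have "map_poly cnj [:1, ?s * u:] * [:1, ?s * u:] = [:1, ?s, ?s * ?s:]"
      by (simp add: map_poly_pCons cnj_u algebra_simps u2 u3)
    then have 1: "(q [:1, ?s * u:])\<^sup>2 \<le> 1" using q_cstar[of "[:1, ?s * u:]"] le by simp
    have "map_poly cnj [:1, ?s * cnj u:] * [:1, ?s * cnj u:] = [:1, ?s, ?s * ?s:]"
      by (simp add: map_poly_pCons cnj_u algebra_simps u2 u3)
    then have 2: "(q [:1, ?s * cnj u:])\<^sup>2 \<le> 1" using q_cstar[of "[:1, ?s * cnj u:]"] le by simp
    from 1 2 show ?thesis by (simp add: abs_square_le_1 abs_le_iff)
  qed
  have boost: "q [:1, complex_of_real (3/2 * t):] \<le> 1"
    if t: "q [:1, complex_of_real t:] \<le> 1" "q [:1, - complex_of_real t:] \<le> 1" for t :: real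
  proof -
    let ?s = "complex_of_real t"
    let ?f1 = "[:1, ?s:]" and ?f2 = "[:1, ?s * u:]" and ?f3 = "[:1, ?s * cnj u:]"
      and ?f4 = "[:1, - ?s * u:]" and ?f5 = "[:1, - ?s * cnj u:]"
    have t': "q [:1, complex_of_real (- t):] \<le> 1" "q [:1, - complex_of_real (- t):] \<le> 1"
      using t by simp_all
    have c: "q ?f1 \<le> 1" "q ?f2 \<le> 1" "q ?f3 \<le> 1" "q ?f4 \<le> 1" "q ?f5 \<le> 1"
      using third[OF t] third[OF t'] t by simp_all
    have average: "[:1, complex_of_real (3/2 * t):]
        = smult (1/3) (?f1 * ?f1 * ?f1) + (smult (1/4) (?f2 * ?f2 * ?f2)
          + (smult (1/4) (?f3 * ?f3 * ?f3) + (smult (1/12) (?f4 * ?f4 * ?f4)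
          + smult (1/12) (?f5 * ?f5 * ?f5))))"
      by (simp add: cnj_u algebra_simps u2 u3)
    have "q [:1, complex_of_real (3/2 * t):] \<le> 1/3 * q (?f1 * ?f1 * ?f1) + (1/4 * q (?f2 * ?f2 * ?f2)
          + (1/4 * q (?f3 * ?f3 * ?f3) + (1/12 * q (?f4 * ?f4 * ?f4)
          + 1/12 * q (?f5 * ?f5 * ?f5))))"
      unfolding average by (intro order_trans[OF q_add] add_mono)
         (simp_all add: q_smult del: mult_pCons_left mult_pCons_right)
    also have "\<dots> \<le> 1"
    proof -
      have avg: "1/3 * v + (1/4 * w + (1/4 * x + (1/12 * y + 1/12 * z))) \<le> 1"
        if "v \<le> 1" "w \<le> 1" "x \<le> 1" "y \<le> 1" "z \<le> 1" for v w x y z :: real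
        using that by linarith
      show ?thesis by (rule avg[OF c[THEN q_pow]])
    qed
    finally show ?thesis .
  qed
  have all: "q [:1, complex_of_real ((3/2) ^ n):] \<le> 1 \<and> q [:1, - complex_of_real ((3/2) ^ n):] \<le> 1"
    for n
  proof (induction n)
    case (Suc n)
    then show ?case
      using boost[of "(3/2) ^ n"] boost[of "- ((3/2) ^ n)"] by simp
  qed (use plus minus in simp)
  have bound: "q [:0, 1:] \<le> (2/3) ^ n" for n
  proof -
    let ?s = "complex_of_real ((3/2) ^ n)"
    have "smult (2 * ?s) [:0, 1:] = [:1, ?s:] + smult (-1) [:1, - ?s:]" by simp
    then have "cmod (2 * ?s) * q [:0, 1:] = q ([:1, ?s:] + smult (-1) [:1, - ?s:])"
      by (metis q_smult)
    also have "\<dots> \<le> q [:1, ?s:] + q (smult (-1) [:1, - ?s:])" by (rule q_add)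
    also have "\<dots> \<le> 2" using all[of n] q_smult[of "-1" "[:1, - ?s:]"] by simp
    finally have "2 * (3/2) ^ n * q [:0, 1:] \<le> 2" by (simp add: norm_mult norm_power norm_divide)
    then have "q [:0, 1:] \<le> inverse ((3/2) ^ n)" by (simp add: field_simps)
    then show ?thesis by (simp flip: power_inverse)
  qed
  have "(\<lambda>n. (2/3 :: real) ^ n) \<longlonglongrightarrow> 0" by (rule LIMSEQ_power_zero) simp
  then have "q [:0, 1:] \<le> 0" using bound by (intro LIMSEQ_le_const) auto
  then show ?thesis using q_nonneg by (simp add: antisym)
qed

context cstar_ring begin

text \<open>Evaluation of a polynomial at \<open>h\<close> in a corner whose unit is \<open>e\<close>.\<close>

definition corner_eval :: "'a \<Rightarrow> 'a \<Rightarrow> complex poly \<Rightarrow> 'a" where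
  "corner_eval e h f = fold_coeffs (\<lambda>c x. c *\<^sub>C e + h * x) f 0"

lemma corner_eval_0 [simp]: "corner_eval e h 0 = 0"
  by (simp add: corner_eval_def)

lemma corner_eval_pCons [simp]:
  "corner_eval e h (pCons c f) = c *\<^sub>C e + h * corner_eval e h f"
  by (cases "f = 0 \<and> c = 0") (auto simp: corner_eval_def)

lemma corner_eval_add: "corner_eval e h (f + g) = corner_eval e h f + corner_eval e h g"
  by (induction f g rule: poly_induct2) (auto simp: scC_left_add algebra_simps)

lemma corner_eval_smult: "corner_eval e h (smult c f) = c *\<^sub>C corner_eval e h f"
  by (induction f) (auto simp: scC_add scC_scC mult_scC)

lemma corner_extreme_unit:
  assumes e: "e * e \<simeq> e" "adj e \<simeq> e" and h: "adj h \<simeq> h" "e * h \<simeq> h" "h * e \<simeq> h"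
    and bounds: "p (e + h) \<le> 1" "p (e - h) \<le> 1"
  shows "p h = 0"
proof -
  let ?ev = "corner_eval e h"
  have unit: "e * ?ev f \<simeq> ?ev f" for f
  proof (induction f)
    case (pCons c f)
    have "e * ?ev (pCons c f) = c *\<^sub>C (e * e) + (e * h) * ?ev f"
      by (simp add: distrib_left mult_scC mult.assoc)
    also have "\<dots> \<simeq> c *\<^sub>C e + h * ?ev f"
      using e h by (intro null.eqv_add null.eqv_scC null.eqv_mult) auto
    finally show ?case by simp
  qed simp
  have mult: "?ev (f * g) \<simeq> ?ev f * ?ev g" for f g
  proof (induction f)
    case (pCons c f)
    have "?ev (pCons c f * g) = c *\<^sub>C ?ev g + h * ?ev (f * g)"
      by (simp add: corner_eval_add corner_eval_smult)
    also have "\<dots> \<simeq> c *\<^sub>C (e * ?ev g) + h * (?ev f * ?ev g)"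
      using pCons.IH
      by (intro null.eqv_add null.eqv_scC null.eqv_mult null.eqv_sym[OF unit]) auto
    finally show ?case by (simp add: distrib_right scC_mult mult.assoc)
  qed simp
  have commute: "h * ?ev f \<simeq> ?ev f * h" for f
  proof (induction f)
    case (pCons c f)
    have "h * ?ev (pCons c f) = c *\<^sub>C (h * e) + h * (h * ?ev f)"
      by (simp add: distrib_left mult_scC)
    also have "\<dots> \<simeq> c *\<^sub>C (e * h) + h * (?ev f * h)"
      by (intro null.eqv_add null.eqv_scC null.eqv_mult[OF null.eqv_refl] pCons.IH
          null.eqv_trans[OF h(3) null.eqv_sym[OF h(2)]])
    finally show ?case by (simp add: distrib_right scC_mult mult.assoc)
  qed simp
  have star: "?ev (map_poly cnj f) \<simeq> adj (?ev f)" for f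
  proof (induction f)
    case (pCons c f)
    have "?ev (map_poly cnj (pCons c f)) = cnj c *\<^sub>C e + h * ?ev (map_poly cnj f)"
      by (simp add: map_poly_pCons)
    also have "\<dots> \<simeq> cnj c *\<^sub>C e + ?ev (map_poly cnj f) * h"
      by (intro null.eqv_add commute) auto
    also have "\<dots> \<simeq> cnj c *\<^sub>C adj e + adj (?ev f) * adj h"
      using pCons.IH null.eqv_sym[OF e(2)] null.eqv_sym[OF h(1)]
      by (intro null.eqv_add null.eqv_scC null.eqv_mult)
    finally show ?case by (simp add: adj_add adj_scC adj_mult)
  qed simp
  have "p (?ev [:0, 1:]) = 0"
  proof (rule poly_seminorm_extreme_one[where q = "\<lambda>f. p (?ev f)"])
    show "p (?ev (f * g)) \<le> p (?ev f) * p (?ev g)" for f g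
      using submult[of "?ev f" "?ev g"] p_cong[OF mult[of f g]] by simp
    show "p (?ev (map_poly cnj f * f)) = (p (?ev f))\<^sup>2" for f
    proof -
      have "?ev (map_poly cnj f * f) \<simeq> adj (?ev f) * ?ev f"
        using null.eqv_trans[OF mult null.eqv_mult[OF star null.eqv_refl]] .
      from p_cong[OF this] show ?thesis by (simp add: cstar)
    qed
    have "?ev [:1, 1:] \<simeq> e + h" "?ev [:1, -1:] \<simeq> e - h"
      using null.eqv_add[OF null.eqv_refl[of e] h(3)] null.eqv_diff[OF null.eqv_refl[of e] h(3)]
      by (simp_all add: scC_one scC_neg_one)
    then show "p (?ev [:1, 1:]) \<le> 1" "p (?ev [:1, -1:]) \<le> 1"
      using bounds by (simp_all add: p_cong del: corner_eval_pCons)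
  qed (use nonneg triangle homogeneous in \<open>auto simp: corner_eval_add corner_eval_smult simp del: corner_eval_pCons\<close>)
  moreover have "?ev [:0, 1:] \<simeq> h" using h(3) by (simp add: scC_one)
  ultimately show ?thesis by (simp add: p_cong del: corner_eval_pCons)
qed

definition projection :: "'a \<Rightarrow> bool" where
  "projection e \<longleftrightarrow> e * e \<simeq> e \<and> adj e \<simeq> e"

lemma projection_norm:
  assumes "projection e"
  shows "p e \<le> 1"
proof -
  have "adj e * e \<simeq> e"
    using assms null.eqv_trans[OF null.eqv_mult[OF _ null.eqv_refl]]
    by (auto simp: projection_def)
  then have "(p e)\<^sup>2 = p e" using p_cong cstar by metis
  then have "p e = 0 \<or> p e = 1" by (simp add: power2_eq_square)
  then show ?thesis by auto
qed

lemma projection_complement: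
  assumes "projection e"
  shows "adj (x - e * x) * (x - e * x) \<simeq> adj x * (x - e * x)"
proof -
  have e: "e * e \<simeq> e" "adj e \<simeq> e" using assms by (auto simp: projection_def)
  have "adj (x - e * x) * (x - e * x)
      = adj x * (x - e * x) - adj x * (adj e * x) + adj x * ((adj e * e) * x)"
    by (simp add: adj_diff adj_mult algebra_simps)
  also have "\<dots> \<simeq> adj x * (x - e * x) - adj x * (e * x) + adj x * (e * x)"
    using e null.eqv_trans[OF null.eqv_mult[OF e(2) null.eqv_refl] e(1)]
    by (intro null.eqv_add null.eqv_diff null.eqv_mult null.eqv_refl)
  finally show ?thesis by simp
qed

lemma projection_complement_norm:
  assumes "projection e"
  shows "p (x - e * x) \<le> p x"
proof -
  have "(p (x - e * x))\<^sup>2 = p (adj x * (x - e * x))"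
    using p_cong[OF projection_complement[OF assms, of x]] by (simp add: cstar)
  also have "\<dots> \<le> p x * p (x - e * x)" using submult[of "adj x"] by (simp add: p_adj)
  finally show ?thesis
    using nonneg[of "x - e * x"] nonneg[of x]
    by (cases "p (x - e * x) = 0") (auto simp: power2_eq_square)
qed

text \<open>
  If projections add up to a projection \<open>E\<close>, they are mutually orthogonal. With
  \<open>h\<^sub>k = e\<^sub>j e\<^sub>k e\<^sub>j\<close>, a compression of a projection, \<open>e\<^sub>j - h\<^sub>k\<close> is a contraction; since
  \<open>e\<^sub>j E e\<^sub>j = e\<^sub>j + \<Sum>\<^bsub>k\<noteq>j\<^esub> h\<^sub>k\<close> is one as well, averaging shows that \<open>e\<^sub>j + h\<^sub>i/c\<close> is a
  contraction too, where \<open>c\<close> is the number of \<open>k \<noteq> j\<close>. So \<open>h\<^sub>i = 0\<close>, because \<open>e\<^sub>j\<close> is extreme.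
\<close>

theorem projections_orthogonal:
  assumes fin: "finite I" and proj: "\<And>k. k \<in> I \<Longrightarrow> projection (e k)"
    and E: "projection E" "E \<simeq> (\<Sum>k\<in>I. e k)" and ij: "i \<in> I" "j \<in> I" "i \<noteq> j"
  shows "e i * e j \<simeq> 0"
proof -
  have pr: "e k * e k \<simeq> e k" "adj (e k) \<simeq> e k" if "k \<in> I" for k
    using proj[OF that] by (auto simp: projection_def)
  define h where "h k = e j * (e k * e j)" for k
  have pj: "p (e j) \<le> 1" using projection_norm[OF proj[OF ij(2)]] .
  have compl: "p (e j - h k) \<le> 1" if k: "k \<in> I" for k
  proof -
    have "adj (e j - e k * e j) * (e j - e k * e j) \<simeq> adj (e j) * (e j - e k * e j)"
      by (rule projection_complement[OF proj[OF k]])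
    also have "\<dots> \<simeq> e j * (e j - e k * e j)"
      using pr[OF ij(2)] by (intro null.eqv_mult) auto
    also have "\<dots> = e j * e j - h k" by (simp add: h_def right_diff_distrib)
    also have "\<dots> \<simeq> e j - h k" using pr[OF ij(2)] by (intro null.eqv_diff) auto
    finally have "p (e j - h k) = (p (e j - e k * e j))\<^sup>2" using p_cong cstar by metis
    also have "\<dots> \<le> 1"
      using projection_complement_norm[OF proj[OF k], of "e j"] pj nonneg[of "e j - e k * e j"]
      by (intro power_le_one) auto
    finally show ?thesis .
  qed
  define c where "c = card (I - {j})"
  have card: "card (I - {i, j}) = c - 1" "c \<ge> 1"
  proof -
    have "I - {i, j} = (I - {j}) - {i}" by auto
    then show "card (I - {i, j}) = c - 1" using fin ij by (simp add: c_def)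
    have "I - {j} \<noteq> {}" using ij by blast
    then show "c \<ge> 1" using fin unfolding c_def Suc_le_eq One_nat_def card_gt_0_iff by blast
  qed
  have "e j * (E * e j) \<simeq> e j * ((\<Sum>k\<in>I. e k) * e j)"
    using E by (intro null.eqv_mult) auto
  also have "\<dots> = (\<Sum>k\<in>I. h k)" by (simp add: h_def sum_distrib_left sum_distrib_right)
  also have "\<dots> = h j + (h i + (\<Sum>k\<in>I - {i, j}. h k))"
  proof -
    have "(\<Sum>k\<in>I. h k) = h j + (\<Sum>k\<in>I - {j}. h k)" by (rule sum.remove[OF fin ij(2)])
    also have "(\<Sum>k\<in>I - {j}. h k) = h i + (\<Sum>k\<in>I - {j} - {i}. h k)"
      using fin ij by (intro sum.remove) auto
    also have "I - {j} - {i} = I - {i, j}" by auto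
    finally show ?thesis .
  qed
  also have "\<dots> \<simeq> e j + (h i + (\<Sum>k\<in>I - {i, j}. h k))"
  proof (intro null.eqv_add null.eqv_refl)
    have "h j \<simeq> e j * e j" unfolding h_def using pr[OF ij(2)] by (intro null.eqv_mult) auto
    then show "h j \<simeq> e j" using pr[OF ij(2)] by (blast intro: null.eqv_trans)
  qed
  finally have sandwich: "e j * (E * e j) \<simeq> e j + (h i + (\<Sum>k\<in>I - {i, j}. h k))" .
  have "of_nat c *\<^sub>C e j + h i = e j + (h i + (\<Sum>k\<in>I - {i, j}. h k)) + (\<Sum>k\<in>I - {i, j}. e j - h k)"
  proof -
    have "of_nat c = 1 + (of_nat (card (I - {i, j})) :: complex)" using card by (simp add: of_nat_diff)
    moreover have "(\<Sum>k\<in>I - {i, j}. e j) = of_nat (card (I - {i, j})) *\<^sub>C e j"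
    proof -
      have "(\<Sum>k\<in>K. x) = of_nat (card K) *\<^sub>C x" if "finite K" for K :: "'b set" and x :: 'a
        using that by (induction K) (auto simp: scC_left_add scC_one)
      then show ?thesis using fin by simp
    qed
    ultimately show ?thesis by (simp add: scC_left_add scC_one sum_subtractf)
  qed
  also have "\<dots> \<simeq> e j * (E * e j) + (\<Sum>k\<in>I - {i, j}. e j - h k)"
    using null.eqv_sym[OF sandwich] by (intro null.eqv_add) auto
  finally have "p (of_nat c *\<^sub>C e j + h i) = p (e j * (E * e j) + (\<Sum>k\<in>I - {i, j}. e j - h k))"
    by (rule p_cong)
  also have "\<dots> \<le> p (e j * (E * e j)) + p (\<Sum>k\<in>I - {i, j}. e j - h k)" by (rule triangle)
  also have "\<dots> \<le> 1 + (\<Sum>k\<in>I - {i, j}. 1)"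
  proof (rule add_mono)
    have "p (e j * (E * e j)) \<le> p (e j) * (p E * p (e j))"
      using submult[of "e j" "E * e j"] submult[of E "e j"] nonneg[of "e j"]
      by (meson mult_left_mono order_trans)
    also have "\<dots> \<le> 1" using pj projection_norm[OF E(1)] nonneg[of E] nonneg[of "e j"]
      by (intro mult_le_one mult_nonneg_nonneg) auto
    finally show "p (e j * (E * e j)) \<le> 1" .
    show "p (\<Sum>k\<in>I - {i, j}. e j - h k) \<le> (\<Sum>k\<in>I - {i, j}. 1)"
      using compl by (intro order_trans[OF p_sum_le] sum_mono) auto
  qed
  also have "\<dots> = real c" using card by (simp add: of_nat_diff)
  finally have upper: "p (of_nat c *\<^sub>C e j + h i) \<le> real c" .
  define H where "H = (1 / of_nat c) *\<^sub>C h i"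
  have c0: "(of_nat c :: complex) \<noteq> 0" "real c > 0" using card by auto
  have "p H = 0"
  proof (rule corner_extreme_unit[of "e j"])
    show "e j * e j \<simeq> e j" "adj (e j) \<simeq> e j" by (fact pr[OF ij(2)])+
    have "adj (h i) = adj (e j) * adj (e i) * adj (e j)" by (simp add: h_def adj_mult)
    also have "\<dots> \<simeq> e j * e i * e j" using pr ij by (intro null.eqv_mult) auto
    also have "\<dots> = h i" by (simp add: h_def mult.assoc)
    finally show "adj H \<simeq> H" unfolding H_def by (simp add: adj_scC null.eqv_scC)
    have "e j * h i = (e j * e j) * (e i * e j)" by (simp add: h_def mult.assoc)
    also have "\<dots> \<simeq> h i" unfolding h_def using pr ij by (intro null.eqv_mult) auto
    finally show "e j * H \<simeq> H" unfolding H_def by (simp add: mult_scC null.eqv_scC)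
    have "h i * e j = e j * (e i * (e j * e j))" by (simp add: h_def mult.assoc)
    also have "\<dots> \<simeq> h i" unfolding h_def using pr ij by (intro null.eqv_mult) auto
    finally show "H * e j \<simeq> H" unfolding H_def by (simp add: scC_mult null.eqv_scC)
    have "e j + H = (1 / of_nat c) *\<^sub>C (of_nat c *\<^sub>C e j + h i)"
      using c0 by (simp add: H_def scC_add scC_scC scC_one)
    then have "p (e j + H) = 1 / real c * p (of_nat c *\<^sub>C e j + h i)"
      by (simp add: homogeneous norm_divide)
    also have "\<dots> \<le> 1 / real c * real c" using upper by (intro mult_left_mono) auto
    finally show "p (e j + H) \<le> 1" using c0 by simp
    have "e j - H = (1 - 1 / of_nat c) *\<^sub>C e j + (1 / of_nat c) *\<^sub>C (e j - h i)"
      by (simp add: H_def scC_diff flip: add_diff_eq scC_left_add add: scC_one)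
    then have "p (e j - H) \<le> cmod (1 - 1 / of_nat c) * p (e j) + cmod (1 / of_nat c) * p (e j - h i)"
      using triangle homogeneous by metis
    also have "cmod (1 - 1 / of_nat c) = 1 - 1 / real c"
    proof -
      have "(1 - 1 / of_nat c :: complex) = of_real (1 - 1 / real c)" by simp
      then have "cmod (1 - 1 / of_nat c) = \<bar>1 - 1 / real c\<bar>" by (metis norm_of_real)
      then show ?thesis using card by simp
    qed
    also have "(1 - 1 / real c) * p (e j) + cmod (1 / of_nat c) * p (e j - h i)
        \<le> (1 - 1 / real c) * 1 + 1 / real c * 1"
      using pj compl[OF ij(1)] card by (intro add_mono mult_mono) (auto simp: norm_divide nonneg)
    finally show "p (e j - H) \<le> 1" by simp
  qed
  then have h0: "p (h i) = 0" using c0 by (simp add: H_def homogeneous)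
  have "adj (e i * e j) * (e i * e j) = adj (e j) * ((adj (e i) * e i) * e j)"
    by (simp add: adj_mult mult.assoc)
  also have "\<dots> \<simeq> h i" unfolding h_def
  proof (intro null.eqv_mult null.eqv_refl)
    show "adj (e i) * e i \<simeq> e i"
      using null.eqv_trans[OF null.eqv_mult[OF pr(2)[OF ij(1)] null.eqv_refl] pr(1)[OF ij(1)]] .
  qed (use pr ij in auto)
  finally have "(p (e i * e j))\<^sup>2 = 0" using h0 p_cong cstar by metis
  then show ?thesis by (simp add: null.eqv_def)
qed

end

section \<open>The free star-algebra\<close>

abbreviation conv :: "'s free_elt \<Rightarrow> 's free_elt \<Rightarrow> 's free_elt" where
  "conv x y z \<equiv> \<Sum>i\<le>length z. x (take i z) * y (drop i z)"

abbreviation flip_letters :: "('s \<times> bool) list \<Rightarrow> ('s \<times> bool) list" where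
  "flip_letters z \<equiv> rev (map (\<lambda>(s, b). (s, \<not> b)) z)"

lemma flip_flip [simp]: "flip_letters (flip_letters z) = z"
  by (simp add: rev_map o_def case_prod_beta)

lemma conv_assoc: "conv (conv x y) w z = conv x (conv y w) z"
proof -
  let ?n = "length z"
  define f where "f j k = x (take j z) * y (take k (drop j z)) * w (drop (j + k) z)" for j k
  have "conv (conv x y) w z = (\<Sum>i\<le>?n. \<Sum>j\<le>i. f j (i - j))"
  proof (rule sum.cong[OF HOL.refl])
    fix i assume i: "i \<in> {..?n}"
    have "(\<Sum>j\<le>length (take i z). x (take j (take i z)) * y (drop j (take i z))) * w (drop i z)
        = (\<Sum>j\<le>i. x (take j z) * y (drop j (take i z)) * w (drop i z))"
      using i by (auto simp: sum_distrib_right min_def intro!: sum.cong)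
    also have "\<dots> = (\<Sum>j\<le>i. f j (i - j))"
      by (auto simp: f_def drop_take intro!: sum.cong)
    finally show "(\<Sum>j\<le>length (take i z). x (take j (take i z)) * y (drop j (take i z)))
        * w (drop i z) = (\<Sum>j\<le>i. f j (i - j))" .
  qed
  also have "\<dots> = (\<Sum>(i, j)\<in>{(i, j). i + j \<le> ?n}. f i j)"
    by (rule sum.triangle_reindex_eq[symmetric])
  also have "{(i, j). i + j \<le> ?n} = Sigma {..?n} (\<lambda>i. {..?n - i})" by auto
  also have "(\<Sum>(i, j)\<in>Sigma {..?n} (\<lambda>i. {..?n - i}). f i j) = (\<Sum>i\<le>?n. \<Sum>j\<le>?n - i. f i j)"
    by (subst sum.Sigma) auto
  also have "\<dots> = conv x (conv y w) z"
    by (auto simp: f_def sum_distrib_left mult.assoc add.commute intro!: sum.cong)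
  finally show ?thesis .
qed

lemma conv_flip:
  "cnj (conv x y (flip_letters z)) = conv (\<lambda>z. cnj (y (flip_letters z))) (\<lambda>z. cnj (x (flip_letters z))) z"
proof -
  have "cnj (conv x y (flip_letters z))
      = (\<Sum>i\<le>length z. cnj (x (take i (flip_letters z))) * cnj (y (drop i (flip_letters z))))"
    by simp
  also have "\<dots> = (\<Sum>i\<le>length z. cnj (y (flip_letters (take i z))) * cnj (x (flip_letters (drop i z))))"
    by (rule sum.reindex_bij_witness[where i = "\<lambda>i. length z - i" and j = "\<lambda>i. length z - i"])
       (auto simp: take_rev drop_rev take_map drop_map mult.commute)
  finally show ?thesis .
qed

lemma conv_support: "{z. conv x y z \<noteq> 0} \<subseteq> (\<lambda>(u, v). u @ v) ` ({z. x z \<noteq> 0} \<times> {z. y z \<noteq> 0})"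
proof
  fix z assume "z \<in> {z. conv x y z \<noteq> 0}"
  then obtain i where "x (take i z) \<noteq> 0" "y (drop i z) \<noteq> 0"
    by (metis (mono_tags, lifting) mem_Collect_eq mult_eq_0_iff sum.neutral)
  then show "z \<in> (\<lambda>(u, v). u @ v) ` ({z. x z \<noteq> 0} \<times> {z. y z \<noteq> 0})"
    by (intro image_eqI[of _ _ "(take i z, drop i z)"]) auto
qed

lemma free_carrier:
  "x \<in> carrier (free_star_algebra S) \<longleftrightarrow>
    finite {z. x z \<noteq> 0} \<and> (\<forall>z. x z \<noteq> 0 \<longrightarrow> z \<in> lists (S \<times> UNIV) \<and> z \<noteq> [])"
  by (auto simp: free_star_algebra_def)

lemma free_ops:
  "splus (free_star_algebra S) x y = (\<lambda>z. x z + y z)"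
  "sscale (free_star_algebra S) c x = (\<lambda>z. c * x z)"
  "stimes (free_star_algebra S) x y = conv x y"
  "sstar (free_star_algebra S) x = (\<lambda>z. cnj (x (flip_letters z)))"
  by (simp_all add: free_star_algebra_def)

lemma free_assoc:
  "stimes (free_star_algebra S) (stimes (free_star_algebra S) x y) w
    = stimes (free_star_algebra S) x (stimes (free_star_algebra S) y w)"
  by (rule ext) (simp only: free_ops conv_assoc)

lemma flip_lists: "flip_letters z \<in> lists (S \<times> UNIV) \<Longrightarrow> z \<in> lists (S \<times> UNIV)"
  by (fastforce simp: in_lists_conv_set)

lemma free_star_alg: "star_alg (free_star_algebra S)"
proof
  let ?F = "free_star_algebra S"
  have "(\<lambda>_. 0) \<in> carrier ?F" by (simp add: free_carrier)
  then show "carrier ?F \<noteq> {}" by blast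
  fix x y w :: "'a free_elt" and c d :: complex
  assume x: "x \<in> carrier ?F"
  have "{z. c * x z \<noteq> 0} \<subseteq> {z. x z \<noteq> 0}" by auto
  then show "sscale ?F c x \<in> carrier ?F"
    using x by (auto simp: free_carrier free_ops intro: finite_subset)
  have "{z. cnj (x (flip_letters z)) \<noteq> 0} \<subseteq> flip_letters ` {z. x z \<noteq> 0}"
    by (auto intro!: image_eqI[of _ flip_letters, OF flip_flip[symmetric]])
  then have "finite {z. cnj (x (flip_letters z)) \<noteq> 0}"
    by (rule finite_subset) (use x in \<open>simp add: free_carrier\<close>)
  moreover have "z \<in> lists (S \<times> UNIV) \<and> z \<noteq> []" if "cnj (x (flip_letters z)) \<noteq> 0" for z
  proof -
    have "x (flip_letters z) \<noteq> 0" using that by simp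
    then have "flip_letters z \<in> lists (S \<times> UNIV)" "flip_letters z \<noteq> []"
      using x unfolding free_carrier by blast+
    then show ?thesis using flip_lists by blast
  qed
  ultimately show "sstar ?F x \<in> carrier ?F" unfolding free_carrier free_ops by blast
  show "sscale ?F 1 x = x" "sscale ?F c (sscale ?F d x) = sscale ?F (c * d) x"
    "sscale ?F (c + d) x = splus ?F (sscale ?F c x) (sscale ?F d x)"
    "sstar ?F (sscale ?F c x) = sscale ?F (cnj c) (sstar ?F x)" "sstar ?F (sstar ?F x) = x"
    by (simp_all add: free_ops fun_eq_iff algebra_simps)
  assume y: "y \<in> carrier ?F"
  have "{z. x z + y z \<noteq> 0} \<subseteq> {z. x z \<noteq> 0} \<union> {z. y z \<noteq> 0}" by auto
  then have "finite {z. x z + y z \<noteq> 0}" using x y by (auto simp: free_carrier intro: finite_subset)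
  then show "splus ?F x y \<in> carrier ?F"
    using x y by (simp add: free_carrier free_ops) (metis add_cancel_right_left)
  show "stimes ?F x y \<in> carrier ?F"
  proof -
    have "finite {z. conv x y z \<noteq> 0}"
      using x y by (intro finite_subset[OF conv_support]) (auto simp: free_carrier)
    moreover have "z \<in> lists (S \<times> UNIV) \<and> z \<noteq> []" if "conv x y z \<noteq> 0" for z
    proof -
      have "z \<in> (\<lambda>(u, v). u @ v) ` ({z. x z \<noteq> 0} \<times> {z. y z \<noteq> 0})"
        using subsetD[OF conv_support] that by blast
      then obtain u v where "z = u @ v" "x u \<noteq> 0" "y v \<noteq> 0" by auto
      then show ?thesis using x y by (auto simp: free_carrier)
    qed
    ultimately show ?thesis by (simp add: free_carrier free_ops)
  qed
  show "splus ?F x y = splus ?F y x" "splus ?F x (sscale ?F 0 y) = x"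
    "sscale ?F c (splus ?F x y) = splus ?F (sscale ?F c x) (sscale ?F c y)"
    "stimes ?F (sscale ?F c x) y = sscale ?F c (stimes ?F x y)"
    "stimes ?F x (sscale ?F c y) = sscale ?F c (stimes ?F x y)"
    "sstar ?F (splus ?F x y) = splus ?F (sstar ?F x) (sstar ?F y)"
    by (simp_all add: free_ops fun_eq_iff algebra_simps sum_distrib_left)
  show "splus ?F (splus ?F x y) w = splus ?F x (splus ?F y w)"
    "stimes ?F (splus ?F x y) w = splus ?F (stimes ?F x w) (stimes ?F y w)"
    "stimes ?F w (splus ?F x y) = splus ?F (stimes ?F w x) (stimes ?F w y)"
    by (simp_all add: free_ops fun_eq_iff algebra_simps sum.distrib)
qed

text \<open>
  The free star-algebra on all elements of a type is itself made into a type, so that the algebra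
  of the relations can be carried out in a ring rather than on a carrier.
\<close>

typedef 's fsa = "carrier (free_star_algebra (UNIV :: 's set))"
  using star_alg.carrier_nonempty[OF free_star_alg] by blast

instantiation fsa :: (type) star_ring
begin

definition "x + y = Abs_fsa (splus (free_star_algebra UNIV) (Rep_fsa x) (Rep_fsa y))"
definition "c *\<^sub>C x = Abs_fsa (sscale (free_star_algebra UNIV) c (Rep_fsa x))"
definition "x * y = Abs_fsa (stimes (free_star_algebra UNIV) (Rep_fsa x) (Rep_fsa y))"
definition "adj x = Abs_fsa (sstar (free_star_algebra UNIV) (Rep_fsa x))"
definition "0 = Abs_fsa (\<lambda>_. 0)"
definition "- x = (-1) *\<^sub>C (x :: 'a fsa)"
definition "x - y = x + (- y :: 'a fsa)"

lemma Rep_fsa_ops: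
  "Rep_fsa (x + y) = splus (free_star_algebra UNIV) (Rep_fsa x) (Rep_fsa y)"
  "Rep_fsa (c *\<^sub>C x) = sscale (free_star_algebra UNIV) c (Rep_fsa x)"
  "Rep_fsa (x * y) = stimes (free_star_algebra UNIV) (Rep_fsa x) (Rep_fsa y)"
  "Rep_fsa (adj x) = sstar (free_star_algebra UNIV) (Rep_fsa x)"
  "Rep_fsa (0 :: 'a fsa) = (\<lambda>_. 0)"
proof -
  interpret star_alg "free_star_algebra (UNIV :: 'a set)" by (rule free_star_alg)
  have "(\<lambda>_. 0) \<in> carrier (free_star_algebra (UNIV :: 'a set))" by (simp add: free_carrier)
  then show
    "Rep_fsa (x + y) = splus (free_star_algebra UNIV) (Rep_fsa x) (Rep_fsa y)"
    "Rep_fsa (c *\<^sub>C x) = sscale (free_star_algebra UNIV) c (Rep_fsa x)"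
    "Rep_fsa (x * y) = stimes (free_star_algebra UNIV) (Rep_fsa x) (Rep_fsa y)"
    "Rep_fsa (adj x) = sstar (free_star_algebra UNIV) (Rep_fsa x)"
    "Rep_fsa (0 :: 'a fsa) = (\<lambda>_. 0)"
    by (simp_all add: plus_fsa_def scC_fsa_def times_fsa_def adj_fsa_def zero_fsa_def
        Abs_fsa_inverse Rep_fsa)
qed

instance
proof
  fix x y w :: "'a fsa" and c d :: complex
  show "(x * y) * w = x * (y * w)"
    by (simp add: Rep_fsa_inject[symmetric] Rep_fsa_ops free_assoc)
  show "adj (x * y) = adj y * adj x"
    by (simp add: Rep_fsa_inject[symmetric] Rep_fsa_ops free_ops)
       (simp add: fun_eq_iff conv_flip[simplified] del: cnj_sum)
  show "adj (adj x) = x"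
    by (simp add: Rep_fsa_inject[symmetric] Rep_fsa_ops free_ops fun_eq_iff)
qed (simp_all add: Rep_fsa_inject[symmetric] Rep_fsa_ops free_ops fun_eq_iff algebra_simps
      sum.distrib sum_distrib_left minus_fsa_def uminus_fsa_def)

end

text \<open>Words over the whole type that use only letters from \<open>S\<close>: a star-homomorphism onto the free algebra on \<open>S\<close>.\<close>

definition restrict_letters :: "'s set \<Rightarrow> 's fsa \<Rightarrow> 's free_elt" where
  "restrict_letters S x = (\<lambda>z. if z \<in> lists (S \<times> UNIV) then Rep_fsa x z else 0)"

lemma free_carrier_mono: "x \<in> carrier (free_star_algebra S) \<Longrightarrow> x \<in> carrier (free_star_algebra UNIV)"
  by (auto simp: free_carrier)

lemma restrict_letters_closed: "restrict_letters S x \<in> carrier (free_star_algebra S)"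
proof -
  have x: "finite {z. Rep_fsa x z \<noteq> 0}" "\<And>z. Rep_fsa x z \<noteq> 0 \<Longrightarrow> z \<noteq> []"
    using Rep_fsa[of x] by (auto simp: free_carrier)
  have "finite {z. restrict_letters S x z \<noteq> 0}"
    by (rule finite_subset[OF _ x(1)]) (auto simp: restrict_letters_def)
  then show ?thesis using x(2) by (auto simp: free_carrier restrict_letters_def split: if_splits)
qed

lemma restrict_letters_Abs:
  "x \<in> carrier (free_star_algebra S) \<Longrightarrow> restrict_letters S (Abs_fsa x) = x"
  by (auto simp: restrict_letters_def Abs_fsa_inverse free_carrier_mono fun_eq_iff)
     (auto simp: free_carrier)

lemma restrict_letters_ops:
  "restrict_letters S (x + y) = splus (free_star_algebra S) (restrict_letters S x) (restrict_letters S y)"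
  "restrict_letters S (c *\<^sub>C x) = sscale (free_star_algebra S) c (restrict_letters S x)"
  "restrict_letters S (x * y) = stimes (free_star_algebra S) (restrict_letters S x) (restrict_letters S y)"
  "restrict_letters S (adj x) = sstar (free_star_algebra S) (restrict_letters S x)"
proof -
  have "restrict_letters S (x * y) z
      = conv (restrict_letters S x) (restrict_letters S y) z" for z
  proof (cases "z \<in> lists (S \<times> UNIV)")
    case True
    then have "take i z \<in> lists (S \<times> UNIV)" "drop i z \<in> lists (S \<times> UNIV)" for i
      by (meson in_lists_conv_set in_set_takeD in_set_dropD)+
    then show ?thesis using True by (simp add: restrict_letters_def Rep_fsa_ops free_ops)
  next
    case False
    have "\<not> (take i z \<in> lists (S \<times> UNIV) \<and> drop i z \<in> lists (S \<times> UNIV))" for i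
      using False by (metis append_in_lists_conv append_take_drop_id)
    then have "restrict_letters S x (take i z) * restrict_letters S y (drop i z) = 0" for i
      by (auto simp: restrict_letters_def)
    then have "conv (restrict_letters S x) (restrict_letters S y) z = 0"
      by (intro sum.neutral) blast
    then show ?thesis using False by (simp add: restrict_letters_def[of _ "x * y"])
  qed
  then show "restrict_letters S (x * y)
      = stimes (free_star_algebra S) (restrict_letters S x) (restrict_letters S y)"
    by (auto simp: free_ops fun_eq_iff)
  have "flip_letters z \<in> lists (S \<times> UNIV) \<longleftrightarrow> z \<in> lists (S \<times> UNIV)" for z
    using flip_lists[of z S] flip_lists[of "flip_letters z" S] by (metis flip_flip)
  then show "restrict_letters S (adj x) = sstar (free_star_algebra S) (restrict_letters S x)"
    by (simp add: restrict_letters_def Rep_fsa_ops free_ops fun_eq_iff)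
qed (auto simp: restrict_letters_def Rep_fsa_ops free_ops fun_eq_iff)

lemma restricted_cstar_ring:
  assumes "cstar_seminorm (free_star_algebra S) p"
  shows "cstar_ring (\<lambda>x. p (restrict_letters S x))"
  using assms restrict_letters_closed
  by unfold_locales (auto simp: cstar_seminorm_def restrict_letters_ops)

lemma restrict_letters_diff:
  "restrict_letters S (x - y) = sdiff (free_star_algebra S) (restrict_letters S x) (restrict_letters S y)"
  by (simp add: minus_fsa_def uminus_fsa_def restrict_letters_ops sdiff_def)

definition gen :: "'s \<Rightarrow> 's fsa" where
  "gen s = Abs_fsa (free_gen s)"

definition monomial :: "('s \<times> bool) list \<Rightarrow> 's fsa" where
  "monomial z = Abs_fsa (\<lambda>z'. if z' = z then 1 else 0)"

lemma Rep_monomial: "z \<noteq> [] \<Longrightarrow> Rep_fsa (monomial z) = (\<lambda>z'. if z' = z then 1 else 0)"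
  unfolding monomial_def by (rule Abs_fsa_inverse) (auto simp: free_carrier)

lemma Rep_gen: "Rep_fsa (gen s) = free_gen s"
  unfolding gen_def by (rule Abs_fsa_inverse) (auto simp: free_carrier free_gen_def)

lemma free_gen_closed: "s \<in> S \<Longrightarrow> free_gen s \<in> carrier (free_star_algebra S)"
  by (auto simp: free_carrier free_gen_def)

lemma monomial_single: "monomial [(s, False)] = gen s" "monomial [(s, True)] = adj (gen s)"
proof -
  show "monomial [(s, False)] = gen s" by (simp add: monomial_def gen_def free_gen_def)
  have "flip_letters z = [(s, False)] \<longleftrightarrow> z = [(s, True)]" for z :: "('a \<times> bool) list"
    by (cases z rule: rev_cases) (auto simp: Cons_eq_append_conv)
  then show "monomial [(s, True)] = adj (gen s)"
    by (simp add: Rep_fsa_inject[symmetric] Rep_monomial Rep_fsa_ops Rep_gen free_ops free_gen_def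
        fun_eq_iff)
qed

lemma monomial_append:
  assumes "u \<noteq> []" "v \<noteq> []"
  shows "monomial (u @ v) = monomial u * monomial v"
proof -
  have "conv (\<lambda>z. if z = u then 1 else 0) (\<lambda>z. if z = v then 1 else 0) z
      = (if z = u @ v then 1 else 0)" for z
  proof -
    have "(if take i z = u then 1 else 0) * (if drop i z = v then 1 else 0)
        = (if i = length u then (if z = u @ v then 1 else 0) else (0::complex))"
      if "i \<in> {..length z}" for i
    proof -
      have "take i z = u \<and> drop i z = v \<longleftrightarrow> i = length u \<and> z = u @ v" using that by auto
      moreover have "(if take i z = u then 1 else 0) * (if drop i z = v then 1 else 0)
          = (if take i z = u \<and> drop i z = v then 1 else (0::complex))" by simp
      ultimately show ?thesis by (simp only:) simp
    qed
    then have "conv (\<lambda>z. if z = u then 1 else 0) (\<lambda>z. if z = v then 1 else 0) z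
        = (\<Sum>i\<le>length z. if i = length u then (if z = u @ v then 1 else 0) else 0)"
      by (rule sum.cong[OF HOL.refl])
    also have "\<dots> = (if z = u @ v then 1 else 0)" by (auto simp: sum.delta)
    finally show ?thesis .
  qed
  then show ?thesis
    using assms by (simp add: Rep_fsa_inject[symmetric] Rep_fsa_ops Rep_monomial free_ops fun_eq_iff)
qed

lemma Rep_sum: "Rep_fsa (sum f I) z = (\<Sum>i\<in>I. Rep_fsa (f i) z)"
  by (induction I rule: infinite_finite_induct) (auto simp: Rep_fsa_ops free_ops)

lemma fsa_expansion: "x = (\<Sum>z | Rep_fsa x z \<noteq> 0. Rep_fsa x z *\<^sub>C monomial z)"
proof -
  have fin: "finite {z. Rep_fsa x z \<noteq> 0}" and ne: "\<And>z. Rep_fsa x z \<noteq> 0 \<Longrightarrow> z \<noteq> []"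
    using Rep_fsa[of x] by (auto simp: free_carrier)
  have "Rep_fsa (\<Sum>z | Rep_fsa x z \<noteq> 0. Rep_fsa x z *\<^sub>C monomial z) z'
      = (\<Sum>z | Rep_fsa x z \<noteq> 0. if z = z' then Rep_fsa x z else 0)" for z'
    unfolding Rep_sum by (rule sum.cong) (auto simp: Rep_fsa_ops free_ops Rep_monomial ne)
  also have "\<dots> z' = Rep_fsa x z'" for z' using fin by (simp add: sum.delta)
  finally show ?thesis by (simp add: Rep_fsa_inject[symmetric] fun_eq_iff)
qed

section \<open>Crossed products\<close>

lemma cont_fun_zero: "(\<lambda>_. 0) \<in> cont_fun X"
  and cont_fun_add: "\<lbrakk>f \<in> cont_fun X; g \<in> cont_fun X\<rbrakk> \<Longrightarrow> (\<lambda>\<omega>. f \<omega> + g \<omega>) \<in> cont_fun X"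
  and cont_fun_mult: "\<lbrakk>f \<in> cont_fun X; g \<in> cont_fun X\<rbrakk> \<Longrightarrow> (\<lambda>\<omega>. f \<omega> * g \<omega>) \<in> cont_fun X"
  and cont_fun_scale: "f \<in> cont_fun X \<Longrightarrow> (\<lambda>\<omega>. c * f \<omega>) \<in> cont_fun X"
  by (auto simp: cont_fun_def continuous_map_atin tendsto_add tendsto_mult)

lemma cont_fun_comp_real:
  assumes f: "f \<in> cont_fun X" and h: "continuous_on UNIV h"
  shows "(\<lambda>\<omega>. if \<omega> \<in> topspace X then h (f \<omega>) else 0) \<in> cont_fun X"
proof -
  have "continuous_map X euclidean (h \<circ> f)"
    using f h by (intro continuous_map_compose[of X euclidean]) (auto simp: cont_fun_def)
  then have "continuous_map X euclidean (\<lambda>\<omega>. if \<omega> \<in> topspace X then h (f \<omega>) else 0)"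
    by (rule continuous_map_eq) auto
  then show ?thesis by (auto simp: cont_fun_def)
qed

lemma cont_fun_sum:
  "(\<And>i. i \<in> I \<Longrightarrow> f i \<in> cont_fun X) \<Longrightarrow> (\<lambda>\<omega>. \<Sum>i\<in>I. f i \<omega>) \<in> cont_fun X"
  by (induction I rule: infinite_finite_induct) (auto simp: cont_fun_zero cont_fun_add)

definition sup_norm :: "('p \<Rightarrow> complex) \<Rightarrow> real" where
  "sup_norm f = (SUP \<omega>. cmod (f \<omega>))"

lemma sup_norm_zero [simp]: "sup_norm (\<lambda>_. 0) = 0"
  by (simp add: sup_norm_def)

lemma sup_norm_le: "(\<And>\<omega>. cmod (f \<omega>) \<le> M) \<Longrightarrow> sup_norm f \<le> M"
  unfolding sup_norm_def by (intro cSUP_least) auto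

locale crossed_system = G: group G for G :: "('g, 'm) monoid_scheme" (structure) +
  fixes X :: "'p topology" and act :: "'g \<Rightarrow> 'p \<Rightarrow> 'p"
  assumes act_closed: "\<lbrakk>g \<in> carrier G; \<omega> \<in> topspace X\<rbrakk> \<Longrightarrow> act g \<omega> \<in> topspace X"
    and act_one: "\<omega> \<in> topspace X \<Longrightarrow> act \<one> \<omega> = \<omega>"
    and act_mult: "\<lbrakk>g \<in> carrier G; h \<in> carrier G; \<omega> \<in> topspace X\<rbrakk>
      \<Longrightarrow> act (g \<otimes> h) \<omega> = act g (act h \<omega>)"
    and act_continuous: "g \<in> carrier G \<Longrightarrow> continuous_map X X (act g)"
    and bounded_cont_fun: "f \<in> cont_fun X \<Longrightarrow> \<exists>M. \<forall>\<omega>. cmod (f \<omega>) \<le> M"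
begin

abbreviation P :: "('g \<Rightarrow> 'p \<Rightarrow> complex) star_algebra" where
  "P \<equiv> algebraic_crossed_product G X act"

abbreviation supp :: "('g \<Rightarrow> 'p \<Rightarrow> complex) \<Rightarrow> 'g set" where
  "supp F \<equiv> {g. F g \<noteq> (\<lambda>_. 0)}"

lemma P_carrier: "F \<in> carrier P \<longleftrightarrow>
    (\<forall>g. F g \<in> cont_fun X) \<and> supp F \<subseteq> carrier G \<and> finite (supp F)"
  by (auto simp: algebraic_crossed_product_def cont_fun_zero)

lemma P_outside: "\<lbrakk>F \<in> carrier P; g \<notin> carrier G \<or> \<omega> \<notin> topspace X\<rbrakk> \<Longrightarrow> F g \<omega> = 0"
  by (auto simp: algebraic_crossed_product_def cont_fun_def)

lemma P_add: "splus P F H = (\<lambda>g \<omega>. F g \<omega> + H g \<omega>)"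
  and P_scale: "sscale P c F = (\<lambda>g \<omega>. c * F g \<omega>)"
  by (simp_all add: algebraic_crossed_product_def)

lemma P_diff: "sdiff P F H = (\<lambda>g \<omega>. F g \<omega> - H g \<omega>)"
  by (simp add: sdiff_def P_add P_scale)

lemma P_star: "sstar P F = (\<lambda>g \<omega>. if g \<in> carrier G \<and> \<omega> \<in> topspace X
    then cnj (F (inv g) (act (inv g) \<omega>)) else 0)"
  by (simp add: algebraic_crossed_product_def)

lemma P_mult:
  assumes "F \<in> carrier P" and K: "finite K" "supp F \<subseteq> K" "K \<subseteq> carrier G"
  shows "stimes P F H = (\<lambda>g \<omega>. if g \<in> carrier G \<and> \<omega> \<in> topspace X
    then \<Sum>h\<in>K. F h \<omega> * H (inv h \<otimes> g) (act (inv h) \<omega>) else 0)"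
proof -
  have "{h \<in> carrier G. F h \<noteq> (\<lambda>_. 0)} = supp F" using assms(1) by (auto simp: P_carrier)
  moreover have "(\<Sum>h\<in>supp F. F h \<omega> * H (inv h \<otimes> g) (act (inv h) \<omega>))
      = (\<Sum>h\<in>K. F h \<omega> * H (inv h \<otimes> g) (act (inv h) \<omega>))" for g \<omega>
    using K by (intro sum.mono_neutral_left) auto
  moreover have "stimes P F H = (\<lambda>g \<omega>. if g \<in> carrier G \<and> \<omega> \<in> topspace X
      then \<Sum>h\<in>{h \<in> carrier G. F h \<noteq> (\<lambda>_. 0)}. F h \<omega> * H (inv h \<otimes> g) (act (inv h) \<omega>) else 0)"
    by (simp add: algebraic_crossed_product_def)
  ultimately show ?thesis by (simp only:)
qed

lemma supp_finite: "F \<in> carrier P \<Longrightarrow> finite (supp F)"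
  and supp_subset: "F \<in> carrier P \<Longrightarrow> supp F \<subseteq> carrier G"
  by (auto simp: P_carrier)

lemma P_memI:
  assumes "\<And>g. F g \<in> cont_fun X" "supp F \<subseteq> K" "K \<subseteq> carrier G" "finite K"
  shows "F \<in> carrier P"
  using assms by (auto simp: P_carrier intro: finite_subset)

lemma cont_fun_act:
  assumes f: "f \<in> cont_fun X" and g: "g \<in> carrier G"
  shows "(\<lambda>\<omega>. if \<omega> \<in> topspace X then f (act g \<omega>) else 0) \<in> cont_fun X"
proof -
  have "continuous_map X euclidean (f \<circ> act g)"
    using f act_continuous[OF g] by (auto simp: cont_fun_def intro: continuous_map_compose)
  then have "continuous_map X euclidean (\<lambda>\<omega>. if \<omega> \<in> topspace X then f (act g \<omega>) else 0)"
    by (rule continuous_map_eq) auto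
  then show ?thesis by (auto simp: cont_fun_def)
qed

lemma P_mult_support:
  assumes F: "F \<in> carrier P" and H: "H \<in> carrier P"
  shows "supp (stimes P F H) \<subseteq> (\<lambda>(h, k). h \<otimes> k) ` (supp F \<times> supp H)"
proof
  fix g assume "g \<in> supp (stimes P F H)"
  then obtain \<omega> where ne: "stimes P F H g \<omega> \<noteq> 0" by (auto simp: fun_eq_iff)
  note eq = P_mult[OF F supp_finite[OF F] subset_refl supp_subset[OF F], of H]
  have g: "g \<in> carrier G" using ne by (auto simp: eq split: if_splits)
  have "(\<Sum>h\<in>supp F. F h \<omega> * H (inv h \<otimes> g) (act (inv h) \<omega>)) \<noteq> 0"
    using ne by (auto simp: eq split: if_splits)
  then obtain h where h: "h \<in> supp F" "F h \<omega> * H (inv h \<otimes> g) (act (inv h) \<omega>) \<noteq> 0"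
    by (rule sum.not_neutral_contains_not_neutral)
  then have "h \<in> carrier G" using supp_subset[OF F] by blast
  then have "g = h \<otimes> (inv h \<otimes> g)" using g by (simp flip: G.m_assoc)
  moreover have "inv h \<otimes> g \<in> supp H" using h(2) by auto
  ultimately show "g \<in> (\<lambda>(h, k). h \<otimes> k) ` (supp F \<times> supp H)"
    using h(1) by (intro image_eqI[of _ _ "(h, inv h \<otimes> g)"]) auto
qed

lemma P_mult_closed:
  assumes F: "F \<in> carrier P" and H: "H \<in> carrier P"
  shows "stimes P F H \<in> carrier P"
proof (rule P_memI[OF _ P_mult_support[OF F H]])
  note eq = P_mult[OF F supp_finite[OF F] subset_refl supp_subset[OF F], of H]
  fix g
  show "stimes P F H g \<in> cont_fun X"
  proof (cases "g \<in> carrier G")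
    case True
    have "(\<lambda>\<omega>. \<Sum>h\<in>supp F. F h \<omega> * (if \<omega> \<in> topspace X then H (inv h \<otimes> g) (act (inv h) \<omega>) else 0))
        \<in> cont_fun X"
      using F H supp_subset[OF F]
      by (intro cont_fun_sum cont_fun_mult cont_fun_act) (auto simp: P_carrier)
    then show ?thesis
      by (rule back_subst[of "\<lambda>f. f \<in> cont_fun X"])
         (use True P_outside[OF F] in \<open>auto simp: eq fun_eq_iff\<close>)
  qed (simp add: eq cont_fun_zero)
  show "(\<lambda>(h, k). h \<otimes> k) ` (supp F \<times> supp H) \<subseteq> carrier G"
    using supp_subset[OF F] supp_subset[OF H] by (auto intro!: G.m_closed)
  show "finite ((\<lambda>(h, k). h \<otimes> k) ` (supp F \<times> supp H))"
    using supp_finite[OF F] supp_finite[OF H] by simp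
qed

lemma P_star_support: "supp (sstar P F) \<subseteq> (\<lambda>g. inv g) ` (supp F \<inter> carrier G)"
proof
  fix g assume "g \<in> supp (sstar P F)"
  then have "g \<in> carrier G" "inv g \<in> supp F" by (auto simp: P_star fun_eq_iff split: if_splits)
  then show "g \<in> (\<lambda>g. inv g) ` (supp F \<inter> carrier G)" by (intro image_eqI[of _ _ "inv g"]) auto
qed

lemma P_star_closed:
  assumes F: "F \<in> carrier P"
  shows "sstar P F \<in> carrier P"
proof (rule P_memI[OF _ P_star_support])
  fix g
  show "sstar P F g \<in> cont_fun X"
  proof (cases "g \<in> carrier G")
    case True
    have "(\<lambda>\<omega>. if \<omega> \<in> topspace X then F (inv g) (act (inv g) \<omega>) else 0) \<in> cont_fun X"
      using F True by (intro cont_fun_act) (auto simp: P_carrier)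
    from cont_fun_comp_real[OF this continuous_on_cnj[OF continuous_on_id]]
    have "(\<lambda>\<omega>. if \<omega> \<in> topspace X then cnj (if \<omega> \<in> topspace X then F (inv g) (act (inv g) \<omega>) else 0) else 0)
        \<in> cont_fun X" .
    then show ?thesis
      by (rule back_subst[of "\<lambda>f. f \<in> cont_fun X"]) (use True in \<open>auto simp: P_star fun_eq_iff\<close>)
  qed (simp add: P_star cont_fun_zero)
qed (use supp_finite[OF F] in auto)

lemma act_inv_cancel: "\<lbrakk>g \<in> carrier G; \<omega> \<in> topspace X\<rbrakk> \<Longrightarrow> act g (act (inv g) \<omega>) = \<omega>"
  "\<lbrakk>g \<in> carrier G; \<omega> \<in> topspace X\<rbrakk> \<Longrightarrow> act (inv g) (act g \<omega>) = \<omega>"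
  by (simp_all add: act_one flip: act_mult)

sublocale star_alg P
proof
  have "(\<lambda>_ _. 0) \<in> carrier P" by (rule P_memI[of _ "{}"]) (auto simp: cont_fun_zero)
  then show "carrier P \<noteq> {}" by blast
  fix F H K :: "'g \<Rightarrow> 'p \<Rightarrow> complex" and c d :: complex
  assume F: "F \<in> carrier P"
  show "sscale P c F \<in> carrier P"
    by (rule P_memI[of _ "supp F"])
       (use F in \<open>auto simp: P_scale P_carrier cont_fun_scale\<close>)
  show "sstar P F \<in> carrier P" by (rule P_star_closed[OF F])
  show "sscale P 1 F = F" "sscale P c (sscale P d F) = sscale P (c * d) F"
    "sscale P (c + d) F = splus P (sscale P c F) (sscale P d F)"
    "sstar P (sscale P c F) = sscale P (cnj c) (sstar P F)"
    by (simp_all add: P_scale P_add P_star fun_eq_iff distrib_right)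
  show "sstar P (sstar P F) = F"
    using F by (auto simp: P_star fun_eq_iff act_closed act_inv_cancel P_outside)
  assume H: "H \<in> carrier P"
  show add: "splus P F H \<in> carrier P"
    by (rule P_memI[of _ "supp F \<union> supp H"])
       (use F H in \<open>auto simp: P_add P_carrier cont_fun_add fun_eq_iff\<close>)
  show "stimes P F H \<in> carrier P" by (rule P_mult_closed[OF F H])
  show "splus P F H = splus P H F" "splus P F (sscale P 0 H) = F"
    "sscale P c (splus P F H) = splus P (sscale P c F) (sscale P c H)"
    "sstar P (splus P F H) = splus P (sstar P F) (sstar P H)"
    by (auto simp: P_scale P_add P_star fun_eq_iff algebra_simps)
  note mF = P_mult[OF F supp_finite[OF F] subset_refl supp_subset[OF F]]
  show "stimes P F (sscale P c H) = sscale P c (stimes P F H)"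
    by (auto simp: mF P_scale fun_eq_iff sum_distrib_left algebra_simps)
  have cF: "sscale P c F \<in> carrier P"
    by (rule P_memI[of _ "supp F"]) (use F in \<open>auto simp: P_scale P_carrier cont_fun_scale\<close>)
  have "supp (sscale P c F) \<subseteq> supp F" by (auto simp: P_scale)
  from P_mult[OF cF supp_finite[OF F] this supp_subset[OF F]]
  show "stimes P (sscale P c F) H = sscale P c (stimes P F H)"
    by (auto simp: mF P_scale fun_eq_iff sum_distrib_left algebra_simps)
  assume K: "K \<in> carrier P"
  show "splus P (splus P F H) K = splus P F (splus P H K)"
    by (simp add: P_add fun_eq_iff add.assoc)
  note mK = P_mult[OF K supp_finite[OF K] subset_refl supp_subset[OF K]]
  show "stimes P K (splus P F H) = splus P (stimes P K F) (stimes P K H)"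
    by (auto simp: mK P_add fun_eq_iff sum.distrib algebra_simps)
  have fin: "finite (supp F \<union> supp H)" and sub: "supp F \<union> supp H \<subseteq> carrier G"
    using F H by (auto simp: P_carrier)
  have "supp (splus P F H) \<subseteq> supp F \<union> supp H" by (auto simp: P_add fun_eq_iff)
  from P_mult[OF add fin this sub, of K] P_mult[OF F fin _ sub, of K] P_mult[OF H fin _ sub, of K]
  show "stimes P (splus P F H) K = splus P (stimes P F K) (stimes P H K)"
    by (auto simp: P_add fun_eq_iff sum.distrib algebra_simps)
qed

lemma P_assoc:
  assumes F: "F \<in> carrier P" and H: "H \<in> carrier P"
  shows "stimes P (stimes P F H) K = stimes P F (stimes P H K)"
proof (intro ext)
  fix g \<omega>
  let ?M = "(\<lambda>(h, k). h \<otimes> k) ` (supp F \<times> supp H)"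
  have M: "finite ?M" "?M \<subseteq> carrier G"
    using F H by (auto simp: P_carrier intro!: G.m_closed)
  note mF = P_mult[OF F supp_finite[OF F] subset_refl supp_subset[OF F]]
  note mH = P_mult[OF H supp_finite[OF H] subset_refl supp_subset[OF H]]
  note mFH = P_mult[OF P_mult_closed[OF F H] M(1) P_mult_support[OF F H] M(2), of K]
  show "stimes P (stimes P F H) K g \<omega> = stimes P F (stimes P H K) g \<omega>"
  proof (cases "g \<in> carrier G \<and> \<omega> \<in> topspace X")
    case True
    then have g: "g \<in> carrier G" and \<omega>: "\<omega> \<in> topspace X" by auto
    let ?f = "\<lambda>h m. F h \<omega> * H (inv h \<otimes> m) (act (inv h) \<omega>) * K (inv m \<otimes> g) (act (inv m) \<omega>)"
    have "stimes P (stimes P F H) K g \<omega> = (\<Sum>m\<in>?M. \<Sum>h\<in>supp F. ?f h m)"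
      unfolding mFH using M(2) g \<omega> by (auto simp: mF sum_distrib_right intro!: sum.cong)
    also have "\<dots> = (\<Sum>h\<in>supp F. \<Sum>m\<in>?M. ?f h m)" by (rule sum.swap)
    also have "\<dots> = (\<Sum>h\<in>supp F. F h \<omega> * stimes P H K (inv h \<otimes> g) (act (inv h) \<omega>))"
    proof (rule sum.cong[OF HOL.refl])
      fix h assume h: "h \<in> supp F"
      then have hG: "h \<in> carrier G" using supp_subset[OF F] by blast
      have "(\<Sum>m\<in>?M. ?f h m) = (\<Sum>m\<in>(\<lambda>k. h \<otimes> k) ` supp H. ?f h m)"
      proof (rule sum.mono_neutral_right[OF M(1)])
        show "(\<lambda>k. h \<otimes> k) ` supp H \<subseteq> ?M" using h by auto
        show "\<forall>m\<in>?M - (\<lambda>k. h \<otimes> k) ` supp H. ?f h m = 0"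
        proof
          fix m assume m: "m \<in> ?M - (\<lambda>k. h \<otimes> k) ` supp H"
          then have "m \<in> carrier G" using M(2) by blast
          then have "m = h \<otimes> (inv h \<otimes> m)" using hG by (simp flip: G.m_assoc)
          then have "inv h \<otimes> m \<notin> supp H" using m by auto
          then show "?f h m = 0" by (simp add: fun_eq_iff)
        qed
      qed
      also have "\<dots> = (\<Sum>k\<in>supp H. ?f h (h \<otimes> k))"
        using supp_subset[OF H] hG
        by (subst sum.reindex) (auto intro!: inj_onI simp: o_def subset_iff)
      also have "\<dots> = (\<Sum>k\<in>supp H. F h \<omega> * (H k (act (inv h) \<omega>)
          * K (inv k \<otimes> (inv h \<otimes> g)) (act (inv k) (act (inv h) \<omega>))))"
      proof (rule sum.cong[OF HOL.refl])
        fix k assume "k \<in> supp H"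
        then have kG: "k \<in> carrier G" using supp_subset[OF H] by blast
        have "inv h \<otimes> (h \<otimes> k) = k" "inv (h \<otimes> k) \<otimes> g = inv k \<otimes> (inv h \<otimes> g)"
          "act (inv (h \<otimes> k)) \<omega> = act (inv k) (act (inv h) \<omega>)"
          using hG kG g \<omega> by (simp_all add: G.inv_mult_group G.m_assoc act_mult flip: G.m_assoc[of "inv h" h k])
        then show "?f h (h \<otimes> k) = F h \<omega> * (H k (act (inv h) \<omega>)
          * K (inv k \<otimes> (inv h \<otimes> g)) (act (inv k) (act (inv h) \<omega>)))" by simp
      qed
      also have "\<dots> = F h \<omega> * stimes P H K (inv h \<otimes> g) (act (inv h) \<omega>)"
        using hG g \<omega> by (simp add: mH act_closed sum_distrib_left)
      finally show "(\<Sum>m\<in>?M. ?f h m) = F h \<omega> * stimes P H K (inv h \<otimes> g) (act (inv h) \<omega>)" .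
    qed
    also have "\<dots> = stimes P F (stimes P H K) g \<omega>" using g \<omega> by (simp add: mF)
    finally show ?thesis .
  next
    case False
    then show ?thesis unfolding mFH unfolding mF by auto
  qed
qed

lemma P_star_mult:
  assumes F: "F \<in> carrier P" and H: "H \<in> carrier P"
  shows "sstar P (stimes P F H) = stimes P (sstar P H) (sstar P F)"
proof (intro ext)
  fix g \<omega>
  let ?K = "(\<lambda>k. inv k) ` supp H"
  have K: "finite ?K" "?K \<subseteq> carrier G" using H by (auto simp: P_carrier)
  have "supp H \<inter> carrier G = supp H" using supp_subset[OF H] by blast
  then have "supp (sstar P H) \<subseteq> ?K" using P_star_support[of H] by simp
  note ms = P_mult[OF P_star_closed[OF H] K(1) this K(2), of "sstar P F"]
  note mF = P_mult[OF F supp_finite[OF F] subset_refl supp_subset[OF F]]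
  show "sstar P (stimes P F H) g \<omega> = stimes P (sstar P H) (sstar P F) g \<omega>"
  proof (cases "g \<in> carrier G \<and> \<omega> \<in> topspace X")
    case True
    then have g: "g \<in> carrier G" and \<omega>: "\<omega> \<in> topspace X" by auto
    let ?w = "act (inv g) \<omega>"
    have w: "?w \<in> topspace X" using g \<omega> act_closed by simp
    let ?f = "\<lambda>k. cnj (H k (act k \<omega>)) * cnj (F (inv (k \<otimes> g)) (act (inv (k \<otimes> g)) (act k \<omega>)))"
    let ?M = "supp H \<union> (\<lambda>h. inv h \<otimes> inv g) ` supp F"
    have M: "finite ?M" "?M \<subseteq> carrier G" using F H g by (auto simp: P_carrier)
    have sF: "cnj (F h ?w * H (inv h \<otimes> inv g) (act (inv h) ?w))
        = ?f (inv h \<otimes> inv g)" if "h \<in> carrier G" for h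
    proof -
      have "act (inv h) ?w = act (inv h \<otimes> inv g) \<omega>" using that g \<omega> by (simp add: act_mult)
      moreover have "inv (inv h \<otimes> inv g \<otimes> g) = h" using that g by (simp add: G.m_assoc)
      moreover have "act h (act (inv h \<otimes> inv g) \<omega>) = ?w"
        using that g \<omega> by (simp add: act_mult act_inv_cancel act_closed)
      ultimately show ?thesis by (simp add: mult.commute)
    qed
    have "sstar P (stimes P F H) g \<omega> = (\<Sum>h\<in>supp F. ?f (inv h \<otimes> inv g))"
      using g \<omega> w sF supp_subset[OF F] by (auto simp: P_star mF simp del: complex_cnj_mult intro!: sum.cong)
    also have "\<dots> = (\<Sum>k\<in>(\<lambda>h. inv h \<otimes> inv g) ` supp F. ?f k)"
    proof (subst sum.reindex)
      show "inj_on (\<lambda>h. inv h \<otimes> inv g) (supp F)"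
      proof (rule inj_on_subset[OF _ supp_subset[OF F]], rule inj_onI)
        fix x y assume xy: "x \<in> carrier G" "y \<in> carrier G" and "inv x \<otimes> inv g = inv y \<otimes> inv g"
        then have "inv x = inv y" using g by simp
        then show "x = y" using xy by (metis G.inv_inv)
      qed
    qed (simp add: o_def)
    also have "\<dots> = (\<Sum>k\<in>?M. ?f k)"
    proof (rule sum.mono_neutral_left[OF M(1)])
      show "\<forall>k\<in>?M - (\<lambda>h. inv h \<otimes> inv g) ` supp F. ?f k = 0"
      proof
        fix k assume k: "k \<in> ?M - (\<lambda>h. inv h \<otimes> inv g) ` supp F"
        then have kG: "k \<in> carrier G" using M by blast
        then have "k = inv (inv (k \<otimes> g)) \<otimes> inv g" using g by (simp add: G.m_assoc)
        then have "inv (k \<otimes> g) \<notin> supp F" using k by blast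
        then show "?f k = 0" by (simp add: fun_eq_iff)
      qed
    qed auto
    also have "\<dots> = (\<Sum>k\<in>supp H. ?f k)"
      by (rule sum.mono_neutral_right[OF M(1)]) (auto simp: fun_eq_iff)
    also have "\<dots> = (\<Sum>m\<in>?K. ?f (inv m))"
      using supp_subset[OF H]
      by (subst sum.reindex[OF inj_on_subset[OF G.inv_inj supp_subset[OF H]]])
         (auto intro!: sum.cong simp: subset_iff)
    also have "\<dots> = stimes P (sstar P H) (sstar P F) g \<omega>"
    proof -
      have "?f (inv m) = sstar P H m \<omega> * sstar P F (inv m \<otimes> g) (act (inv m) \<omega>)" if "m \<in> ?K" for m
        using that K(2) g \<omega> by (auto simp: P_star act_closed subset_iff)
      then show ?thesis using g \<omega> by (simp add: ms)
    qed
    finally show ?thesis .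
  next
    case False
    then show ?thesis unfolding ms unfolding P_star by auto
  qed
qed

section \<open>The \<open>\<ell>\<^sup>1\<close>-norm of a crossed product\<close>

lemma sup_norm_upper: "f \<in> cont_fun X \<Longrightarrow> cmod (f \<omega>) \<le> sup_norm f"
proof -
  assume "f \<in> cont_fun X"
  then obtain M where "\<forall>\<omega>. cmod (f \<omega>) \<le> M" using bounded_cont_fun by blast
  then show ?thesis
    unfolding sup_norm_def by (intro cSUP_upper bdd_aboveI2[where M = M]) auto
qed

lemma sup_norm_nonneg: "f \<in> cont_fun X \<Longrightarrow> 0 \<le> sup_norm f"
  using sup_norm_upper[of f] norm_ge_zero order_trans by metis

definition l1_norm :: "('g \<Rightarrow> 'p \<Rightarrow> complex) \<Rightarrow> real" where
  "l1_norm F = (\<Sum>g\<in>supp F. sup_norm (F g))"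

lemma l1_norm_eq:
  assumes "finite K" "supp F \<subseteq> K"
  shows "l1_norm F = (\<Sum>g\<in>K. sup_norm (F g))"
  unfolding l1_norm_def using assms by (intro sum.mono_neutral_left) auto

lemma P_cont: "F \<in> carrier P \<Longrightarrow> F g \<in> cont_fun X"
  by (simp add: P_carrier)

lemma l1_star_le:
  assumes F: "F \<in> carrier P"
  shows "l1_norm (sstar P F) \<le> l1_norm F"
proof -
  let ?K = "(\<lambda>g. inv g) ` supp F"
  have sub: "supp F \<subseteq> carrier G" using supp_subset[OF F] .
  have "l1_norm (sstar P F) = (\<Sum>g\<in>?K. sup_norm (sstar P F g))"
    using P_star_support[of F] sub supp_finite[OF F] by (intro l1_norm_eq) (auto simp: Int_absorb2)
  also have "\<dots> = (\<Sum>g\<in>supp F. sup_norm (sstar P F (inv g)))"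
    by (subst sum.reindex[OF inj_on_subset[OF G.inv_inj sub]]) simp
  also have "\<dots> \<le> (\<Sum>g\<in>supp F. sup_norm (F g))"
  proof (rule sum_mono)
    fix g assume "g \<in> supp F"
    then have "g \<in> carrier G" using sub by blast
    then show "sup_norm (sstar P F (inv g)) \<le> sup_norm (F g)"
      using sup_norm_upper[OF P_cont[OF F]] sup_norm_nonneg[OF P_cont[OF F]]
      by (intro sup_norm_le) (auto simp: P_star)
  qed
  finally show ?thesis by (simp add: l1_norm_def)
qed

lemma l1_star_seminorm: "star_seminorm P l1_norm"
proof
  fix F H :: "'g \<Rightarrow> 'p \<Rightarrow> complex" and c
  assume F: "F \<in> carrier P"
  note uF = sup_norm_upper[OF P_cont[OF F]] and nF = sup_norm_nonneg[OF P_cont[OF F]]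
  show "0 \<le> l1_norm F" unfolding l1_norm_def using nF by (intro sum_nonneg)
  show "l1_norm (sstar P F) = l1_norm F"
    using l1_star_le[OF F] l1_star_le[OF star_closed[OF F]] by (simp add: star_star F)
  show "l1_norm (sscale P c F) = cmod c * l1_norm F"
  proof -
    have "sup_norm (\<lambda>\<omega>. c * F g \<omega>) = cmod c * sup_norm (F g)" for g
    proof (rule antisym)
      show "sup_norm (\<lambda>\<omega>. c * F g \<omega>) \<le> cmod c * sup_norm (F g)"
        using uF by (intro sup_norm_le) (auto simp: norm_mult mult_left_mono)
      have "cmod (F g \<omega>) \<le> sup_norm (\<lambda>\<omega>. c * F g \<omega>) / cmod c" if "c \<noteq> 0" for \<omega>
        using sup_norm_upper[OF cont_fun_scale[OF P_cont[OF F]], of c g \<omega>] that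
        by (simp add: norm_mult field_simps)
      then have "sup_norm (F g) \<le> sup_norm (\<lambda>\<omega>. c * F g \<omega>) / cmod c" if "c \<noteq> 0"
        using that by (intro sup_norm_le)
      then show "cmod c * sup_norm (F g) \<le> sup_norm (\<lambda>\<omega>. c * F g \<omega>)"
        by (cases "c = 0") (auto simp: field_simps)
    qed
    moreover have "l1_norm (sscale P c F) = (\<Sum>g\<in>supp F. sup_norm (\<lambda>\<omega>. c * F g \<omega>))"
      using supp_finite[OF F] by (subst l1_norm_eq[of "supp F"]) (auto simp: P_scale)
    ultimately show ?thesis by (simp add: l1_norm_def sum_distrib_left)
  qed
  assume H: "H \<in> carrier P"
  note uH = sup_norm_upper[OF P_cont[OF H]] and nH = sup_norm_nonneg[OF P_cont[OF H]]
  have fin: "finite (supp F \<union> supp H)" using F H by (simp add: supp_finite)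
  have "l1_norm (splus P F H) = (\<Sum>g\<in>supp F \<union> supp H. sup_norm (\<lambda>\<omega>. F g \<omega> + H g \<omega>))"
    by (subst l1_norm_eq[OF fin]) (auto simp: P_add fun_eq_iff)
  also have "\<dots> \<le> (\<Sum>g\<in>supp F \<union> supp H. sup_norm (F g) + sup_norm (H g))"
    using uF uH by (intro sum_mono sup_norm_le order_trans[OF norm_triangle_ineq] add_mono)
  also have "\<dots> = l1_norm F + l1_norm H"
    using l1_norm_eq[OF fin, of F] l1_norm_eq[OF fin, of H] by (simp add: sum.distrib)
  finally show "l1_norm (splus P F H) \<le> l1_norm F + l1_norm H" .
  let ?M = "(\<lambda>(h, k). h \<otimes> k) ` (supp F \<times> supp H)"
  have M: "finite ?M" "?M \<subseteq> carrier G" using F H by (auto simp: P_carrier intro!: G.m_closed)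
  note mF = P_mult[OF F supp_finite[OF F] subset_refl supp_subset[OF F]]
  have "l1_norm (stimes P F H) = (\<Sum>g\<in>?M. sup_norm (stimes P F H g))"
    by (rule l1_norm_eq[OF M(1) P_mult_support[OF F H]])
  also have "\<dots> \<le> (\<Sum>g\<in>?M. \<Sum>h\<in>supp F. sup_norm (F h) * sup_norm (H (inv h \<otimes> g)))"
  proof (intro sum_mono sup_norm_le)
    fix g \<omega>
    show "cmod (stimes P F H g \<omega>) \<le> (\<Sum>h\<in>supp F. sup_norm (F h) * sup_norm (H (inv h \<otimes> g)))"
      using uF uH nF nH
      by (auto simp: mF intro!: sum_norm_le sum_nonneg mult_mono mult_nonneg_nonneg simp: norm_mult)
  qed
  also have "\<dots> = (\<Sum>h\<in>supp F. sup_norm (F h) * (\<Sum>g\<in>?M. sup_norm (H (inv h \<otimes> g))))"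
    by (subst sum.swap) (simp add: sum_distrib_left)
  also have "\<dots> \<le> (\<Sum>h\<in>supp F. sup_norm (F h) * l1_norm H)"
  proof (intro sum_mono mult_left_mono nF)
    fix h assume "h \<in> supp F"
    then have h: "h \<in> carrier G" using supp_subset[OF F] by blast
    have inj: "inj_on (\<lambda>g. inv h \<otimes> g) ?M"
      by (rule inj_on_subset[OF G.inj_on_cmult M(2)]) (use h in simp)
    have "(\<Sum>g\<in>?M. sup_norm (H (inv h \<otimes> g))) = (\<Sum>k\<in>(\<lambda>g. inv h \<otimes> g) ` ?M. sup_norm (H k))"
      by (subst sum.reindex[OF inj]) simp
    also have "\<dots> \<le> (\<Sum>k\<in>(\<lambda>g. inv h \<otimes> g) ` ?M \<union> supp H. sup_norm (H k))"
      using M(1) supp_finite[OF H] nH by (intro sum_mono2) auto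
    also have "\<dots> = l1_norm H"
      using M(1) supp_finite[OF H] by (intro l1_norm_eq[symmetric]) auto
    finally show "(\<Sum>g\<in>?M. sup_norm (H (inv h \<otimes> g))) \<le> l1_norm H" .
  qed
  also have "\<dots> = l1_norm F * l1_norm H" by (simp add: l1_norm_def[of F] sum_distrib_right)
  finally show "l1_norm (stimes P F H) \<le> l1_norm F * l1_norm H" .
qed

definition single :: "'g \<Rightarrow> ('p \<Rightarrow> complex) \<Rightarrow> 'g \<Rightarrow> 'p \<Rightarrow> complex" where
  "single g f = (\<lambda>g' \<omega>. if g' = g then f \<omega> else 0)"

lemma single_closed: "\<lbrakk>g \<in> carrier G; f \<in> cont_fun X\<rbrakk> \<Longrightarrow> single g f \<in> carrier P"
proof (rule P_memI[of _ "{g}"])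
  fix g' assume "f \<in> cont_fun X"
  then show "single g f g' \<in> cont_fun X" by (cases "g' = g") (auto simp: single_def cont_fun_zero)
qed (auto simp: single_def)

lemma single_mult:
  assumes "g \<in> carrier G" "h \<in> carrier G" "f \<in> cont_fun X"
  shows "stimes P (single g f) (single h k)
    = single (g \<otimes> h) (\<lambda>\<omega>. if \<omega> \<in> topspace X then f \<omega> * k (act (inv g) \<omega>) else 0)"
proof -
  have "stimes P (single g f) (single h k) = (\<lambda>g' \<omega>. if g' \<in> carrier G \<and> \<omega> \<in> topspace X
      then \<Sum>h'\<in>{g}. single g f h' \<omega> * single h k (inv h' \<otimes> g') (act (inv h') \<omega>) else 0)"
    using assms by (intro P_mult single_closed) (auto simp: single_def)
  moreover have "inv g \<otimes> g' = h \<longleftrightarrow> g' = g \<otimes> h" if "g' \<in> carrier G" for g'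
    using assms that by (metis G.inv_closed G.inv_solve_left' G.inv_inv)
  ultimately show ?thesis using assms by (auto simp: single_def fun_eq_iff)
qed

lemma single_star:
  assumes "g \<in> carrier G"
  shows "sstar P (single g f)
    = single (inv g) (\<lambda>\<omega>. if \<omega> \<in> topspace X then cnj (f (act g \<omega>)) else 0)"
proof -
  have "inv g' = g \<longleftrightarrow> g' = inv g" if "g' \<in> carrier G" for g'
    using assms that by (metis G.inv_inv)
  then show ?thesis using assms by (auto simp: P_star single_def fun_eq_iff)
qed

lemma P_sum_closed:
  "(\<And>i. i \<in> I \<Longrightarrow> F i \<in> carrier P) \<Longrightarrow> (\<lambda>g \<omega>. \<Sum>i\<in>I. F i g \<omega>) \<in> carrier P"
proof (induction I rule: infinite_finite_induct)
  case (insert i I)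
  then have "splus P (F i) (\<lambda>g \<omega>. \<Sum>i\<in>I. F i g \<omega>) \<in> carrier P" by (intro add_closed) auto
  then show ?case using insert by (simp add: P_add)
qed (auto intro: P_memI[of _ "{}"] simp: cont_fun_zero)

lemma seminorm_sum_le:
  assumes q: "cstar_seminorm P q"
  shows "(\<And>i. i \<in> I \<Longrightarrow> F i \<in> carrier P) \<Longrightarrow> q (\<lambda>g \<omega>. \<Sum>i\<in>I. F i g \<omega>) \<le> (\<Sum>i\<in>I. q (F i))"
proof (induction I rule: infinite_finite_induct)
  case (insert i I)
  then have "q (splus P (F i) (\<lambda>g \<omega>. \<Sum>i\<in>I. F i g \<omega>)) \<le> q (F i) + q (\<lambda>g \<omega>. \<Sum>i\<in>I. F i g \<omega>)"
    using q P_sum_closed[of I F] by (simp add: cstar_seminorm_def)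
  then show ?case using insert by (simp add: P_add)
next
  case (infinite I)
  have "(\<lambda>_ _. 0) \<in> carrier P" by (rule P_memI[of _ "{}"]) (auto simp: cont_fun_zero)
  then have "q (sscale P 0 (\<lambda>_ _. 0)) = 0" using q by (simp add: cstar_seminorm_def)
  then show ?case using infinite by (simp add: P_scale)
next
  case empty
  have "(\<lambda>_ _. 0) \<in> carrier P" by (rule P_memI[of _ "{}"]) (auto simp: cont_fun_zero)
  then have "q (sscale P 0 (\<lambda>_ _. 0)) = 0" using q by (simp add: cstar_seminorm_def)
  then show ?case by (simp add: P_scale)
qed

text \<open>
  By the C*-identity only the coefficient at the identity matters. A continuous real function with
  values in \<open>[-1, 1]\<close> is the average of the unitaries \<open>f \<plusminus> i \<surd>(1 - f\<^sup>2)\<close>, and a unitary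
  has norm at most 1 in any C*-seminorm.
\<close>

lemma cstar_seminorm_single_le:
  assumes q: "cstar_seminorm P q" and g: "g \<in> carrier G" and f: "f \<in> cont_fun X"
  shows "q (single g f) \<le> sup_norm f"
proof -
  interpret q: star_seminorm P q by (rule cstar_seminorm_imp_star_seminorm[OF q])
  have sq: "q (stimes P (sstar P F) F) = (q F)\<^sup>2" if "F \<in> carrier P" for F
    using q that by (simp add: cstar_seminorm_def)
  have one: "\<one> \<in> carrier G" by simp
  let ?e = "single \<one> (\<lambda>\<omega>. if \<omega> \<in> topspace X then 1 else 0)"
  have c1: "(\<lambda>\<omega>. if \<omega> \<in> topspace X then 1 else 0) \<in> cont_fun X"
    using cont_fun_comp_real[OF cont_fun_zero, of "\<lambda>_. 1"] by simp
  have e: "?e \<in> carrier P" by (rule single_closed[OF one c1])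
  have "stimes P (sstar P ?e) ?e = ?e"
  proof -
    have "sstar P ?e = ?e" by (simp add: single_star act_one if_distrib cong: if_cong)
    then show ?thesis using c1 by (simp add: single_mult act_one cong: if_cong)
  qed
  then have "(q ?e)\<^sup>2 = q ?e" using sq[OF e] by simp
  then have "q ?e = 0 \<or> q ?e = 1" by (simp add: power2_eq_square)
  then have qe: "q ?e \<le> 1" by auto
  have unitary: "q (single \<one> v) \<le> 1"
    if v: "v \<in> cont_fun X" and uni: "\<And>\<omega>. \<omega> \<in> topspace X \<Longrightarrow> cnj (v \<omega>) * v \<omega> = 1" for v
  proof -
    have cv: "(\<lambda>\<omega>. if \<omega> \<in> topspace X then cnj (v \<omega>) else 0) \<in> cont_fun X"
      by (rule cont_fun_comp_real[OF v continuous_on_cnj[OF continuous_on_id]])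
    have "sstar P (single \<one> v) = single \<one> (\<lambda>\<omega>. if \<omega> \<in> topspace X then cnj (v \<omega>) else 0)"
      by (simp add: single_star act_one cong: if_cong)
    then have "stimes P (sstar P (single \<one> v)) (single \<one> v) = ?e"
      by (simp add: single_mult[OF one one cv] act_one uni cong: if_cong)
    then have "(q (single \<one> v))\<^sup>2 \<le> 1" using sq[OF single_closed[OF one v]] qe by simp
    then show ?thesis by (simp add: abs_square_le_1 abs_le_iff)
  qed
  have real: "q (single \<one> (\<lambda>\<omega>. of_real (h \<omega>))) \<le> 1"
    if h: "(\<lambda>\<omega>. complex_of_real (h \<omega>)) \<in> cont_fun X" and bd: "\<And>\<omega>. \<bar>h \<omega>\<bar> \<le> 1" for h
  proof -
    define v where "v s \<omega> = (if \<omega> \<in> topspace X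
      then complex_of_real (h \<omega>) + s * \<i> * of_real (sqrt (1 - (h \<omega>)\<^sup>2)) else 0)" for s \<omega>
    have v: "v s \<in> cont_fun X" for s
    proof -
      have "continuous_on UNIV (\<lambda>z. z + s * \<i> * of_real (sqrt (1 - (Re z)\<^sup>2)))"
        by (intro continuous_intros)
      from cont_fun_comp_real[OF h this] show ?thesis
        unfolding v_def by (simp only: Re_complex_of_real)
    qed
    have uni: "cnj (v s \<omega>) * v s \<omega> = 1" if "\<omega> \<in> topspace X" "s = 1 \<or> s = -1" for s \<omega>
    proof -
      have "1 - (h \<omega>)\<^sup>2 \<ge> 0" using bd[of \<omega>] by (simp add: abs_square_le_1)
      then have "(sqrt (1 - (h \<omega>)\<^sup>2))\<^sup>2 = 1 - (h \<omega>)\<^sup>2" by (rule real_sqrt_pow2)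
      then have "complex_of_real (sqrt (1 - (h \<omega>)\<^sup>2)) * of_real (sqrt (1 - (h \<omega>)\<^sup>2))
          = 1 - of_real (h \<omega>) * of_real (h \<omega>)"
        by (metis of_real_1 of_real_diff of_real_mult power2_eq_square)
      then show ?thesis using that by (auto simp: v_def algebra_simps)
    qed
    have h0: "h \<omega> = 0" if "\<omega> \<notin> topspace X" for \<omega>
      using h that by (auto simp: cont_fun_def)
    have average: "single \<one> (\<lambda>\<omega>. of_real (h \<omega>))
        = splus P (sscale P (1/2) (single \<one> (v 1))) (sscale P (1/2) (single \<one> (v (-1))))"
      by (auto simp: P_add P_scale single_def v_def fun_eq_iff h0 field_simps)
    have "q (single \<one> (\<lambda>\<omega>. of_real (h \<omega>)))
        \<le> 1/2 * q (single \<one> (v 1)) + 1/2 * q (single \<one> (v (-1)))"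
      unfolding average using single_closed[OF one v]
      by (intro order_trans[OF q.triangle]) (auto simp: q.homogeneous)
    also have "\<dots> \<le> 1" using unitary[OF v uni, of 1] unitary[OF v uni, of "-1"] by simp
    finally show ?thesis .
  qed
  let ?M = "sup_norm f"
  have M: "cmod (f \<omega>) \<le> ?M" for \<omega> using sup_norm_upper[OF f] .
  have f0: "f \<omega> = 0" if "\<omega> \<notin> topspace X" for \<omega> using f that by (simp add: cont_fun_def)
  show ?thesis
  proof (cases "?M = 0")
    case True
    then have "f = (\<lambda>_. 0)" using M by (simp add: fun_eq_iff)
    then have "single g f = sscale P 0 (single g f)" by (auto simp: P_scale single_def fun_eq_iff)
    then have "q (single g f) = 0"
      using q.homogeneous[OF single_closed[OF g f], of 0] by simp
    then show ?thesis using True by simp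
  next
    case False
    then have Mpos: "?M > 0" using sup_norm_nonneg[OF f] by simp
    define h where "h \<omega> = (cmod (f \<omega>) / ?M)\<^sup>2" for \<omega>
    have hc: "(\<lambda>\<omega>. complex_of_real (h \<omega>)) \<in> cont_fun X"
    proof -
      have "continuous_on UNIV (\<lambda>z. complex_of_real ((cmod z / ?M)\<^sup>2))"
        using Mpos by (intro continuous_intros) auto
      from cont_fun_comp_real[OF f this] show ?thesis
        by (rule back_subst[of "\<lambda>f. f \<in> cont_fun X"]) (auto simp: h_def f0 fun_eq_iff)
    qed
    have bd: "\<bar>h \<omega>\<bar> \<le> 1" for \<omega>
      using M[of \<omega>] Mpos by (simp add: h_def power_le_one)
    have s: "single g f \<in> carrier P" by (rule single_closed[OF g f])
    have "stimes P (single g f) (sstar P (single g f))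
        = sscale P (of_real (?M\<^sup>2)) (single \<one> (\<lambda>\<omega>. of_real (h \<omega>)))"
    proof -
      have "f \<omega> * cnj (f \<omega>) = of_real (?M\<^sup>2) * of_real (h \<omega>)" for \<omega>
        using Mpos by (simp add: h_def complex_norm_square[symmetric] power_divide flip: of_real_power)
      then have "(\<lambda>\<omega>. if \<omega> \<in> topspace X then f \<omega> * cnj (f \<omega>) else 0)
          = (\<lambda>\<omega>. of_real (?M\<^sup>2) * of_real (h \<omega>))"
        by (auto simp: fun_eq_iff h_def f0)
      moreover have "stimes P (single g f) (sstar P (single g f))
          = single \<one> (\<lambda>\<omega>. if \<omega> \<in> topspace X then f \<omega> * cnj (f \<omega>) else 0)"
        using g f by (simp add: single_star single_mult act_inv_cancel act_closed cong: if_cong)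
      ultimately show ?thesis by (auto simp: P_scale single_def fun_eq_iff)
    qed
    then have "q (stimes P (single g f) (sstar P (single g f)))
        = ?M\<^sup>2 * q (single \<one> (\<lambda>\<omega>. of_real (h \<omega>)))"
      using q.homogeneous[OF single_closed[OF one hc]] by (simp add: norm_power)
    also have "\<dots> \<le> ?M\<^sup>2 * 1" using real[OF hc bd] by (intro mult_left_mono) auto
    finally have "q (stimes P (single g f) (sstar P (single g f))) \<le> ?M\<^sup>2" by simp
    moreover have "q (stimes P (single g f) (sstar P (single g f))) = (q (single g f))\<^sup>2"
      using sq[OF star_closed[OF s]] s by (simp add: star_star q.star_isometric)
    ultimately have "(q (single g f))\<^sup>2 \<le> ?M\<^sup>2" by simp
    then show ?thesis by (rule power2_le_imp_le) (use Mpos in simp)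
  qed
qed

lemma cstar_seminorm_le_l1:
  assumes q: "cstar_seminorm P q" and F: "F \<in> carrier P"
  shows "q F \<le> l1_norm F"
proof -
  have "F = (\<lambda>g \<omega>. \<Sum>h\<in>supp F. single h (F h) g \<omega>)"
  proof (intro ext)
    fix g \<omega>
    have "(\<Sum>h\<in>supp F. single h (F h) g \<omega>) = (\<Sum>h\<in>supp F. if h = g then F g \<omega> else 0)"
      by (intro sum.cong) (auto simp: single_def)
    also have "\<dots> = F g \<omega>" using supp_finite[OF F] by (auto simp: sum.delta fun_eq_iff)
    finally show "F g \<omega> = (\<Sum>h\<in>supp F. single h (F h) g \<omega>)" by simp
  qed
  then have "q F = q (\<lambda>g \<omega>. \<Sum>h\<in>supp F. single h (F h) g \<omega>)" by simp
  also have "\<dots> \<le> (\<Sum>h\<in>supp F. q (single h (F h)))"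
    using F supp_subset[OF F] by (intro seminorm_sum_le[OF q] single_closed) (auto simp: P_carrier)
  also have "\<dots> \<le> (\<Sum>h\<in>supp F. sup_norm (F h))"
    using F supp_subset[OF F] by (intro sum_mono cstar_seminorm_single_le[OF q]) (auto simp: P_carrier)
  finally show ?thesis by (simp add: l1_norm_def)
qed

lemma P_lincomb_closed:
  assumes "\<And>i. i \<in> I \<Longrightarrow> F i \<in> carrier P"
  shows "(\<lambda>g \<omega>. \<Sum>i\<in>I. c i * F i g \<omega>) \<in> carrier P"
proof -
  have "sscale P (c i) (F i) \<in> carrier P" if "i \<in> I" for i using assms that by simp
  from P_sum_closed[OF this] show ?thesis by (simp add: P_scale)
qed

section \<open>Homomorphisms from a free star-algebra to a crossed product\<close>

fun word_value :: "('s \<Rightarrow> 'g \<Rightarrow> 'p \<Rightarrow> complex) \<Rightarrow> ('s \<times> bool) list \<Rightarrow> 'g \<Rightarrow> 'p \<Rightarrow> complex" where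
  "word_value V [] = (\<lambda>_ _. 0)"
| "word_value V [(s, b)] = (if b then sstar P (V s) else V s)"
| "word_value V ((s, b) # l # z) = stimes P (if b then sstar P (V s) else V s) (word_value V (l # z))"

definition free_lift :: "('s \<Rightarrow> 'g \<Rightarrow> 'p \<Rightarrow> complex) \<Rightarrow> 's free_elt \<Rightarrow> 'g \<Rightarrow> 'p \<Rightarrow> complex" where
  "free_lift V x = (\<lambda>g \<omega>. \<Sum>z | x z \<noteq> 0. x z * word_value V z g \<omega>)"

context
  fixes V :: "'s \<Rightarrow> 'g \<Rightarrow> 'p \<Rightarrow> complex" and S :: "'s set"
  assumes V: "\<And>s. s \<in> S \<Longrightarrow> V s \<in> carrier P"
begin

lemma word_value_closed: "z \<in> lists (S \<times> UNIV) \<Longrightarrow> z \<noteq> [] \<Longrightarrow> word_value V z \<in> carrier P"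
  by (induction z rule: induct_list012) (auto simp: V)

lemma word_value_append:
  "\<lbrakk>u \<in> lists (S \<times> UNIV); v \<in> lists (S \<times> UNIV); u \<noteq> []; v \<noteq> []\<rbrakk>
    \<Longrightarrow> word_value V (u @ v) = stimes P (word_value V u) (word_value V v)"
proof (induction u rule: induct_list012)
  case (2 l)
  then show ?case by (cases v; cases l) auto
next
  case (3 k l z)
  obtain s b where k: "k = (s, b)" by fastforce
  have "word_value V (l # z) \<in> carrier P" using 3 by (intro word_value_closed) auto
  moreover have "(if b then sstar P (V s) else V s) \<in> carrier P" using 3 V k by auto
  ultimately show ?case using 3 by (simp add: k P_assoc)
qed auto

lemma word_value_flip:
  "\<lbrakk>z \<in> lists (S \<times> UNIV); z \<noteq> []\<rbrakk> \<Longrightarrow> word_value V (flip_letters z) = sstar P (word_value V z)"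
proof (induction z rule: induct_list012)
  case (2 l)
  then show ?case using V by (cases l) (auto simp: star_star)
next
  case (3 k l z)
  obtain s b where k: "k = (s, b)" by fastforce
  have fl: "flip_letters (l # z) \<in> lists (S \<times> UNIV)"
    using 3 flip_lists[of "flip_letters (l # z)" S] by (simp only: flip_flip) auto
  have lz: "word_value V (l # z) \<in> carrier P" using 3 by (intro word_value_closed) auto
  have s: "s \<in> S" using 3 k by auto
  have "word_value V (flip_letters (k # l # z))
      = word_value V (flip_letters (l # z) @ [(s, \<not> b)])" by (simp add: k)
  also have "\<dots> = stimes P (word_value V (flip_letters (l # z))) (word_value V [(s, \<not> b)])"
    using fl s by (intro word_value_append) auto
  also have "\<dots> = stimes P (sstar P (word_value V (l # z))) (word_value V [(s, \<not> b)])"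
    using 3 by simp
  also have "\<dots> = sstar P (word_value V (k # l # z))"
    using V[OF s] lz by (cases b) (simp_all add: k P_star_mult star_star)
  finally show ?case .
qed simp

lemma free_lift_eq:
  assumes "finite K" "{z. x z \<noteq> 0} \<subseteq> K"
  shows "free_lift V x g \<omega> = (\<Sum>z\<in>K. x z * word_value V z g \<omega>)"
  unfolding free_lift_def using assms by (intro sum.mono_neutral_left) auto

lemma P_mult_sum_left:
  "\<lbrakk>\<And>i. i \<in> I \<Longrightarrow> F i \<in> carrier P; H \<in> carrier P; finite I\<rbrakk>
    \<Longrightarrow> stimes P (\<lambda>g \<omega>. \<Sum>i\<in>I. c i * F i g \<omega>) H = (\<lambda>g \<omega>. \<Sum>i\<in>I. c i * stimes P (F i) H g \<omega>)"
proof (induction I rule: infinite_finite_induct)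
  case (insert i I)
  have 1: "sscale P (c i) (F i) \<in> carrier P" using insert by simp
  have 2: "(\<lambda>g \<omega>. \<Sum>i\<in>I. c i * F i g \<omega>) \<in> carrier P"
    using insert by (intro P_lincomb_closed) auto
  have "(\<lambda>g \<omega>. \<Sum>i\<in>insert i I. c i * F i g \<omega>)
      = splus P (sscale P (c i) (F i)) (\<lambda>g \<omega>. \<Sum>i\<in>I. c i * F i g \<omega>)"
    using insert by (simp add: P_add P_scale)
  then have "stimes P (\<lambda>g \<omega>. \<Sum>i\<in>insert i I. c i * F i g \<omega>) H
      = splus P (sscale P (c i) (stimes P (F i) H)) (stimes P (\<lambda>g \<omega>. \<Sum>i\<in>I. c i * F i g \<omega>) H)"
    using insert 1 2 by (simp add: add_mult scale_mult)
  then show ?case using insert by (simp add: P_add P_scale)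
next
  case empty
  have "(\<lambda>_ _. 0) \<in> carrier P" by (rule P_memI[of _ "{}"]) (auto simp: cont_fun_zero)
  then have "stimes P (sscale P 0 (\<lambda>_ _. 0)) H = sscale P 0 (stimes P (\<lambda>_ _. 0) H)"
    using empty by (intro scale_mult)
  then show ?case by (simp add: P_scale)
qed auto

lemma P_mult_sum_right:
  "\<lbrakk>\<And>i. i \<in> I \<Longrightarrow> F i \<in> carrier P; H \<in> carrier P; finite I\<rbrakk>
    \<Longrightarrow> stimes P H (\<lambda>g \<omega>. \<Sum>i\<in>I. c i * F i g \<omega>) = (\<lambda>g \<omega>. \<Sum>i\<in>I. c i * stimes P H (F i) g \<omega>)"
proof (induction I rule: infinite_finite_induct)
  case (insert i I)
  have 1: "sscale P (c i) (F i) \<in> carrier P" using insert by simp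
  have 2: "(\<lambda>g \<omega>. \<Sum>i\<in>I. c i * F i g \<omega>) \<in> carrier P"
    using insert by (intro P_lincomb_closed) auto
  have "(\<lambda>g \<omega>. \<Sum>i\<in>insert i I. c i * F i g \<omega>)
      = splus P (sscale P (c i) (F i)) (\<lambda>g \<omega>. \<Sum>i\<in>I. c i * F i g \<omega>)"
    using insert by (simp add: P_add P_scale)
  then have "stimes P H (\<lambda>g \<omega>. \<Sum>i\<in>insert i I. c i * F i g \<omega>)
      = splus P (sscale P (c i) (stimes P H (F i))) (stimes P H (\<lambda>g \<omega>. \<Sum>i\<in>I. c i * F i g \<omega>))"
    using insert 1 2 by (simp add: mult_add mult_scale)
  then show ?case using insert by (simp add: P_add P_scale)
next
  case empty
  have "(\<lambda>_ _. 0) \<in> carrier P" by (rule P_memI[of _ "{}"]) (auto simp: cont_fun_zero)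
  then have "stimes P H (sscale P 0 (\<lambda>_ _. 0)) = sscale P 0 (stimes P H (\<lambda>_ _. 0))"
    using empty by (intro mult_scale)
  then show ?case by (simp add: P_scale)
qed auto

theorem free_lift_star_hom: "star_hom (free_star_algebra S) P (free_lift V)"
  unfolding star_hom_def
proof (intro conjI ballI allI)
  let ?F = "free_star_algebra S"
  fix x :: "'s free_elt" and c
  assume x: "x \<in> carrier ?F"
  have fx: "finite {z. x z \<noteq> 0}" and wx: "\<And>z. x z \<noteq> 0 \<Longrightarrow> word_value V z \<in> carrier P"
    and lx: "\<And>z. x z \<noteq> 0 \<Longrightarrow> z \<in> lists (S \<times> UNIV) \<and> z \<noteq> []"
    using x word_value_closed by (auto simp: free_carrier)
  show "free_lift V x \<in> carrier P"
    unfolding free_lift_def using wx by (intro P_lincomb_closed) simp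
  show "free_lift V (sscale ?F c x) = sscale P c (free_lift V x)"
  proof (intro ext)
    fix g \<omega>
    have "free_lift V (sscale ?F c x) g \<omega> = (\<Sum>z | x z \<noteq> 0. sscale ?F c x z * word_value V z g \<omega>)"
      using fx by (intro free_lift_eq) (auto simp: free_ops)
    then show "free_lift V (sscale ?F c x) g \<omega> = sscale P c (free_lift V x) g \<omega>"
      by (simp add: free_lift_def P_scale free_ops sum_distrib_left mult.assoc)
  qed
  show "free_lift V (sstar ?F x) = sstar P (free_lift V x)"
  proof (intro ext)
    fix g \<omega>
    let ?K = "flip_letters ` {z. x z \<noteq> 0}"
    have "{z. sstar ?F x z \<noteq> 0} \<subseteq> ?K"
      by (auto simp: free_ops intro!: image_eqI[of _ flip_letters, OF flip_flip[symmetric]])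
    then have "free_lift V (sstar ?F x) g \<omega> = (\<Sum>z\<in>?K. sstar ?F x z * word_value V z g \<omega>)"
      using fx by (intro free_lift_eq) auto
    also have "\<dots> = (\<Sum>z | x z \<noteq> 0. sstar ?F x (flip_letters z) * word_value V (flip_letters z) g \<omega>)"
      by (subst sum.reindex) (rule inj_on_inverseI[where g = flip_letters], rule flip_flip, simp)
    also have "\<dots> = (\<Sum>z | x z \<noteq> 0. cnj (x z) * sstar P (word_value V z) g \<omega>)"
      using lx by (intro sum.cong) (simp_all add: free_ops word_value_flip flip_flip)
    also have "\<dots> = sstar P (free_lift V x) g \<omega>"
      by (cases "g \<in> carrier G"; cases "\<omega> \<in> topspace X") (simp_all add: P_star free_lift_def)
    finally show "free_lift V (sstar ?F x) g \<omega> = sstar P (free_lift V x) g \<omega>" .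
  qed
  fix y :: "'s free_elt"
  assume y: "y \<in> carrier ?F"
  have fy: "finite {z. y z \<noteq> 0}" and wy: "\<And>z. y z \<noteq> 0 \<Longrightarrow> word_value V z \<in> carrier P"
    and ly: "\<And>z. y z \<noteq> 0 \<Longrightarrow> z \<in> lists (S \<times> UNIV) \<and> z \<noteq> []"
    using y word_value_closed by (auto simp: free_carrier)
  show "free_lift V (splus ?F x y) = splus P (free_lift V x) (free_lift V y)"
  proof (intro ext)
    fix g \<omega>
    let ?K = "{z. x z \<noteq> 0} \<union> {z. y z \<noteq> 0}"
    have K: "finite ?K" using fx fy by simp
    have "free_lift V (splus ?F x y) g \<omega> = (\<Sum>z\<in>?K. splus ?F x y z * word_value V z g \<omega>)"
      using K by (intro free_lift_eq) (auto simp: free_ops)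
    moreover have "free_lift V x g \<omega> = (\<Sum>z\<in>?K. x z * word_value V z g \<omega>)"
      "free_lift V y g \<omega> = (\<Sum>z\<in>?K. y z * word_value V z g \<omega>)"
      using K by (auto intro!: free_lift_eq)
    ultimately show "free_lift V (splus ?F x y) g \<omega> = splus P (free_lift V x) (free_lift V y) g \<omega>"
      by (simp add: P_add free_ops distrib_right sum.distrib)
  qed
  show "free_lift V (stimes ?F x y) = stimes P (free_lift V x) (free_lift V y)"
  proof (intro ext)
    fix g \<omega>
    let ?X = "{z. x z \<noteq> 0}" and ?Y = "{z. y z \<noteq> 0}"
    let ?K = "(\<lambda>(u, v). u @ v) ` (?X \<times> ?Y)"
    have K: "finite ?K" using fx fy by simp
    have lifty: "free_lift V y \<in> carrier P"
      unfolding free_lift_def using wy by (intro P_lincomb_closed) simp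
    have "free_lift V (stimes ?F x y) g \<omega> = (\<Sum>z\<in>?K. conv x y z * word_value V z g \<omega>)"
      using free_lift_eq[OF K conv_support] by (simp add: free_ops)
    also have "\<dots> = (\<Sum>z\<in>?K. \<Sum>(u, v) | (u, v) \<in> ?X \<times> ?Y \<and> u @ v = z. x u * y v * word_value V (u @ v) g \<omega>)"
    proof (rule sum.cong[OF HOL.refl])
      fix z assume "z \<in> ?K"
      have "conv x y z = (\<Sum>i | i \<le> length z \<and> x (take i z) \<noteq> 0 \<and> y (drop i z) \<noteq> 0. x (take i z) * y (drop i z))"
        by (rule sum.mono_neutral_right) auto
      also have "\<dots> = (\<Sum>(u, v) | (u, v) \<in> ?X \<times> ?Y \<and> u @ v = z. x u * y v)"
        by (rule sum.reindex_bij_witness[where i = "\<lambda>(u, v). length u" and j = "\<lambda>i. (take i z, drop i z)"])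
           auto
      finally show "conv x y z * word_value V z g \<omega>
          = (\<Sum>(u, v) | (u, v) \<in> ?X \<times> ?Y \<and> u @ v = z. x u * y v * word_value V (u @ v) g \<omega>)"
        by (simp add: sum_distrib_right case_prod_beta)
    qed
    also have "\<dots> = (\<Sum>z\<in>?K. \<Sum>w | w \<in> ?X \<times> ?Y \<and> (\<lambda>(u, v). u @ v) w = z.
        (\<lambda>(u, v). x u * y v * word_value V (u @ v) g \<omega>) w)"
      by (intro sum.cong) auto
    also have "\<dots> = (\<Sum>w\<in>?X \<times> ?Y. (\<lambda>(u, v). x u * y v * word_value V (u @ v) g \<omega>) w)"
      using fx fy by (intro sum.group) auto
    also have "\<dots> = (\<Sum>u\<in>?X. \<Sum>v\<in>?Y. x u * y v * word_value V (u @ v) g \<omega>)"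
      by (simp add: sum.cartesian_product)
    also have "\<dots> = (\<Sum>u\<in>?X. x u * (\<Sum>v\<in>?Y. y v * stimes P (word_value V u) (word_value V v) g \<omega>))"
      using lx ly by (auto simp: sum_distrib_left word_value_append mult.assoc intro!: sum.cong)
    also have "\<dots> = (\<Sum>u\<in>?X. x u * stimes P (word_value V u) (free_lift V y) g \<omega>)"
    proof (rule sum.cong[OF HOL.refl])
      fix u assume "u \<in> ?X"
      then show "x u * (\<Sum>v\<in>?Y. y v * stimes P (word_value V u) (word_value V v) g \<omega>)
          = x u * stimes P (word_value V u) (free_lift V y) g \<omega>"
        using P_mult_sum_right[of ?Y "word_value V" "word_value V u" y] wx wy fy
        by (simp add: free_lift_def)
    qed
    also have "\<dots> = stimes P (free_lift V x) (free_lift V y) g \<omega>"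
      using P_mult_sum_left[of ?X "word_value V" "free_lift V y" x] wx fx lifty
      by (simp add: free_lift_def[of V x])
    finally show "free_lift V (stimes ?F x y) g \<omega> = stimes P (free_lift V x) (free_lift V y) g \<omega>" .
  qed
qed

end

lemma free_lift_gen: "free_lift V (free_gen s) = V s"
proof -
  have "{z. free_gen s z \<noteq> 0} = {[(s, False)]}" by (auto simp: free_gen_def)
  then show ?thesis by (simp add: free_lift_def free_gen_def)
qed

end

section \<open>Actions on a tree of reduced sequences\<close>

text \<open>
  A vertex or an end of the tree of reduced words over \<open>P\<close> is a finite or infinite reduced
  sequence, coded as a map into an option type that stays \<open>None\<close> once it is \<open>None\<close>.
  A letter \<open>p\<close> acts by prepending, with cancellation. A letter \<open>q\<close> of the other kind is pushed
  through the sequence from left to right: \<open>push q p = (p', q')\<close> encodes the relation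
  \<open>q p = p' q'\<close>.
\<close>

locale tree_action =
  fixes P :: "'p set" and ip :: "'p \<Rightarrow> 'p" and Q :: "'q set" and iq :: "'q \<Rightarrow> 'q"
    and push :: "'q \<Rightarrow> 'p \<Rightarrow> 'p \<times> 'q"
  assumes ip: "p \<in> P \<Longrightarrow> ip p \<in> P" "p \<in> P \<Longrightarrow> ip (ip p) = p" "p \<in> P \<Longrightarrow> ip p \<noteq> p"
    and iq: "q \<in> Q \<Longrightarrow> iq q \<in> Q" "q \<in> Q \<Longrightarrow> iq (iq q) = q"
    and push_closed: "\<lbrakk>q \<in> Q; p \<in> P\<rbrakk> \<Longrightarrow> push q p \<in> P \<times> Q"
    and push_left: "\<lbrakk>q \<in> Q; p \<in> P; push q p = (p', q')\<rbrakk> \<Longrightarrow> push (iq q) p' = (p, iq q')"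
    and push_right: "\<lbrakk>q \<in> Q; p \<in> P; push q p = (p', q')\<rbrakk> \<Longrightarrow> push q' (ip p) = (ip p', q)"
begin

definition red :: "(nat \<Rightarrow> 'p option) \<Rightarrow> bool" where
  "red f \<longleftrightarrow> (\<forall>n. (f n = None \<longrightarrow> f (Suc n) = None) \<and>
     (\<forall>p. f n = Some p \<longrightarrow> p \<in> P \<and> f (Suc n) \<noteq> Some (ip p)))"

primrec state :: "'q \<Rightarrow> (nat \<Rightarrow> 'p option) \<Rightarrow> nat \<Rightarrow> 'q" where
  "state q f 0 = q"
| "state q f (Suc n) = (case f n of None \<Rightarrow> state q f n | Some p \<Rightarrow> snd (push (state q f n) p))"

definition push_seq :: "'q \<Rightarrow> (nat \<Rightarrow> 'p option) \<Rightarrow> nat \<Rightarrow> 'p option" where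
  "push_seq q f = (\<lambda>n. map_option (\<lambda>p. fst (push (state q f n) p)) (f n))"

definition cons_seq :: "'p \<Rightarrow> (nat \<Rightarrow> 'p option) \<Rightarrow> nat \<Rightarrow> 'p option" where
  "cons_seq p f = (if f 0 = Some (ip p) then (\<lambda>n. f (Suc n)) else case_nat (Some p) f)"

abbreviation tail :: "(nat \<Rightarrow> 'p option) \<Rightarrow> nat \<Rightarrow> 'p option" where
  "tail f \<equiv> (\<lambda>n. f (Suc n))"

lemma redD:
  assumes "red f"
  shows "f n = None \<Longrightarrow> f (Suc n) = None" "f n = Some p \<Longrightarrow> p \<in> P"
    "f n = Some p \<Longrightarrow> f (Suc n) \<noteq> Some (ip p)"
  using assms by (auto simp: red_def)

lemma red_tail: "red f \<Longrightarrow> red (tail f)"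
  by (simp add: red_def)

lemma red_Cons: "\<lbrakk>red f; p \<in> P; f 0 \<noteq> Some (ip p)\<rbrakk> \<Longrightarrow> red (case_nat (Some p) f)"
  unfolding red_def by (intro allI) (simp split: nat.split)

lemma red_empty: "red (\<lambda>_. None)"
  by (simp add: red_def)

lemma red_cons_seq: "\<lbrakk>red f; p \<in> P\<rbrakk> \<Longrightarrow> red (cons_seq p f)"
  by (simp add: cons_seq_def red_tail red_Cons)

lemma push_fst_inj:
  assumes "q \<in> Q" "p \<in> P" "p2 \<in> P" "fst (push q p) = fst (push q p2)"
  shows "p = p2"
proof -
  obtain p' r r2 where "push q p = (p', r)" "push q p2 = (p', r2)"
    using assms(4) by (metis prod.collapse)
  from push_left[OF assms(1,2) this(1)] push_left[OF assms(1,3) this(2)]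
  have "push (iq q) p' = (p, iq r)" "push (iq q) p' = (p2, iq r2)" .
  then show ?thesis by simp
qed

lemma push_mem: "\<lbrakk>q \<in> Q; p \<in> P\<rbrakk> \<Longrightarrow> fst (push q p) \<in> P" "\<lbrakk>q \<in> Q; p \<in> P\<rbrakk> \<Longrightarrow> snd (push q p) \<in> Q"
  using push_closed by (auto simp: mem_Times_iff)

lemma state_closed: "\<lbrakk>q \<in> Q; red f\<rbrakk> \<Longrightarrow> state q f n \<in> Q"
  by (induction n) (auto split: option.split dest: redD push_mem(2))

text \<open>Reducedness is preserved because a cancelling pair is pushed to a cancelling pair and back.\<close>

lemma push_no_cancel:
  assumes "q \<in> Q" "p \<in> P" "p2 \<in> P" "push q p = (p', q')" "fst (push q' p2) = ip p'"
  shows "p2 = ip p"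
proof (rule push_fst_inj)
  show "q' \<in> Q" using push_closed[OF assms(1,2)] assms(4) by simp
  show "fst (push q' p2) = fst (push q' (ip p))" using push_right[OF assms(1,2,4)] assms(5) by simp
qed (use assms ip in auto)

lemma red_push_seq:
  assumes q: "q \<in> Q" and f: "red f"
  shows "red (push_seq q f)"
  unfolding red_def
proof (intro allI conjI impI)
  fix n p
  show "push_seq q f (Suc n) = None" if "push_seq q f n = None"
    using that redD(1)[OF f] by (simp add: push_seq_def)
  assume "push_seq q f n = Some p"
  then obtain p0 where p0: "f n = Some p0" "p = fst (push (state q f n) p0)"
    by (auto simp: push_seq_def)
  have s: "state q f n \<in> Q" "p0 \<in> P" using state_closed[OF q f] redD(2)[OF f p0(1)] by auto
  show "p \<in> P" using p0 push_mem(1)[OF s] by simp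
  show "push_seq q f (Suc n) \<noteq> Some (ip p)"
  proof
    assume "push_seq q f (Suc n) = Some (ip p)"
    then obtain p2 where p2: "f (Suc n) = Some p2"
      and eq: "fst (push (snd (push (state q f n) p0)) p2) = ip p"
      using p0 by (auto simp: push_seq_def)
    have "push (state q f n) p0 = (p, snd (push (state q f n) p0))" using p0 by simp
    from push_no_cancel[OF s redD(2)[OF f p2] this eq] have "p2 = ip p0" .
    then show False using p2 redD(3)[OF f p0(1)] by simp
  qed
qed

lemma push_left': "\<lbrakk>q \<in> Q; p \<in> P\<rbrakk> \<Longrightarrow> push (iq q) (fst (push q p)) = (p, iq (snd (push q p)))"
  using push_left[of q p "fst (push q p)" "snd (push q p)"] by simp

lemma push_seq_inverse:
  assumes q: "q \<in> Q" and f: "red f"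
  shows "push_seq (iq q) (push_seq q f) = f"
proof -
  have st: "state (iq q) (push_seq q f) n = iq (state q f n)" for n
  proof (induction n)
    case (Suc n)
    show ?case
    proof (cases "f n")
      case None
      then show ?thesis using Suc by (simp add: push_seq_def)
    next
      case (Some p)
      then show ?thesis
        using Suc push_left'[OF state_closed[OF q f] redD(2)[OF f Some], of n]
        by (simp add: push_seq_def)
    qed
  qed simp
  show ?thesis
  proof
    fix n
    show "push_seq (iq q) (push_seq q f) n = f n"
    proof (cases "f n")
      case (Some p)
      then show ?thesis
        using push_left'[OF state_closed[OF q f] redD(2)[OF f Some], of n] st[of n]
        unfolding push_seq_def[of "iq q"] by (simp add: push_seq_def)
    qed (simp add: push_seq_def)
  qed
qed

lemma cons_seq_inverse:
  assumes p: "p \<in> P" and f: "red f"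
  shows "cons_seq (ip p) (cons_seq p f) = f"
proof (cases "f 0 = Some (ip p)")
  case True
  then have "f (Suc 0) \<noteq> Some p" using redD(3)[OF f True] ip p by simp
  then show ?thesis
    using True ip p by (auto simp: cons_seq_def fun_eq_iff split: nat.split)
qed (simp add: cons_seq_def ip p)

lemma state_Cons:
  assumes "push q p = (p', q')"
  shows "state q (case_nat (Some p) f) (Suc n) = state q' f n"
  by (induction n) (auto simp: assms split: option.split)

lemma push_seq_Cons:
  assumes "push q p = (p', q')"
  shows "push_seq q (case_nat (Some p) f) = case_nat (Some p') (push_seq q' f)"
proof
  fix n
  show "push_seq q (case_nat (Some p) f) n = case_nat (Some p') (push_seq q' f) n"
    using state_Cons[OF assms] by (cases n) (simp_all add: push_seq_def assms del: state.simps(2))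
qed

lemma push_cons_seq:
  assumes q: "q \<in> Q" and p: "p \<in> P" and eq: "push q p = (p', q')" and f: "red f"
  shows "push_seq q (cons_seq p f) = cons_seq p' (push_seq q' f)"
proof (cases "f 0 = Some (ip p)")
  case True
  then have f_eq: "f = case_nat (Some (ip p)) (tail f)" by (auto simp: fun_eq_iff split: nat.split)
  have "push_seq q' f = case_nat (Some (ip p')) (push_seq q (tail f))"
    using push_seq_Cons[OF push_right[OF q p eq], of "tail f"] f_eq by simp
  then show ?thesis using True by (simp add: cons_seq_def)
next
  case False
  have q': "q' \<in> Q" using push_closed[OF q p] eq by simp
  have "push_seq q' f 0 \<noteq> Some (ip p')"
  proof
    assume "push_seq q' f 0 = Some (ip p')"
    then obtain p2 where p2: "f 0 = Some p2" "fst (push q' p2) = ip p'" by (auto simp: push_seq_def)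
    then have "p2 = ip p" using push_no_cancel[OF q p redD(2)[OF f p2(1)] eq] by simp
    then show False using p2 False by simp
  qed
  then show ?thesis using False push_seq_Cons[OF eq, of f] by (simp add: cons_seq_def)
qed

lemma state_cong: "(\<And>i. i < n \<Longrightarrow> f i = f' i) \<Longrightarrow> state q f n = state q f' n"
  by (induction n) (auto split: option.split)

lemma push_seq_cong:
  assumes "\<And>i. i < n \<Longrightarrow> f i = f' i" "i < n"
  shows "push_seq q f i = push_seq q f' i"
  using assms state_cong[of i f f' q] by (simp add: push_seq_def)

definition trunc :: "nat \<Rightarrow> (nat \<Rightarrow> 'p option) \<Rightarrow> nat \<Rightarrow> 'p option" where
  "trunc n f = (\<lambda>i. if i < n then f i else None)"

lemma push_seq_trunc: "push_seq q (trunc n f) = trunc n (push_seq q f)"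
proof
  fix i
  show "push_seq q (trunc n f) i = trunc n (push_seq q f) i"
  proof (cases "i < n")
    case True
    then have "push_seq q (trunc n f) i = push_seq q f i"
      by (intro push_seq_cong[of n]) (auto simp: trunc_def)
    then show ?thesis using True by (simp add: trunc_def)
  qed (simp add: trunc_def push_seq_def)
qed

lemma cons_seq_trunc:
  "f 0 \<noteq> Some (ip p) \<Longrightarrow> cons_seq p (trunc n f) = trunc (Suc n) (cons_seq p f)"
  by (auto simp: cons_seq_def trunc_def fun_eq_iff split: nat.split)

lemma trunc_eqD:
  assumes "trunc n f = trunc m f'" "\<And>i. f i \<noteq> None" "\<And>i. f' i \<noteq> None"
  shows "n = m \<and> (\<forall>i<n. f i = f' i)"
proof -
  have eq: "trunc n f i = trunc m f' i" for i using assms(1) by simp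
  have "\<not> n < m" using eq[of n] assms(3)[of n] by (auto simp: trunc_def)
  moreover have "\<not> m < n" using eq[of m] assms(2)[of m] by (auto simp: trunc_def)
  ultimately have "n = m" by simp
  moreover have "f i = f' i" if "i < n" for i
    using eq[of i] that \<open>n = m\<close> by (simp add: trunc_def)
  ultimately show ?thesis by simp
qed

lemma infinite_push_seq: "(\<And>i. f i \<noteq> None) \<Longrightarrow> push_seq q f i \<noteq> None"
  by (simp add: push_seq_def)

lemma infinite_cons_seq: "(\<And>i. f i \<noteq> None) \<Longrightarrow> cons_seq p f i \<noteq> None"
  by (simp add: cons_seq_def split: nat.split)

lemma cons_seq_cong:
  assumes "\<And>i. i < Suc n \<Longrightarrow> f i = f' i" "i < n"
  shows "cons_seq p f i = cons_seq p f' i"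
  using assms by (auto simp: cons_seq_def split: nat.split)

end

section \<open>The BM group and its action on the two trees\<close>

type_synonym ('x, 'y) seq_pair = "(nat \<Rightarrow> 'x option) \<times> (nat \<Rightarrow> 'y option)"

context BM_data begin

abbreviation A where "A \<equiv> Aset D"
abbreviation B where "B \<equiv> Bset D"
abbreviation R where "R \<equiv> Rset D"

lemma R_mem: "(a, b, b', a') \<in> R \<Longrightarrow> a \<in> A \<and> b \<in> B \<and> b' \<in> B \<and> a' \<in> A"
  using R_subset by auto

lemma tile_unique:
  assumes "(a, b, b', a') \<in> R" "(c, d, d', c') \<in> R"
  shows "a = c \<Longrightarrow> b = d \<Longrightarrow> (a, b, b', a') = (c, d, d', c')"
    and "a = c \<Longrightarrow> b' = d' \<Longrightarrow> (a, b, b', a') = (c, d, d', c')"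
    and "b = d \<Longrightarrow> a' = c' \<Longrightarrow> (a, b, b', a') = (c, d, d', c')"
    and "b' = d' \<Longrightarrow> a' = c' \<Longrightarrow> (a, b, b', a') = (c, d, d', c')"
  by (rule inj_onD[OF bij_betw_imp_inj_on[OF R_projections(1)] _ assms], simp)
     (rule inj_onD[OF bij_betw_imp_inj_on[OF R_projections(2)] _ assms], simp,
      rule inj_onD[OF bij_betw_imp_inj_on[OF R_projections(3)] _ assms], simp,
      rule inj_onD[OF bij_betw_imp_inj_on[OF R_projections(4)] _ assms], simp)

lemma tile_ex_bottom_right: "\<lbrakk>a \<in> A; b \<in> B\<rbrakk> \<Longrightarrow> \<exists>b' a'. (a, b, b', a') \<in> R"
  and tile_ex_bottom_left: "\<lbrakk>a \<in> A; b' \<in> B\<rbrakk> \<Longrightarrow> \<exists>b a'. (a, b, b', a') \<in> R"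
  and tile_ex_left_top: "\<lbrakk>b' \<in> B; a' \<in> A\<rbrakk> \<Longrightarrow> \<exists>a b. (a, b, b', a') \<in> R"
proof -
  have "(a, b) \<in> (\<lambda>(a, b, b', a'). (a, b)) ` R" if "a \<in> A" "b \<in> B" for a b
    unfolding bij_betw_imp_surj_on[OF R_projections(1)] using that by simp
  then show "\<lbrakk>a \<in> A; b \<in> B\<rbrakk> \<Longrightarrow> \<exists>b' a'. (a, b, b', a') \<in> R" by fastforce
  have "(a, b') \<in> (\<lambda>(a, b, b', a'). (a, b')) ` R" if "a \<in> A" "b' \<in> B" for a b'
    unfolding bij_betw_imp_surj_on[OF R_projections(2)] using that by simp
  then show "\<lbrakk>a \<in> A; b' \<in> B\<rbrakk> \<Longrightarrow> \<exists>b a'. (a, b, b', a') \<in> R" by fastforce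
  have "(b', a') \<in> (\<lambda>(a, b, b', a'). (b', a')) ` R" if "b' \<in> B" "a' \<in> A" for b' a'
    unfolding bij_betw_imp_surj_on[OF R_projections(4)] using that by simp
  then show "\<lbrakk>b' \<in> B; a' \<in> A\<rbrakk> \<Longrightarrow> \<exists>a b. (a, b, b', a') \<in> R" by fastforce
qed

text \<open>
  A tile \<open>(a, b, b', a')\<close> is the relation \<open>a b = b' a'\<close>. Reading it from right to left moves \<open>b'\<close> past \<open>a'\<close>, and
  reading it from left to right moves \<open>a\<close> past \<open>b\<close>; these are the local rules of the actions on the two trees.
\<close>

definition push1 :: "'b \<Rightarrow> 'a \<Rightarrow> 'a \<times> 'b" where
  "push1 b' a' = (THE ab. (fst ab, snd ab, b', a') \<in> R)"

definition push2 :: "'a \<Rightarrow> 'b \<Rightarrow> 'b \<times> 'a" where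
  "push2 a b = (THE ba. (a, b, fst ba, snd ba) \<in> R)"

definition corner_tile :: "'a \<Rightarrow> 'b \<Rightarrow> ('a, 'b) tile" where
  "corner_tile a b' = (THE r. r \<in> R \<and> fst r = a \<and> fst (snd (snd r)) = b')"

lemma push1_eq: "(a, b, b', a') \<in> R \<Longrightarrow> push1 b' a' = (a, b)"
  unfolding push1_def by (rule the_equality) (auto dest: tile_unique(4))

lemma push2_eq: "(a, b, b', a') \<in> R \<Longrightarrow> push2 a b = (b', a')"
  unfolding push2_def by (rule the_equality) (auto dest: tile_unique(1))

lemma corner_tile_eq: "(a, b, b', a') \<in> R \<Longrightarrow> corner_tile a b' = (a, b, b', a')"
  unfolding corner_tile_def by (rule the_equality) (auto dest: tile_unique(2))

lemma push1_iff: "\<lbrakk>b' \<in> B; a' \<in> A\<rbrakk> \<Longrightarrow> push1 b' a' = (a, b) \<longleftrightarrow> (a, b, b', a') \<in> R"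
  using tile_ex_left_top[of b' a'] push1_eq by auto

lemma push2_iff: "\<lbrakk>a \<in> A; b \<in> B\<rbrakk> \<Longrightarrow> push2 a b = (b', a') \<longleftrightarrow> (a, b, b', a') \<in> R"
  using tile_ex_bottom_right[of a b] push2_eq by auto

sublocale T1: tree_action A "invA D" B "invB D" push1
proof
  fix q p p' q' assume q: "q \<in> B" and p: "p \<in> A"
  show "push1 q p \<in> A \<times> B" using tile_ex_left_top[OF q p] push1_eq R_mem by fastforce
  assume "push1 q p = (p', q')"
  then have "(p', q', q, p) \<in> R" using push1_iff[OF q p] by simp
  from R_symmetric[OF this] show "push1 (invB D q) p' = (p, invB D q')"
    "push1 q' (invA D p) = (invA D p', q)" by (auto intro: push1_eq)
qed (use invA invB in auto)

sublocale T2: tree_action B "invB D" A "invA D" push2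
proof
  fix q p p' q' assume q: "q \<in> A" and p: "p \<in> B"
  show "push2 q p \<in> B \<times> A" using tile_ex_bottom_right[OF q p] push2_eq R_mem by fastforce
  assume "push2 q p = (p', q')"
  then have "(q, p, p', q') \<in> R" using push2_iff[OF q p] by simp
  from R_symmetric[OF this] show "push2 (invA D q) p' = (p, invA D q')"
    "push2 q' (invB D p) = (invB D p', q)" by (auto intro: push2_eq)
qed (use invA invB in auto)

abbreviation \<Gamma> where "\<Gamma> \<equiv> bm_group D"
abbreviation gmult (infixl "\<cdot>" 70) where "g \<cdot> h \<equiv> g \<otimes>\<^bsub>\<Gamma>\<^esub> h"
abbreviation ginv where "ginv g \<equiv> inv\<^bsub>\<Gamma>\<^esub> g"
abbreviation unit where "unit \<equiv> \<one>\<^bsub>\<Gamma>\<^esub>"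
abbreviation L where "L \<equiv> letters D"
abbreviation linv where "linv \<equiv> letter_inv D"

lemma L_simps [simp]: "Inl a \<in> L \<longleftrightarrow> a \<in> A" "Inr b \<in> L \<longleftrightarrow> b \<in> B"
  by (auto simp: letters_def)

lemma linv_simps [simp]: "linv (Inl a) = Inl (invA D a)" "linv (Inr b) = Inr (invB D b)"
  by (simp_all add: letter_inv_def)

lemma L_cases: "c \<in> L \<Longrightarrow> (\<And>a. c = Inl a \<Longrightarrow> a \<in> A \<Longrightarrow> thesis) \<Longrightarrow>
    (\<And>b. c = Inr b \<Longrightarrow> b \<in> B \<Longrightarrow> thesis) \<Longrightarrow> thesis"
  by (auto simp: letters_def)

lemma linv_closed: "c \<in> L \<Longrightarrow> linv c \<in> L" and linv_linv: "c \<in> L \<Longrightarrow> linv (linv c) = c"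
  by (auto elim!: L_cases simp: invA invB)

lemma cong_lists: "bm_cong D u v \<Longrightarrow> u \<in> lists L \<and> v \<in> lists L"
  by (induction rule: bm_cong.induct) (auto simp: linv_closed dest: R_mem)

lemma cong_equiv: "equiv (lists L) {(u, v). bm_cong D u v}"
  by (rule equivI) (auto simp: refl_on_def sym_def trans_def dest: cong_lists
      intro: bm_cong.refl bm_cong.sym bm_cong.trans)

lemma cong_append_left: "bm_cong D u v \<Longrightarrow> w \<in> lists L \<Longrightarrow> bm_cong D (w @ u) (w @ v)"
proof (induction rule: bm_cong.induct)
  case (refl u)
  then show ?case by (intro bm_cong.refl) auto
next
  case (cancel x u v)
  then show ?case using bm_cong.cancel[of x D "w @ u" v] by simp
next
  case (tile a b b' a' u v)
  then show ?case using bm_cong.tile[of a b b' a' D "w @ u" v] by simp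
qed (auto intro: bm_cong.sym bm_cong.trans)

lemma cong_append_right: "bm_cong D u v \<Longrightarrow> w \<in> lists L \<Longrightarrow> bm_cong D (u @ w) (v @ w)"
proof (induction rule: bm_cong.induct)
  case (refl u)
  then show ?case by (intro bm_cong.refl) auto
next
  case (cancel x u v)
  then show ?case using bm_cong.cancel[of x D u "v @ w"] by simp
next
  case (tile a b b' a' u v)
  then show ?case using bm_cong.tile[of a b b' a' D u "v @ w"] by simp
qed (auto intro: bm_cong.sym bm_cong.trans)

lemma class_eq_iff: "\<lbrakk>u \<in> lists L; v \<in> lists L\<rbrakk> \<Longrightarrow> bm_class D u = bm_class D v \<longleftrightarrow> bm_cong D u v"
  unfolding bm_class_def using eq_equiv_class_iff[OF cong_equiv] by auto

lemma mem_class: "v \<in> bm_class D u \<longleftrightarrow> bm_cong D u v"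
  by (simp add: bm_class_def)

lemma \<Gamma>_carrier: "carrier \<Gamma> = bm_class D ` lists L"
  by (auto simp: bm_group_def quotient_def bm_class_def)

lemma class_closed [simp]: "u \<in> lists L \<Longrightarrow> bm_class D u \<in> carrier \<Gamma>"
  by (auto simp: \<Gamma>_carrier)

lemma class_mult:
  assumes u: "u \<in> lists L" and v: "v \<in> lists L"
  shows "bm_class D u \<cdot> bm_class D v = bm_class D (u @ v)"
proof -
  have eq: "bm_class D (u' @ v') = bm_class D (u @ v)"
    if "u' \<in> bm_class D u" "v' \<in> bm_class D v" for u' v'
  proof -
    have c: "bm_cong D u u'" "bm_cong D v v'" using that by (simp_all add: mem_class)
    then have l: "u' \<in> lists L" "v' \<in> lists L" using cong_lists by auto
    have "bm_cong D (u @ v) (u' @ v')"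
      using cong_append_right[OF c(1) v] cong_append_left[OF c(2) l(1)] by (rule bm_cong.trans)
    then show ?thesis using u v l class_eq_iff[of "u @ v" "u' @ v'"] by simp
  qed
  have "(\<Union>u'\<in>bm_class D u. \<Union>v'\<in>bm_class D v. bm_class D (u' @ v'))
      = (\<Union>u'\<in>bm_class D u. \<Union>v'\<in>bm_class D v. bm_class D (u @ v))"
    using eq by simp
  moreover have "u \<in> bm_class D u" "v \<in> bm_class D v" using u v by (simp_all add: mem_class bm_cong.refl)
  ultimately show ?thesis by (auto simp: bm_group_def)
qed

lemma \<Gamma>_one: "unit = bm_class D []"
  by (simp add: bm_group_def)

lemma cong_inverse: "u \<in> lists L \<Longrightarrow> bm_cong D (rev (map linv u) @ u) []"
proof (induction u)
  case (Cons x u)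
  have x: "x \<in> L" "u \<in> lists L" using Cons by auto
  have u': "rev (map linv u) \<in> lists L" using x linv_closed by (auto simp: in_lists_conv_set)
  have "bm_cong D (rev (map linv u) @ [linv x, linv (linv x)] @ u) (rev (map linv u) @ u)"
    by (rule bm_cong.cancel) (use x u' linv_closed in auto)
  then have "bm_cong D (rev (map linv (x # u)) @ x # u) (rev (map linv u) @ u)"
    using x by (simp add: linv_linv)
  then show ?case using Cons bm_cong.trans by auto
qed (simp add: bm_cong.refl)

lemma \<Gamma>_group: "group \<Gamma>"
proof (rule groupI)
  show "unit \<in> carrier \<Gamma>" by (simp add: \<Gamma>_one)
  fix x y z assume x: "x \<in> carrier \<Gamma>"
  then obtain u where u: "u \<in> lists L" "x = bm_class D u" by (auto simp: \<Gamma>_carrier)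
  have u': "rev (map linv u) \<in> lists L" using u linv_closed by (auto simp: in_lists_conv_set)
  show "unit \<cdot> x = x" using u by (simp add: \<Gamma>_one class_mult)
  show "\<exists>y\<in>carrier \<Gamma>. y \<cdot> x = unit"
    using u u' cong_inverse[OF u(1)]
    by (intro bexI[of _ "bm_class D (rev (map linv u))"]) (auto simp: class_mult \<Gamma>_one class_eq_iff)
  assume y: "y \<in> carrier \<Gamma>"
  then obtain v where v: "v \<in> lists L" "y = bm_class D v" by (auto simp: \<Gamma>_carrier)
  show "x \<cdot> y \<in> carrier \<Gamma>" using u v by (simp add: class_mult)
  assume z: "z \<in> carrier \<Gamma>"
  then obtain w where "w \<in> lists L" "z = bm_class D w" by (auto simp: \<Gamma>_carrier)
  then show "x \<cdot> y \<cdot> z = x \<cdot> (y \<cdot> z)" using u v by (simp add: class_mult)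
qed

sublocale \<Gamma>: group \<Gamma> by (rule \<Gamma>_group)

abbreviation gn where "gn \<equiv> bm_gen D"

lemma gn_closed [simp]: "c \<in> L \<Longrightarrow> gn c \<in> carrier \<Gamma>"
  by (simp add: bm_gen_def)

lemma gn_inv: "c \<in> L \<Longrightarrow> ginv (gn c) = gn (linv c)"
proof (rule \<Gamma>.inv_equality)
  assume c: "c \<in> L"
  have "bm_cong D ([] @ [linv c, linv (linv c)] @ []) ([] @ [])"
    using linv_closed[OF c] by (intro bm_cong.cancel) auto
  then show "gn (linv c) \<cdot> gn c = unit"
    using c linv_closed[OF c] by (simp add: bm_gen_def class_mult \<Gamma>_one class_eq_iff linv_linv)
qed (auto simp: linv_closed)

lemma gn_tile:
  assumes "(a, b, b', a') \<in> R"
  shows "gn (Inl a) \<cdot> gn (Inr b) = gn (Inr b') \<cdot> gn (Inl a')"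
proof -
  have "bm_cong D ([] @ [Inl a, Inr b] @ []) ([] @ [Inr b', Inl a'] @ [])"
    using assms by (intro bm_cong.tile) auto
  then show ?thesis using R_mem[OF assms] by (simp add: bm_gen_def class_mult class_eq_iff)
qed

lemma \<Gamma>_induct [consumes 1, case_names one gen]:
  assumes "g \<in> carrier \<Gamma>" and "Q unit"
    and "\<And>c g. c \<in> L \<Longrightarrow> g \<in> carrier \<Gamma> \<Longrightarrow> Q g \<Longrightarrow> Q (gn c \<cdot> g)"
  shows "Q g"
proof -
  obtain u where u: "u \<in> lists L" "g = bm_class D u" using assms(1) by (auto simp: \<Gamma>_carrier)
  have "Q (bm_class D u)" using u(1)
  proof (induction u)
    case (Cons c u)
    then have "Q (gn c \<cdot> bm_class D u)" by (intro assms(3)) auto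
    then show ?case using Cons by (simp add: bm_gen_def class_mult)
  qed (use assms(2) in \<open>simp add: \<Gamma>_one\<close>)
  then show ?thesis using u by simp
qed

fun letter_act :: "'a + 'b \<Rightarrow> ('a, 'b) seq_pair \<Rightarrow> ('a, 'b) seq_pair" where
  "letter_act (Inl a) (f, h) = (T1.cons_seq a f, T2.push_seq a h)"
| "letter_act (Inr b) (f, h) = (T1.push_seq b f, T2.cons_seq b h)"

definition red_pairs :: "('a, 'b) seq_pair set" where
  "red_pairs = {(f, h). T1.red f \<and> T2.red h}"

definition ends :: "('a, 'b) seq_pair set" where
  "ends = {z \<in> red_pairs. \<forall>n. fst z n \<noteq> None \<and> snd z n \<noteq> None}"

lemma letter_act_red: "\<lbrakk>c \<in> L; z \<in> red_pairs\<rbrakk> \<Longrightarrow> letter_act c z \<in> red_pairs"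
  by (auto elim!: L_cases simp: red_pairs_def T1.red_cons_seq T1.red_push_seq T2.red_cons_seq T2.red_push_seq)

lemma letter_act_ends: "\<lbrakk>c \<in> L; z \<in> ends\<rbrakk> \<Longrightarrow> letter_act c z \<in> ends"
proof -
  assume c: "c \<in> L" and z: "z \<in> ends"
  obtain f h where fh: "z = (f, h)" by fastforce
  have inf: "\<And>n. f n \<noteq> None" "\<And>n. h n \<noteq> None" and red: "z \<in> red_pairs"
    using z fh by (auto simp: ends_def)
  have "T1.cons_seq a f n \<noteq> None" "T1.push_seq b f n \<noteq> None"
    "T2.cons_seq b h n \<noteq> None" "T2.push_seq a h n \<noteq> None" for a b n
    using T1.infinite_cons_seq T1.infinite_push_seq T2.infinite_cons_seq T2.infinite_push_seq inf
    by blast+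
  then show ?thesis using letter_act_red[OF c red] c
    by (auto elim!: L_cases simp: ends_def fh)
qed

lemma letter_act_inverse: "\<lbrakk>c \<in> L; z \<in> red_pairs\<rbrakk> \<Longrightarrow> letter_act (linv c) (letter_act c z) = z"
  by (auto elim!: L_cases simp: red_pairs_def T1.cons_seq_inverse T1.push_seq_inverse
      T2.cons_seq_inverse T2.push_seq_inverse)

lemma letter_act_tile:
  assumes r: "(a, b, b', a') \<in> R" and z: "z \<in> red_pairs"
  shows "letter_act (Inl a) (letter_act (Inr b) z) = letter_act (Inr b') (letter_act (Inl a') z)"
proof -
  obtain f h where fh: "z = (f, h)" "T1.red f" "T2.red h" using z by (auto simp: red_pairs_def)
  have m: "a \<in> A" "b \<in> B" "b' \<in> B" "a' \<in> A" using R_mem[OF r] by auto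
  show ?thesis
    using T1.push_cons_seq[OF m(3,4) push1_eq[OF r] fh(2)] T2.push_cons_seq[OF m(1,2) push2_eq[OF r] fh(3)]
    by (simp add: fh)
qed

abbreviation word_act :: "('a + 'b) list \<Rightarrow> ('a, 'b) seq_pair \<Rightarrow> ('a, 'b) seq_pair" where
  "word_act u z \<equiv> foldr letter_act u z"

lemma word_act_red: "\<lbrakk>u \<in> lists L; z \<in> red_pairs\<rbrakk> \<Longrightarrow> word_act u z \<in> red_pairs"
  by (induction u) (auto intro: letter_act_red)

lemma word_act_cong: "bm_cong D u v \<Longrightarrow> z \<in> red_pairs \<Longrightarrow> word_act u z = word_act v z"
proof (induction arbitrary: z rule: bm_cong.induct)
  case (cancel x u v)
  have "letter_act (linv (linv x)) (letter_act (linv x) (word_act v z)) = word_act v z"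
    using cancel by (intro letter_act_inverse linv_closed word_act_red) auto
  then show ?case using cancel by (simp add: linv_linv)
next
  case (tile a b b' a' u v)
  then show ?case using letter_act_tile[OF tile(1) word_act_red[OF tile(3)]] by simp
qed auto

text \<open>
  The defining relations act trivially on pairs of reduced sequences, so that all words in a class act alike. This
  gives an action of the group without a normal form for its elements.
\<close>

definition gact :: "('a, 'b) bm_elt \<Rightarrow> ('a, 'b) seq_pair \<Rightarrow> ('a, 'b) seq_pair" where
  "gact g z = word_act (SOME u. u \<in> g) z"

lemma gact_class:
  assumes u: "u \<in> lists L" and z: "z \<in> red_pairs"
  shows "gact (bm_class D u) z = word_act u z"
proof -
  have "u \<in> bm_class D u" using u by (simp add: mem_class bm_cong.refl)
  then have "(SOME v. v \<in> bm_class D u) \<in> bm_class D u" by (rule someI)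
  then show ?thesis using word_act_cong[OF _ z] by (simp add: gact_def mem_class)
qed

lemma gact_one: "z \<in> red_pairs \<Longrightarrow> gact unit z = z"
  by (simp add: \<Gamma>_one gact_class)

lemma gact_gn: "\<lbrakk>c \<in> L; z \<in> red_pairs\<rbrakk> \<Longrightarrow> gact (gn c) z = letter_act c z"
  by (simp add: bm_gen_def gact_class)

lemma gact_red: "\<lbrakk>g \<in> carrier \<Gamma>; z \<in> red_pairs\<rbrakk> \<Longrightarrow> gact g z \<in> red_pairs"
  unfolding \<Gamma>_carrier by (elim imageE) (simp only: gact_class word_act_red)

lemma gact_mult:
  assumes "g \<in> carrier \<Gamma>" "h \<in> carrier \<Gamma>" "z \<in> red_pairs"
  shows "gact (g \<cdot> h) z = gact g (gact h z)"
proof -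
  obtain u v where "u \<in> lists L" "g = bm_class D u" "v \<in> lists L" "h = bm_class D v"
    using assms by (auto simp: \<Gamma>_carrier)
  then show ?thesis using assms(3) by (simp add: class_mult gact_class word_act_red)
qed

lemma ends_red: "z \<in> ends \<Longrightarrow> z \<in> red_pairs"
  by (simp add: ends_def)

lemma gact_ends: "g \<in> carrier \<Gamma> \<Longrightarrow> z \<in> ends \<Longrightarrow> gact g z \<in> ends"
  by (induction g rule: \<Gamma>_induct)
     (auto simp: gact_one gact_mult gact_gn gact_red ends_red letter_act_ends)

lemma gact_inv_cancel:
  assumes "g \<in> carrier \<Gamma>" "z \<in> red_pairs"
  shows "gact (ginv g) (gact g z) = z" "gact g (gact (ginv g) z) = z"
  using assms gact_mult[of "ginv g" g z] gact_mult[of g "ginv g" z] by (simp_all add: gact_one)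

end

section \<open>The flow of tiles towards an end\<close>

context BM_data begin

definition a0 :: "('a, 'b) seq_pair \<Rightarrow> 'a" where "a0 z = the (fst z 0)"
definition b0 :: "('a, 'b) seq_pair \<Rightarrow> 'b" where "b0 z = the (snd z 0)"

text \<open>The tile at the identity vertex that opens towards the end \<open>z\<close>, and the two moves across it.\<close>

definition tl :: "('a, 'b) seq_pair \<Rightarrow> ('a, 'b) tile" where
  "tl z = corner_tile (a0 z) (b0 z)"

definition right :: "('a, 'b) seq_pair \<Rightarrow> ('a, 'b) seq_pair" where
  "right z = letter_act (Inl (invA D (a0 z))) z"

definition up :: "('a, 'b) seq_pair \<Rightarrow> ('a, 'b) seq_pair" where
  "up z = letter_act (Inr (invB D (b0 z))) z"

lemma ends_cases:
  assumes "z \<in> ends"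
  obtains f h where "z = (f, h)" "T1.red f" "T2.red h" "\<And>n. f n \<noteq> None" "\<And>n. h n \<noteq> None"
  using assms by (cases z) (auto simp: ends_def red_pairs_def)

lemma ends_head:
  assumes "z \<in> ends"
  shows "fst z 0 = Some (a0 z)" "snd z 0 = Some (b0 z)" "a0 z \<in> A" "b0 z \<in> B"
  using assms by (auto simp: a0_def b0_def elim!: ends_cases intro: T1.redD(2)[of _ 0] T2.redD(2)[of _ 0])

lemma tl_tile:
  assumes "z \<in> ends"
  obtains b a' where "tl z = (a0 z, b, b0 z, a')" "(a0 z, b, b0 z, a') \<in> R"
  using tile_ex_bottom_left[of "a0 z" "b0 z"] ends_head[OF assms] corner_tile_eq
  by (auto simp: tl_def)

lemma tl_R: "z \<in> ends \<Longrightarrow> tl z \<in> R"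
  by (metis tl_tile)

lemma tl_eq_iff:
  assumes z: "z \<in> ends" and r: "(a, b, b', a') \<in> R"
  shows "tl z = (a, b, b', a') \<longleftrightarrow> a0 z = a \<and> b0 z = b'"
  using tl_tile[OF z] corner_tile_eq[OF r] by (metis Pair_inject tl_def)

lemma right_ends: "z \<in> ends \<Longrightarrow> right z \<in> ends" and up_ends: "z \<in> ends \<Longrightarrow> up z \<in> ends"
  by (auto simp: right_def up_def ends_head invA invB intro!: letter_act_ends)

lemma right_eq: "z \<in> ends \<Longrightarrow> right z = (T1.tail (fst z), T2.push_seq (invA D (a0 z)) (snd z))"
  and up_eq: "z \<in> ends \<Longrightarrow> up z = (T1.push_seq (invB D (b0 z)) (fst z), T2.tail (snd z))"
  using ends_head[of z] by (cases z; simp add: right_def up_def T1.cons_seq_def T2.cons_seq_def invA invB)+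

lemma act_right: "z \<in> ends \<Longrightarrow> letter_act (Inl (a0 z)) (right z) = z"
  and act_up: "z \<in> ends \<Longrightarrow> letter_act (Inr (b0 z)) (up z) = z"
  using letter_act_inverse[of "Inl (invA D (a0 z))" z] letter_act_inverse[of "Inr (invB D (b0 z))" z]
    ends_head[of z] ends_red[of z] by (simp_all add: right_def up_def invA invB)

lemma tl_moves:
  assumes z: "z \<in> ends" and tl: "tl z = (a, b, b', a')"
  shows "a0 z = a" "b0 z = b'" "b0 (right z) = b" "a0 (up z) = a'" "(a, b, b', a') \<in> R"
proof -
  show r: "(a, b, b', a') \<in> R" using tl_R[OF z] tl by simp
  then show ab: "a0 z = a" "b0 z = b'" using tl_eq_iff[OF z r] tl by simp_all
  have "push2 (invA D a) b' = (b, invA D a')" "push1 (invB D b') a = (a', invB D b)"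
    using R_symmetric[OF r] by (auto intro: push1_eq push2_eq)
  then show "b0 (right z) = b" "a0 (up z) = a'"
    using ends_head[OF z] ab
    by (simp_all add: right_eq[OF z] up_eq[OF z] b0_def[of "(_, _)"] a0_def[of "(_, _)"]
        T1.push_seq_def T2.push_seq_def)
qed

lemma right_up:
  assumes z: "z \<in> ends"
  shows "right (up z) = up (right z)"
proof -
  obtain a b b' a' where tl: "tl z = (a, b, b', a')" by (metis prod_cases4)
  note m = tl_moves[OF z tl]
  have "(invA D a', invB D b', invB D b, invA D a) \<in> R" using R_symmetric[OF m(5)] by simp
  from letter_act_tile[OF this ends_red[OF z]] show ?thesis
    by (simp add: right_def[of "up z"] up_def[of "right z"] m)
       (simp add: right_def up_def m)
qed

definition pos :: "('a, 'b) seq_pair \<Rightarrow> nat \<Rightarrow> nat \<Rightarrow> ('a, 'b) seq_pair" where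
  "pos z i j = (right ^^ i) ((up ^^ j) z)"

lemma up_pow_ends: "z \<in> ends \<Longrightarrow> (up ^^ j) z \<in> ends"
  by (induction j) (auto simp: up_ends)

lemma pos_ends: "z \<in> ends \<Longrightarrow> pos z i j \<in> ends"
  unfolding pos_def by (induction i) (auto simp: up_pow_ends right_ends)

lemma pos_0 [simp]: "pos z 0 0 = z"
  by (simp add: pos_def)

lemma right_pos: "right (pos z i j) = pos z (Suc i) j"
  by (simp add: pos_def)

lemma up_pos: "z \<in> ends \<Longrightarrow> up (pos z i j) = pos z i (Suc j)"
proof (induction i)
  case (Suc i)
  then show ?case using right_up[OF pos_ends[OF Suc.prems, of i j]] by (simp add: right_pos[symmetric])
qed (simp add: pos_def)

lemma pos_right: "z \<in> ends \<Longrightarrow> pos (right z) i j = pos z (Suc i) j"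
proof (induction i)
  case 0
  show ?case
  proof (induction j)
    case (Suc j)
    have "pos (right z) 0 (Suc j) = up (pos (right z) 0 j)" using up_pos right_ends 0 by simp
    also have "\<dots> = up (pos z (Suc 0) j)" using Suc by simp
    finally show ?case using up_pos[OF 0] by simp
  qed (simp add: pos_def)
qed (simp add: right_pos[symmetric])

lemma pos_up: "z \<in> ends \<Longrightarrow> pos (up z) i j = pos z i (Suc j)"
proof (induction i)
  case 0
  show ?case unfolding pos_def funpow.simps(1) id_apply by (simp add: funpow_swap1)
qed (simp add: right_pos[symmetric])

fun vert :: "('a, 'b) seq_pair \<Rightarrow> nat \<Rightarrow> nat \<Rightarrow> ('a, 'b) bm_elt" where
  "vert z 0 0 = unit"
| "vert z 0 (Suc j) = gn (Inr (b0 z)) \<cdot> vert (up z) 0 j"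
| "vert z (Suc i) j = gn (Inl (a0 z)) \<cdot> vert (right z) i j"

lemma vert_closed [simp]: "z \<in> ends \<Longrightarrow> vert z i j \<in> carrier \<Gamma>"
  by (induction z i j rule: vert.induct) (auto simp: up_ends right_ends ends_head)

lemma vert_up: "z \<in> ends \<Longrightarrow> vert z i (Suc j) = gn (Inr (b0 z)) \<cdot> vert (up z) i j"
proof (induction i arbitrary: z)
  case (Suc i)
  note z = Suc.prems
  obtain a b b' a' where tl: "tl z = (a, b, b', a')" by (metis prod_cases4)
  note m = tl_moves[OF z tl]
  have mem: "a \<in> A" "b \<in> B" "b' \<in> B" "a' \<in> A" using R_mem[OF m(5)] by auto
  note e = right_ends[OF z] up_ends[OF z]
  have "vert z (Suc i) (Suc j) = gn (Inl a) \<cdot> (gn (Inr b) \<cdot> vert (up (right z)) i j)"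
    using Suc.IH[OF e(1)] by (simp add: m)
  also have "\<dots> = (gn (Inl a) \<cdot> gn (Inr b)) \<cdot> vert (up (right z)) i j"
    using mem e by (simp add: \<Gamma>.m_assoc up_ends)
  also have "\<dots> = (gn (Inr b') \<cdot> gn (Inl a')) \<cdot> vert (right (up z)) i j"
    by (simp add: gn_tile[OF m(5)] right_up[OF z])
  also have "\<dots> = gn (Inr (b0 z)) \<cdot> vert (up z) (Suc i) j"
    using mem e by (simp add: \<Gamma>.m_assoc right_ends m)
  finally show ?case .
qed simp

lemma vert_pos: "z \<in> ends \<Longrightarrow> gact (vert z i j) (pos z i j) = z"
proof (induction z i j rule: vert.induct)
  case (1 z)
  then show ?case by (simp add: gact_one ends_red)
next
  case (2 z j)
  then show ?case
    using pos_up[of z 0 j] act_up[of z]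
    by (simp add: up_ends ends_head gact_mult pos_ends ends_red gact_gn)
next
  case (3 z i j)
  then show ?case
    using pos_right[of z i j] act_right[of z]
    by (simp add: right_ends ends_head gact_mult pos_ends ends_red gact_gn)
qed

lemma pos_vert: "z \<in> ends \<Longrightarrow> gact (ginv (vert z i j)) z = pos z i j"
  using gact_inv_cancel(1)[of "vert z i j" "pos z i j"] vert_pos[of z i j]
  by (simp add: pos_ends ends_red)

lemma vert_right_step:
  "z \<in> ends \<Longrightarrow> vert z (Suc i) j = vert z i j \<cdot> gn (Inl (a0 (pos z i j)))"
proof (induction i arbitrary: z)
  case 0
  then show ?case
  proof (induction j arbitrary: z)
    case (Suc j)
    have "vert z (Suc 0) (Suc j) = gn (Inr (b0 z)) \<cdot> vert (up z) (Suc 0) j"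
      using Suc.prems by (rule vert_up)
    then show ?case
      using Suc ends_head[OF Suc.prems] ends_head[OF pos_ends[OF Suc.prems, of 0 "Suc j"]]
      by (simp add: up_ends \<Gamma>.m_assoc pos_up del: vert.simps(3))
  qed (simp add: ends_head)
next
  case (Suc i)
  note z = Suc.prems
  have "vert z (Suc (Suc i)) j = gn (Inl (a0 z)) \<cdot> vert (right z) (Suc i) j" by (rule vert.simps(3))
  also have "vert (right z) (Suc i) j = vert (right z) i j \<cdot> gn (Inl (a0 (pos z (Suc i) j)))"
    by (simp only: Suc.IH[OF right_ends[OF z]] pos_right[OF z])
  finally show ?case
    using ends_head[OF z] ends_head[OF pos_ends[OF z, of "Suc i" j]] right_ends[OF z]
    by (simp add: \<Gamma>.m_assoc)
qed

lemma vert_up_step: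
  "z \<in> ends \<Longrightarrow> vert z i (Suc j) = vert z i j \<cdot> gn (Inr (b0 (pos z i j)))"
proof (induction i arbitrary: z)
  case 0
  then show ?case
  proof (induction j arbitrary: z)
    case (Suc j)
    note z = Suc.prems
    have "vert z 0 (Suc (Suc j)) = gn (Inr (b0 z)) \<cdot> vert (up z) 0 (Suc j)" by (rule vert.simps(2))
    also have "vert (up z) 0 (Suc j) = vert (up z) 0 j \<cdot> gn (Inr (b0 (pos z 0 (Suc j))))"
      by (simp only: Suc.IH[OF up_ends[OF z]] pos_up[OF z])
    finally show ?case
      using ends_head[OF z] ends_head[OF pos_ends[OF z, of 0 "Suc j"]] up_ends[OF z]
      by (simp add: \<Gamma>.m_assoc)
  qed (simp add: ends_head)
next
  case (Suc i)
  note z = Suc.prems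
  have "vert z (Suc i) (Suc j) = gn (Inl (a0 z)) \<cdot> vert (right z) i (Suc j)" by (rule vert.simps(3))
  also have "vert (right z) i (Suc j) = vert (right z) i j \<cdot> gn (Inr (b0 (pos z (Suc i) j)))"
    by (simp only: Suc.IH[OF right_ends[OF z]] pos_right[OF z])
  finally show ?case
    using ends_head[OF z] ends_head[OF pos_ends[OF z, of "Suc i" j]] right_ends[OF z]
    by (simp add: \<Gamma>.m_assoc)
qed

lemma pos_pos: "z \<in> ends \<Longrightarrow> pos (pos z i j) k l = pos z (i + k) (j + l)"
proof -
  assume z: "z \<in> ends"
  have "pos (pos z i j) 0 l = pos z i (j + l)"
  proof (induction l)
    case (Suc l)
    then show ?case using up_pos[OF pos_ends[OF z], of i j 0 l] up_pos[OF z, of i "j + l"] by simp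
  qed simp
  then show ?thesis
  proof (induction k)
    case (Suc k)
    then show ?case by (simp add: right_pos[symmetric])
  qed simp
qed

lemma vert_add:
  assumes z: "z \<in> ends"
  shows "vert z (i + k) (j + l) = vert z i j \<cdot> vert (pos z i j) k l"
proof (induction k)
  case 0
  show ?case
  proof (induction l)
    case (Suc l)
    have "b0 (pos z i (j + l)) \<in> B" using ends_head[OF pos_ends[OF z]] by blast
    then show ?case
      using vert_up_step[OF z, of i "j + l"] vert_up_step[OF pos_ends[OF z, of i j], of 0 l] Suc z
      by (simp add: pos_ends pos_pos \<Gamma>.m_assoc del: vert.simps)
  qed (simp add: z)
next
  case (Suc k)
  have "a0 (pos z (i + k) (j + l)) \<in> A" using ends_head[OF pos_ends[OF z]] by blast
  then show ?case
    using vert_right_step[OF z, of "i + k" "j + l"] vert_right_step[OF pos_ends[OF z, of i j], of k l] Suc z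
    by (simp add: pos_ends pos_pos \<Gamma>.m_assoc del: vert.simps)
qed

section \<open>Coordinates of vertices in the two trees\<close>

definition origin :: "('a, 'b) seq_pair" where
  "origin = (\<lambda>_. None, \<lambda>_. None)"

lemma origin_red: "origin \<in> red_pairs"
  by (simp add: origin_def red_pairs_def T1.red_empty T2.red_empty)

text \<open>
  The base vertex of both trees is the empty sequence, and the orbit map at it gives coordinates of
  vertices. For a vertex of a sector they are truncations of the end, from which position and direction are read off.
\<close>

lemma vert_coord:
  "z \<in> ends \<Longrightarrow> gact (vert z i j) origin = (T1.trunc i (fst z), T2.trunc j (snd z))"
proof (induction z i j rule: vert.induct)
  case (1 z)
  show ?case by (simp add: gact_one[OF origin_red]) (simp add: origin_def T1.trunc_def T2.trunc_def)
next
  case (2 z j)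
  note z = \<open>z \<in> ends\<close>
  have IH: "gact (vert (up z) 0 j) origin = (T1.trunc 0 (fst (up z)), T2.trunc j (snd (up z)))"
    using 2 up_ends by blast
  obtain f h where fh: "up z = (f, h)" by fastforce
  have act: "(T1.push_seq (b0 z) f, T2.cons_seq (b0 z) h) = z" using act_up[OF z] fh by simp
  have "h 0 = snd z (Suc 0)" using up_eq[OF z] fh by simp
  moreover have "snd z (Suc 0) \<noteq> Some (invB D (b0 z))"
    using z ends_head(2)[OF z] T2.redD(3) by (metis ends_cases snd_conv)
  ultimately have h0: "h 0 \<noteq> Some (invB D (b0 z))" by simp
  have "gact (vert z 0 (Suc j)) origin = letter_act (Inr (b0 z)) (gact (vert (up z) 0 j) origin)"
    using ends_head[OF z] z
    by (simp add: gact_mult up_ends origin_red gact_gn gact_red del: letter_act.simps)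
  also have "\<dots> = letter_act (Inr (b0 z)) (T1.trunc 0 f, T2.trunc j h)" using IH fh by simp
  also have "\<dots> = (T1.trunc 0 (T1.push_seq (b0 z) f), T2.trunc (Suc j) (T2.cons_seq (b0 z) h))"
    by (simp add: T1.push_seq_trunc T2.cons_seq_trunc[of h "b0 z", OF h0])
  also have "\<dots> = (T1.trunc 0 (fst z), T2.trunc (Suc j) (snd z))" using act by (metis fst_conv snd_conv)
  finally show ?case .
next
  case (3 z i j)
  note z = \<open>z \<in> ends\<close>
  have IH: "gact (vert (right z) i j) origin = (T1.trunc i (fst (right z)), T2.trunc j (snd (right z)))"
    using 3 right_ends by blast
  obtain f h where fh: "right z = (f, h)" by fastforce
  have act: "(T1.cons_seq (a0 z) f, T2.push_seq (a0 z) h) = z" using act_right[OF z] fh by simp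
  have "f 0 = fst z (Suc 0)" using right_eq[OF z] fh by simp
  moreover have "fst z (Suc 0) \<noteq> Some (invA D (a0 z))"
    using z ends_head(1)[OF z] T1.redD(3) by (metis ends_cases fst_conv)
  ultimately have f0: "f 0 \<noteq> Some (invA D (a0 z))" by simp
  have "gact (vert z (Suc i) j) origin = letter_act (Inl (a0 z)) (gact (vert (right z) i j) origin)"
    using ends_head[OF z] z
    by (simp add: gact_mult right_ends origin_red gact_gn gact_red del: letter_act.simps)
  also have "\<dots> = letter_act (Inl (a0 z)) (T1.trunc i f, T2.trunc j h)" using IH fh by simp
  also have "\<dots> = (T1.trunc (Suc i) (T1.cons_seq (a0 z) f), T2.trunc j (T2.push_seq (a0 z) h))"
    by (simp add: T2.push_seq_trunc T1.cons_seq_trunc[of f "a0 z", OF f0])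
  also have "\<dots> = (T1.trunc (Suc i) (fst z), T2.trunc j (snd z))" using act by (metis fst_conv snd_conv)
  finally show ?case .
qed

definition agree :: "nat \<Rightarrow> nat \<Rightarrow> ('a, 'b) seq_pair \<Rightarrow> ('a, 'b) seq_pair \<Rightarrow> bool" where
  "agree m n z z' \<longleftrightarrow> (\<forall>i<m. fst z i = fst z' i) \<and> (\<forall>j<n. snd z j = snd z' j)"

lemma vert_eqD:
  assumes "z \<in> ends" "z' \<in> ends" "vert z i j = vert z' i' j'"
  shows "i = i' \<and> j = j' \<and> agree i j z z'"
proof -
  have eq: "(T1.trunc i (fst z), T2.trunc j (snd z)) = (T1.trunc i' (fst z'), T2.trunc j' (snd z'))"
    using vert_coord[OF assms(1), of i j] vert_coord[OF assms(2), of i' j'] assms(3) by simp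
  have inf: "fst z n \<noteq> None" "snd z n \<noteq> None" "fst z' n \<noteq> None" "snd z' n \<noteq> None" for n
    using assms(1,2) by (auto simp: ends_def)
  show ?thesis
    using T1.trunc_eqD[of i "fst z" i' "fst z'"] T2.trunc_eqD[of j "snd z" j' "snd z'"] eq inf
    by (auto simp: agree_def)
qed

lemma agree_refl [simp]: "agree m n z z"
  by (simp add: agree_def)

lemma agree_sym: "agree m n z z' \<Longrightarrow> agree m n z' z"
  by (simp add: agree_def)

lemma agree_trans: "agree m n z z' \<Longrightarrow> agree m n z' z'' \<Longrightarrow> agree m n z z''"
  by (simp add: agree_def)

lemma agree_mono: "agree m n z z' \<Longrightarrow> m' \<le> m \<Longrightarrow> n' \<le> n \<Longrightarrow> agree m' n' z z'"
  by (simp add: agree_def)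

lemma agree_a0: "agree (Suc m) n z z' \<Longrightarrow> a0 z = a0 z'"
  and agree_b0: "agree m (Suc n) z z' \<Longrightarrow> b0 z = b0 z'"
  by (simp_all add: agree_def a0_def b0_def)

lemma agree_right:
  assumes "z \<in> ends" "z' \<in> ends" "agree (Suc m) n z z'"
  shows "agree m n (right z) (right z')"
  using assms(3) agree_a0[OF assms(3)] T2.push_seq_cong[of n "snd z" "snd z'"]
  by (simp add: right_eq assms agree_def)

lemma agree_up:
  assumes "z \<in> ends" "z' \<in> ends" "agree m (Suc n) z z'"
  shows "agree m n (up z) (up z')"
  using assms(3) agree_b0[OF assms(3)] T1.push_seq_cong[of m "fst z" "fst z'"]
  by (simp add: up_eq assms agree_def)

lemma agree_pos:
  assumes "z \<in> ends" "z' \<in> ends"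
  shows "agree (i + m) (j + n) z z' \<Longrightarrow> agree m n (pos z i j) (pos z' i j)"
proof (induction i arbitrary: m)
  case 0
  then show ?case
  proof (induction j arbitrary: n)
    case (Suc j)
    then have "agree m (Suc n) (pos z 0 j) (pos z' 0 j)" by simp
    from agree_up[OF pos_ends[OF assms(1)] pos_ends[OF assms(2)] this] show ?case
      by (simp add: up_pos assms)
  qed simp
next
  case (Suc i)
  then have "agree (Suc m) n (pos z i j) (pos z' i j)" by simp
  from agree_right[OF pos_ends[OF assms(1)] pos_ends[OF assms(2)] this] show ?case
    by (simp add: right_pos)
qed

lemma vert_cong:
  "\<lbrakk>z \<in> ends; z' \<in> ends; agree i j z z'\<rbrakk> \<Longrightarrow> vert z i j = vert z' i j"
proof (induction z i j arbitrary: z' rule: vert.induct)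
  case (2 z j)
  show ?case using agree_b0[OF 2(4)] 2(1)[OF up_ends[OF 2(2)] up_ends[OF 2(3)] agree_up[OF 2(2-4)]]
    by simp
next
  case (3 z i j)
  show ?case
    using agree_a0[OF 3(4)] 3(1)[OF right_ends[OF 3(2)] right_ends[OF 3(3)] agree_right[OF 3(2-4)]]
    by simp
qed simp

lemma tl_cong: "agree (Suc 0) (Suc 0) z z' \<Longrightarrow> tl z = tl z'"
  using agree_a0 agree_b0 by (fastforce simp: tl_def)

lemma tl_eqD:
  assumes "z \<in> ends" "z' \<in> ends" "tl z = tl z'"
  shows "agree (Suc 0) (Suc 0) z z'"
proof -
  have "a0 z = a0 z'" "b0 z = b0 z'"
    using tl_moves(1,2)[OF assms(1)] tl_moves(1,2)[OF assms(2)] assms(3) by (metis prod_cases4)+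
  then show ?thesis using ends_head[OF assms(1)] ends_head[OF assms(2)] by (simp add: agree_def)
qed

lemma tl_pos_cong:
  assumes "z \<in> ends" "z' \<in> ends" "agree (Suc i) (Suc j) z z'"
  shows "tl (pos z i j) = tl (pos z' i j)"
  using agree_pos[OF assms(1,2), of i "Suc 0" j "Suc 0"] assms(3) by (simp add: tl_cong)

text \<open>
  A tile in position \<open>(i, j)\<close> of a sector determines the whole rectangle behind it: if \<open>y\<close> starts with that
  tile, then transporting \<open>y\<close> to this position gives an end whose sector contains the rectangle.
\<close>

lemma agree_transport:
  "\<lbrakk>z \<in> ends; y \<in> ends; tl y = tl (pos z i j)\<rbrakk> \<Longrightarrow> agree (Suc i) (Suc j) (gact (vert z i j) y) z"
proof (induction z i j rule: vert.induct)
  case (1 z)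
  then show ?case by (simp add: gact_one ends_red tl_eqD)
next
  case (2 z j)
  note z = \<open>z \<in> ends\<close> and y = \<open>y \<in> ends\<close>
  let ?w = "gact (vert (up z) 0 j) y"
  have w: "?w \<in> ends" using z y by (simp add: gact_ends up_ends)
  have IH: "agree (Suc 0) (Suc j) ?w (up z)" using 2 by (simp add: up_ends pos_up)
  obtain f h where fh: "?w = (f, h)" by fastforce
  have eq: "gact (vert z 0 (Suc j)) y = (T1.push_seq (b0 z) f, T2.cons_seq (b0 z) h)"
    using ends_head[OF z] z y
    by (simp add: gact_mult up_ends ends_red gact_gn gact_red del: letter_act.simps) (simp add: fh)
  have h: "\<forall>i<Suc j. h i = snd z (Suc i)" using IH fh by (simp add: agree_def up_eq[OF z])
  moreover have "snd z (Suc 0) \<noteq> Some (invB D (b0 z))"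
    using z ends_head(2)[OF z] T2.redD(3) by (metis ends_cases snd_conv)
  ultimately have cons: "T2.cons_seq (b0 z) h = case_nat (Some (b0 z)) h" by (simp add: T2.cons_seq_def)
  have "T1.push_seq (b0 z) f i = fst z i" if "i < Suc 0" for i
  proof -
    have "T1.push_seq (b0 z) f i = T1.push_seq (b0 z) (fst (up z)) i"
      using IH fh that by (intro T1.push_seq_cong[of "Suc 0"]) (auto simp: agree_def)
    also have "\<dots> = fst z i" using act_up[OF z] by (metis fst_conv letter_act.simps(2) prod.collapse)
    finally show ?thesis .
  qed
  moreover have "T2.cons_seq (b0 z) h k = snd z k" if "k < Suc (Suc j)" for k
    using that h ends_head(2)[OF z] by (auto simp: cons split: nat.split)
  ultimately show ?case unfolding eq agree_def by simp
next
  case (3 z i j)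
  note z = \<open>z \<in> ends\<close> and y = \<open>y \<in> ends\<close>
  let ?w = "gact (vert (right z) i j) y"
  have w: "?w \<in> ends" using z y by (simp add: gact_ends right_ends)
  have IH: "agree (Suc i) (Suc j) ?w (right z)" using 3 by (simp add: right_ends pos_right)
  obtain f h where fh: "?w = (f, h)" by fastforce
  have eq: "gact (vert z (Suc i) j) y = (T1.cons_seq (a0 z) f, T2.push_seq (a0 z) h)"
    using ends_head[OF z] z y
    by (simp add: gact_mult right_ends ends_red gact_gn gact_red del: letter_act.simps) (simp add: fh)
  have f: "\<forall>k<Suc i. f k = fst z (Suc k)" using IH fh by (simp add: agree_def right_eq[OF z])
  moreover have "fst z (Suc 0) \<noteq> Some (invA D (a0 z))"
    using z ends_head(1)[OF z] T1.redD(3) by (metis ends_cases fst_conv)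
  ultimately have cons: "T1.cons_seq (a0 z) f = case_nat (Some (a0 z)) f" by (simp add: T1.cons_seq_def)
  have "T2.push_seq (a0 z) h k = snd z k" if "k < Suc j" for k
  proof -
    have "T2.push_seq (a0 z) h k = T2.push_seq (a0 z) (snd (right z)) k"
      using IH fh that by (intro T2.push_seq_cong[of "Suc j"]) (auto simp: agree_def)
    also have "\<dots> = snd z k" using act_right[OF z] by (metis snd_conv letter_act.simps(1) prod.collapse)
    finally show ?thesis .
  qed
  moreover have "T1.cons_seq (a0 z) f k = fst z k" if "k < Suc (Suc i)" for k
    using that f ends_head(1)[OF z] by (auto simp: cons split: nat.split)
  ultimately show ?case unfolding eq agree_def by simp
qed

lemma ends_const: "\<lbrakk>a \<in> A; b \<in> B\<rbrakk> \<Longrightarrow> (\<lambda>_. Some a, \<lambda>_. Some b) \<in> ends"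
  by (auto simp: ends_def red_pairs_def T1.red_def T2.red_def invA invB) (metis invA invB)+

section \<open>Comparison of sectors with different base vertices\<close>

lemma letter_vert:
  assumes c: "c \<in> L" and z: "z \<in> ends" and ij: "1 \<le> i" "1 \<le> j"
  shows "\<exists>i' j'. i \<le> Suc i' \<and> j \<le> Suc j' \<and> gn c \<cdot> vert z i j = vert (letter_act c z) i' j'"
proof -
  from c consider (hor) a where "c = Inl a" "a \<in> A" | (ver) b where "c = Inr b" "b \<in> B"
    by (auto elim!: L_cases)
  then show ?thesis
  proof cases
  case 1: (hor a)
  let ?y = "letter_act (Inl a) z"
  have y: "?y \<in> ends" using letter_act_ends[OF c z] 1 by simp
  show ?thesis
  proof (cases "a0 z = invA D a")
    case True
    obtain i' where i: "i = Suc i'" using ij by (cases i) auto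
    have "right z = ?y" using True 1 by (simp add: right_def invA)
    then have "gn c \<cdot> vert z i j = gn (Inl a) \<cdot> (gn (linv (Inl a)) \<cdot> vert ?y i' j)"
      using True i 1 by simp
    also have "\<dots> = vert ?y i' j"
      using 1 y by (simp add: \<Gamma>.m_assoc[symmetric] invA flip: gn_inv linv_simps)
    finally have "i \<le> Suc i' \<and> j \<le> Suc j \<and> gn c \<cdot> vert z i j = vert (letter_act c z) i' j"
      unfolding i 1 by simp
    then show ?thesis by blast
  next
    case False
    obtain f h where fh: "z = (f, h)" by fastforce
    have "f 0 \<noteq> Some (invA D a)" using False ends_head(1)[OF z] fh by simp
    then have "a0 ?y = a" by (simp add: fh a0_def T1.cons_seq_def)
    moreover from this have "right ?y = z" using letter_act_inverse[OF c ends_red[OF z]] 1 by (simp add: right_def)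
    ultimately have "vert ?y (Suc i) j = gn c \<cdot> vert z i j" using 1 by simp
    then have "i \<le> Suc (Suc i) \<and> j \<le> Suc j
        \<and> gn c \<cdot> vert z i j = vert (letter_act c z) (Suc i) j"
      unfolding 1 by (simp del: vert.simps)
    then show ?thesis by blast
  qed
next
  case 2: (ver b)
  let ?y = "letter_act (Inr b) z"
  have y: "?y \<in> ends" using letter_act_ends[OF c z] 2 by simp
  show ?thesis
  proof (cases "b0 z = invB D b")
    case True
    obtain j' where j: "j = Suc j'" using ij by (cases j) auto
    have "up z = ?y" using True 2 by (simp add: up_def invB)
    then have "gn c \<cdot> vert z i j = gn (Inr b) \<cdot> (gn (linv (Inr b)) \<cdot> vert ?y i j')"
      using True j 2 z by (simp add: vert_up)
    also have "\<dots> = vert ?y i j'"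
      using 2 y by (simp add: \<Gamma>.m_assoc[symmetric] invB flip: gn_inv linv_simps)
    finally have "i \<le> Suc i \<and> j \<le> Suc j' \<and> gn c \<cdot> vert z i j = vert (letter_act c z) i j'"
      unfolding j 2 by simp
    then show ?thesis by blast
  next
    case False
    obtain f h where fh: "z = (f, h)" by fastforce
    have "h 0 \<noteq> Some (invB D b)" using False ends_head(2)[OF z] fh by simp
    then have "b0 ?y = b" by (simp add: fh b0_def T2.cons_seq_def)
    moreover from this have "up ?y = z" using letter_act_inverse[OF c ends_red[OF z]] 2 by (simp add: up_def)
    ultimately have "vert ?y i (Suc j) = gn c \<cdot> vert z i j" using 2 y by (simp add: vert_up)
    then have "i \<le> Suc i \<and> j \<le> Suc (Suc j)
        \<and> gn c \<cdot> vert z i j = vert (letter_act c z) i (Suc j)"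
      unfolding 2 by (simp del: vert.simps)
    then show ?thesis by blast
  qed
  qed
qed

text \<open>
  Translating by \<open>g\<close> moves the base vertex a bounded distance away, so that far out in the sector the vertices
  of the translated sector are vertices of the sector towards the translated end.
\<close>

lemma translate_vert:
  "g \<in> carrier \<Gamma> \<Longrightarrow> \<exists>N. \<forall>z\<in>ends. \<forall>i\<ge>N. \<forall>j\<ge>N. \<exists>i' j'. i \<le> i' + N \<and> j \<le> j' + N \<and>
    g \<cdot> vert z i j = vert (gact g z) i' j'"
proof (induction g rule: \<Gamma>_induct)
  case one
  show ?case by (intro exI[of _ 0]) (auto simp: gact_one ends_red)
next
  case (gen c g)
  then obtain N where N: "\<And>z i j. \<lbrakk>z \<in> ends; i \<ge> N; j \<ge> N\<rbrakk> \<Longrightarrow> \<exists>i' j'. i \<le> i' + N \<and> j \<le> j' + N \<and>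
    g \<cdot> vert z i j = vert (gact g z) i' j'" by blast
  show ?case
  proof (rule exI[of _ "Suc N"], intro ballI allI impI)
    fix z i j assume z: "z \<in> ends" and ij: "Suc N \<le> i" "Suc N \<le> j"
    obtain i' j' where 1: "i \<le> i' + N" "j \<le> j' + N" "g \<cdot> vert z i j = vert (gact g z) i' j'"
      using N[OF z, of i j] ij by auto
    have gz: "gact g z \<in> ends" using gact_ends gen z by blast
    obtain i'' j'' where 2: "i' \<le> Suc i''" "j' \<le> Suc j''"
      "gn c \<cdot> vert (gact g z) i' j' = vert (letter_act c (gact g z)) i'' j''"
      using letter_vert[OF gen(1) gz, of i' j'] 1 ij by auto
    have "gn c \<cdot> g \<cdot> vert z i j = vert (gact (gn c \<cdot> g) z) i'' j''"
      using gen z 1 2 gz by (simp add: \<Gamma>.m_assoc gact_mult gact_gn ends_red gact_red)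
    then show "\<exists>i' j'. i \<le> i' + Suc N \<and> j \<le> j' + Suc N \<and>
        gn c \<cdot> g \<cdot> vert z i j = vert (gact (gn c \<cdot> g) z) i' j'"
      using 1(1,2) 2(1,2) by (metis Suc_le_mono add_Suc_right le_trans add_le_mono1 add_Suc)
  qed
qed

lemma agree_letter:
  assumes "agree (Suc m) (Suc n) z z'"
  shows "agree m n (letter_act c z) (letter_act c z')"
proof -
  obtain f h f' h' where eq: "z = (f, h)" "z' = (f', h')" by fastforce
  have f: "\<And>i. i < Suc m \<Longrightarrow> f i = f' i" and h: "\<And>i. i < Suc n \<Longrightarrow> h i = h' i"
    using assms by (auto simp: agree_def eq)
  have "T1.push_seq b f i = T1.push_seq b f' i" "T1.cons_seq a f i = T1.cons_seq a f' i" if "i < m" for i a b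
    using T1.push_seq_cong[of m f f' i b] T1.cons_seq_cong[of m f f' i a] f that by auto
  moreover have "T2.push_seq a h i = T2.push_seq a h' i" "T2.cons_seq b h i = T2.cons_seq b h' i"
    if "i < n" for i a b
    using T2.push_seq_cong[of n h h' i a] T2.cons_seq_cong[of n h h' i b] h that by auto
  ultimately show ?thesis by (cases c) (auto simp: agree_def eq)
qed

lemma agree_translate:
  "g \<in> carrier \<Gamma> \<Longrightarrow> \<exists>N. \<forall>z\<in>red_pairs. \<forall>z'\<in>red_pairs. \<forall>m n.
    agree (m + N) (n + N) z z' \<longrightarrow> agree m n (gact g z) (gact g z')"
proof (induction g rule: \<Gamma>_induct)
  case one
  show ?case by (intro exI[of _ 0]) (auto simp: gact_one)
next
  case (gen c g)
  then obtain N where N: "\<And>z z' m n. \<lbrakk>z \<in> red_pairs; z' \<in> red_pairs; agree (m + N) (n + N) z z'\<rbrakk>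
    \<Longrightarrow> agree m n (gact g z) (gact g z')" by blast
  have "agree m n (gact (gn c \<cdot> g) z) (gact (gn c \<cdot> g) z')"
    if "z \<in> red_pairs" "z' \<in> red_pairs" "agree (m + Suc N) (n + Suc N) z z'" for z z' m n
    using agree_letter[OF N[of z z' "Suc m" "Suc n"], of c] that gen
    by (simp add: gact_mult gact_gn gact_red)
  then show ?case by (intro exI[of _ "Suc N"]) auto
qed

end

section \<open>Sectors\<close>

lemma plane_cells_eq:
  "plane_cells = {{m..m + int d} \<times> {n..n + int e} | m n d e. d \<le> 1 \<and> e \<le> 1}"
proof (intro equalityI subsetI)
  fix c assume "c \<in> plane_cells"
  then obtain l k where lk: "c = {l..l + k}" "k \<in> {(0, 0), (1, 0), (0, 1), (1, 1)}"
    unfolding plane_cells_def by blast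
  have "c = {fst l..fst l + int (nat (fst k))} \<times> {snd l..snd l + int (nat (snd k))}"
    using lk by (auto simp: less_eq_prod_def)
  moreover have "nat (fst k) \<le> 1" "nat (snd k) \<le> 1" using lk by auto
  ultimately show "c \<in> {{m..m + int d} \<times> {n..n + int e} | m n d e. d \<le> 1 \<and> e \<le> 1}" by blast
next
  fix c assume "c \<in> {{m..m + int d} \<times> {n..n + int e} | m n d e. d \<le> 1 \<and> e \<le> 1}"
  then obtain m n d e where c: "c = {m..m + int d} \<times> {n..n + int e}" "d \<le> 1" "e \<le> 1" by blast
  have "c = {(m, n)..(m, n) + (int d, int e)}" using c by (auto simp: less_eq_prod_def)
  moreover have "(int d, int e) \<in> {(0, 0), (1, 0), (0, 1), (1, 1)}" using c by (auto simp: le_Suc_eq)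
  ultimately show "c \<in> plane_cells" unfolding plane_cells_def by blast
qed

lemma unit_interval: "d \<le> 1 \<Longrightarrow> {m..m + int d} = {m, m + int d}"
  by (auto simp: le_Suc_eq)

lemma quadrant_cells_eq:
  "quadrant_cells = {({int i, int (i + d)} \<times> {int j, int (j + e)}) | i j d e. d \<le> 1 \<and> e \<le> 1}"
proof (intro equalityI subsetI)
  fix c assume c: "c \<in> quadrant_cells"
  then obtain m n d e where mn: "c = {m..m + int d} \<times> {n..n + int e}" "d \<le> 1" "e \<le> 1"
    by (auto simp: quadrant_cells_def plane_cells_eq)
  moreover from this have "(m, n) \<in> c" by auto
  then have "0 \<le> m" "0 \<le> n" using c by (auto simp: quadrant_cells_def less_eq_prod_def)
  ultimately have "c = {int (nat m), int (nat m + d)} \<times> {int (nat n), int (nat n + e)}"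
    by (simp add: unit_interval)
  then show "c \<in> {({int i, int (i + d)} \<times> {int j, int (j + e)}) | i j d e. d \<le> 1 \<and> e \<le> 1}"
    using mn(2,3) by blast
next
  fix c assume "c \<in> {({int i, int (i + d)} \<times> {int j, int (j + e)}) | i j d e. d \<le> 1 \<and> e \<le> 1}"
  then obtain i j d e where c: "c = {int i, int (i + d)} \<times> {int j, int (j + e)}" "d \<le> 1" "e \<le> 1"
    by blast
  then have "c = {int i..int i + int d} \<times> {int j..int j + int e}" by (simp add: unit_interval)
  then have "c \<in> plane_cells" unfolding plane_cells_eq using c(2,3) by blast
  moreover have "c \<subseteq> {(0, 0)..}" using c(1) by (auto simp: less_eq_prod_def)
  ultimately show "c \<in> quadrant_cells" by (simp add: quadrant_cells_def)
qed

text \<open>A unit interval of integers, read outwards from the origin.\<close>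

lemma signed_unit_interval:
  assumes "d \<le> 1"
  obtains s i where "{m..m + int d} = (\<lambda>k. if s then int k else - int k) ` {i, i + d}"
proof (cases "0 \<le> m")
  case True
  then have "{m..m + int d} = (\<lambda>k. if True then int k else - int k) ` {nat m, nat m + d}"
    using assms by (simp add: unit_interval)
  then show thesis by (rule that)
next
  case False
  then have "{m..m + int d} = (\<lambda>k. if False then int k else - int k) ` {nat (- m - int d), nat (- m - int d) + d}"
    using assms by (auto simp: unit_interval le_Suc_eq)
  then show thesis by (rule that)
qed

context BM_data begin

definition rect :: "(nat \<times> nat \<Rightarrow> ('a, 'b) bm_elt) \<Rightarrow> ('a, 'b) bm_elt set set" where
  "rect V = {V ` ({i, i + d} \<times> {j, j + e}) | i j d e. d \<le> 1 \<and> e \<le> 1}"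

lemma rectI: "\<lbrakk>c = V ` ({i, i + d} \<times> {j, j + e}); d \<le> 1; e \<le> 1\<rbrakk> \<Longrightarrow> c \<in> rect V"
  unfolding rect_def mem_Collect_eq by (intro exI conjI)

lemma rectE:
  assumes "c \<in> rect V"
  obtains i j d e where "c = V ` ({i, i + d} \<times> {j, j + e})" "d \<le> 1" "e \<le> 1"
  using assms unfolding rect_def mem_Collect_eq by (elim exE conjE) (rule that)

lemma image_quadrant_cells:
  assumes "\<And>i j. \<phi> (int i, int j) = V (i, j)"
  shows "image \<phi> ` quadrant_cells = rect V"
proof -
  have "\<phi> ` ({int i, int (i + d)} \<times> {int j, int (j + e)}) = V ` ({i, i + d} \<times> {j, j + e})" for i j d e
    using assms[of i j] assms[of "i + d" j] assms[of i "j + e"] assms[of "i + d" "j + e"]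
    by (simp add: insert_Times_insert)
  note eq = this
  show ?thesis unfolding quadrant_cells_eq rect_def
  proof (intro equalityI subsetI)
    fix c
    assume "c \<in> image \<phi> ` {{int i, int (i + d)} \<times> {int j, int (j + e)} | i j d e. d \<le> 1 \<and> e \<le> 1}"
    then obtain i j d e where "c = \<phi> ` ({int i, int (i + d)} \<times> {int j, int (j + e)})" "d \<le> 1" "e \<le> 1"
      by blast
    then show "c \<in> {V ` ({i, i + d} \<times> {j, j + e}) | i j d e. d \<le> 1 \<and> e \<le> 1}" using eq by blast
  next
    fix c assume "c \<in> {V ` ({i, i + d} \<times> {j, j + e}) | i j d e. d \<le> 1 \<and> e \<le> 1}"
    then obtain i j d e where "c = \<phi> ` ({int i, int (i + d)} \<times> {int j, int (j + e)})" "d \<le> 1" "e \<le> 1"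
      using eq by blast
    then show "c \<in> image \<phi> ` {{int i, int (i + d)} \<times> {int j, int (j + e)} | i j d e. d \<le> 1 \<and> e \<le> 1}"
      by blast
  qed
qed

definition sec :: "('a, 'b) bm_elt \<Rightarrow> ('a, 'b) seq_pair \<Rightarrow> ('a, 'b) bm_elt set set" where
  "sec x z = rect (\<lambda>(i, j). x \<cdot> vert z i j)"

lemma singleton_sec: "{v} \<in> sec x z \<longleftrightarrow> (\<exists>i j. v = x \<cdot> vert z i j)"
proof
  assume "{v} \<in> sec x z"
  then obtain i j d e where "{v} = (\<lambda>(i, j). x \<cdot> vert z i j) ` ({i, i + d} \<times> {j, j + e})"
    unfolding sec_def by (rule rectE)
  then have "x \<cdot> vert z i j \<in> {v}" by simp
  then show "\<exists>i j. v = x \<cdot> vert z i j" by auto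
next
  assume "\<exists>i j. v = x \<cdot> vert z i j"
  then obtain i j where "v = x \<cdot> vert z i j" by blast
  then have "{v} = (\<lambda>(i, j). x \<cdot> vert z i j) ` ({i, i + 0} \<times> {j, j + 0})" by simp
  then show "{v} \<in> sec x z" unfolding sec_def by (rule rectI) auto
qed

text \<open>
  Elements of the group are told apart by where they move the pair of base vertices of the trees.
\<close>

definition coord :: "('a, 'b) bm_elt \<Rightarrow> ('a, 'b) seq_pair" where
  "coord g = gact g origin"

lemma coord_simps:
  "coord unit = (\<lambda>_. None, \<lambda>_. None)"
  "a \<in> A \<Longrightarrow> coord (gn (Inl a)) = (case_nat (Some a) (\<lambda>_. None), \<lambda>_. None)"
  "b \<in> B \<Longrightarrow> coord (gn (Inr b)) = (\<lambda>_. None, case_nat (Some b) (\<lambda>_. None))"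
  "(a, b, b', a') \<in> R \<Longrightarrow> coord (gn (Inl a) \<cdot> gn (Inr b))
    = (case_nat (Some a) (\<lambda>_. None), case_nat (Some b') (\<lambda>_. None))"
proof -
  have p: "T1.push_seq q (\<lambda>_. None) = (\<lambda>_. None)" "T2.push_seq q' (\<lambda>_. None) = (\<lambda>_. None)" for q q'
    by (auto simp: T1.push_seq_def T2.push_seq_def)
  show "coord unit = (\<lambda>_. None, \<lambda>_. None)" by (simp add: coord_def gact_one[OF origin_red]) (simp add: origin_def)
  show "a \<in> A \<Longrightarrow> coord (gn (Inl a)) = (case_nat (Some a) (\<lambda>_. None), \<lambda>_. None)"
    by (simp add: coord_def gact_gn origin_red) (simp add: origin_def T1.cons_seq_def p)
  show b: "b \<in> B \<Longrightarrow> coord (gn (Inr b)) = (\<lambda>_. None, case_nat (Some b) (\<lambda>_. None))" for b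
    by (simp add: coord_def gact_gn origin_red) (simp add: origin_def T2.cons_seq_def p)
  assume r: "(a, b, b', a') \<in> R"
  then have m: "a \<in> A" "b \<in> B" using R_mem by auto
  have "coord (gn (Inl a) \<cdot> gn (Inr b)) = letter_act (Inl a) (coord (gn (Inr b)))"
    using m unfolding coord_def
    by (simp add: gact_mult gact_gn letter_act_red origin_red del: letter_act.simps)
  also have "\<dots> = (case_nat (Some a) (\<lambda>_. None), T2.push_seq a (case_nat (Some b) (\<lambda>_. None)))"
    using m by (simp add: b T1.cons_seq_def)
  also have "T2.push_seq a (case_nat (Some b) (\<lambda>_. None)) = case_nat (Some b') (\<lambda>_. None)"
    using T2.push_seq_Cons[OF push2_eq[OF r]] p by simp
  finally show "coord (gn (Inl a) \<cdot> gn (Inr b))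
    = (case_nat (Some a) (\<lambda>_. None), case_nat (Some b') (\<lambda>_. None))" .
qed

lemma case_nat_None: "case_nat (Some a) f \<noteq> (\<lambda>_. None)" "(\<lambda>_. None) \<noteq> case_nat (Some a) f"
  "case_nat (Some a) f = case_nat (Some a') f' \<longleftrightarrow> a = a' \<and> f = f'"
  by (auto simp: fun_eq_iff split: nat.splits)

lemma gn_inj: "\<lbrakk>c \<in> L; c' \<in> L; gn c = gn c'\<rbrakk> \<Longrightarrow> c = c'"
  by (auto elim!: L_cases dest!: arg_cong[of "gn _" "gn _" coord] simp: coord_simps case_nat_None)

lemma gn_ne_one: "c \<in> L \<Longrightarrow> gn c \<noteq> unit"
  by (auto elim!: L_cases dest!: arg_cong[of "gn _" _ coord] simp: coord_simps case_nat_None)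

lemma diagonal_ne:
  assumes "(a, b, b', a') \<in> R"
  shows "c \<in> L \<Longrightarrow> gn c \<noteq> gn (Inl a) \<cdot> gn (Inr b)"
    and "gn (Inl a) \<cdot> gn (Inr b) \<noteq> unit"
  by (auto elim!: L_cases dest!: arg_cong[of _ "gn (Inl a) \<cdot> gn (Inr b)" coord]
      arg_cong[of "gn (Inl a) \<cdot> gn (Inr b)" _ coord] simp: coord_simps coord_simps(4)[OF assms] case_nat_None)

abbreviation square :: "('a, 'b) bm_elt \<Rightarrow> 'a \<Rightarrow> 'b \<Rightarrow> 'b \<Rightarrow> ('a, 'b) bm_elt set" where
  "square g a b b' \<equiv> {g, g \<cdot> gn (Inl a), g \<cdot> gn (Inr b'),
     g \<cdot> gn (Inl a) \<cdot> gn (Inr b)}"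

lemma complex_cells_cases:
  assumes "c \<in> complex_cells D"
  obtains (vertex) g where "g \<in> carrier \<Gamma>" "c = {g}"
  | (edge) g y where "g \<in> carrier \<Gamma>" "y \<in> L" "c = {g, g \<cdot> gn y}"
  | (square) g a b b' a' where "g \<in> carrier \<Gamma>" "(a, b, b', a') \<in> R" "c = square g a b b'"
  using assms unfolding complex_cells_def Un_iff mem_Collect_eq
  by (elim disjE exE conjE)
     ((rule that(1), assumption+) | (rule that(2), assumption+) | (rule that(3), assumption+))+

lemma complex_cells_vertex: "g \<in> carrier \<Gamma> \<Longrightarrow> {g} \<in> complex_cells D"
  and complex_cells_edge: "\<lbrakk>g \<in> carrier \<Gamma>; y \<in> L\<rbrakk> \<Longrightarrow> {g, g \<cdot> gn y} \<in> complex_cells D"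
  and complex_cells_square:
    "\<lbrakk>g \<in> carrier \<Gamma>; (a, b, b', a') \<in> R\<rbrakk> \<Longrightarrow> square g a b b' \<in> complex_cells D"
  unfolding complex_cells_def Un_iff mem_Collect_eq
  by (rule disjI1, rule disjI1, intro exI conjI, rule HOL.refl, assumption,
      rule disjI1, rule disjI2, intro exI conjI, rule HOL.refl, assumption+,
      rule disjI2, intro exI conjI, rule HOL.refl, assumption+)

lemma rect_cell:
  assumes v: "v \<in> carrier \<Gamma>" and z: "z \<in> ends" and de: "d \<le> 1" "e \<le> 1"
  shows "(\<lambda>(i, j). v \<cdot> vert z i j) ` ({i, i + d} \<times> {j, j + e}) \<in> complex_cells D"
proof -
  let ?g = "v \<cdot> vert z i j"
  obtain a b b' a' where tl: "tl (pos z i j) = (a, b, b', a')" by (metis prod_cases4)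
  note m = tl_moves[OF pos_ends[OF z] tl]
  have mem: "a \<in> A" "b \<in> B" "b' \<in> B" "a' \<in> A" using R_mem[OF m(5)] by auto
  have g: "?g \<in> carrier \<Gamma>" using v z by simp
  have r: "v \<cdot> vert z (Suc i) j = ?g \<cdot> gn (Inl a)"
    and u: "v \<cdot> vert z i (Suc j) = ?g \<cdot> gn (Inr b')"
    and ru: "v \<cdot> vert z (Suc i) (Suc j) = ?g \<cdot> gn (Inl a) \<cdot> gn (Inr b)"
    using vert_right_step[OF z, of i j] vert_up_step[OF z, of i j] vert_up_step[OF z, of "Suc i" j]
      mem m v z by (simp_all add: \<Gamma>.m_assoc right_pos[symmetric] del: vert.simps)
  have "{?g} \<in> complex_cells D" "{?g, ?g \<cdot> gn (Inl a)} \<in> complex_cells D"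
    "{?g, ?g \<cdot> gn (Inr b')} \<in> complex_cells D" "square ?g a b b' \<in> complex_cells D"
    using g mem m(5) by (simp_all add: complex_cells_vertex complex_cells_edge complex_cells_square)
  moreover have "d = 0 \<or> d = 1" "e = 0 \<or> e = 1" using de by auto

  ultimately show ?thesis
    by (auto simp: insert_Times_insert r u ru insert_commute simp del: vert.simps)
qed

text \<open>
  The sector towards \<open>z\<close> is a quarter of an apartment: continue the two boundary rays backwards by constant
  sequences and fill the other three quadrants by the sectors towards the corresponding ends.
\<close>

lemma sec_sector_at:
  assumes v: "v \<in> carrier \<Gamma>" and z: "z \<in> ends"
  shows "sector_at D v (sec v z)"
proof -
  obtain f h where fh: "z = (f, h)" "T1.red f" "T2.red h" "\<And>n. f n \<noteq> None" "\<And>n. h n \<noteq> None"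
    using ends_cases[OF z] by blast
  have "\<exists>c\<in>A. c \<noteq> a0 z" using card_A finite_A card_le_Suc0_iff_eq[OF finite_A] ends_head(3)[OF z]
    by (metis One_nat_def numeral_le_one_iff order_trans semiring_norm(69) invA)
  then obtain c where c: "c \<in> A" "c \<noteq> a0 z" by blast
  have "\<exists>d\<in>B. d \<noteq> b0 z" using ends_head(4)[OF z] invB by metis
  then obtain d where d: "d \<in> B" "d \<noteq> b0 z" by blast
  define fs where "fs s = (if s then f else (\<lambda>_. Some c))" for s
  define hs where "hs t = (if t then h else (\<lambda>_. Some d))" for t
  define zz where "zz s t = (fs s, hs t)" for s t
  have zz: "zz s t \<in> ends" for s t
    using fh ends_const[OF c(1) d(1)] by (cases s; cases t) (auto simp: zz_def fs_def hs_def ends_def red_pairs_def)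
  define \<phi> where "\<phi> = (\<lambda>(m, n). v \<cdot> vert (zz (0 \<le> m) (0 \<le> n)) (nat \<bar>m\<bar>) (nat \<bar>n\<bar>))"
  have \<phi>_eq: "\<phi> ((if s then int i else - int i), (if t then int j else - int j))
      = v \<cdot> vert (zz s t) i j" for s t i j
  proof -
    have "vert (zz (0 \<le> (if s then int i else - int i)) (0 \<le> (if t then int j else - int j))) i j
        = vert (zz s t) i j"
      by (rule vert_cong[OF zz zz]) (auto simp: agree_def zz_def fs_def hs_def)
    note eq = this
    have n: "nat \<bar>if s then int i else - int i\<bar> = i" "nat \<bar>if t then int j else - int j\<bar> = j" by auto
    show ?thesis by (simp only: \<phi>_def prod.case n eq)
  qed
  have "inj \<phi>"
  proof (rule injI)
    fix l l' assume eq: "\<phi> l = \<phi> l'"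
    obtain m n m' n' where l: "l = (m, n)" "l' = (m', n')" by fastforce
    have "vert (zz (0 \<le> m) (0 \<le> n)) (nat \<bar>m\<bar>) (nat \<bar>n\<bar>) = vert (zz (0 \<le> m') (0 \<le> n')) (nat \<bar>m'\<bar>) (nat \<bar>n'\<bar>)"
      using eq v zz by (simp add: \<phi>_def l)
    from vert_eqD[OF zz zz this]
    have "nat \<bar>m\<bar> = nat \<bar>m'\<bar>" "nat \<bar>n\<bar> = nat \<bar>n'\<bar>"
      and ag: "agree (nat \<bar>m\<bar>) (nat \<bar>n\<bar>) (zz (0 \<le> m) (0 \<le> n)) (zz (0 \<le> m') (0 \<le> n'))" by blast+
    then have abs: "\<bar>m\<bar> = \<bar>m'\<bar>" "\<bar>n\<bar> = \<bar>n'\<bar>" by (simp_all add: eq_nat_nat_iff)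
    have f0: "fs True 0 \<noteq> fs False 0" "hs True 0 \<noteq> hs False 0"
      using ends_head(1,2)[OF z] c d fh by (auto simp: fs_def hs_def)
    have "fs (0 \<le> m) 0 = fs (0 \<le> m') 0" if "m \<noteq> 0" using ag that by (simp add: agree_def zz_def)
    then have "m = m'" using abs(1) f0(1) by (cases "0 \<le> m"; cases "0 \<le> m'"; cases "m = 0") auto
    moreover have "hs (0 \<le> n) 0 = hs (0 \<le> n') 0" if "n \<noteq> 0" using ag that by (simp add: agree_def zz_def)
    then have "n = n'" using abs(2) f0(2) by (cases "0 \<le> n"; cases "0 \<le> n'"; cases "n = 0") auto
    ultimately show "l = l'" by (simp add: l)
  qed
  moreover have "\<phi> ` c \<in> complex_cells D" if "c \<in> plane_cells" for c
  proof -
    obtain m n d e where c: "c = {m..m + int d} \<times> {n..n + int e}" "d \<le> 1" "e \<le> 1"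
      using \<open>c \<in> plane_cells\<close> by (auto simp: plane_cells_eq)
    obtain s i where s: "{m..m + int d} = (\<lambda>k. if s then int k else - int k) ` {i, i + d}"
      using signed_unit_interval[OF c(2)] by blast
    obtain t j where t: "{n..n + int e} = (\<lambda>k. if t then int k else - int k) ` {j, j + e}"
      using signed_unit_interval[OF c(3)] by blast
    have "\<phi> ` c = (\<lambda>(i, j). v \<cdot> vert (zz s t) i j) ` ({i, i + d} \<times> {j, j + e})"
      unfolding c s t by (simp only: image_insert image_empty insert_Times_insert) (simp add: \<phi>_eq del: of_nat_add)
    then show ?thesis using rect_cell[OF v zz c(2,3)] by simp
  qed
  ultimately have "apartment_map D \<phi>" by (simp add: apartment_map_def)
  moreover have "\<phi> (0, 0) = v" using \<phi>_eq[of True 0 True 0] v by simp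
  moreover have "image \<phi> ` quadrant_cells = sec v z" unfolding sec_def
    by (rule image_quadrant_cells) (use \<phi>_eq[of True _ True] in \<open>simp add: zz_def fs_def hs_def fh\<close>)
  ultimately show ?thesis unfolding sector_at_def by (intro exI[of _ \<phi>]) simp
qed

lemma doubleton_cell:
  assumes "{g, h} \<in> complex_cells D" "g \<noteq> h"
  shows "\<exists>y\<in>L. h = g \<cdot> gn y"
  using assms(1)
proof (cases rule: complex_cells_cases)
  case (vertex k)
  then show ?thesis using assms(2) by auto
next
  case (edge k y)
  have "k = k \<cdot> gn y \<cdot> gn (linv y)"
    using edge linv_closed by (simp add: \<Gamma>.m_assoc flip: gn_inv)
  then show ?thesis using edge assms(2) linv_closed by (metis doubleton_eq_iff)
next
  case (square k a b b' a')
  have m: "a \<in> A" "b' \<in> B" "b \<in> B" using R_mem[OF square(2)] by auto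
  have "gn (Inl a) \<noteq> gn (Inr b')" "gn (Inl a) \<noteq> unit" "gn (Inr b') \<noteq> unit"
    using gn_inj[of "Inl a" "Inr b'"] gn_ne_one m by auto
  then have "k \<noteq> k \<cdot> gn (Inl a)" "k \<noteq> k \<cdot> gn (Inr b')"
    "k \<cdot> gn (Inl a) \<noteq> k \<cdot> gn (Inr b')"
    using square(1) m by simp_all
  then show ?thesis using square(3) by (metis insertE insertI1 insertI2 singletonD)
qed

text \<open>
  The four forms of a tile listed in the symmetry condition are its views from its four corners.
\<close>

lemma square_rebase:
  assumes g: "g \<in> carrier \<Gamma>" and r: "(a, b, b', a') \<in> R" and k: "k \<in> square g a b b'"
  shows "\<exists>c d d' c'. (c, d, d', c') \<in> R \<and> square g a b b' = square k c d d'"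
proof -
  have m: "a \<in> A" "b \<in> B" "b' \<in> B" "a' \<in> A" using R_mem[OF r] by auto
  note sym = R_symmetric[OF r]
  have canc: "x \<cdot> gn c \<cdot> gn (linv c) = x" if "x \<in> carrier \<Gamma>" "c \<in> L" for x c
    using that linv_closed by (simp add: \<Gamma>.m_assoc flip: gn_inv)
  note cA = canc[of _ "Inl _", simplified] and cB = canc[of _ "Inr _", simplified]
  have diag: "g \<cdot> gn (Inl a) \<cdot> gn (Inr b) = g \<cdot> gn (Inr b') \<cdot> gn (Inl a')"
    using g m gn_tile[OF r] by (simp add: \<Gamma>.m_assoc)
  consider "k = g" | "k = g \<cdot> gn (Inl a)" | "k = g \<cdot> gn (Inr b')"
    | "k = g \<cdot> gn (Inl a) \<cdot> gn (Inr b)" using k by blast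
  then show ?thesis
  proof cases
    case 1
    then show ?thesis using r by blast
  next
    case 2
    have "square k (invA D a) b' b = square g a b b'" using g m by (auto simp: 2 cA)
    then show ?thesis using sym by metis
  next
    case 3
    have "square k a' (invB D b) (invB D b') = square g a b b'"
      using g m by (auto simp: 3 cA cB diag[symmetric])
    then show ?thesis using sym by metis
  next
    case 4
    have "k \<cdot> gn (Inl (invA D a')) = g \<cdot> gn (Inr b')" using g m by (simp add: 4 diag cA)
    moreover have "k \<cdot> gn (Inr (invB D b)) = g \<cdot> gn (Inl a)" using g m by (simp add: 4 cB)
    moreover have "g \<cdot> gn (Inr b') \<cdot> gn (Inr (invB D b')) = g" using g m by (simp add: cB)
    ultimately have "square k (invA D a') (invB D b') (invB D b) = square g a b b'"
      by (auto simp: 4)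
    then show ?thesis using sym by metis
  qed
qed

lemma fst_pos_row: "z \<in> ends \<Longrightarrow> fst (pos z i 0) = (\<lambda>n. fst z (n + i))"
proof (induction i)
  case (Suc i)
  then show ?case by (simp add: right_pos[symmetric] right_eq pos_ends)
qed simp

lemma snd_pos_column: "z \<in> ends \<Longrightarrow> snd (pos z 0 j) = (\<lambda>n. snd z (n + j))"
proof (induction j)
  case (Suc j)
  have "pos z 0 (Suc j) = up (pos z 0 j)" using up_pos[OF Suc.prems] by simp
  then show ?case using Suc by (simp add: up_eq pos_ends)
qed simp

lemma apartment_map_swap:
  assumes "apartment_map D \<phi>"
  shows "apartment_map D (\<phi> \<circ> prod.swap)" "image (\<phi> \<circ> prod.swap) ` quadrant_cells = image \<phi> ` quadrant_cells"
proof -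
  have "prod.swap ` c \<in> plane_cells" if "c \<in> plane_cells" for c
    using that unfolding plane_cells_eq by (fastforce simp: product_swap)
  then show "apartment_map D (\<phi> \<circ> prod.swap)"
    using assms unfolding apartment_map_def image_comp[symmetric] by (simp add: inj_compose)
  have "image prod.swap ` quadrant_cells \<subseteq> quadrant_cells"
    unfolding quadrant_cells_eq by (fastforce simp: product_swap)
  moreover have "c = prod.swap ` (prod.swap ` c)" for c :: "(int \<times> int) set" by (simp add: image_image)
  ultimately have "image prod.swap ` quadrant_cells = quadrant_cells" by (metis image_eqI subsetI equalityI subsetD)
  moreover have "image (\<phi> \<circ> prod.swap) ` quadrant_cells = image \<phi> ` (image prod.swap ` quadrant_cells)"
    by (simp only: image_image o_def)
  ultimately show "image (\<phi> \<circ> prod.swap) ` quadrant_cells = image \<phi> ` quadrant_cells" by simp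
qed

text \<open>
  In an apartment each square is a translate of a tile, with its horizontal edges labelled either by \<open>A\<close> or by
  \<open>B\<close>; adjacent squares share an edge, so the alternative is the same for all squares.
\<close>

lemma apartment_square:
  assumes "apartment_map D \<phi>"
  defines "\<Psi> \<equiv> \<lambda>i j. \<phi> (int i, int j)"
  shows "\<exists>a b b' a'. (a, b, b', a') \<in> R \<and>
    \<Psi> (Suc i) (Suc j) = \<Psi> i j \<cdot> gn (Inl a) \<cdot> gn (Inr b) \<and>
    (\<Psi> (Suc i) j = \<Psi> i j \<cdot> gn (Inl a) \<and> \<Psi> i (Suc j) = \<Psi> i j \<cdot> gn (Inr b') \<or>
     \<Psi> (Suc i) j = \<Psi> i j \<cdot> gn (Inr b') \<and> \<Psi> i (Suc j) = \<Psi> i j \<cdot> gn (Inl a))"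
proof -
  have inj: "\<Psi> i j = \<Psi> i' j' \<longleftrightarrow> i = i' \<and> j = j'" for i j i' j'
    unfolding \<Psi>_def using assms(1) inj_eq[of \<phi>] by (simp add: apartment_map_def)
  have cell: "(\<lambda>(i, j). \<Psi> i j) ` ({i, i + d} \<times> {j, j + e}) \<in> complex_cells D" if "d \<le> 1" "e \<le> 1" for i j d e
  proof -
    have "{int i, int (i + d)} \<times> {int j, int (j + e)} \<in> quadrant_cells"
      unfolding quadrant_cells_eq using that by blast
    then have "{int i, int (i + d)} \<times> {int j, int (j + e)} \<in> plane_cells"
      unfolding quadrant_cells_def by blast
    then have "\<phi> ` ({int i, int (i + d)} \<times> {int j, int (j + e)}) \<in> complex_cells D"
      using assms(1) unfolding apartment_map_def by blast
    then show ?thesis by (simp add: \<Psi>_def insert_Times_insert)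
  qed
  have sq: "{\<Psi> i j, \<Psi> i (Suc j), \<Psi> (Suc i) j, \<Psi> (Suc i) (Suc j)} \<in> complex_cells D"
    using cell[of 1 1 i j] by (simp add: insert_Times_insert insert_commute)
  have e1: "{\<Psi> i j, \<Psi> (Suc i) j} \<in> complex_cells D" using cell[of 1 0 i j] by simp
  have e2: "{\<Psi> i j, \<Psi> i (Suc j)} \<in> complex_cells D" using cell[of 0 1 i j] by simp
  obtain y where y: "y \<in> L" "\<Psi> (Suc i) j = \<Psi> i j \<cdot> gn y"
    using doubleton_cell[OF e1] inj by auto
  obtain w where w: "w \<in> L" "\<Psi> i (Suc j) = \<Psi> i j \<cdot> gn w"
    using doubleton_cell[OF e2] inj by auto
  have dist: "\<Psi> i j \<noteq> \<Psi> (Suc i) j" "\<Psi> i j \<noteq> \<Psi> i (Suc j)" "\<Psi> (Suc i) j \<noteq> \<Psi> i (Suc j)"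
    "\<Psi> i j \<noteq> \<Psi> (Suc i) (Suc j)" "\<Psi> (Suc i) (Suc j) \<noteq> \<Psi> i (Suc j)" "\<Psi> (Suc i) (Suc j) \<noteq> \<Psi> (Suc i) j"
    by (auto simp: inj)
  have "\<exists>g a b b' a'. g \<in> carrier \<Gamma> \<and> (a, b, b', a') \<in> R \<and>
    {\<Psi> i j, \<Psi> i (Suc j), \<Psi> (Suc i) j, \<Psi> (Suc i) (Suc j)} = square g a b b'"
    using sq
  proof (cases rule: complex_cells_cases)
    case (vertex g)
    then show ?thesis using dist(1) by (metis insertI1 insertI2 singletonD)
  next
    case (edge g y)
    then show ?thesis using dist(1-3) by (metis insertE insertI1 insertI2 singletonD)
  next
    case (square g a b b' a')
    then show ?thesis by (intro exI conjI)
  qed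
  then obtain g a1 b1 b1' a1' where g: "g \<in> carrier \<Gamma>" and r1: "(a1, b1, b1', a1') \<in> R"
    and eq1: "{\<Psi> i j, \<Psi> i (Suc j), \<Psi> (Suc i) j, \<Psi> (Suc i) (Suc j)} = square g a1 b1 b1'"
    by (elim exE conjE) (rule that)
  have "\<Psi> i j \<in> square g a1 b1 b1'" using eq1 by blast
  from square_rebase[OF g r1 this]
  obtain a b b' a' where r: "(a, b, b', a') \<in> R"
    and "square g a1 b1 b1' = square (\<Psi> i j) a b b'" by (elim exE conjE) (rule that)
  with eq1 have eq: "{\<Psi> i j, \<Psi> i (Suc j), \<Psi> (Suc i) j, \<Psi> (Suc i) (Suc j)} = square (\<Psi> i j) a b b'"
    by (simp only:)
  have m: "a \<in> A" "b \<in> B" "b' \<in> B" using R_mem[OF r] by auto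
  have \<Psi>: "\<Psi> i j \<in> carrier \<Gamma>"
    using \<open>\<Psi> i j \<in> square g a1 b1 b1'\<close> g R_mem[OF r1] by auto
  have nd: "\<Psi> i j \<cdot> gn c \<noteq> \<Psi> i j \<cdot> gn (Inl a) \<cdot> gn (Inr b)" if "c \<in> L" for c
    using diagonal_ne(1)[OF r that] that \<Psi> m by (simp add: \<Gamma>.m_assoc)
  have "\<Psi> (Suc i) j \<in> {\<Psi> i j \<cdot> gn (Inl a), \<Psi> i j \<cdot> gn (Inr b')}"
    using eq dist(1) nd[OF y(1)] y(2) by (metis insert_iff)
  moreover have "\<Psi> i (Suc j) \<in> {\<Psi> i j \<cdot> gn (Inl a), \<Psi> i j \<cdot> gn (Inr b')}"
    using eq dist(2) nd[OF w(1)] w(2) by (metis insert_iff)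
  moreover from calculation have "\<Psi> (Suc i) (Suc j) = \<Psi> i j \<cdot> gn (Inl a) \<cdot> gn (Inr b)"
    using eq dist by (metis insert_iff singletonD)
  ultimately show ?thesis using r dist(3) by blast
qed

text \<open>
  Once the first edge fixes which direction is labelled by \<open>A\<close>, the labels of the bottom and left edges of the
  quadrant form reduced sequences, because backtracking would contradict injectivity, and they determine the rest.
\<close>

lemma oriented_apartment_sector:
  assumes ap: "apartment_map D \<phi>"
    and start: "\<phi> (1, 0) = \<phi> (0, 0) \<cdot> gn (Inl a)" "a \<in> A"
  shows "\<exists>z\<in>ends. image \<phi> ` quadrant_cells = sec (\<phi> (0, 0)) z"
proof -
  define \<Psi> where "\<Psi> i j = \<phi> (int i, int j)" for i j
  have inj: "\<Psi> i j = \<Psi> i' j' \<longleftrightarrow> i = i' \<and> j = j'" for i j i' j'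
    unfolding \<Psi>_def using ap inj_eq[of \<phi>] by (simp add: apartment_map_def)
  have \<Psi>: "\<Psi> i j \<in> carrier \<Gamma>" for i j
  proof -
    have "{int i..int i + int 0} \<times> {int j..int j + int 0} \<in> plane_cells" unfolding plane_cells_eq by blast
    then have "\<phi> ` ({int i..int i + int 0} \<times> {int j..int j + int 0}) \<in> complex_cells D"
      using ap unfolding apartment_map_def by blast
    then have "{\<Psi> i j} \<in> complex_cells D" by (simp add: \<Psi>_def)
    then show ?thesis
    proof (cases rule: complex_cells_cases)
      case (edge g y)
      then show ?thesis by (metis insertI1 singletonD)
    next
      case (square g a b b' a')
      then show ?thesis by (metis insertI1 singletonD)
    qed auto
  qed
  note sq = apartment_square[OF ap, folded \<Psi>_def]
  let ?H = "\<lambda>i j. \<exists>a b b' a'. (a, b, b', a') \<in> R \<and>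
    \<Psi> (Suc i) (Suc j) = \<Psi> i j \<cdot> gn (Inl a) \<cdot> gn (Inr b) \<and>
    \<Psi> (Suc i) j = \<Psi> i j \<cdot> gn (Inl a) \<and> \<Psi> i (Suc j) = \<Psi> i j \<cdot> gn (Inr b')"
  have AB: "\<Psi> i j \<cdot> gn (Inl a) \<noteq> \<Psi> i j \<cdot> gn (Inr b)" if "a \<in> A" "b \<in> B" for i j a b
    using gn_inj[of "Inl a" "Inr b"] that \<Psi> by auto
  have H_right_edge: "?H i j" if "\<Psi> (Suc i) j = \<Psi> i j \<cdot> gn (Inl a)" "a \<in> A" for i j a
    using sq[of i j] AB[of a _ i j] that R_mem by metis
  have H_up_edge: "?H i j" if "\<Psi> i (Suc j) = \<Psi> i j \<cdot> gn (Inr b)" "b \<in> B" for i j b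
    using sq[of i j] AB[of _ b i j] that R_mem by metis
  have H00: "?H 0 0" using start by (intro H_right_edge) (auto simp: \<Psi>_def)
  have H_up: "?H i (Suc j)" if H: "?H i j" for i j
  proof -
    obtain a b b' a' where r: "(a, b, b', a') \<in> R" and e: "\<Psi> (Suc i) (Suc j) = \<Psi> i j \<cdot> gn (Inl a) \<cdot> gn (Inr b)"
      "\<Psi> i (Suc j) = \<Psi> i j \<cdot> gn (Inr b')" using H by blast
    have "\<Psi> (Suc i) (Suc j) = \<Psi> i (Suc j) \<cdot> gn (Inl a')"
      using e gn_tile[OF r] R_mem[OF r] \<Psi> by (simp add: \<Gamma>.m_assoc)
    then show ?thesis using R_mem[OF r] by (intro H_right_edge) auto
  qed
  have H_right: "?H (Suc i) j" if H: "?H i j" for i j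
  proof -
    obtain a b b' a' where r: "(a, b, b', a') \<in> R" and e: "\<Psi> (Suc i) (Suc j) = \<Psi> i j \<cdot> gn (Inl a) \<cdot> gn (Inr b)"
      "\<Psi> (Suc i) j = \<Psi> i j \<cdot> gn (Inl a)" using H by blast
    have "\<Psi> (Suc i) (Suc j) = \<Psi> (Suc i) j \<cdot> gn (Inr b)" using e by simp
    then show ?thesis using R_mem[OF r] by (intro H_up_edge) auto
  qed
  have H: "?H i j" for i j
  proof (induction i)
    case 0
    show ?case by (induction j) (use H00 H_up in blast)+
  qed (use H_right in blast)
  have "\<forall>i. \<exists>a\<in>A. \<Psi> (Suc i) 0 = \<Psi> i 0 \<cdot> gn (Inl a)" using H R_mem by metis
  then obtain \<alpha> where \<alpha>: "\<And>i. \<alpha> i \<in> A" "\<And>i. \<Psi> (Suc i) 0 = \<Psi> i 0 \<cdot> gn (Inl (\<alpha> i))" by metis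
  have "\<forall>j. \<exists>b\<in>B. \<Psi> 0 (Suc j) = \<Psi> 0 j \<cdot> gn (Inr b)" using H R_mem by metis
  then obtain \<beta> where \<beta>: "\<And>j. \<beta> j \<in> B" "\<And>j. \<Psi> 0 (Suc j) = \<Psi> 0 j \<cdot> gn (Inr (\<beta> j))" by metis
  define z where "z = (\<lambda>i. Some (\<alpha> i), \<lambda>j. Some (\<beta> j))"
  have canc: "x \<cdot> gn c \<cdot> gn (linv c) = x" if "x \<in> carrier \<Gamma>" "c \<in> L" for x c
    using that linv_closed by (simp add: \<Gamma>.m_assoc flip: gn_inv)
  have "\<alpha> (Suc i) \<noteq> invA D (\<alpha> i)" for i
  proof
    assume "\<alpha> (Suc i) = invA D (\<alpha> i)"
    then have "\<Psi> (Suc (Suc i)) 0 = \<Psi> i 0" using canc[OF \<Psi>, of "Inl (\<alpha> i)" i 0] \<alpha> by simp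
    then show False by (simp add: inj)
  qed
  moreover have "\<beta> (Suc j) \<noteq> invB D (\<beta> j)" for j
  proof
    assume "\<beta> (Suc j) = invB D (\<beta> j)"
    then have "\<Psi> 0 (Suc (Suc j)) = \<Psi> 0 j" using canc[OF \<Psi>, of "Inr (\<beta> j)" 0 j] \<beta> by simp
    then show False by (simp add: inj)
  qed
  ultimately have z: "z \<in> ends"
    using \<alpha>(1) \<beta>(1) by (auto simp: z_def ends_def red_pairs_def T1.red_def T2.red_def)
  let ?v = "\<Psi> 0 0"
  have row: "\<Psi> i 0 = ?v \<cdot> vert z i 0" for i
  proof (induction i)
    case (Suc i)
    have "a0 (pos z i 0) = \<alpha> i" using fst_pos_row[OF z, of i] by (simp add: a0_def z_def)
    then show ?case using Suc \<alpha> \<Psi> z vert_right_step[OF z, of i 0] by (simp add: \<Gamma>.m_assoc del: vert.simps)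
  qed (simp add: \<Psi>)
  have col: "\<Psi> 0 j = ?v \<cdot> vert z 0 j" for j
  proof (induction j)
    case (Suc j)
    have "b0 (pos z 0 j) = \<beta> j" using snd_pos_column[OF z, of j] by (simp add: b0_def z_def)
    then show ?case using Suc \<beta> \<Psi> z vert_up_step[OF z, of 0 j] by (simp add: \<Gamma>.m_assoc del: vert.simps)
  qed (simp add: \<Psi>)
  have all: "\<Psi> i j = ?v \<cdot> vert z i j" for i j
  proof (induction i arbitrary: j)
    case 0
    show ?case by (rule col)
  next
    case (Suc i)
    note IHi = Suc
    show ?case
    proof (induction j)
      case 0
      show ?case by (rule row)
    next
      case (Suc j)
      obtain a b b' a' where r: "(a, b, b', a') \<in> R"
        and e: "\<Psi> (Suc i) (Suc j) = \<Psi> i j \<cdot> gn (Inl a) \<cdot> gn (Inr b)"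
        "\<Psi> (Suc i) j = \<Psi> i j \<cdot> gn (Inl a)" "\<Psi> i (Suc j) = \<Psi> i j \<cdot> gn (Inr b')" using H by blast
      have m: "a \<in> A" "b \<in> B" "b' \<in> B" using R_mem[OF r] by auto
      let ?p = "pos z i j"
      note p = pos_ends[OF z, of i j] ends_head[OF pos_ends[OF z, of i j]]
      have "\<Psi> (Suc i) j = \<Psi> i j \<cdot> gn (Inl (a0 ?p))"
        using Suc IHi[of j] \<Psi>[of 0 0] z p vert_right_step[OF z, of i j] by (simp add: \<Gamma>.m_assoc del: vert.simps)
      then have "gn (Inl a) = gn (Inl (a0 ?p))" using e(2) \<Psi> m p by simp
      then have a: "a0 ?p = a" using gn_inj[of "Inl a" "Inl (a0 ?p)"] m p by simp
      have "\<Psi> i (Suc j) = \<Psi> i j \<cdot> gn (Inr (b0 ?p))"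
        using IHi[of j] IHi[of "Suc j"] \<Psi>[of 0 0] z p vert_up_step[OF z, of i j] by (simp add: \<Gamma>.m_assoc del: vert.simps)
      then have "gn (Inr b') = gn (Inr (b0 ?p))" using e(3) \<Psi> m p by simp
      then have b: "b0 ?p = b'" using gn_inj[of "Inr b'" "Inr (b0 ?p)"] m p by simp
      have "tl ?p = (a, b, b', a')" using tl_eq_iff[OF p(1) r] a b by simp
      from tl_moves(3)[OF p(1) this] have "b0 (pos z (Suc i) j) = b" by (simp add: right_pos)
      then have "vert z (Suc i) (Suc j) = vert z (Suc i) j \<cdot> gn (Inr b)"
        using vert_up_step[OF z, of "Suc i" j] by simp
      then show ?case using Suc e \<Psi>[of 0 0] z m by (simp add: \<Gamma>.m_assoc del: vert.simps)
    qed
  qed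
  have "image \<phi> ` quadrant_cells = sec (\<phi> (0, 0)) z" unfolding sec_def
    by (rule image_quadrant_cells) (use all in \<open>simp add: \<Psi>_def\<close>)
  then show ?thesis using z by blast
qed

lemma sector_at_sec:
  assumes "sector_at D v S"
  shows "v \<in> carrier \<Gamma> \<and> (\<exists>z\<in>ends. S = sec v z)"
proof -
  obtain \<phi> where ap: "apartment_map D \<phi>" and v: "\<phi> (0, 0) = v" and S: "S = image \<phi> ` quadrant_cells"
    using assms unfolding sector_at_def by blast
  obtain a b b' a' where r: "(a, b, b', a') \<in> R"
    and e: "\<phi> (1, 0) = \<phi> (0, 0) \<cdot> gn (Inl a) \<or> \<phi> (0, 1) = \<phi> (0, 0) \<cdot> gn (Inl a)"
    using apartment_square[OF ap, of 0 0] by auto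
  have a: "a \<in> A" using R_mem[OF r] by simp
  have ex: "\<exists>z\<in>ends. S = sec v z"
    using e
  proof
    assume "\<phi> (1, 0) = \<phi> (0, 0) \<cdot> gn (Inl a)"
    from oriented_apartment_sector[OF ap this a] show ?thesis by (simp add: S v)
  next
    assume "\<phi> (0, 1) = \<phi> (0, 0) \<cdot> gn (Inl a)"
    then have "(\<phi> \<circ> prod.swap) (1, 0) = (\<phi> \<circ> prod.swap) (0, 0) \<cdot> gn (Inl a)" by simp
    from oriented_apartment_sector[OF apartment_map_swap(1)[OF ap] this a] apartment_map_swap(2)[OF ap]
    show ?thesis by (simp add: S v)
  qed
  have "{0..0 + int 0} \<times> {0..0 + int 0} \<in> plane_cells" unfolding plane_cells_eq by blast
  then have "\<phi> ` ({0..0 + int 0} \<times> {0..0 + int 0}) \<in> complex_cells D"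
    using ap unfolding apartment_map_def by blast
  then have "{v} \<in> complex_cells D" by (simp add: v)
  then have "v \<in> carrier \<Gamma>"
  proof (cases rule: complex_cells_cases)
    case (edge g y)
    then show ?thesis by (metis insertI1 singletonD)
  next
    case (square g a b b' a')
    then show ?thesis by (metis insertI1 singletonD)
  qed auto
  then show ?thesis using ex by blast
qed

lemma sectors_eq: "sectors D = {sec x z | x z. x \<in> carrier \<Gamma> \<and> z \<in> ends}"
  unfolding sectors_def using sector_at_sec sec_sector_at by blast

section \<open>The boundary as the set of pairs of ends\<close>

lemma agree_all_eq:
  assumes "\<And>n. \<exists>m\<ge>n. \<exists>k\<ge>n. agree m k z z'"
  shows "z = z'"
proof -
  have "fst z i = fst z' i \<and> snd z i = snd z' i" for i
    using assms[of "Suc i"] by (auto simp: agree_def)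
  then show ?thesis by (simp add: prod_eq_iff fun_eq_iff)
qed

text \<open>
  Far vertices of the smaller sector are also far vertices of the larger one translated to the same base vertex,
  and a vertex far out determines long initial parts of the end.
\<close>

lemma subsector_end:
  assumes x: "x \<in> carrier \<Gamma>" "z \<in> ends" and x': "x' \<in> carrier \<Gamma>" "z' \<in> ends"
    and sub: "sec x' z' \<subseteq> sec x z"
  shows "gact x' z' = gact x z"
proof -
  let ?g = "ginv x \<cdot> x'"
  have g: "?g \<in> carrier \<Gamma>" using x x' by simp
  obtain N where N: "\<And>z i j. \<lbrakk>z \<in> ends; i \<ge> N; j \<ge> N\<rbrakk> \<Longrightarrow> \<exists>i' j'. i \<le> i' + N \<and> j \<le> j' + N \<and>
    ?g \<cdot> vert z i j = vert (gact ?g z) i' j'" using translate_vert[OF g] by blast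
  have "z = gact ?g z'"
  proof (rule agree_all_eq)
    fix n
    obtain i' j' where ij: "N + n \<le> i' + N" "N + n \<le> j' + N"
      "?g \<cdot> vert z' (N + n) (N + n) = vert (gact ?g z') i' j'"
      using N[OF x'(2), of "N + n" "N + n"] by auto
    have "{x' \<cdot> vert z' (N + n) (N + n)} \<in> sec x z" using sub singleton_sec by blast
    then obtain i j where "x' \<cdot> vert z' (N + n) (N + n) = x \<cdot> vert z i j"
      using singleton_sec by auto
    then have "vert z i j = ?g \<cdot> vert z' (N + n) (N + n)"
      using x x' by (simp add: \<Gamma>.m_assoc \<Gamma>.inv_solve_left)
    then have "vert z i j = vert (gact ?g z') i' j'" using ij by simp
    from vert_eqD[OF x(2) gact_ends[OF g x'(2)] this] ij(1,2)
    show "\<exists>m\<ge>n. \<exists>k\<ge>n. agree m k z (gact ?g z')" by auto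
  qed
  then show ?thesis using x x' by (simp add: gact_mult ends_red gact_red gact_inv_cancel)
qed

lemma sec_shift_subset:
  assumes x: "x \<in> carrier \<Gamma>" "z \<in> ends"
  shows "sec (x \<cdot> vert z i j) (pos z i j) \<subseteq> sec x z"
proof
  fix c assume "c \<in> sec (x \<cdot> vert z i j) (pos z i j)"
  then obtain k l d e where c: "c = (\<lambda>(k, l). x \<cdot> vert z i j \<cdot> vert (pos z i j) k l) ` ({k, k + d} \<times> {l, l + e})"
    "d \<le> 1" "e \<le> 1" unfolding sec_def by (rule rectE)
  have "c = (\<lambda>(k, l). x \<cdot> vert z k l) ` ({i + k, i + k + d} \<times> {j + l, j + l + e})"
    using vert_add[OF x(2)] x by (simp add: c insert_Times_insert \<Gamma>.m_assoc pos_ends add.assoc del: vert.simps)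
  then show "c \<in> sec x z" unfolding sec_def using c(2,3) by (rule rectI)
qed

lemma sec_equiv_iff:
  assumes x: "x \<in> carrier \<Gamma>" "z \<in> ends" and x': "x' \<in> carrier \<Gamma>" "z' \<in> ends"
  shows "(sec x z, sec x' z') \<in> sector_equiv D \<longleftrightarrow> gact x z = gact x' z'"
proof
  assume "(sec x z, sec x' z') \<in> sector_equiv D"
  then obtain y w where "y \<in> carrier \<Gamma>" "w \<in> ends" "sec y w \<subseteq> sec x z" "sec y w \<subseteq> sec x' z'"
    by (auto simp: sector_equiv_def sectors_eq)
  then show "gact x z = gact x' z'" using subsector_end x x' by metis
next
  assume eq: "gact x z = gact x' z'"
  let ?g = "ginv x' \<cdot> x"
  have g: "?g \<in> carrier \<Gamma>" using x x' by simp
  have gz: "gact ?g z = z'" using x x' eq by (simp add: gact_mult ends_red gact_red gact_inv_cancel)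
  obtain N i j where ij: "?g \<cdot> vert z N N = vert z' i j"
    using translate_vert[OF g] x(2) gz by (metis order_refl)
  let ?h = "x \<cdot> vert z N N"
  have h: "?h \<in> carrier \<Gamma>" using x by simp
  have h': "?h = x' \<cdot> vert z' i j"
    unfolding ij[symmetric] using x x' by (simp add: \<Gamma>.m_assoc \<Gamma>.inv_solve_left' flip: \<Gamma>.m_assoc)
  have "pos z N N = gact (ginv ?h) (gact x z)"
    using x by (simp add: pos_vert[symmetric] \<Gamma>.inv_mult_group gact_mult gact_red ends_red gact_inv_cancel)
  also have "\<dots> = pos z' i j"
    unfolding eq h' using x' by (simp add: pos_vert[symmetric] \<Gamma>.inv_mult_group gact_mult gact_red ends_red gact_inv_cancel)
  finally have p: "pos z N N = pos z' i j" .
  have "sec ?h (pos z N N) \<subseteq> sec x z \<inter> sec x' z'"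
    using sec_shift_subset[OF x, of N N] sec_shift_subset[OF x', of i j] h' p by simp
  moreover have "sec ?h (pos z N N) \<in> sectors D" "sec x z \<in> sectors D" "sec x' z' \<in> sectors D"
    unfolding sectors_eq using h pos_ends x x' by blast+
  ultimately show "(sec x z, sec x' z') \<in> sector_equiv D" unfolding sector_equiv_def by blast
qed

text \<open>
  An equivalence class of sectors contains exactly one sector at each vertex.
\<close>

definition end_class :: "('a, 'b) seq_pair \<Rightarrow> ('a, 'b) bm_end" where
  "end_class y = {sec x (gact (ginv x) y) | x. x \<in> carrier \<Gamma>}"

lemma sector_equiv_class:
  assumes x: "x \<in> carrier \<Gamma>" "z \<in> ends"
  shows "sector_equiv D `` {sec x z} = end_class (gact x z)"
proof (intro equalityI subsetI)
  fix S assume S: "S \<in> sector_equiv D `` {sec x z}"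
  then obtain x' z' where x': "x' \<in> carrier \<Gamma>" "z' \<in> ends" "S = sec x' z'"
    by (auto simp: sector_equiv_def sectors_eq)
  then have "gact x z = gact x' z'" using S sec_equiv_iff[OF x x'(1,2)] by simp
  then have "z' = gact (ginv x') (gact x z)" using x' by (simp add: gact_inv_cancel ends_red)
  then show "S \<in> end_class (gact x z)" unfolding end_class_def using x' by blast
next
  fix S assume "S \<in> end_class (gact x z)"
  then obtain x' where x': "x' \<in> carrier \<Gamma>" "S = sec x' (gact (ginv x') (gact x z))"
    by (auto simp: end_class_def)
  have "gact (ginv x') (gact x z) \<in> ends" using x x' by (simp add: gact_ends)
  then show "S \<in> sector_equiv D `` {sec x z}"
    using sec_equiv_iff[OF x x'(1)] x x' by (simp add: gact_inv_cancel gact_red ends_red)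
qed

lemma boundary_eq: "boundary D = end_class ` ends"
proof
  show "boundary D \<subseteq> end_class ` ends"
    unfolding boundary_def quotient_def sectors_eq using sector_equiv_class gact_ends by auto
  have "end_class y \<in> boundary D" if y: "y \<in> ends" for y
  proof -
    have "end_class y = sector_equiv D `` {sec unit y}"
      using sector_equiv_class[of "unit" y] y by (simp add: gact_one ends_red)
    moreover have "sec unit y \<in> sectors D" unfolding sectors_eq using y by blast
    ultimately show ?thesis unfolding boundary_def quotient_def by blast
  qed
  then show "end_class ` ends \<subseteq> boundary D" by blast
qed

lemma end_class_mem:
  assumes "x \<in> carrier \<Gamma>" "z \<in> ends" "y \<in> ends"
  shows "sec x z \<in> end_class y \<longleftrightarrow> gact x z = y"
proof -
  have "end_class y = sector_equiv D `` {sec unit y}"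
    using sector_equiv_class[of "unit" y] assms(3) by (simp add: gact_one ends_red)
  then show ?thesis
    using sec_equiv_iff[of "unit" y x z] assms by (auto simp: gact_one ends_red)
qed

lemma end_class_inj: "inj_on end_class ends"
proof (rule inj_onI)
  fix y y' assume y: "y \<in> ends" "y' \<in> ends" and eq: "end_class y = end_class y'"
  have "sec unit y \<in> end_class y" using end_class_mem[of "unit" y y] y by (simp add: gact_one ends_red)
  then show "y = y'" using end_class_mem[of "unit" y y'] y eq by (simp add: gact_one ends_red)
qed

lemma rep_sector_eq:
  assumes x: "x \<in> carrier \<Gamma>" and y: "y \<in> ends"
  shows "rep_sector D x (end_class y) = sec x (gact (ginv x) y)"
  unfolding rep_sector_def
proof (rule the_equality)
  have e: "gact (ginv x) y \<in> ends" using x y by (simp add: gact_ends)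
  show "sec x (gact (ginv x) y) \<in> end_class y \<and> sector_at D x (sec x (gact (ginv x) y))"
    using sec_sector_at[OF x e] x by (auto simp: end_class_def)
  fix S assume S: "S \<in> end_class y \<and> sector_at D x S"
  then obtain z where z: "z \<in> ends" "S = sec x z" using sector_at_sec by blast
  then have "gact x z = y" using S end_class_mem[OF x z(1) y] by simp
  then show "S = sec x (gact (ginv x) y)" using x z by (auto simp: gact_inv_cancel ends_red)
qed

lemma boundary_action_eq:
  assumes g: "g \<in> carrier \<Gamma>" and y: "y \<in> ends"
  shows "boundary_action D g (end_class y) = end_class (gact g y)"
proof -
  have im: "image (image (\<lambda>h. g \<cdot> h)) (sec x z) = sec (g \<cdot> x) z"
    if "x \<in> carrier \<Gamma>" "z \<in> ends" for x z
  proof -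
    have "(\<lambda>h. g \<cdot> h) ` ((\<lambda>(i, j). x \<cdot> vert z i j) ` K) = (\<lambda>(i, j). g \<cdot> x \<cdot> vert z i j) ` K" for K
      using that g by (auto simp: image_image \<Gamma>.m_assoc case_prod_beta)
    note eq = this
    show ?thesis
    proof (intro equalityI subsetI)
      fix C assume "C \<in> image (image (\<lambda>h. g \<cdot> h)) (sec x z)"
      then obtain c where c: "c \<in> sec x z" "C = (\<lambda>h. g \<cdot> h) ` c" by (rule imageE)
      from c(1) obtain i j d e where "c = (\<lambda>(i, j). x \<cdot> vert z i j) ` ({i, i + d} \<times> {j, j + e})"
        "d \<le> 1" "e \<le> 1" unfolding sec_def by (rule rectE)
      then show "C \<in> sec (g \<cdot> x) z" unfolding sec_def
        by (intro rectI[of _ _ i d j e]) (simp_all only: c(2) eq)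
    next
      fix C assume "C \<in> sec (g \<cdot> x) z"
      then obtain i j d e where C: "C = (\<lambda>(i, j). g \<cdot> x \<cdot> vert z i j) ` ({i, i + d} \<times> {j, j + e})"
        "d \<le> 1" "e \<le> 1" unfolding sec_def by (rule rectE)
      have "(\<lambda>(i, j). x \<cdot> vert z i j) ` ({i, i + d} \<times> {j, j + e}) \<in> sec x z"
        unfolding sec_def using C(2,3) by (intro rectI[OF HOL.refl])
      moreover have "C = (\<lambda>h. g \<cdot> h) ` ((\<lambda>(i, j). x \<cdot> vert z i j) ` ({i, i + d} \<times> {j, j + e}))"
        by (simp only: C(1) eq)
      ultimately show "C \<in> image (image (\<lambda>h. g \<cdot> h)) (sec x z)" by (rule rev_image_eqI)
    qed
  qed
  have "boundary_action D g (end_class y)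
      = {sec (g \<cdot> x) (gact (ginv x) y) | x. x \<in> carrier \<Gamma>}"
  proof -
    have "boundary_action D g (end_class y)
        = (\<lambda>x. image (image (\<lambda>h. g \<cdot> h)) (sec x (gact (ginv x) y))) ` carrier \<Gamma>"
      unfolding boundary_action_def end_class_def by (auto simp: image_iff)
    also have "\<dots> = (\<lambda>x. sec (g \<cdot> x) (gact (ginv x) y)) ` carrier \<Gamma>"
      using im y by (intro image_cong) (auto simp: gact_ends)
    finally show ?thesis by auto
  qed
  also have "\<dots> = end_class (gact g y)" unfolding end_class_def
  proof (intro equalityI subsetI)
    fix S assume "S \<in> {sec (g \<cdot> x) (gact (ginv x) y) | x. x \<in> carrier \<Gamma>}"
    then obtain x where x: "x \<in> carrier \<Gamma>" "S = sec (g \<cdot> x) (gact (ginv x) y)" by blast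
    have "gact (ginv (g \<cdot> x)) (gact g y) = gact (ginv x) y"
      using g x y by (simp add: \<Gamma>.inv_mult_group gact_mult gact_red ends_red gact_inv_cancel)
    moreover have "g \<cdot> x \<in> carrier \<Gamma>" using g x by simp
    ultimately have "S = sec (g \<cdot> x) (gact (ginv (g \<cdot> x)) (gact g y))"
      "g \<cdot> x \<in> carrier \<Gamma>" by (simp_all only: x(2))
    then show "S \<in> {sec x (gact (ginv x) (gact g y)) | x. x \<in> carrier \<Gamma>}"
      unfolding mem_Collect_eq by (intro exI conjI)
  next
    fix S assume "S \<in> {sec x (gact (ginv x) (gact g y)) | x. x \<in> carrier \<Gamma>}"
    then obtain x where x: "x \<in> carrier \<Gamma>" "S = sec x (gact (ginv x) (gact g y))" by blast
    let ?x = "ginv g \<cdot> x"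
    have "?x \<in> carrier \<Gamma>" "g \<cdot> ?x = x" using g x by (simp_all flip: \<Gamma>.m_assoc)
    moreover have "gact (ginv ?x) y = gact (ginv x) (gact g y)"
      using g x y by (simp add: \<Gamma>.inv_mult_group gact_mult gact_red ends_red)
    ultimately have "S = sec (g \<cdot> ?x) (gact (ginv ?x) y)" "?x \<in> carrier \<Gamma>"
      by (simp_all only: x(2))
    then show "S \<in> {sec (g \<cdot> x) (gact (ginv x) y) | x. x \<in> carrier \<Gamma>}"
      unfolding mem_Collect_eq by (intro exI conjI)
  qed
  finally show ?thesis .
qed

lemma boundary_basic_iff:
  assumes x: "x \<in> carrier \<Gamma>" and y: "y \<in> ends"
  shows "end_class y \<in> boundary_basic D x v \<longleftrightarrow> (\<exists>i j. v = x \<cdot> vert (gact (ginv x) y) i j)"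
  using y by (simp add: boundary_basic_def boundary_eq rep_sector_eq[OF x y] singleton_sec)

text \<open>
  A basic open set at \<open>x\<close> fixes finite initial parts of the end as seen from \<open>x\<close>. Changing the base vertex shifts
  the length of these parts by a bounded amount, so that the topology can be described by the sequences themselves.
\<close>

lemma openin_boundary_iff:
  assumes x: "x \<in> carrier \<Gamma>"
  shows "openin (boundary_topology D x) U \<longleftrightarrow> U \<subseteq> boundary D \<and>
    (\<forall>y\<in>ends. end_class y \<in> U \<longrightarrow> (\<exists>n. \<forall>y'\<in>ends. agree n n y y' \<longrightarrow> end_class y' \<in> U))"
    (is "_ \<longleftrightarrow> ?nbhd U")
proof
  have ix: "ginv x \<in> carrier \<Gamma>" using x by simp
  obtain N where N: "\<And>z z' m n. \<lbrakk>z \<in> red_pairs; z' \<in> red_pairs; agree (m + N) (n + N) z z'\<rbrakk>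
    \<Longrightarrow> agree m n (gact (ginv x) z) (gact (ginv x) z')" using agree_translate[OF ix] by blast
  assume "openin (boundary_topology D x) U"
  then have "generate_topology_on (boundary_basic D x ` carrier \<Gamma>) U"
    by (simp add: boundary_topology_def openin_topology_generated_by_iff)
  then show "?nbhd U"
  proof (induction rule: generate_topology_on.induct)
    case (Int U V)
    have "\<exists>n. \<forall>y'\<in>ends. agree n n y y' \<longrightarrow> end_class y' \<in> U \<inter> V"
      if y: "y \<in> ends" "end_class y \<in> U \<inter> V" for y
    proof -
      obtain m n where "\<forall>y'\<in>ends. agree m m y y' \<longrightarrow> end_class y' \<in> U"
        "\<forall>y'\<in>ends. agree n n y y' \<longrightarrow> end_class y' \<in> V" using Int y by blast
      moreover have "agree m m y y' \<and> agree n n y y'" if "agree (max m n) (max m n) y y'" for y'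
        using agree_mono[OF that, of m m] agree_mono[OF that, of n n] by simp
      ultimately show ?thesis by (intro exI[of _ "max m n"]) blast
    qed
    then show ?case using Int by blast
  next
    case (UN K)
    then show ?case by (meson Sup_least UnionE UnionI)
  next
    case (Basis U)
    then obtain v where v: "v \<in> carrier \<Gamma>" "U = boundary_basic D x v" by blast
    have "\<exists>n. \<forall>y'\<in>ends. agree n n y y' \<longrightarrow> end_class y' \<in> U"
      if y: "y \<in> ends" "end_class y \<in> U" for y
    proof -
      obtain i j where ij: "v = x \<cdot> vert (gact (ginv x) y) i j"
        using y v boundary_basic_iff[OF x y(1)] by blast
      show ?thesis
      proof (intro exI ballI impI)
        fix y' assume y': "y' \<in> ends" "agree (i + j + N) (i + j + N) y y'"
        then have "agree (i + j) (i + j) (gact (ginv x) y) (gact (ginv x) y')"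
          using N y(1) ends_red by blast
        then have "agree i j (gact (ginv x) y) (gact (ginv x) y')" by (rule agree_mono) auto
        from vert_cong[OF gact_ends[OF ix y(1)] gact_ends[OF ix y'(1)] this] ij
        show "end_class y' \<in> U" using v boundary_basic_iff[OF x y'(1)] by auto
      qed
    qed
    then show ?case using v by (auto simp: boundary_basic_def)
  qed simp
next
  assume U: "?nbhd U"
  obtain N where N: "\<And>z z' m n. \<lbrakk>z \<in> red_pairs; z' \<in> red_pairs; agree (m + N) (n + N) z z'\<rbrakk>
    \<Longrightarrow> agree m n (gact x z) (gact x z')" using agree_translate[OF x] by blast
  have "\<exists>T. openin (boundary_topology D x) T \<and> \<omega> \<in> T \<and> T \<subseteq> U" if \<omega>: "\<omega> \<in> U" for \<omega>
  proof -
    obtain y where y: "y \<in> ends" "\<omega> = end_class y" using U \<omega> by (auto simp: boundary_eq)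
    obtain n where n: "\<And>y'. \<lbrakk>y' \<in> ends; agree n n y y'\<rbrakk> \<Longrightarrow> end_class y' \<in> U" using U y \<omega> by blast
    let ?z = "gact (ginv x) y"
    have z: "?z \<in> ends" using x y by (simp add: gact_ends)
    let ?v = "x \<cdot> vert ?z (n + N) (n + N)"
    have v: "?v \<in> carrier \<Gamma>" using x z by simp
    have "openin (boundary_topology D x) (boundary_basic D x ?v)"
      unfolding boundary_topology_def using v by (intro topology_generated_by_Basis) blast
    moreover have "\<omega> \<in> boundary_basic D x ?v" using y boundary_basic_iff[OF x y(1)] by blast
    moreover have "boundary_basic D x ?v \<subseteq> U"
    proof
      fix \<omega>' assume \<omega>': "\<omega>' \<in> boundary_basic D x ?v"
      then obtain y' where y': "y' \<in> ends" "\<omega>' = end_class y'" by (auto simp: boundary_basic_def boundary_eq)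
      let ?z' = "gact (ginv x) y'"
      have z': "?z' \<in> ends" using x y' by (simp add: gact_ends)
      obtain i j where "?v = x \<cdot> vert ?z' i j" using \<omega>' y' boundary_basic_iff[OF x y'(1)] by blast
      then have "vert ?z (n + N) (n + N) = vert ?z' i j" using x z z' by simp
      from vert_eqD[OF z z' this] have "agree (n + N) (n + N) ?z ?z'" by blast
      from N[OF ends_red[OF z] ends_red[OF z'] this] have "agree n n y y'"
        using x y y' by (simp add: gact_inv_cancel ends_red)
      then show "\<omega>' \<in> U" using n y' by simp
    qed
    ultimately show ?thesis by blast
  qed
  then show "openin (boundary_topology D x) U" by (subst openin_subopen) blast
qed

lemma topspace_boundary: "x \<in> carrier \<Gamma> \<Longrightarrow> topspace (boundary_topology D x) = boundary D"
proof (rule antisym)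
  assume x: "x \<in> carrier \<Gamma>"
  show "topspace (boundary_topology D x) \<subseteq> boundary D"
    using openin_boundary_iff[OF x] openin_topspace by blast
  show "boundary D \<subseteq> topspace (boundary_topology D x)"
    using openin_boundary_iff[OF x, of "boundary D"] by (intro openin_subset) (auto simp: boundary_eq)
qed

definition end_of :: "('a, 'b) bm_end \<Rightarrow> ('a, 'b) seq_pair" where
  "end_of = inv_into ends end_class"

lemma end_of_class: "y \<in> ends \<Longrightarrow> end_of (end_class y) = y"
  by (simp add: end_of_def end_class_inj)

lemma end_of_ends: "\<omega> \<in> boundary D \<Longrightarrow> end_of \<omega> \<in> ends"
  and class_end_of: "\<omega> \<in> boundary D \<Longrightarrow> end_class (end_of \<omega>) = \<omega>"
  unfolding boundary_eq by (erule imageE, simp only: end_of_class, erule imageE, simp only: end_of_class)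

lemma end_of_action:
  "\<lbrakk>g \<in> carrier \<Gamma>; \<omega> \<in> boundary D\<rbrakk> \<Longrightarrow> end_of (boundary_action D g \<omega>) = gact g (end_of \<omega>)"
  unfolding boundary_eq by (erule imageE, simp only: boundary_action_eq end_of_class gact_ends)

end

section \<open>Families of partial isometries indexed by words\<close>

inductive_set lin :: "('w \<Rightarrow> 'w \<Rightarrow> 'a::star_ring) \<Rightarrow> ('w \<Rightarrow> 'w \<Rightarrow> bool) \<Rightarrow> 'a set"
  for s Q where
  lin_zero: "0 \<in> lin s Q"
| lin_gen: "Q u v \<Longrightarrow> s u v \<in> lin s Q"
| lin_add: "x \<in> lin s Q \<Longrightarrow> y \<in> lin s Q \<Longrightarrow> x + y \<in> lin s Q"
| lin_scC: "x \<in> lin s Q \<Longrightarrow> c *\<^sub>C x \<in> lin s Q"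

lemma lin_mono: "x \<in> lin s Q \<Longrightarrow> (\<And>u v. Q u v \<Longrightarrow> Q' u v) \<Longrightarrow> x \<in> lin s Q'"
  by (induction rule: lin.induct) (auto intro: lin.intros)

lemma lin_finite_sum:
  "x \<in> lin s Q \<Longrightarrow> \<exists>F c. finite F \<and> (\<forall>(u, v)\<in>F. Q u v) \<and> x = (\<Sum>(u, v)\<in>F. c u v *\<^sub>C s u v)"
proof (induction rule: lin.induct)
  case lin_zero
  show ?case by (intro exI[of _ "{}"]) simp
next
  case (lin_gen u v)
  show ?case by (intro exI[of _ "{(u, v)}"] exI[of _ "\<lambda>_ _. 1"]) (simp add: lin_gen scC_one)
next
  case (lin_add x y)
  then obtain F c F' c' where F: "finite F" "\<forall>(u, v)\<in>F. Q u v" "x = (\<Sum>(u, v)\<in>F. c u v *\<^sub>C s u v)"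
    and F': "finite F'" "\<forall>(u, v)\<in>F'. Q u v" "y = (\<Sum>(u, v)\<in>F'. c' u v *\<^sub>C s u v)" by blast
  let ?c = "\<lambda>u v. if (u, v) \<in> F then c u v else 0" and ?c' = "\<lambda>u v. if (u, v) \<in> F' then c' u v else 0"
  have "x = (\<Sum>(u, v)\<in>F \<union> F'. ?c u v *\<^sub>C s u v)"
    unfolding F(3) using F(1) F'(1) by (intro sum.mono_neutral_cong_left) auto
  moreover have "y = (\<Sum>(u, v)\<in>F \<union> F'. ?c' u v *\<^sub>C s u v)"
    unfolding F'(3) using F(1) F'(1) by (intro sum.mono_neutral_cong_left) auto
  ultimately have "x + y = (\<Sum>(u, v)\<in>F \<union> F'. (?c u v + ?c' u v) *\<^sub>C s u v)"
    by (simp only: scC_left_add sum.distrib split_def)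
  then show ?case using F F' by (intro exI[of _ "F \<union> F'"] exI[of _ "\<lambda>u v. ?c u v + ?c' u v"]) auto
next
  case (lin_scC x k)
  then obtain F c where F: "finite F" "\<forall>(u, v)\<in>F. Q u v" "x = (\<Sum>(u, v)\<in>F. c u v *\<^sub>C s u v)" by blast
  have "k *\<^sub>C x = (\<Sum>(u, v)\<in>F. (k * c u v) *\<^sub>C s u v)"
    by (simp add: F(3) scC_sum scC_scC case_prod_beta)
  then show ?case using F by (intro exI[of _ F] exI[of _ "\<lambda>u v. k * c u v"]) auto
qed

text \<open>
  The relations of a rank-2 Cuntz--Krieger algebra modulo an ideal, for words of shape \<open>sh u\<close> and type \<open>tm u\<close>
  that can be prolonged by the words in \<open>nxt e (tm u)\<close> in either direction \<open>e\<close>. The sets \<open>U u\<close>, which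
  shrink under prolongation, stand for the cylinder sets of a boundary.
\<close>

locale ck_prefamily = star_ideal J for J :: "'a::star_ring set" +
  fixes W :: "'w set" and sh :: "'w \<Rightarrow> nat \<times> nat" and tm :: "'w \<Rightarrow> 't"
    and nxt :: "nat \<times> nat \<Rightarrow> 't \<Rightarrow> 'w set" and mul :: "'w \<Rightarrow> 'w \<Rightarrow> 'w"
    and U :: "'w \<Rightarrow> 'y set" and s :: "'w \<Rightarrow> 'w \<Rightarrow> 'a"
  assumes mul_closed: "\<lbrakk>e \<in> {(1, 0), (0, 1)}; u \<in> W; w \<in> nxt e (tm u)\<rbrakk> \<Longrightarrow> mul u w \<in> W"
    and mul_sh: "\<lbrakk>e \<in> {(1, 0), (0, 1)}; u \<in> W; w \<in> nxt e (tm u)\<rbrakk> \<Longrightarrow> sh (mul u w) = sh u + e"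
    and mul_tm: "\<lbrakk>e \<in> {(1, 0), (0, 1)}; u \<in> W; w \<in> nxt e (tm u)\<rbrakk> \<Longrightarrow> tm (mul u w) = tm w"
    and mul_U: "\<lbrakk>e \<in> {(1, 0), (0, 1)}; u \<in> W; w \<in> nxt e (tm u)\<rbrakk> \<Longrightarrow> U (mul u w) \<subseteq> U u"
    and U_nonempty: "u \<in> W \<Longrightarrow> U u \<noteq> {}"
    and s_adj: "\<lbrakk>u \<in> W; v \<in> W; tm u = tm v\<rbrakk> \<Longrightarrow> adj (s u v) \<simeq> s v u"
    and s_mult: "\<lbrakk>u \<in> W; v \<in> W; w \<in> W; tm u = tm v; tm v = tm w\<rbrakk> \<Longrightarrow> s u v * s v w \<simeq> s u w"
    and s_sum: "\<lbrakk>e \<in> {(1, 0), (0, 1)}; u \<in> W; v \<in> W; tm u = tm v\<rbrakk>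
      \<Longrightarrow> s u v \<simeq> (\<Sum>w\<in>nxt e (tm u). s (mul u w) (mul v w))"

text \<open>
  Orthogonality is kept apart since it has different sources: in the crossed product it comes from the
  disjointness of cylinder sets, in the abstract algebra from the C*-identity.
\<close>

locale ck_family = ck_prefamily J W sh tm nxt mul U s
  for J :: "'a::star_ring set" and W :: "'w set" and sh and tm :: "'w \<Rightarrow> 't" and nxt and mul
    and U :: "'w \<Rightarrow> 'y set" and s +
  assumes s_orth: "\<lbrakk>u \<in> W; v \<in> W; sh u = sh v; u \<noteq> v\<rbrakk> \<Longrightarrow> s u u * s v v \<simeq> 0"
begin

definition good :: "'w \<Rightarrow> 'w \<Rightarrow> bool" where
  "good u v \<longleftrightarrow> u \<in> W \<and> v \<in> W \<and> tm u = tm v"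

abbreviation spanned :: "('w \<Rightarrow> 'w \<Rightarrow> bool) \<Rightarrow> 'a \<Rightarrow> bool" where
  "spanned Q x \<equiv> \<exists>y\<in>lin s Q. x \<simeq> y"

lemma spanned_gen: "Q u v \<Longrightarrow> spanned Q (s u v)"
  by (meson eqv_refl lin_gen)

lemma spanned_zero: "x \<simeq> 0 \<Longrightarrow> spanned Q x"
  by (meson lin_zero)

lemma spanned_add: "spanned Q x \<Longrightarrow> spanned Q y \<Longrightarrow> spanned Q (x + y)"
  by (meson eqv_add lin_add)

lemma spanned_scC: "spanned Q x \<Longrightarrow> spanned Q (c *\<^sub>C x)"
  by (meson eqv_scC lin_scC)

lemma spanned_eqv: "x \<simeq> y \<Longrightarrow> spanned Q y \<Longrightarrow> spanned Q x"
  by (meson eqv_trans)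

lemma spanned_mono: "spanned Q x \<Longrightarrow> (\<And>u v. Q u v \<Longrightarrow> Q' u v) \<Longrightarrow> spanned Q' x"
  by (meson lin_mono)

lemma spanned_sum: "(\<And>i. i \<in> I \<Longrightarrow> spanned Q (f i)) \<Longrightarrow> spanned Q (sum f I)"
  by (induction I rule: infinite_finite_induct) (auto intro: spanned_add spanned_zero)

lemma spanned_mult:
  assumes "spanned Q x" "spanned Q' y"
    and gen: "\<And>u v u' v'. Q u v \<Longrightarrow> Q' u' v' \<Longrightarrow> spanned Q'' (s u v * s u' v')"
  shows "spanned Q'' (x * y)"
proof -
  obtain x' y' where xy: "x' \<in> lin s Q" "x \<simeq> x'" "y' \<in> lin s Q'" "y \<simeq> y'" using assms by blast
  have 1: "spanned Q'' (s u v * y')" if "Q u v" for u v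
    using xy(3)
  proof (induction rule: lin.induct)
    case (lin_gen u' v')
    then show ?case using gen that by blast
  qed (simp_all add: spanned_zero distrib_left spanned_add mult_scC spanned_scC)
  have "spanned Q'' (x' * y')"
    using xy(1)
  proof (induction rule: lin.induct)
    case (lin_gen u' v')
    then show ?case using 1 by blast
  qed (simp_all add: spanned_zero distrib_right spanned_add scC_mult spanned_scC)
  then show ?thesis using eqv_mult[OF xy(2,4)] by (rule spanned_eqv[rotated])
qed

definition prolonged :: "nat \<times> nat \<Rightarrow> 'w \<Rightarrow> 'w \<Rightarrow> 'w \<Rightarrow> 'w \<Rightarrow> bool" where
  "prolonged d u v a b \<longleftrightarrow> good a b \<and> sh a = sh u + d \<and> sh b = sh v + d \<and> U a \<subseteq> U u \<and> U b \<subseteq> U v"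

lemma prolong_step:
  assumes e: "e \<in> {(1, 0), (0, 1)}" and X: "\<And>u v. good u v \<Longrightarrow> spanned (prolonged d u v) (s u v)"
    and uv: "good u v"
  shows "spanned (prolonged (d + e) u v) (s u v)"
proof -
  have uv': "u \<in> W" "v \<in> W" "tm u = tm v" using uv by (auto simp: good_def)
  have "spanned (prolonged (d + e) u v) (s (mul u w) (mul v w))" if w: "w \<in> nxt e (tm u)" for w
  proof (rule spanned_mono[OF X])
    have w': "w \<in> nxt e (tm v)" using w uv' by simp
    show "good (mul u w) (mul v w)"
      using mul_closed[OF e uv'(1) w] mul_closed[OF e uv'(2) w'] mul_tm[OF e uv'(1) w] mul_tm[OF e uv'(2) w']
      by (simp add: good_def)
    fix a b assume "prolonged d (mul u w) (mul v w) a b"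
    then show "prolonged (d + e) u v a b"
      using mul_sh[OF e uv'(1) w] mul_sh[OF e uv'(2) w'] mul_U[OF e uv'(1) w] mul_U[OF e uv'(2) w']
      by (auto simp: prolonged_def add_ac)
  qed
  then show ?thesis by (rule spanned_eqv[OF s_sum[OF e uv'] spanned_sum])
qed

text \<open>
  By the summation relation a generator may be replaced by generators for longer words. This makes any two shapes
  comparable, so that products of generators can be evaluated.
\<close>

lemma prolong:
  assumes "good u v"
  shows "spanned (prolonged d u v) (s u v)"
proof -
  have row: "\<forall>u v. good u v \<longrightarrow> spanned (prolonged (m, 0) u v) (s u v)" for m
  proof (induction m)
    case 0
    show ?case by (auto intro!: spanned_gen simp: prolonged_def zero_prod_def[symmetric])
  next
    case (Suc m)
    then show ?case using prolong_step[of "(1, 0)" "(m, 0)"] by simp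
  qed
  have "\<forall>u v. good u v \<longrightarrow> spanned (prolonged (m, n) u v) (s u v)" for m n
  proof (induction n)
    case (Suc n)
    then show ?case using prolong_step[of "(0, 1)" "(m, n)"] by simp
  qed (rule row)
  then show ?thesis using assms by (cases d) blast
qed

lemma gen_mult_cases:
  assumes "good a b" "good a' b'" "sh b = sh a'"
  shows "s a b * s a' b' \<simeq> (if b = a' then s a b' else 0)"
proof (cases "b = a'")
  case True
  then show ?thesis using assms s_mult by (auto simp: good_def)
next
  case False
  have W: "a \<in> W" "b \<in> W" "a' \<in> W" "b' \<in> W" "tm a = tm b" "tm a' = tm b'"
    using assms by (auto simp: good_def)
  have "s a b * s a' b' \<simeq> (s a b * s b b) * (s a' a' * s a' b')"
    using W by (intro eqv_mult eqv_sym[OF s_mult]) auto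
  also have "\<dots> = s a b * (s b b * s a' a') * s a' b'" by (simp add: mult.assoc)
  also have "\<dots> \<simeq> s a b * 0 * s a' b'"
    using W assms(3) False by (intro eqv_mult s_orth) auto
  finally show ?thesis using False by simp
qed

lemma sup_shape: obtains d d' where "k + d = k' + (d' :: nat \<times> nat)"
  by (rule that[of k' k]) (simp add: add.commute)

lemma gen_mult_spanned:
  assumes "good u v" "good u' v'"
  shows "spanned good (s u v * s u' v')"
proof -
  obtain d d' where d: "sh v + d = sh u' + d'" by (rule sup_shape)
  show ?thesis
  proof (rule spanned_mult[OF prolong[OF assms(1), of d] prolong[OF assms(2), of d']])
    fix a b a' b' assume ab: "prolonged d u v a b" "prolonged d' u' v' a' b'"
    then have g: "good a b" "good a' b'" "sh b = sh a'" using d by (auto simp: prolonged_def)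
    from gen_mult_cases[OF g] show "spanned good (s a b * s a' b')"
    proof (rule spanned_eqv)
      show "spanned good (if b = a' then s a b' else 0)"
        using g spanned_gen[of good a b'] spanned_zero[OF eqv_refl, of good]
        by (cases "b = a'") (auto simp: good_def)
    qed
  qed
qed

text \<open>
  Prolonging both words to a common shape reduces this to distinct words of one shape: a common prolongation would
  have a nonempty cylinder set inside both \<open>U u\<close> and \<open>U v\<close>.
\<close>

lemma disjoint_orth:
  assumes "u \<in> W" "v \<in> W" "U u \<inter> U v = {}"
  shows "s u u * s v v \<simeq> 0"
proof -
  obtain d d' where d: "sh u + d = sh v + d'" by (rule sup_shape)
  have g: "good u u" "good v v" using assms by (auto simp: good_def)
  have "spanned (\<lambda>_ _. False) (s u u * s v v)"
  proof (rule spanned_mult[OF prolong[OF g(1), of d] prolong[OF g(2), of d']])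
    fix a b a' b' assume ab: "prolonged d u u a b" "prolonged d' v v a' b'"
    then have g: "good a b" "good a' b'" "sh b = sh a'" using d by (auto simp: prolonged_def)
    have "b \<noteq> a'" using ab assms(3) U_nonempty[of b] by (auto simp: prolonged_def good_def)
    then show "spanned (\<lambda>_ _. False) (s a b * s a' b')"
      using gen_mult_cases[OF g] by (auto intro: spanned_zero)
  qed
  then obtain y where y: "y \<in> lin s (\<lambda>_ _. False)" "s u u * s v v \<simeq> y" by blast
  from y(1) have "y = 0" by (induction rule: lin.induct) auto
  then show ?thesis using y by simp
qed

lemma common_shape:
  assumes "x \<in> lin s good"
  shows "\<exists>k0. \<forall>k. spanned (\<lambda>u v. good u v \<and> sh v = k0 + k) x"
  using assms
proof (induction rule: lin.induct)
  case lin_zero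
  show ?case by (intro exI allI spanned_zero eqv_refl)
next
  case (lin_gen u v)
  have "spanned (\<lambda>a b. good a b \<and> sh b = sh v + k) (s u v)" for k
    by (rule spanned_mono[OF prolong[OF lin_gen, of k]]) (auto simp: prolonged_def)
  then show ?case by blast
next
  case (lin_add x y)
  then obtain k0 l0 where k: "\<And>k. spanned (\<lambda>u v. good u v \<and> sh v = k0 + k) x"
    "\<And>k. spanned (\<lambda>u v. good u v \<and> sh v = l0 + k) y" by blast
  have "spanned (\<lambda>u v. good u v \<and> sh v = k0 + l0 + k) (x + y)" for k
    using k(1)[of "l0 + k"] k(2)[of "k0 + k"] by (intro spanned_add) (simp_all add: add_ac)
  then show ?case by blast
next
  case (lin_scC x c)
  then show ?case by (meson spanned_scC)
qed

end

lemma average_of_unimodular: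
  assumes "cmod c \<le> M"
  obtains d d' where "cmod d = 1" "cmod d' = 1" "c = of_real (M / 2) * d + of_real (M / 2) * d'"
proof (cases "M = 0")
  case True
  then show thesis using assms by (intro that[of 1 1]) auto
next
  case False
  then have M: "M > 0" using assms norm_ge_zero[of c] by linarith
  define r where "r = cmod c / M"
  have r: "0 \<le> r" "r \<le> 1" using assms M by (auto simp: r_def)
  define w where "w = Complex r (sqrt (1 - r\<^sup>2))"
  have w: "cmod w = 1" using r by (simp add: w_def cmod_def power_le_one)
  have sum: "w + cnj w = of_real (2 * r)" by (simp add: w_def complex_eq_iff)
  define a where "a = (if c = 0 then 1 else sgn c)"
  have a: "cmod a = 1" by (simp add: a_def norm_sgn)
  have ca: "c = of_real (cmod c) * a" by (simp add: a_def sgn_eq)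
  have "of_real (M / 2) * (a * w) + of_real (M / 2) * (a * cnj w) = of_real (M / 2) * a * (w + cnj w)"
    by (simp add: algebra_simps)
  also have "\<dots> = of_real (cmod c) * a" using M by (simp add: sum r_def)
  finally have "c = of_real (M / 2) * (a * w) + of_real (M / 2) * (a * cnj w)" using ca by simp
  then show thesis using a w by (intro that[of "a * w" "a * cnj w"]) (auto simp: norm_mult)
qed

text \<open>
  Partial isometries with pairwise orthogonal domains and pairwise orthogonal ranges: a combination with
  unimodular coefficients is a partial isometry, and every coefficient of modulus at most \<open>M\<close> is the average of
  two coefficients of modulus \<open>M\<close>.
\<close>

lemma (in cstar_ring) ck_sum_norm_le:
  assumes fam: "ck_family {x. p x = 0} W sh tm nx mul U s"
    and F: "finite F" "\<And>u v. (u, v) \<in> F \<Longrightarrow> u \<in> W \<and> v \<in> W \<and> tm u = tm v"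
    and dist: "\<And>u v u' v'. \<lbrakk>(u, v) \<in> F; (u', v') \<in> F; (u, v) \<noteq> (u', v')\<rbrakk>
      \<Longrightarrow> v \<noteq> v' \<and> sh v = sh v' \<and> U u \<inter> U u' = {}"
    and c: "\<And>u v. (u, v) \<in> F \<Longrightarrow> cmod (c u v) \<le> M" and M: "0 \<le> M"
  shows "p (\<Sum>(u, v)\<in>F. c u v *\<^sub>C s u v) \<le> M"
proof -
  interpret f: ck_family "{x. p x = 0}" W sh tm nx mul U s by (rule fam)
  have uni: "p (\<Sum>(u, v)\<in>F. d u v *\<^sub>C s u v) \<le> 1"
    if d: "\<And>u v. (u, v) \<in> F \<Longrightarrow> cmod (d u v) = 1" for d
  proof -
    let ?T = "\<Sum>(u, v)\<in>F. d u v *\<^sub>C s u v" and ?e = "\<Sum>(u, v)\<in>F. s u u"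
    have diag: "(\<Sum>q\<in>F. if q = r then f q else 0) = f r" if "r \<in> F" for r and f :: "_ \<Rightarrow> 'a"
      using that F(1) by (simp add: sum.delta')
    have "adj ?T \<simeq> (\<Sum>(u, v)\<in>F. cnj (d u v) *\<^sub>C s v u)"
      unfolding adj_sum case_prod_beta adj_scC
      by (intro null.eqv_sum null.eqv_scC f.s_adj) (use F(2) in auto)
    then have "?T * adj ?T \<simeq> ?T * (\<Sum>(u, v)\<in>F. cnj (d u v) *\<^sub>C s v u)" by (intro null.eqv_mult) auto
    also have "\<dots> = (\<Sum>q\<in>F. \<Sum>r\<in>F. (d (fst q) (snd q) * cnj (d (fst r) (snd r))) *\<^sub>C (s (fst q) (snd q) * s (snd r) (fst r)))"
      by (simp add: sum_product split_def scC_mult mult_scC scC_scC mult.commute[of "cnj _"])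
    also have "\<dots> \<simeq> (\<Sum>q\<in>F. \<Sum>r\<in>F. if r = q then s (fst q) (fst q) else 0)"
    proof (intro null.eqv_sum)
      fix q r assume q: "q \<in> F" and r: "r \<in> F"
      obtain u v u' v' where uv: "q = (u, v)" "r = (u', v')" by fastforce
      have g: "f.good u v" "f.good v' u'" using F(2) q r uv by (auto simp: f.good_def)
      show "(d (fst q) (snd q) * cnj (d (fst r) (snd r))) *\<^sub>C (s (fst q) (snd q) * s (snd r) (fst r))
          \<simeq> (if r = q then s (fst q) (fst q) else 0)"
      proof (cases "r = q")
        case True
        have "d u v * cnj (d u v) = 1" using d[of u v] q uv by (simp add: complex_norm_square[symmetric])
        moreover have "s u v * s v u \<simeq> s u u" by (rule f.s_mult) (use F(2)[of u v] q uv in auto)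
        moreover have "u' = u" "v' = v" using True uv by auto
        ultimately show ?thesis by (simp only: uv fst_conv snd_conv scC_one HOL.simp_thms if_True)
      next
        case False
        then have "v \<noteq> v'" "sh v = sh v'" using dist[of u v u' v'] q r uv by auto
        then have "s u v * s v' u' \<simeq> 0" using f.gen_mult_cases[OF g] by simp
        from null.eqv_scC[OF this] False show ?thesis by (simp only: uv fst_conv snd_conv scC_zero_right if_False)
      qed
    qed
    also have "\<dots> = ?e" using diag by (simp add: case_prod_beta)
    finally have TT: "?T * adj ?T \<simeq> ?e" .
    have "?e * ?e = (\<Sum>q\<in>F. \<Sum>r\<in>F. s (fst q) (fst q) * s (fst r) (fst r))"
      by (simp add: sum_product split_def)
    also have "\<dots> \<simeq> (\<Sum>q\<in>F. \<Sum>r\<in>F. if r = q then s (fst q) (fst q) else 0)"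
    proof (intro null.eqv_sum)
      fix q r assume q: "q \<in> F" and r: "r \<in> F"
      obtain u v u' v' where uv: "q = (u, v)" "r = (u', v')" by fastforce
      show "s (fst q) (fst q) * s (fst r) (fst r) \<simeq> (if r = q then s (fst q) (fst q) else 0)"
      proof (cases "r = q")
        case True
        then have "u' = u" using uv by auto
        moreover have "s u u * s u u \<simeq> s u u" by (rule f.s_mult) (use F(2)[of u v] q uv in auto)
        ultimately show ?thesis using True by (simp only: uv fst_conv snd_conv HOL.simp_thms if_True)
      next
        case False
        then have "U u \<inter> U u' = {}" using dist[of u v u' v'] q r uv by auto
        then have "s u u * s u' u' \<simeq> 0" by (intro f.disjoint_orth) (use F(2)[of u v] F(2)[of u' v'] q r uv in auto)
        then show ?thesis using False by (simp only: uv fst_conv snd_conv if_False)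
      qed
    qed
    also have "\<dots> = ?e" using diag by (simp add: case_prod_beta)
    finally have "?e * ?e \<simeq> ?e" .
    moreover have "adj ?e \<simeq> ?e"
      unfolding adj_sum case_prod_beta by (intro null.eqv_sum f.s_adj) (use F(2) in auto)
    ultimately have "p ?e \<le> 1" by (intro projection_norm) (simp add: projection_def)
    moreover have "(p ?T)\<^sup>2 = p (?T * adj ?T)" using cstar[of "adj ?T"] by (simp add: adj_adj p_adj)
    ultimately have "(p ?T)\<^sup>2 \<le> 1" using p_cong[OF TT] by simp
    then show ?thesis by (simp add: abs_square_le_1 abs_le_iff)
  qed
  have "\<exists>d d'. cmod d = 1 \<and> cmod d' = 1 \<and> ((u, v) \<in> F \<longrightarrow>
    c u v = of_real (M / 2) * d + of_real (M / 2) * d')" for u v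
  proof (cases "(u, v) \<in> F")
    case True
    then show ?thesis using average_of_unimodular[OF c[OF True]] by metis
  next
    case False
    then show ?thesis by (intro exI[of _ 1]) simp
  qed
  then obtain d d' where d: "\<And>u v. cmod (d u v) = 1" "\<And>u v. cmod (d' u v) = 1"
    and eq: "\<And>u v. (u, v) \<in> F \<Longrightarrow> c u v = of_real (M / 2) * d u v + of_real (M / 2) * d' u v" by metis
  have "(\<Sum>(u, v)\<in>F. c u v *\<^sub>C s u v)
      = of_real (M / 2) *\<^sub>C (\<Sum>(u, v)\<in>F. d u v *\<^sub>C s u v) + of_real (M / 2) *\<^sub>C (\<Sum>(u, v)\<in>F. d' u v *\<^sub>C s u v)"
    unfolding scC_sum sum.distrib[symmetric]
    by (intro sum.cong) (auto simp: eq scC_scC simp flip: scC_left_add)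
  then have "p (\<Sum>(u, v)\<in>F. c u v *\<^sub>C s u v)
      \<le> cmod (of_real (M / 2)) * p (\<Sum>(u, v)\<in>F. d u v *\<^sub>C s u v)
        + cmod (of_real (M / 2)) * p (\<Sum>(u, v)\<in>F. d' u v *\<^sub>C s u v)"
    by (simp only: triangle flip: homogeneous)
  also have "\<dots> = M / 2 * p (\<Sum>(u, v)\<in>F. d u v *\<^sub>C s u v) + M / 2 * p (\<Sum>(u, v)\<in>F. d' u v *\<^sub>C s u v)"
    using M by (simp add: norm_of_real)
  also have "\<dots> \<le> M / 2 * 1 + M / 2 * 1"
    using M uni[OF d(1)] uni[OF d(2)] by (intro add_mono mult_left_mono) simp_all
  finally show ?thesis by simp
qed

text \<open>
  By induction on the shape. Distinct prolongations of the same word are orthogonal because their projections add up to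
  a projection; prolongations of distinct words are orthogonal because they lie below orthogonal projections.
\<close>

lemma (in cstar_ring) same_shape_orth:
  assumes fam: "ck_prefamily {x. p x = 0} W sh tm nxt mul U s"
    and fin: "\<And>e r. finite (nxt e r)"
    and split: "\<And>u k e. \<lbrakk>u \<in> W; e \<in> {(1, 0), (0, 1)}; sh u = k + e\<rbrakk>
      \<Longrightarrow> \<exists>u'\<in>W. \<exists>w\<in>nxt e (tm u'). sh u' = k \<and> u = mul u' w"
    and zero: "\<And>u v. \<lbrakk>u \<in> W; v \<in> W; sh u = 0; sh v = 0; u \<noteq> v\<rbrakk> \<Longrightarrow> s u u * s v v \<simeq> 0"
    and uv: "u \<in> W" "v \<in> W" "sh u = sh v" "u \<noteq> v"
  shows "s u u * s v v \<simeq> 0"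
proof -
  interpret f: ck_prefamily "{x. p x = 0}" W sh tm nxt mul U s by (rule fam)
  have idem: "s u u * s u u \<simeq> s u u" and self: "adj (s u u) \<simeq> s u u" if "u \<in> W" for u
    using that f.s_mult[of u u u] f.s_adj[of u u] by simp_all
  then have proj: "projection (s u u)" if "u \<in> W" for u using that by (simp add: projection_def)
  have siblings: "s (mul u w) (mul u w) * s (mul u w') (mul u w') \<simeq> 0"
    if e: "e \<in> {(1, 0), (0, 1)}" and u: "u \<in> W" and w: "w \<in> nxt e (tm u)" "w' \<in> nxt e (tm u)" "w \<noteq> w'" for e u w w'
    by (rule projections_orthogonal[where e = "\<lambda>w. s (mul u w) (mul u w)", OF fin proj proj[OF u] f.s_sum[OF e u u HOL.refl] w])
       (rule f.mul_closed[OF e u])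
  have absorb: "s u u * s (mul u w) (mul u w) \<simeq> s (mul u w) (mul u w)"
    if e: "e \<in> {(1, 0), (0, 1)}" and u: "u \<in> W" and w: "w \<in> nxt e (tm u)" for e u w
  proof -
    have "s u u * s (mul u w) (mul u w)
        \<simeq> (\<Sum>w'\<in>nxt e (tm u). s (mul u w') (mul u w')) * s (mul u w) (mul u w)"
      by (rule null.eqv_mult[OF f.s_sum[OF e u u HOL.refl] null.eqv_refl])
    also have "\<dots> = (\<Sum>w'\<in>nxt e (tm u). s (mul u w') (mul u w') * s (mul u w) (mul u w))"
      by (rule sum_distrib_right)
    also have "\<dots> \<simeq> (\<Sum>w'\<in>nxt e (tm u). if w' = w then s (mul u w) (mul u w) else 0)"
    proof (rule null.eqv_sum)
      fix w' assume w': "w' \<in> nxt e (tm u)"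
      show "s (mul u w') (mul u w') * s (mul u w) (mul u w) \<simeq> (if w' = w then s (mul u w) (mul u w) else 0)"
        using siblings[OF e u w' w] idem[OF f.mul_closed[OF e u w]] by simp
    qed
    also have "\<dots> = s (mul u w) (mul u w)" using fin w by (simp add: sum.delta)
    finally show ?thesis .
  qed
  have step: "s u u * s v v \<simeq> 0"
    if e: "e \<in> {(1, 0), (0, 1)}" and IH: "\<And>u v. \<lbrakk>u \<in> W; v \<in> W; sh u = k; sh v = k; u \<noteq> v\<rbrakk> \<Longrightarrow> s u u * s v v \<simeq> 0"
      and uv: "u \<in> W" "v \<in> W" "sh u = k + e" "sh v = k + e" "u \<noteq> v" for e k u v
  proof -
    obtain u' w where u': "u' \<in> W" "w \<in> nxt e (tm u')" "sh u' = k" "u = mul u' w" using split[OF uv(1) e uv(3)] by auto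
    obtain v' w' where v': "v' \<in> W" "w' \<in> nxt e (tm v')" "sh v' = k" "v = mul v' w'" using split[OF uv(2) e uv(4)] by auto
    show ?thesis
    proof (cases "u' = v'")
      case True
      have "w \<noteq> w'" using True uv(5) u'(4) v'(4) by auto
      then show ?thesis using siblings[OF e u'(1,2)] u' v' True by simp
    next
      case False
      have L: "s u u * s u' u' \<simeq> s u u"
      proof -
        have "s u u * s u' u' \<simeq> adj (s u u) * adj (s u' u')"
          using self u'(1) uv(1) by (intro null.eqv_mult null.eqv_sym[OF self]) auto
        also have "\<dots> = adj (s u' u' * s u u)" by (simp add: adj_mult)
        also have "\<dots> \<simeq> adj (s u u)" using null.eqv_adj[OF absorb[OF e u'(1,2)]] u'(4) by simp
        also have "\<dots> \<simeq> s u u" by (rule self[OF uv(1)])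
        finally show ?thesis .
      qed
      have R: "s v' v' * s v v \<simeq> s v v" using absorb[OF e v'(1,2)] v'(4) by simp
      have "s u u * s v v \<simeq> (s u u * s u' u') * (s v' v' * s v v)"
        by (rule null.eqv_mult[OF null.eqv_sym[OF L] null.eqv_sym[OF R]])
      also have "\<dots> = s u u * (s u' u' * s v' v') * s v v" by (simp only: mult.assoc)
      also have "\<dots> \<simeq> s u u * 0 * s v v"
        using IH[OF u'(1) v'(1) u'(3) v'(3) False] by (intro null.eqv_mult null.eqv_refl)
      finally show ?thesis by simp
    qed
  qed
  have row: "\<lbrakk>u \<in> W; v \<in> W; sh u = (m, 0); sh v = (m, 0); u \<noteq> v\<rbrakk> \<Longrightarrow> s u u * s v v \<simeq> 0" for m u v
  proof (induction m arbitrary: u v)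
    case 0
    then show ?case using zero[of u v] by (simp add: zero_prod_def)
  next
    case (Suc m)
    have "(Suc m, 0 :: nat) = (m, 0) + (1, 0)" by simp
    then have sh: "sh u = (m, 0) + (1, 0)" "sh v = (m, 0) + (1, 0)" using Suc.prems(3,4) by simp_all
    show ?case by (rule step[OF _ Suc.IH Suc.prems(1,2) sh Suc.prems(5)]) simp_all
  qed
  have "\<lbrakk>u \<in> W; v \<in> W; sh u = (m, n); sh v = (m, n); u \<noteq> v\<rbrakk> \<Longrightarrow> s u u * s v v \<simeq> 0" for m n u v
  proof (induction n arbitrary: u v)
    case 0
    then show ?case by (intro row)
  next
    case (Suc n)
    have "(m :: nat, Suc n) = (m, n) + (0, 1)" by simp
    then have sh: "sh u = (m, n) + (0, 1)" "sh v = (m, n) + (0, 1)" using Suc.prems(3,4) by simp_all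
    show ?case by (rule step[OF _ Suc.IH Suc.prems(1,2) sh Suc.prems(5)]) simp_all
  qed
  then show ?thesis using uv by (cases "sh v") simp
qed

section \<open>The boundary action as a crossed system\<close>

text \<open>
  Koenig's lemma, by repeated use of the pigeonhole principle; it supplies the compactness of the boundary
  in the form of accumulation points.
\<close>

lemma infinite_agreement:
  fixes c :: "nat \<Rightarrow> nat \<Rightarrow> 'l"
  assumes fin: "finite K" and c: "\<And>m i. c m i \<in> K"
  shows "\<exists>d. \<forall>n. infinite {m. \<forall>i<n. c m i = d i}"
proof -
  have step: "\<exists>M'. infinite M' \<and> M' \<subseteq> M \<and> (\<exists>v. \<forall>m\<in>M'. c m n = v)" if "infinite M" for M :: "nat set" and n
  proof -
    note inf = that
    have "finite ((\<lambda>m. c m n) ` M)" using fin c by (meson finite_subset image_subsetI)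
    from pigeonhole_infinite[OF inf this] obtain m0 where "infinite {m \<in> M. c m n = c m0 n}" ..
    then show ?thesis by (intro exI[of _ "{m \<in> M. c m n = c m0 n}"]) auto
  qed
  have "\<exists>M. \<forall>n. infinite (M n) \<and> (M (Suc n) \<subseteq> M n \<and> (\<exists>v. \<forall>m\<in>M (Suc n). c m n = v))"
  proof (rule dependent_nat_choice)
    show "\<exists>M :: nat set. infinite M" using infinite_UNIV_nat by (rule exI)
    fix M :: "nat set" and n assume "infinite M"
    from step[OF this, of n] show "\<exists>M'. infinite M' \<and> (M' \<subseteq> M \<and> (\<exists>v. \<forall>m\<in>M'. c m n = v))" by simp
  qed
  then obtain M where M: "\<forall>n. infinite (M n) \<and> (M (Suc n) \<subseteq> M n \<and> (\<exists>v. \<forall>m\<in>M (Suc n). c m n = v))" ..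
  then have "\<forall>n. \<exists>v. \<forall>m\<in>M (Suc n). c m n = v" by simp
  from choice[OF this] obtain d where d: "\<forall>n. \<forall>m\<in>M (Suc n). c m n = d n" ..
  have mono: "M n \<subseteq> M (Suc i)" if "i < n" for i n
    using lift_Suc_antimono_le[of M "Suc i" n] M that by simp
  have "infinite {m. \<forall>i<n. c m i = d i}" for n
  proof (rule infinite_super)
    show "M n \<subseteq> {m. \<forall>i<n. c m i = d i}"
    proof (intro subsetI CollectI allI impI)
      fix m i assume "m \<in> M n" "i < n"
      then have "m \<in> M (Suc i)" using mono by (rule_tac subsetD)
      then show "c m i = d i" using d by simp
    qed
  qed (simp add: M)
  then show ?thesis by (intro exI allI)
qed

context BM_data begin

lemma ends_accumulation:
  fixes y :: "nat \<Rightarrow> ('a, 'b) seq_pair"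
  assumes y: "\<And>m. y m \<in> ends"
  shows "\<exists>z\<in>ends. \<forall>n. infinite {m. agree n n (y m) z}"
proof -
  have mem: "(fst (y m) i, snd (y m) i) \<in> Some ` A \<times> Some ` B" for m i
  proof -
    have red: "T1.red (fst (y m))" "T2.red (snd (y m))" using ends_red[OF y[of m]] by (auto simp: red_pairs_def)
    have "fst (y m) i \<noteq> None" "snd (y m) i \<noteq> None" using y[of m] by (auto simp: ends_def)
    then obtain a b where ab: "fst (y m) i = Some a" "snd (y m) i = Some b" by fast
    then show ?thesis using T1.redD(2)[OF red(1) ab(1)] T2.redD(2)[OF red(2) ab(2)] by simp
  qed
  have "finite (Some ` A \<times> Some ` B)" using finite_A finite_B by simp
  from infinite_agreement[where c = "\<lambda>m i. (fst (y m) i, snd (y m) i)", OF this mem]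
  obtain d where d: "\<forall>n. infinite {m. \<forall>i<n. (fst (y m) i, snd (y m) i) = d i}" ..
  define z where "z = (\<lambda>i. fst (d i), \<lambda>i. snd (d i))"
  have eq: "{m. agree n n (y m) z} = {m. \<forall>i<n. (fst (y m) i, snd (y m) i) = d i}" for n
    by (auto simp: agree_def z_def prod_eq_iff)
  have inf: "infinite {m. agree n n (y m) z}" for n unfolding eq using d by (rule spec)
  have ex: "\<exists>m. agree n n (y m) z" for n using infinite_imp_nonempty[OF inf[of n]] by simp
  have z: "z \<in> ends"
  proof -
    have "fst z n \<noteq> None \<and> snd z n \<noteq> None \<and> (\<forall>a. fst z n = Some a \<longrightarrow> a \<in> A \<and> fst z (Suc n) \<noteq> Some (invA D a))
      \<and> (\<forall>b. snd z n = Some b \<longrightarrow> b \<in> B \<and> snd z (Suc n) \<noteq> Some (invB D b))" for n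
    proof -
      from ex[of "Suc (Suc n)"] obtain m where "agree (Suc (Suc n)) (Suc (Suc n)) (y m) z" ..
      then have eq: "fst z n = fst (y m) n" "fst z (Suc n) = fst (y m) (Suc n)"
        "snd z n = snd (y m) n" "snd z (Suc n) = snd (y m) (Suc n)" by (auto simp: agree_def)
      have red: "T1.red (fst (y m))" "T2.red (snd (y m))" using ends_red[OF y[of m]] by (auto simp: red_pairs_def)
      have "fst (y m) n \<noteq> None" "snd (y m) n \<noteq> None" using y[of m] by (auto simp: ends_def)
      then show ?thesis unfolding eq using T1.redD(2,3)[OF red(1)] T2.redD(2,3)[OF red(2)] by simp
    qed
    then have "T1.red (fst z) \<and> T2.red (snd z) \<and> (\<forall>n. fst z n \<noteq> None \<and> snd z n \<noteq> None)"
      unfolding T1.red_def T2.red_def by (simp del: not_None_eq)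
    then show ?thesis unfolding ends_def red_pairs_def by (simp add: mem_Times_iff del: not_None_eq)
  qed
  show ?thesis using inf by (intro bexI[OF _ z] allI)
qed

end

locale BM_boundary = BM_data D for D :: "('a, 'b) bm_data" +
  fixes x :: "('a, 'b) bm_elt"
  assumes x: "x \<in> carrier (bm_group D)"
begin

abbreviation X where "X \<equiv> boundary_topology D x"
abbreviation act where "act \<equiv> boundary_action D"

lemma cont_fun_near:
  assumes f: "f \<in> cont_fun X" and y: "y \<in> ends" and e: "e > 0"
  shows "\<exists>n. \<forall>y'\<in>ends. agree n n y y' \<longrightarrow> cmod (f (end_class y') - f (end_class y)) < e"
proof -
  have top: "topspace X = boundary D" by (rule topspace_boundary[OF x])
  let ?V = "{\<omega> \<in> topspace X. f \<omega> \<in> ball (f (end_class y)) e}"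
  have op: "openin X ?V"
    using f by (intro openin_continuous_map_preimage[of X euclidean]) (auto simp: cont_fun_def)
  have mem: "end_class y \<in> ?V" using y e by (simp add: top boundary_eq)
  from bspec[OF conjunct2[OF iffD1[OF openin_boundary_iff[OF x] op]] y, THEN mp, OF mem]
  obtain n where n: "\<forall>y'\<in>ends. agree n n y y' \<longrightarrow> end_class y' \<in> ?V" ..
  have "cmod (f (end_class y') - f (end_class y)) < e" if "y' \<in> ends" "agree n n y y'" for y'
  proof -
    have "end_class y' \<in> ?V" by (rule mp[OF bspec[OF n that(1)] that(2)])
    then have "dist (f (end_class y)) (f (end_class y')) < e" by simp
    then show ?thesis unfolding dist_norm norm_minus_commute[of "f (end_class y)"] .
  qed
  then show ?thesis by (intro exI[of _ n] ballI impI)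
qed

lemma cont_fun_uniform:
  assumes f: "f \<in> cont_fun X" and e: "e > 0"
  shows "\<exists>n. \<forall>y\<in>ends. \<forall>y'\<in>ends. agree n n y y' \<longrightarrow> cmod (f (end_class y) - f (end_class y')) < e"
proof (rule ccontr)
  assume "\<not> ?thesis"
  then have "\<forall>n. \<exists>y y'. y \<in> ends \<and> y' \<in> ends \<and> agree n n y y' \<and> \<not> cmod (f (end_class y) - f (end_class y')) < e"
    by blast
  then obtain y y' where yy: "\<And>n. y n \<in> ends" "\<And>n. y' n \<in> ends" "\<And>n. agree n n (y n) (y' n)"
    "\<And>n. \<not> cmod (f (end_class (y n)) - f (end_class (y' n))) < e" by metis
  obtain z where z: "z \<in> ends" "\<And>n. infinite {m. agree n n (y m) z}"
    using ends_accumulation[of y] yy(1) by blast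
  have "e / 2 > 0" using e by simp
  then obtain n where n: "\<And>y'. \<lbrakk>y' \<in> ends; agree n n z y'\<rbrakk> \<Longrightarrow> cmod (f (end_class y') - f (end_class z)) < e / 2"
    using cont_fun_near[OF f z(1)] by blast
  obtain m where m: "m \<ge> n" "agree n n (y m) z"
    using z(2)[of n] unfolding infinite_nat_iff_unbounded_le by auto
  have 1: "cmod (f (end_class (y m)) - f (end_class z)) < e / 2"
    using n[OF yy(1)] agree_sym[OF m(2)] by blast
  have "agree n n z (y' m)"
    using agree_trans[OF agree_sym[OF m(2)] agree_mono[OF yy(3)[of m] m(1) m(1)]] .
  then have 2: "cmod (f (end_class (y' m)) - f (end_class z)) < e / 2" using n[OF yy(2)] by blast
  have "cmod (f (end_class (y m)) - f (end_class (y' m))) < e"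
    using norm_triangle_lt[of "f (end_class (y m)) - f (end_class z)" "f (end_class z) - f (end_class (y' m))" e] 1 2
    by (simp add: norm_minus_commute)
  then show False using yy(4) by blast
qed

lemma cont_fun_bounded:
  assumes f: "f \<in> cont_fun X"
  shows "\<exists>M. \<forall>\<omega>. cmod (f \<omega>) \<le> M"
proof (rule ccontr)
  assume no: "\<not> ?thesis"
  have top: "topspace X = boundary D" by (rule topspace_boundary[OF x])
  have "\<exists>y\<in>ends. cmod (f (end_class y)) > real m" for m :: nat
  proof -
    obtain \<omega> where \<omega>: "cmod (f \<omega>) > real m" using no by (meson not_le)
    then have "\<omega> \<in> topspace X" using f by (auto simp: cont_fun_def)
    then show ?thesis using \<omega> top by (auto simp: boundary_eq)
  qed
  then obtain y where y: "\<And>m. y m \<in> ends" "\<And>m. cmod (f (end_class (y m))) > real m" by metis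
  obtain z where z: "z \<in> ends" "\<And>n. infinite {m. agree n n (y m) z}"
    using ends_accumulation[of y] y(1) by blast
  obtain n where n: "\<And>y'. \<lbrakk>y' \<in> ends; agree n n z y'\<rbrakk> \<Longrightarrow> cmod (f (end_class y') - f (end_class z)) < 1"
    using cont_fun_near[OF f z(1), of 1] by auto
  obtain m where m: "m \<ge> nat \<lceil>cmod (f (end_class z)) + 1\<rceil>" "agree n n (y m) z"
    using z(2)[of n] unfolding infinite_nat_iff_unbounded_le by auto
  have "cmod (f (end_class (y m))) \<le> cmod (f (end_class z)) + cmod (f (end_class (y m)) - f (end_class z))"
    using norm_triangle_sub[of "f (end_class (y m))" "f (end_class z)"] by simp
  also have "\<dots> < cmod (f (end_class z)) + 1" using n[OF y(1)] agree_sym[OF m(2)] by simp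
  also have "\<dots> \<le> real m" using m(1) by linarith
  finally show False using y(2)[of m] by linarith
qed

lemma act_boundary: "\<lbrakk>g \<in> carrier \<Gamma>; \<omega> \<in> boundary D\<rbrakk> \<Longrightarrow> act g \<omega> \<in> boundary D"
  by (auto simp: boundary_eq boundary_action_eq gact_ends)

lemma act_continuous_map:
  assumes g: "g \<in> carrier \<Gamma>"
  shows "continuous_map X X (act g)"
proof -
  have top: "topspace X = boundary D" by (rule topspace_boundary[OF x])
  obtain N where N: "\<And>z z' m n. \<lbrakk>z \<in> red_pairs; z' \<in> red_pairs; agree (m + N) (n + N) z z'\<rbrakk>
    \<Longrightarrow> agree m n (gact g z) (gact g z')" using agree_translate[OF g] by blast
  have "openin X {\<omega> \<in> boundary D. act g \<omega> \<in> V}" if V: "openin X V" for V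
    unfolding openin_boundary_iff[OF x]
  proof (intro conjI ballI impI)
    fix y assume y: "y \<in> ends" "end_class y \<in> {\<omega> \<in> boundary D. act g \<omega> \<in> V}"
    then have "end_class (gact g y) \<in> V" using g by (simp add: boundary_action_eq)
    then obtain n where n: "\<And>y'. \<lbrakk>y' \<in> ends; agree n n (gact g y) y'\<rbrakk> \<Longrightarrow> end_class y' \<in> V"
      using openin_boundary_iff[OF x, of V] V gact_ends[OF g y(1)] by metis
    have "end_class y' \<in> {\<omega> \<in> boundary D. act g \<omega> \<in> V}" if "y' \<in> ends" "agree (n + N) (n + N) y y'" for y'
      using n[OF gact_ends[OF g that(1)]] N[OF ends_red[OF y(1)] ends_red[OF that(1)] that(2)] that g
      by (simp add: boundary_action_eq boundary_eq)
    then show "\<exists>n. \<forall>y'\<in>ends. agree n n y y' \<longrightarrow> end_class y' \<in> {\<omega> \<in> boundary D. act g \<omega> \<in> V}" by blast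
  qed auto
  then show ?thesis unfolding continuous_map_def top using act_boundary[OF g] by auto
qed

sublocale crossed_system \<Gamma> X act
proof
  have top: "topspace X = boundary D" by (rule topspace_boundary[OF x])
  fix g h \<omega> assume g: "g \<in> carrier \<Gamma>"
  show "\<omega> \<in> topspace X \<Longrightarrow> act g \<omega> \<in> topspace X" using act_boundary g top by simp
  show "h \<in> carrier \<Gamma> \<Longrightarrow> \<omega> \<in> topspace X \<Longrightarrow> act (g \<cdot> h) \<omega> = act g (act h \<omega>)"
    using g by (auto simp: top boundary_eq boundary_action_eq gact_ends gact_mult ends_red)
  show "continuous_map X X (act g)" by (rule act_continuous_map[OF g])
next
  fix \<omega> assume "\<omega> \<in> topspace X"
  then show "act unit \<omega> = \<omega>"
    by (auto simp: topspace_boundary[OF x] boundary_eq boundary_action_eq gact_one ends_red)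
qed (rule cont_fun_bounded)

section \<open>Words as rectangles of tiles\<close>

abbreviation M1 where "M1 \<equiv> trans1 D"
abbreviation M2 where "M2 \<equiv> trans2 D"
abbreviation W where "W \<equiv> ck_words R M1 M2"

definition word :: "('a, 'b) seq_pair \<Rightarrow> nat \<Rightarrow> nat \<Rightarrow> ('a, 'b) tile ck_word" where
  "word z i j = ((i, j), \<lambda>l\<in>{(0, 0)..(i, j)}. tl (pos z (fst l) (snd l)))"

lemma mem_rectangle: "(k, l) \<in> {(0::nat, 0::nat)..(i, j)} \<longleftrightarrow> k \<le> i \<and> l \<le> j"
  by (auto simp: less_eq_prod_def)

lemma word_shape_word [simp]: "word_shape (word z i j) = (i, j)"
  and word_origin_word [simp]: "word_origin (word z i j) = tl z"
  and word_end_word [simp]: "word_end (word z i j) = tl (pos z i j)"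
proof -
  show "word_shape (word z i j) = (i, j)" by (simp add: word_def word_shape_def)
  then show "word_end (word z i j) = tl (pos z i j)" unfolding word_end_def by (simp add: word_def mem_rectangle)
  show "word_origin (word z i j) = tl z" unfolding word_origin_def by (simp add: word_def mem_rectangle)
qed

lemma snd_word: "k \<le> i \<Longrightarrow> l \<le> j \<Longrightarrow> snd (word z i j) (k, l) = tl (pos z k l)"
  by (simp add: word_def mem_rectangle)

lemma trans_right:
  assumes z: "z \<in> ends"
  shows "M1 (tl (right z)) (tl z) = 1"
proof -
  obtain a b b' a' where tl: "tl z = (a, b, b', a')" by (rule prod_cases4)
  obtain c d d' c' where tl': "tl (right z) = (c, d, d', c')" by (rule prod_cases4)
  note m = tl_moves[OF z tl] and m' = tl_moves[OF right_ends[OF z] tl']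
  have red: "T1.red (fst z)" using ends_red[OF z] by (auto simp: red_pairs_def)
  have "fst (right z) 0 = fst z (Suc 0)" by (simp add: right_eq[OF z])
  then have "c \<noteq> invA D a"
    using T1.redD(3)[OF red ends_head(1)[OF z]] ends_head(1)[OF right_ends[OF z]] m(1) m'(1) by auto
  then show ?thesis using m(3) m'(2) by (simp add: tl tl' trans1_def)
qed

lemma trans_up:
  assumes z: "z \<in> ends"
  shows "M2 (tl (up z)) (tl z) = 1"
proof -
  obtain a b b' a' where tl: "tl z = (a, b, b', a')" by (rule prod_cases4)
  obtain c d d' c' where tl': "tl (up z) = (c, d, d', c')" by (rule prod_cases4)
  note m = tl_moves[OF z tl] and m' = tl_moves[OF up_ends[OF z] tl']
  have red: "T2.red (snd z)" using ends_red[OF z] by (auto simp: red_pairs_def)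
  have "snd (up z) 0 = snd z (Suc 0)" by (simp add: up_eq[OF z])
  then have d': "d' \<noteq> invB D b'"
    using T2.redD(3)[OF red ends_head(2)[OF z]] ends_head(2)[OF up_ends[OF z]] m(2) m'(2) by auto
  have "(a', invB D b, invB D b', a) \<in> R" using R_symmetric[OF m(5)] by simp
  \<comment> \<open>Backtracking along the right edges is the same as backtracking along the left ones.\<close>
  from tile_unique(1)[OF m'(5) this] have "d \<noteq> invB D b" using m(4) m'(1) d' by auto
  then show ?thesis using m(4) m'(1) by (simp add: tl tl' trans2_def)
qed

lemma word_in: "z \<in> ends \<Longrightarrow> word z i j \<in> ck_words_of_shape R M1 M2 (i, j)"
proof -
  assume z: "z \<in> ends"
  have "M1 (snd (word z i j) (l + (1, 0))) (snd (word z i j) l) = 1" if "l + (1, 0) \<le> (i, j)" for l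
  proof -
    obtain k m where l: "l = (k, m)" by fastforce
    then show ?thesis using that trans_right[OF pos_ends[OF z, of k m]] by (simp add: snd_word right_pos)
  qed
  moreover have "M2 (snd (word z i j) (l + (0, 1))) (snd (word z i j) l) = 1" if "l + (0, 1) \<le> (i, j)" for l
  proof -
    obtain k m where l: "l = (k, m)" by fastforce
    then show ?thesis using that trans_up[OF pos_ends[OF z, of k m]] z by (simp add: snd_word up_pos)
  qed
  ultimately show ?thesis
    using tl_R pos_ends[OF z] by (auto simp: ck_words_of_shape_def word_def)
qed

lemma word_W: "z \<in> ends \<Longrightarrow> word z i j \<in> W"
  using word_in[of z i j] unfolding ck_words_def by (rule UN_I[OF UNIV_I])

text \<open>
  Every word extends to an end: continue its bottom row and its left column by constant sequences. The tiles of
  the sector are then determined one after the other by their bottom and left edges.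
\<close>

lemma word_ex:
  assumes w: "w \<in> ck_words_of_shape R M1 M2 (i, j)"
  obtains z where "z \<in> ends" "w = word z i j"
proof -
  obtain t where wt: "w = ((i, j), t)" and t: "t \<in> {(0, 0)..(i, j)} \<rightarrow>\<^sub>E R"
    and h: "\<And>l. l + (1, 0) \<le> (i, j) \<Longrightarrow> M1 (t (l + (1, 0))) (t l) = 1"
    and v: "\<And>l. l + (0, 1) \<le> (i, j) \<Longrightarrow> M2 (t (l + (0, 1))) (t l) = 1"
    using w by (auto simp: ck_words_of_shape_def)
  have tR: "t (k, l) \<in> R" if "k \<le> i" "l \<le> j" for k l using t that by (auto simp: mem_rectangle)
  define ha where "ha k l = fst (t (k, l))" for k l
  define hb' where "hb' k l = fst (snd (snd (t (k, l))))" for k l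
  have tA: "ha k l \<in> A" "hb' k l \<in> B" if "k \<le> i" "l \<le> j" for k l
    using tR[OF that] R_subset by (auto simp: ha_def hb'_def)
  have M1: "hb' (Suc k) l = fst (snd (t (k, l))) \<and> ha (Suc k) l \<noteq> invA D (ha k l)" if "Suc k \<le> i" "l \<le> j" for k l
    using h[of "(k, l)"] that by (auto simp: trans1_def ha_def hb'_def split: prod.splits if_splits)
  have M2: "ha k (Suc l) = snd (snd (snd (t (k, l)))) \<and> fst (snd (t (k, Suc l))) \<noteq> invB D (fst (snd (t (k, l))))"
    if "k \<le> i" "Suc l \<le> j" for k l
    using v[of "(k, l)"] that by (auto simp: trans2_def ha_def split: prod.splits if_splits)
  have M2': "hb' k (Suc l) \<noteq> invB D (hb' k l)" if "k \<le> i" "Suc l \<le> j" for k l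
  proof
    assume eq: "hb' k (Suc l) = invB D (hb' k l)"
    obtain a b b' a' where r: "t (k, l) = (a, b, b', a')" by (metis prod_cases4)
    obtain c d d' c' where s: "t (k, Suc l) = (c, d, d', c')" by (metis prod_cases4)
    have "(a, b, b', a') \<in> R" "(c, d, d', c') \<in> R" using tR[of k l] tR[of k "Suc l"] that r s by auto
    moreover from this have "(a', invB D b, invB D b', a) \<in> R" using R_symmetric by blast
    ultimately have "d = invB D b" using tile_unique(2)[of c d d' c'] M2[OF that] eq r s by (auto simp: ha_def hb'_def)
    then show False using M2[OF that] r s by simp
  qed
  define z where "z = (\<lambda>k. Some (ha (min k i) 0), \<lambda>l. Some (hb' 0 (min l j)))"
  have "ha (min (Suc k) i) 0 \<noteq> invA D (ha (min k i) 0)" for k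
  proof (cases "Suc k \<le> i")
    case True
    then show ?thesis using M1[of k 0] by (simp add: min_def)
  next
    case False
    then show ?thesis using invA[OF tA(1)[of i 0]] by (metis le_refl min.absorb2 not_less_eq_eq le_SucI zero_le)
  qed
  moreover have "hb' 0 (min (Suc l) j) \<noteq> invB D (hb' 0 (min l j))" for l
  proof (cases "Suc l \<le> j")
    case True
    then show ?thesis using M2'[of 0 l] by (simp add: min_def)
  next
    case False
    then show ?thesis using invB[OF tA(2)[of 0 j]] by (metis le_refl min.absorb2 not_less_eq_eq le_SucI zero_le)
  qed
  ultimately have z: "z \<in> ends"
    using tA by (auto simp: z_def ends_def red_pairs_def T1.red_def T2.red_def)
  have tile: "tl (pos z k l) = t (k, l)"
    if "a0 (pos z k l) = ha k l" "b0 (pos z k l) = hb' k l" "k \<le> i" "l \<le> j" for k l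
  proof -
    obtain a b b' a' where r: "t (k, l) = (a, b, b', a')" by (metis prod_cases4)
    then have "(a, b, b', a') \<in> R" using tR[OF that(3,4)] by simp
    from tl_eq_iff[OF pos_ends[OF z] this] show ?thesis using that r by (simp add: ha_def hb'_def)
  qed
  have a_next: "a0 (pos z k (Suc l)) = ha k (Suc l)" if "tl (pos z k l) = t (k, l)" "k \<le> i" "Suc l \<le> j" for k l
  proof -
    obtain a b b' a' where r: "t (k, l) = (a, b, b', a')" by (metis prod_cases4)
    from tl_moves(4)[OF pos_ends[OF z, of k l]] r that(1) have "a0 (up (pos z k l)) = a'" by simp
    then show ?thesis using M2[OF that(2,3)] r by (simp add: up_pos[OF z])
  qed
  have b_next: "b0 (pos z (Suc k) l) = hb' (Suc k) l" if "tl (pos z k l) = t (k, l)" "Suc k \<le> i" "l \<le> j" for k l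
  proof -
    obtain a b b' a' where r: "t (k, l) = (a, b, b', a')" by (metis prod_cases4)
    from tl_moves(3)[OF pos_ends[OF z, of k l]] r that(1) have "b0 (right (pos z k l)) = b" by simp
    then show ?thesis using M1[OF that(2,3)] r by (simp add: right_pos)
  qed
  have row: "a0 (pos z k 0) = ha k 0" if "k \<le> i" for k
    using fst_pos_row[OF z, of k] that by (simp add: a0_def z_def)
  have col: "b0 (pos z 0 l) = hb' 0 l" if "l \<le> j" for l
    using snd_pos_column[OF z, of l] that by (simp add: b0_def z_def)
  have all: "k \<le> i \<longrightarrow> l \<le> j \<longrightarrow> tl (pos z k l) = t (k, l)" for k l
  proof (induction k arbitrary: l)
    case 0
    show ?case
    proof (induction l)
      case 0
      show ?case using tile[of 0 0] row[of 0] col[of 0] by simp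
    next
      case (Suc l)
      then show ?case using tile[of 0 "Suc l"] a_next[of 0 l] col[of "Suc l"] by simp
    qed
  next
    case (Suc k)
    note IH = Suc
    show ?case
    proof (induction l)
      case 0
      show ?case using tile[of "Suc k" 0] row[of "Suc k"] b_next[of k 0] IH[of 0] by simp
    next
      case (Suc l)
      then show ?case using tile[of "Suc k" "Suc l"] a_next[of "Suc k" l] b_next[of k "Suc l"] IH[of "Suc l"] by simp
    qed
  qed
  have "t l = (\<lambda>l\<in>{(0, 0)..(i, j)}. tl (pos z (fst l) (snd l))) l" for l
    using all t by (cases l) (auto simp: mem_rectangle restrict_def PiE_def extensional_def)
  then have "w = word z i j" by (auto simp: wt word_def)
  then show thesis using that z by blast
qed

lemma W_cases:
  assumes "w \<in> W"
  obtains z i j where "z \<in> ends" "w = word z i j"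
proof -
  obtain i j where "w \<in> ck_words_of_shape R M1 M2 (i, j)" using assms by (auto simp: ck_words_def)
  then show thesis by (elim word_ex) (rule that)
qed

lemma word_eq_iff:
  assumes z: "z \<in> ends" and z': "z' \<in> ends"
  shows "word z i j = word z' i' j' \<longleftrightarrow> i = i' \<and> j = j' \<and> agree (Suc i) (Suc j) z z'"
proof
  assume eq: "word z i j = word z' i' j'"
  then have ij: "i' = i" "j' = j" by (auto simp: word_def)
  have tl: "tl (pos z k l) = tl (pos z' k l)" if "k \<le> i" "l \<le> j" for k l
    using arg_cong[OF eq, of "\<lambda>w. snd w (k, l)"] that by (simp add: snd_word ij)
  have "fst z k = fst z' k" if "k < Suc i" for k
    using agree_a0[OF tl_eqD[OF pos_ends[OF z] pos_ends[OF z'] tl[of k 0]]] that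
      ends_head(1)[OF pos_ends[OF z, of k 0]] ends_head(1)[OF pos_ends[OF z', of k 0]]
    by (simp add: fst_pos_row z z')
  moreover have "snd z l = snd z' l" if "l < Suc j" for l
    using agree_b0[OF tl_eqD[OF pos_ends[OF z] pos_ends[OF z'] tl[of 0 l]]] that
      ends_head(2)[OF pos_ends[OF z, of 0 l]] ends_head(2)[OF pos_ends[OF z', of 0 l]]
    by (simp add: snd_pos_column z z')
  ultimately show "i = i' \<and> j = j' \<and> agree (Suc i) (Suc j) z z'" using ij by (simp add: agree_def)
next
  assume a: "i = i' \<and> j = j' \<and> agree (Suc i) (Suc j) z z'"
  then have "tl (pos z k l) = tl (pos z' k l)" if "k \<le> i" "l \<le> j" for k l
    using tl_pos_cong[OF z z', of k l] agree_mono[of "Suc i" "Suc j" z z' "Suc k" "Suc l"] that a by simp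
  then show "word z i j = word z' i' j'" using a by (auto simp: word_def mem_rectangle intro!: restrict_ext)
qed

text \<open>The base vertex of the last tile of a word, when the rectangle is placed at \<open>x\<close>.\<close>

definition base :: "('a, 'b) tile ck_word \<Rightarrow> ('a, 'b) bm_elt" where
  "base w = (let z = SOME z. z \<in> ends \<and> w = word z (fst (fst w)) (snd (fst w))
     in x \<cdot> vert z (fst (fst w)) (snd (fst w)))"

lemma base_word: "z \<in> ends \<Longrightarrow> base (word z i j) = x \<cdot> vert z i j"
proof -
  assume z: "z \<in> ends"
  have sh: "fst (word z i j) = (i, j)" by (simp add: word_def)
  define z' where "z' = (SOME z'. z' \<in> ends \<and> word z i j = word z' i j)"
  have "z' \<in> ends \<and> word z i j = word z' i j"
    unfolding z'_def by (rule someI[of _ z]) (simp add: z)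
  then have z': "z' \<in> ends" "agree (Suc i) (Suc j) z z'" using word_eq_iff[OF z, of z' i j i j] by simp_all
  then have "vert z i j = vert z' i j" using vert_cong[OF z z'(1)] agree_mono[OF z'(2), of i j] by simp
  then show ?thesis by (simp add: base_def sh z'_def)
qed

lemma base_closed: "w \<in> W \<Longrightarrow> base w \<in> carrier \<Gamma>"
  using x by (elim W_cases) (simp add: base_word)

definition U :: "('a, 'b) tile ck_word \<Rightarrow> ('a, 'b) seq_pair set" where
  "U w = {y \<in> ends. tl (gact (ginv (base w)) y) = word_end w}"

text \<open>
  One direction is the rigidity of rectangles, the other says that moving along the sector of \<open>y\<close> meets its tiles.
\<close>

lemma tl_translate_iff:
  assumes z: "z \<in> ends" and y: "y \<in> ends"
  shows "tl (gact (ginv (vert z i j)) y) = tl (pos z i j) \<longleftrightarrow> agree (Suc i) (Suc j) y z"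
proof
  assume "tl (gact (ginv (vert z i j)) y) = tl (pos z i j)"
  from agree_transport[OF z _ this] show "agree (Suc i) (Suc j) y z"
    using y z by (simp add: gact_ends gact_inv_cancel ends_red)
next
  assume ag: "agree (Suc i) (Suc j) y z"
  have "agree i j y z" by (rule agree_mono[OF ag]) simp_all
  from vert_cong[OF y z this] have "vert y i j = vert z i j" .
  then have "gact (ginv (vert z i j)) y = pos y i j" using pos_vert[OF y, of i j] by simp
  then show "tl (gact (ginv (vert z i j)) y) = tl (pos z i j)" using tl_pos_cong[OF y z ag] by simp
qed

text \<open>
  By homogeneity an end lies in the cylinder set of \<open>w\<close>, defined by the last tile of \<open>w\<close> alone, iff its sector at \<open>x\<close>
  starts with the whole rectangle \<open>w\<close>.
\<close>

lemma U_word: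
  assumes z: "z \<in> ends" and y: "y \<in> ends"
  shows "y \<in> U (word z i j) \<longleftrightarrow> agree (Suc i) (Suc j) (gact (ginv x) y) z"
proof -
  let ?y = "gact (ginv x) y"
  have y': "?y \<in> ends" using x y by (simp add: gact_ends)
  have p: "gact (ginv (base (word z i j))) y = gact (ginv (vert z i j)) ?y"
    using x y z by (simp add: base_word \<Gamma>.inv_mult_group gact_mult ends_red)
  show ?thesis using y tl_translate_iff[OF z y', of i j] by (simp add: U_def p)
qed

lemma U_word_iff:
  assumes z: "z \<in> ends" and y: "y \<in> ends"
  shows "y \<in> U (word z i j) \<longleftrightarrow> word (gact (ginv x) y) i j = word z i j"
proof -
  have "gact (ginv x) y \<in> ends" using x y by (simp add: gact_ends)
  then show ?thesis unfolding U_word[OF z y] by (subst word_eq_iff) (simp_all add: z)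
qed

lemma U_nonempty: "w \<in> W \<Longrightarrow> U w \<noteq> {}"
proof (elim W_cases)
  fix z i j assume z: "z \<in> ends" and w: "w = word z i j"
  have "gact x z \<in> U w" using U_word[OF z gact_ends[OF x z], of i j] x z w by (simp add: gact_inv_cancel ends_red)
  then show ?thesis by blast
qed

lemma U_disjoint: "\<lbrakk>v \<in> W; w \<in> W; word_shape v = word_shape w; v \<noteq> w\<rbrakk> \<Longrightarrow> U v \<inter> U w = {}"
proof (elim W_cases)
  fix z i j z' i' j'
  assume *: "word_shape v = word_shape w" "v \<noteq> w" "z \<in> ends" "v = word z i j" "z' \<in> ends" "w = word z' i' j'"
  have "v = w" if "y \<in> U v" "y \<in> U w" for y
  proof -
    have "y \<in> ends" using that by (simp add: U_def)
    then show ?thesis using that * U_word_iff[of z y i j] U_word_iff[of z' y i' j'] by simp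
  qed
  then show ?thesis using * by blast
qed

text \<open>The last tile, put in its position, forces the rectangle behind it.\<close>

lemma base_end_inj:
  assumes "v \<in> W" "w \<in> W" "base v = base w" "word_end v = word_end w"
  shows "v = w"
proof -
  obtain z i j where z: "z \<in> ends" "v = word z i j" using assms W_cases by blast
  obtain z' i' j' where z': "z' \<in> ends" "w = word z' i' j'" using assms W_cases by blast
  have "vert z i j = vert z' i' j'" using assms(3) x z z' by (simp add: base_word)
  from vert_eqD[OF z(1) z'(1) this] have ij: "i' = i" "j' = j" by auto
  have veq: "vert z i j = vert z' i j" using \<open>vert z i j = vert z' i' j'\<close> ij by simp
  have "tl (pos z' i j) = tl (pos z i j)" using assms(4) z z' ij by simp
  from agree_transport[OF z(1) pos_ends[OF z'(1)] this]
  have "agree (Suc i) (Suc j) z' z" using vert_pos[OF z'(1), of i j] by (simp add: veq)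
  then show ?thesis using word_eq_iff[OF z(1) z'(1)] z z' ij agree_sym by blast
qed

section \<open>Prolongation of words\<close>

lemma prolong_end:
  assumes z: "z \<in> ends" and y: "y \<in> ends" and eq: "tl y = tl (pos z i j)"
  shows "\<exists>z'\<in>ends. agree (Suc i) (Suc j) z z' \<and> pos z' i j = y"
proof (intro bexI conjI)
  let ?z = "gact (vert z i j) y"
  show z': "?z \<in> ends" using z y by (simp add: gact_ends)
  show ag: "agree (Suc i) (Suc j) z ?z" using agree_sym[OF agree_transport[OF z y eq]] .
  have "agree i j z ?z" by (rule agree_mono[OF ag]) simp_all
  from vert_cong[OF z z' this] show "pos ?z i j = y" using pos_vert[OF z', of i j] y z by (simp add: gact_inv_cancel ends_red)
qed

lemma step_word:
  assumes e: "(e1, e2) \<in> {(1, 0), (0, 1)}" and z: "z \<in> ends"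
    and w: "w \<in> W" "word_shape w = (e1, e2)" "word_origin w = tl (pos z i j)"
  shows "\<exists>z'\<in>ends. agree (Suc i) (Suc j) z z' \<and> w = word (pos z' i j) e1 e2"
proof -
  obtain y where y: "y \<in> ends" "w = word y e1 e2" using w(1,2) by (elim W_cases) auto
  then have "tl y = tl (pos z i j)" using w(3) by simp
  from prolong_end[OF z y(1) this] show ?thesis using y by blast
qed

text \<open>
  All products that are needed arise from one end that prolongs both factors; uniqueness of the product is then
  uniqueness of the rectangle behind the last tile.
\<close>

lemma word_mult_word:
  assumes e: "(e1, e2) \<in> {(1, 0), (0, 1)}" and z: "z \<in> ends"
  shows "word_mult R M1 M2 (word z i j) (word (pos z i j) e1 e2) = word z (i + e1) (j + e2)"
  unfolding word_mult_def
proof (rule the_equality)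
  let ?u = "word z i j" and ?w = "word (pos z i j) e1 e2"
  have end_eq: "word_end ?w = tl (pos z (i + e1) (j + e2))" by (simp add: pos_pos z)
  show "word z (i + e1) (j + e2) \<in> ck_words_of_shape R M1 M2 (word_shape ?u + word_shape ?w) \<and>
    (\<forall>l\<in>{(0, 0)..word_shape ?u}. snd (word z (i + e1) (j + e2)) l = snd ?u l) \<and>
    snd (word z (i + e1) (j + e2)) (word_shape ?u) = word_origin ?w \<and>
    snd (word z (i + e1) (j + e2)) (word_shape ?u + word_shape ?w) = word_end ?w"
    using word_in[OF z, of "i + e1" "j + e2"] end_eq by (auto simp: snd_word less_eq_prod_def)
  fix v assume v: "v \<in> ck_words_of_shape R M1 M2 (word_shape ?u + word_shape ?w) \<and>
    (\<forall>l\<in>{(0, 0)..word_shape ?u}. snd v l = snd ?u l) \<and>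
    snd v (word_shape ?u) = word_origin ?w \<and> snd v (word_shape ?u + word_shape ?w) = word_end ?w"
  then have "v \<in> ck_words_of_shape R M1 M2 (i + e1, j + e2)" by simp
  then obtain z' where z': "z' \<in> ends" "v = word z' (i + e1) (j + e2)" by (rule word_ex)
  have "tl (pos z' k l) = tl (pos z k l)" if "k \<le> i" "l \<le> j" for k l
  proof -
    have "snd v (k, l) = snd ?u (k, l)" using v that by (auto simp: mem_rectangle)
    then show ?thesis using that by (simp add: z' snd_word)
  qed
  then have "word z' i j = word z i j" by (auto simp: word_def mem_rectangle intro!: restrict_ext)
  then have ag: "agree (Suc i) (Suc j) z' z" using word_eq_iff[OF z'(1) z] by simp
  have tl: "tl (pos z' (i + e1) (j + e2)) = tl (pos z (i + e1) (j + e2))"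
    using v end_eq by (simp add: z' snd_word)
  have "i + e1 \<le> Suc i" "j + e2 \<le> Suc j" using e by auto
  from vert_cong[OF z'(1) z agree_mono[OF ag this]]
  have "vert z' (i + e1) (j + e2) = vert z (i + e1) (j + e2)" .
  then have "agree (Suc (i + e1)) (Suc (j + e2)) z' z"
    using agree_transport[OF z pos_ends[OF z'(1)] tl] vert_pos[OF z'(1), of "i + e1" "j + e2"] by simp
  then show "v = word z (i + e1) (j + e2)" using word_eq_iff[OF z'(1) z] z' by simp
qed

lemma prolong_word:
  assumes e: "e \<in> {(1, 0), (0, 1)}" and u: "u \<in> W"
    and w: "w \<in> W" "word_shape w = e" "word_origin w = word_end u"
  obtains z i j e1 e2 where "z \<in> ends" "e = (e1, e2)" "u = word z i j" "w = word (pos z i j) e1 e2"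
    "word_mult R M1 M2 u w = word z (i + e1) (j + e2)"
proof -
  obtain z i j where z: "z \<in> ends" "u = word z i j" using u W_cases by blast
  obtain e1 e2 where ee: "e = (e1, e2)" by fastforce
  obtain z' where z': "z' \<in> ends" "agree (Suc i) (Suc j) z z'" "w = word (pos z' i j) e1 e2"
    using step_word[of e1 e2 z w i j] e ee z w by auto
  have "u = word z' i j" using word_eq_iff[OF z(1) z'(1), of i j i j] z z' by simp
  then show thesis using that[OF z'(1) ee _ z'(3)] word_mult_word[of e1 e2 z' i j] e ee z' by simp
qed

section \<open>The partial isometries in the crossed product\<close>

abbreviation mul where "mul \<equiv> word_mult R M1 M2"
abbreviation S where "S \<equiv> ck_generators R M1 M2"

definition steps :: "nat \<times> nat \<Rightarrow> ('a, 'b) tile \<Rightarrow> ('a, 'b) tile ck_word set" where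
  "steps e r = {w \<in> W. word_shape w = e \<and> word_origin w = r}"

lemma S_iff: "(u, v) \<in> S \<longleftrightarrow> u \<in> W \<and> v \<in> W \<and> word_end u = word_end v"
  by (simp add: ck_generators_def)

lemma finite_words: "finite {w \<in> W. word_shape w = k}"
proof (rule finite_subset)
  have "finite R" using R_subset by (rule finite_subset) (simp add: finite_A finite_B)
  moreover have "finite {(0, 0)..k}"
    by (rule finite_subset[of _ "{0..fst k} \<times> {0..snd k}"]) (auto simp: less_eq_prod_def)
  ultimately show "finite ({k} \<times> ({(0, 0)..k} \<rightarrow>\<^sub>E R))" by (intro finite_cartesian_product finite_PiE) auto
  show "{w \<in> W. word_shape w = k} \<subseteq> {k} \<times> ({(0, 0)..k} \<rightarrow>\<^sub>E R)"
  proof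
    fix w assume "w \<in> {w \<in> W. word_shape w = k}"
    then obtain k' where "w \<in> ck_words_of_shape R M1 M2 k'" and k: "fst w = k"
      by (auto simp: ck_words_def word_shape_def)
    then have "fst w = k'" "snd w \<in> {(0, 0)..k'} \<rightarrow>\<^sub>E R" by (simp_all only: ck_words_of_shape_def mem_Times_iff mem_Collect_eq singleton_iff)
    then show "w \<in> {k} \<times> ({(0, 0)..k} \<rightarrow>\<^sub>E R)" using k by (simp add: mem_Times_iff)
  qed
qed

lemma finite_steps: "finite (steps e r)"
  using finite_words[of e] by (rule finite_subset[rotated]) (auto simp: steps_def)

lemma U_ends: "y \<in> U w \<Longrightarrow> y \<in> ends"
  by (simp add: U_def)

lemma U_locally_constant:
  assumes "u \<in> W"
  shows "\<exists>n. \<forall>y\<in>ends. \<forall>y'\<in>ends. agree n n y y' \<longrightarrow> (y \<in> U u \<longleftrightarrow> y' \<in> U u)"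
proof -
  have "ginv (base u) \<in> carrier \<Gamma>" using base_closed[OF assms] by simp
  from agree_translate[OF this] obtain N where N: "\<forall>z\<in>red_pairs. \<forall>z'\<in>red_pairs. \<forall>m n.
    agree (m + N) (n + N) z z' \<longrightarrow> agree m n (gact (ginv (base u)) z) (gact (ginv (base u)) z')" ..
  show ?thesis
  proof (intro exI[of _ "Suc 0 + N"] ballI impI)
    fix y y' assume y: "y \<in> ends" "y' \<in> ends" "agree (Suc 0 + N) (Suc 0 + N) y y'"
    then have "agree (Suc 0) (Suc 0) (gact (ginv (base u)) y) (gact (ginv (base u)) y')"
      using N ends_red by simp
    from tl_cong[OF this] show "y \<in> U u \<longleftrightarrow> y' \<in> U u" using y(1,2) by (simp add: U_def)
  qed
qed

definition ind :: "('a, 'b) tile ck_word \<Rightarrow> ('a, 'b) bm_end \<Rightarrow> complex" where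
  "ind u \<omega> = (if \<omega> \<in> boundary D \<and> end_of \<omega> \<in> U u then 1 else 0)"

lemma ind_cont_fun:
  assumes u: "u \<in> W"
  shows "ind u \<in> cont_fun X"
proof -
  have top: "topspace X = boundary D" by (rule topspace_boundary[OF x])
  obtain n where n: "\<forall>y\<in>ends. \<forall>y'\<in>ends. agree n n y y' \<longrightarrow> (y \<in> U u \<longleftrightarrow> y' \<in> U u)"
    using U_locally_constant[OF u] ..
  have "openin X {\<omega> \<in> boundary D. ind u \<omega> \<in> O'}" for O'
  proof (rule iffD2[OF openin_boundary_iff[OF x]], intro conjI ballI impI)
    fix y assume y: "y \<in> ends" "end_class y \<in> {\<omega> \<in> boundary D. ind u \<omega> \<in> O'}"
    have "end_class y' \<in> {\<omega> \<in> boundary D. ind u \<omega> \<in> O'}" if y': "y' \<in> ends" "agree n n y y'" for y'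
    proof -
      have "y \<in> U u \<longleftrightarrow> y' \<in> U u" by (rule n[rule_format, OF y(1) y'])
      then have "ind u (end_class y') = ind u (end_class y)"
        using y(1) y'(1) by (simp add: ind_def boundary_eq end_of_class)
      then show ?thesis using y y' by (simp add: boundary_eq)
    qed
    then show "\<exists>n. \<forall>y'\<in>ends. agree n n y y' \<longrightarrow> end_class y' \<in> {\<omega> \<in> boundary D. ind u \<omega> \<in> O'}"
      by (intro exI[of _ n] ballI impI)
  qed auto
  then show ?thesis unfolding cont_fun_def continuous_map_def top by (auto simp: ind_def)
qed

text \<open>The group element that carries the rectangle of \<open>v\<close> so that its last tile covers that of \<open>u\<close>.\<close>

definition quot :: "('a, 'b) tile ck_word \<Rightarrow> ('a, 'b) tile ck_word \<Rightarrow> ('a, 'b) bm_elt" where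
  "quot u v = base u \<cdot> ginv (base v)"

definition V :: "('a, 'b) tile ck_word \<times> ('a, 'b) tile ck_word \<Rightarrow> ('a, 'b) bm_elt \<Rightarrow> ('a, 'b) bm_end \<Rightarrow> complex" where
  "V = (\<lambda>(u, v). single (quot u v) (ind u))"

lemma quot_closed: "\<lbrakk>u \<in> W; v \<in> W\<rbrakk> \<Longrightarrow> quot u v \<in> carrier \<Gamma>"
  by (simp add: quot_def base_closed)

lemma quot_mult: "\<lbrakk>u \<in> W; v \<in> W; w \<in> W\<rbrakk> \<Longrightarrow> quot u v \<cdot> quot v w = quot u w"
proof -
  assume m: "u \<in> W" "v \<in> W" "w \<in> W"
  note b = base_closed[OF m(1)] base_closed[OF m(2)] base_closed[OF m(3)]
  have "quot u v \<cdot> quot v w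
      = base u \<cdot> (ginv (base v) \<cdot> base v \<cdot> ginv (base w))"
    unfolding quot_def using b by (simp only: \<Gamma>.m_assoc \<Gamma>.inv_closed \<Gamma>.m_closed)
  then show ?thesis using b by (simp add: quot_def)
qed

lemma quot_inv: "\<lbrakk>u \<in> W; v \<in> W\<rbrakk> \<Longrightarrow> ginv (quot u v) = quot v u"
  by (simp add: quot_def base_closed \<Gamma>.inv_mult_group)

lemma quot_self: "u \<in> W \<Longrightarrow> quot u u = unit"
  by (simp add: quot_def base_closed)

lemma U_quot:
  assumes uv: "(u, v) \<in> S" and y: "y \<in> ends"
  shows "gact (quot v u) y \<in> U v \<longleftrightarrow> y \<in> U u"
proof -
  have m: "u \<in> W" "v \<in> W" "word_end u = word_end v" using uv by (auto simp: S_iff)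
  note b = base_closed[OF m(1)] base_closed[OF m(2)]
  have "ginv (base v) \<cdot> quot v u = ginv (base u)"
    unfolding quot_def using b by (simp flip: \<Gamma>.m_assoc)
  then have "gact (ginv (base v)) (gact (quot v u) y) = gact (ginv (base u)) y"
    using gact_mult[of "ginv (base v)" "quot v u" y] b quot_closed[OF m(2,1)] ends_red[OF y] by simp
  then show ?thesis using y gact_ends[OF quot_closed[OF m(2,1)] y] m(3) by (simp add: U_def)
qed

lemma ind_quot:
  assumes uv: "(u, v) \<in> S" and \<omega>: "\<omega> \<in> boundary D"
  shows "ind v (act (quot v u) \<omega>) = ind u \<omega>"
proof -
  have q: "quot v u \<in> carrier \<Gamma>" using uv by (simp add: S_iff quot_closed)
  show ?thesis
    using U_quot[OF uv end_of_ends[OF \<omega>]] act_boundary[OF q \<omega>] end_of_action[OF q \<omega>] \<omega> by (simp add: ind_def)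
qed

lemma V_closed: "s \<in> S \<Longrightarrow> V s \<in> carrier P"
  by (cases s) (simp add: S_iff V_def single_closed quot_closed ind_cont_fun)

lemma ind_outside: "\<omega> \<notin> boundary D \<Longrightarrow> ind u \<omega> = 0"
  by (simp add: ind_def)

lemma V_mult:
  assumes "(u, v) \<in> S" "(v, w) \<in> S"
  shows "stimes P (V (u, v)) (V (v, w)) = V (u, w)"
proof -
  have m: "u \<in> W" "v \<in> W" "w \<in> W" using assms by (auto simp: S_iff)
  have "ind u \<omega> * ind v (act (ginv (quot u v)) \<omega>) = ind u \<omega>" if "\<omega> \<in> boundary D" for \<omega>
    by (simp only: quot_inv[OF m(1,2)] ind_quot[OF assms(1) that]) (simp add: ind_def)
  then have "(\<lambda>\<omega>. if \<omega> \<in> topspace X then ind u \<omega> * ind v (act (ginv (quot u v)) \<omega>) else 0) = ind u"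
    by (intro ext) (simp add: topspace_boundary[OF x] ind_outside)
  then show ?thesis
    using m by (simp add: V_def single_mult quot_closed ind_cont_fun quot_mult)
qed

lemma V_star:
  assumes "(u, v) \<in> S"
  shows "sstar P (V (u, v)) = V (v, u)"
proof -
  have m: "u \<in> W" "v \<in> W" and vu: "(v, u) \<in> S" using assms by (auto simp: S_iff)
  have "(\<lambda>\<omega>. if \<omega> \<in> topspace X then cnj (ind u (act (quot u v) \<omega>)) else 0) = ind v"
    by (rule ext) (auto simp: topspace_boundary[OF x] ind_quot[OF vu] ind_outside, simp add: ind_def)
  then show ?thesis using m by (simp add: V_def single_star quot_closed quot_inv)
qed

lemma V_orth:
  assumes "u \<in> W" "v \<in> W" "word_shape u = word_shape v" "u \<noteq> v"
  shows "stimes P (V (u, u)) (V (v, v)) = (\<lambda>_ _. 0)"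
proof -
  have "ind u \<omega> * ind v (act unit \<omega>) = 0" if "\<omega> \<in> topspace X" for \<omega>
  proof -
    have "end_of \<omega> \<notin> U u \<inter> U v" by (simp only: U_disjoint[OF assms] empty_iff not_False_eq_True)
    then show ?thesis by (simp add: act_one[OF that]) (simp add: ind_def)
  qed
  then have "(\<lambda>\<omega>. if \<omega> \<in> topspace X then ind u \<omega> * ind v (act (ginv unit) \<omega>) else 0) = (\<lambda>_. 0)"
    by (intro ext) simp
  then show ?thesis
    using assms by (simp add: V_def quot_self single_mult ind_cont_fun) (simp add: single_def fun_eq_iff)
qed

lemma steps_prolong:
  assumes e: "e \<in> {(1, 0), (0, 1)}" and u: "u \<in> W" and w: "w \<in> steps e (word_end u)"
  obtains z i j e1 e2 where "z \<in> ends" "e = (e1, e2)" "u = word z i j" "w = word (pos z i j) e1 e2"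
    "mul u w = word z (i + e1) (j + e2)"
proof -
  have m: "w \<in> W" "word_shape w = e" "word_origin w = word_end u" using w by (auto simp: steps_def)
  show thesis by (rule prolong_word[OF e u m]) (rule that)
qed

lemma mul_facts:
  assumes e: "e \<in> {(1, 0), (0, 1)}" and u: "u \<in> W" and w: "w \<in> steps e (word_end u)"
  shows "mul u w \<in> W" "word_shape (mul u w) = word_shape u + e" "word_end (mul u w) = word_end w"
proof -
  from e u w obtain z i j e1 e2 where *: "z \<in> ends" "e = (e1, e2)" "u = word z i j"
    "w = word (pos z i j) e1 e2" "mul u w = word z (i + e1) (j + e2)" by (rule steps_prolong)
  show "mul u w \<in> W" "word_shape (mul u w) = word_shape u + e" "word_end (mul u w) = word_end w"
    using * word_W by (simp_all add: pos_pos)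
qed

text \<open>
  The displacement along a word does not depend on where the word is placed. It cancels in \<open>quot\<close> when two words
  are prolonged by the same step.
\<close>

lemma displacement:
  assumes "w \<in> W"
  obtains d where "d \<in> carrier \<Gamma>" "\<And>y i j. \<lbrakk>y \<in> ends; w = word y i j\<rbrakk> \<Longrightarrow> vert y i j = d"
proof -
  obtain z i j where z: "z \<in> ends" "w = word z i j" using assms W_cases by blast
  have eq: "vert y i' j' = vert z i j" if y: "y \<in> ends" "w = word y i' j'" for y i' j'
  proof -
    have ij: "i' = i" "j' = j" and ag: "agree (Suc i) (Suc j) y z"
      using word_eq_iff[OF y(1) z(1), of i' j' i j] y z by auto
    have "agree i j y z" by (rule agree_mono[OF ag]) simp_all
    from vert_cong[OF y(1) z(1) this] show ?thesis unfolding ij .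
  qed
  show thesis
  proof (rule that)
    show "vert z i j \<in> carrier \<Gamma>" using z(1) by simp
  qed (rule eq)
qed

lemma base_mul:
  assumes e: "e \<in> {(1, 0), (0, 1)}" and w: "w \<in> W"
    and d: "\<And>y i j. \<lbrakk>y \<in> ends; w = word y i j\<rbrakk> \<Longrightarrow> vert y i j = d"
    and u: "u \<in> W" "w \<in> steps e (word_end u)"
  shows "base (mul u w) = base u \<cdot> d"
proof -
  from e u obtain z i j e1 e2 where *: "z \<in> ends" "e = (e1, e2)" "u = word z i j"
    "w = word (pos z i j) e1 e2" "mul u w = word z (i + e1) (j + e2)" by (rule steps_prolong)
  have "base (mul u w) = x \<cdot> (vert z i j \<cdot> vert (pos z i j) e1 e2)"
    using * by (simp add: base_word vert_add)
  also have "vert (pos z i j) e1 e2 = d" using * by (intro d pos_ends)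
  finally show ?thesis using * x d[OF pos_ends[OF *(1)] *(4)] pos_ends[OF *(1)]
    by (auto simp: base_word \<Gamma>.m_assoc)
qed

lemma quot_mul:
  assumes e: "e \<in> {(1, 0), (0, 1)}" and uv: "(u, v) \<in> S" and w: "w \<in> steps e (word_end u)"
  shows "quot (mul u w) (mul v w) = quot u v"
proof -
  have m: "u \<in> W" "v \<in> W" "w \<in> W" and w': "w \<in> steps e (word_end v)"
    using uv w by (auto simp: S_iff steps_def)
  obtain d where d: "d \<in> carrier \<Gamma>" "\<And>y i j. \<lbrakk>y \<in> ends; w = word y i j\<rbrakk> \<Longrightarrow> vert y i j = d"
    using displacement[OF m(3)] by metis
  have b: "base u \<in> carrier \<Gamma>" "base v \<in> carrier \<Gamma>" using m base_closed by auto
  have "base (mul u w) = base u \<cdot> d" by (rule base_mul[OF e m(3) _ m(1) w]) (rule d(2))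
  moreover have "base (mul v w) = base v \<cdot> d" by (rule base_mul[OF e m(3) _ m(2) w']) (rule d(2))
  ultimately have "quot (mul u w) (mul v w)
      = base u \<cdot> (d \<cdot> (ginv d \<cdot> ginv (base v)))"
    unfolding quot_def using b d(1) by (simp add: \<Gamma>.inv_mult_group \<Gamma>.m_assoc)
  also have "d \<cdot> (ginv d \<cdot> ginv (base v)) = ginv (base v)"
    using b d(1) by (simp flip: \<Gamma>.m_assoc)
  finally show ?thesis by (simp add: quot_def)
qed

lemma U_mul:
  assumes e: "e \<in> {(1, 0), (0, 1)}" and u: "u \<in> W" and w: "w \<in> steps e (word_end u)" and y: "y \<in> ends"
  shows "y \<in> U (mul u w) \<longleftrightarrow> word (gact (ginv (base u)) y) (fst e) (snd e) = w"
proof -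
  from e u w obtain z i j e1 e2 where *: "z \<in> ends" "e = (e1, e2)" "u = word z i j"
    "w = word (pos z i j) e1 e2" "mul u w = word z (i + e1) (j + e2)" by (rule steps_prolong)
  let ?y = "gact (ginv (base u)) y" and ?d = "vert (pos z i j) e1 e2"
  have pz: "pos z i j \<in> ends" by (rule pos_ends[OF *(1)])
  have b: "base u \<in> carrier \<Gamma>" and d: "?d \<in> carrier \<Gamma>" using base_closed[OF u] pz by auto
  have y': "?y \<in> ends" using b y by (simp add: gact_ends)
  have "base (mul u w) = base u \<cdot> ?d" using * x pz by (simp add: base_word vert_add \<Gamma>.m_assoc)
  then have "gact (ginv (base (mul u w))) y = gact (ginv ?d) ?y"
    using b d y by (simp add: \<Gamma>.inv_mult_group gact_mult ends_red)
  moreover have "word_end (mul u w) = tl (pos (pos z i j) e1 e2)" using * by (simp add: pos_pos)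
  ultimately have "y \<in> U (mul u w) \<longleftrightarrow> agree (Suc e1) (Suc e2) ?y (pos z i j)"
    using tl_translate_iff[OF pz y', of e1 e2] y by (simp add: U_def)
  also have "\<dots> \<longleftrightarrow> word ?y e1 e2 = word (pos z i j) e1 e2"
    using word_eq_iff[OF y' pz, of e1 e2 e1 e2] by simp
  finally show ?thesis using * by simp
qed

lemma U_mul_subset:
  assumes e: "e \<in> {(1, 0), (0, 1)}" and u: "u \<in> W" and w: "w \<in> steps e (word_end u)"
  shows "U (mul u w) \<subseteq> U u"
proof
  fix y assume y: "y \<in> U (mul u w)"
  note ye = U_ends[OF y]
  have "word_origin (word (gact (ginv (base u)) y) (fst e) (snd e)) = word_end u"
    using iffD1[OF U_mul[OF e u w ye] y] w by (simp add: steps_def)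
  then show "y \<in> U u" using ye by (simp add: U_def)
qed

text \<open>
  The sector of an end in \<open>U u\<close> continues the rectangle \<open>u\<close> by exactly one step in each direction, so the cylinder sets of the
  prolongations partition \<open>U u\<close>.
\<close>

lemma ind_sum:
  assumes e: "e \<in> {(1, 0), (0, 1)}" and u: "u \<in> W"
  shows "(\<Sum>w\<in>steps e (word_end u). ind (mul u w) \<omega>) = ind u \<omega>"
proof (cases "\<omega> \<in> boundary D \<and> end_of \<omega> \<in> U u")
  case True
  let ?y = "gact (ginv (base u)) (end_of \<omega>)" and ?w = "\<lambda>y. word y (fst e) (snd e)"
  have ye: "end_of \<omega> \<in> ends" and tl: "tl ?y = word_end u" using True by (auto simp: U_def)
  have y': "?y \<in> ends" using ye base_closed[OF u] by (simp add: gact_ends)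
  have w0: "?w ?y \<in> steps e (word_end u)" using word_W[OF y'] tl by (simp add: steps_def)
  have "(\<Sum>w\<in>steps e (word_end u). ind (mul u w) \<omega>) = (\<Sum>w\<in>steps e (word_end u). if w = ?w ?y then 1 else 0)"
  proof (rule sum.cong[OF HOL.refl])
    fix w assume w: "w \<in> steps e (word_end u)"
    have "end_of \<omega> \<in> U (mul u w) \<longleftrightarrow> w = ?w ?y" using U_mul[OF e u w ye] by (simp add: eq_commute)
    then show "ind (mul u w) \<omega> = (if w = ?w ?y then 1 else 0)" using True by (simp add: ind_def)
  qed
  also have "\<dots> = 1" using w0 finite_steps by (simp add: sum.delta)
  finally show ?thesis using True by (simp add: ind_def)
next
  case False
  have "ind (mul u w) \<omega> = 0" if "w \<in> steps e (word_end u)" for w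
    using subsetD[OF U_mul_subset[OF e u that], of "end_of \<omega>"] False unfolding ind_def by argo
  then show ?thesis using False by (simp add: ind_def)
qed

lemma V_sum:
  assumes e: "e \<in> {(1, 0), (0, 1)}" and uv: "(u, v) \<in> S"
  shows "V (u, v) = (\<lambda>g \<omega>. \<Sum>w\<in>steps e (word_end u). V (mul u w, mul v w) g \<omega>)"
proof (intro ext)
  fix g \<omega>
  have u: "u \<in> W" using uv by (simp add: S_iff)
  have "(\<Sum>w\<in>steps e (word_end u). V (mul u w, mul v w) g \<omega>)
      = (\<Sum>w\<in>steps e (word_end u). if g = quot u v then ind (mul u w) \<omega> else 0)"
    by (rule sum.cong) (simp_all add: V_def quot_mul[OF e uv] single_def)
  then show "V (u, v) g \<omega> = (\<Sum>w\<in>steps e (word_end u). V (mul u w, mul v w) g \<omega>)"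
    using ind_sum[OF e u, of \<omega>] by (simp add: V_def single_def)
qed

section \<open>The homomorphism from the free algebra\<close>

definition lift :: "(('a, 'b) tile ck_word \<times> ('a, 'b) tile ck_word) fsa
    \<Rightarrow> ('a, 'b) bm_elt \<Rightarrow> ('a, 'b) bm_end \<Rightarrow> complex" where
  "lift y = free_lift V (restrict_letters S y)"

lemma free_lift_hom: "star_hom (free_star_algebra S) P (free_lift V)"
  by (rule free_lift_star_hom) (rule V_closed)

lemma lift_closed: "lift y \<in> carrier P"
  unfolding lift_def by (rule star_hom_closed[OF free_lift_hom restrict_letters_closed])

lemma lift_add: "lift (y + z) = (\<lambda>g \<omega>. lift y g \<omega> + lift z g \<omega>)"
  and lift_scC: "lift (c *\<^sub>C y) = (\<lambda>g \<omega>. c * lift y g \<omega>)"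
  and lift_mult: "lift (y * z) = stimes P (lift y) (lift z)"
  and lift_adj: "lift (adj y) = sstar P (lift y)"
  using star_hom_add[OF free_lift_hom, of "restrict_letters S y" "restrict_letters S z"]
    star_hom_scale[OF free_lift_hom, of "restrict_letters S y" c]
    star_hom_mult[OF free_lift_hom, of "restrict_letters S y" "restrict_letters S z"]
    star_hom_star[OF free_lift_hom, of "restrict_letters S y"]
  by (simp_all only: lift_def restrict_letters_ops restrict_letters_closed P_add P_scale simp_thms)

lemma lift_zero: "lift 0 = (\<lambda>_ _. 0)"
  using lift_scC[of 0 0] by simp

lemma lift_diff: "lift (y - z) = (\<lambda>g \<omega>. lift y g \<omega> - lift z g \<omega>)"
  using lift_add[of y "(-1) *\<^sub>C z"] lift_scC[of "-1" z] by (simp add: scC_neg_one)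

lemma lift_sum: "lift (\<Sum>i\<in>I. c i *\<^sub>C f i) = (\<lambda>g \<omega>. \<Sum>i\<in>I. c i * lift (f i) g \<omega>)"
  by (induction I rule: infinite_finite_induct) (simp_all add: lift_zero lift_add lift_scC)

lemma restrict_gen: "s \<in> S \<Longrightarrow> restrict_letters S (gen s) = free_gen s"
  unfolding gen_def by (intro restrict_letters_Abs free_gen_closed)

lemma lift_gen: "s \<in> S \<Longrightarrow> lift (gen s) = V s"
  by (simp add: lift_def restrict_gen free_lift_gen)

lemma restrict_sum: "restrict_letters S (sum f I) = (\<lambda>z. \<Sum>i\<in>I. restrict_letters S (f i) z)"
  by (auto simp: restrict_letters_def Rep_sum fun_eq_iff)

lemma restrict_zero: "restrict_letters S 0 = (\<lambda>_. 0)"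
  by (auto simp: restrict_letters_def Rep_fsa_ops)

lemma steps_S: "\<lbrakk>e \<in> {(1, 0), (0, 1)}; (u, v) \<in> S; w \<in> steps e (word_end u)\<rbrakk> \<Longrightarrow> (mul u w, mul v w) \<in> S"
  using mul_facts[of e u w] mul_facts[of e v w] by (simp add: S_iff)

lemma restrict_steps:
  assumes "e \<in> {(1, 0), (0, 1)}" "(u, v) \<in> S"
  shows "restrict_letters S (\<Sum>w\<in>steps e (word_end u). gen (mul u w, mul v w))
    = (\<lambda>z. \<Sum>w\<in>steps e (word_end u). free_gen (mul u w, mul v w) z)"
  unfolding restrict_sum using steps_S[OF assms] by (intro ext sum.cong) (simp_all add: restrict_gen)

lemma words_of_shape_iff: "w \<in> ck_words_of_shape R M1 M2 k \<longleftrightarrow> w \<in> W \<and> word_shape w = k"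
proof -
  have shape: "word_shape w = k'" if "w \<in> ck_words_of_shape R M1 M2 k'" for k'
    using that by (simp add: ck_words_of_shape_def mem_Times_iff word_shape_def)
  show ?thesis
  proof
    assume w: "w \<in> ck_words_of_shape R M1 M2 k"
    have "w \<in> W" unfolding ck_words_def by (rule UN_I[of k]) (rule UNIV_I, rule w)
    then show "w \<in> W \<and> word_shape w = k" using shape[OF w] by simp
  next
    assume w: "w \<in> W \<and> word_shape w = k"
    then have "w \<in> (\<Union>k. ck_words_of_shape R M1 M2 k)" by (simp only: ck_words_def)
    then obtain k' where k': "w \<in> ck_words_of_shape R M1 M2 k'" by (rule UN_E)
    then show "w \<in> ck_words_of_shape R M1 M2 k" using shape[OF k'] w by simp
  qed
qed

lemma relation_cases:
  assumes "(a, b) \<in> ck_relations R M1 M2"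
  shows "\<exists>y z. a = restrict_letters S y \<and> b = restrict_letters S z \<and> lift y = lift z"
  using assms unfolding ck_relations_def Let_def ck_free_def
proof (elim UnE CollectE exE conjE)
  fix u v assume eq: "(a, b) = (stimes (free_star_algebra S) (stimes (free_star_algebra S) (free_gen (u, v))
    (sstar (free_star_algebra S) (free_gen (u, v)))) (free_gen (u, v)), free_gen (u, v))" and uv: "(u, v) \<in> S"
  have vu: "(v, u) \<in> S" "(u, u) \<in> S" using uv by (auto simp: S_iff)
  show ?thesis
    using eq uv vu
    by (intro exI[of _ "gen (u, v) * adj (gen (u, v)) * gen (u, v)"] exI[of _ "gen (u, v)"])
       (simp add: restrict_letters_ops restrict_gen lift_mult lift_adj lift_gen V_star V_mult)
next
  fix u v assume eq: "(a, b) = (sstar (free_star_algebra S) (free_gen (u, v)), free_gen (v, u))" and uv: "(u, v) \<in> S"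
  have vu: "(v, u) \<in> S" using uv by (auto simp: S_iff)
  show ?thesis
    using eq uv vu by (intro exI[of _ "adj (gen (u, v))"] exI[of _ "gen (v, u)"])
      (simp add: restrict_letters_ops restrict_gen lift_adj lift_gen V_star)
next
  fix u v w assume eq: "(a, b) = (stimes (free_star_algebra S) (free_gen (u, v)) (free_gen (v, w)), free_gen (u, w))"
    and uv: "(u, v) \<in> S" "(v, w) \<in> S"
  have uw: "(u, w) \<in> S" using uv by (auto simp: S_iff)
  show ?thesis
    using eq uv uw by (intro exI[of _ "gen (u, v) * gen (v, w)"] exI[of _ "gen (u, w)"])
      (simp add: restrict_letters_ops restrict_gen lift_mult lift_gen V_mult)
next
  fix u v e assume eq: "(a, b) = (free_gen (u, v), \<lambda>z. \<Sum>w\<in>{w \<in> W. word_shape w = e \<and> word_origin w = word_end u}.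
      free_gen (mul u w, mul v w) z)" and uv: "(u, v) \<in> S" and e: "e \<in> {(1, 0), (0, 1)}"
  have "lift (\<Sum>w\<in>steps e (word_end u). gen (mul u w, mul v w))
      = (\<lambda>g \<omega>. \<Sum>w\<in>steps e (word_end u). V (mul u w, mul v w) g \<omega>)"
    using lift_sum[of "\<lambda>_. 1" "\<lambda>w. gen (mul u w, mul v w)" "steps e (word_end u)"] steps_S[OF e uv]
    by (simp add: scC_one lift_gen)
  then have "lift (\<Sum>w\<in>steps e (word_end u). gen (mul u w, mul v w)) = lift (gen (u, v))"
    using V_sum[OF e uv] lift_gen[OF uv] by simp
  then show ?thesis
    using eq uv restrict_steps[OF e uv]
    by (intro exI[of _ "gen (u, v)"] exI[of _ "\<Sum>w\<in>steps e (word_end u). gen (mul u w, mul v w)"])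
       (simp add: restrict_gen steps_def)
next
  fix u v assume eq: "(a, b) = (stimes (free_star_algebra S) (free_gen (u, u)) (free_gen (v, v)), \<lambda>_. 0)"
    and uv: "u \<in> ck_words_of_shape R M1 M2 (0, 0)" "v \<in> ck_words_of_shape R M1 M2 (0, 0)" "u \<noteq> v"
  have m: "u \<in> W" "v \<in> W" "word_shape u = word_shape v"
    using uv(1,2) unfolding words_of_shape_iff by simp_all
  show ?thesis
    using eq m uv(3) restrict_zero by (intro exI[of _ "gen (u, u) * gen (v, v)"] exI[of _ 0])
      (simp add: restrict_letters_ops restrict_gen lift_mult lift_gen lift_zero V_orth S_iff)
qed

lemma relation_star: "(u, v) \<in> S \<Longrightarrow>
    (restrict_letters S (adj (gen (u, v))), restrict_letters S (gen (v, u))) \<in> ck_relations R M1 M2"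
proof -
  assume uv: "(u, v) \<in> S"
  have eq: "(restrict_letters S (adj (gen (u, v))), restrict_letters S (gen (v, u)))
      = (sstar (free_star_algebra S) (free_gen (u, v)), free_gen (v, u))"
    using uv by (simp add: restrict_letters_ops restrict_gen S_iff)
  show ?thesis unfolding eq ck_relations_def Let_def ck_free_def
    by (rule UnI1, rule UnI1, rule UnI1, rule UnI2, intro CollectI exI conjI, rule HOL.refl, rule uv)
qed

lemma relation_mult: "(u, v) \<in> S \<Longrightarrow> (v, w) \<in> S \<Longrightarrow>
    (restrict_letters S (gen (u, v) * gen (v, w)), restrict_letters S (gen (u, w))) \<in> ck_relations R M1 M2"
proof -
  assume uv: "(u, v) \<in> S" "(v, w) \<in> S"
  have eq: "(restrict_letters S (gen (u, v) * gen (v, w)), restrict_letters S (gen (u, w)))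
      = (stimes (free_star_algebra S) (free_gen (u, v)) (free_gen (v, w)), free_gen (u, w))"
    using uv by (simp add: restrict_letters_ops restrict_gen S_iff)
  show ?thesis unfolding eq ck_relations_def Let_def ck_free_def
    by (rule UnI1, rule UnI1, rule UnI2, intro CollectI exI conjI, rule HOL.refl, rule uv, rule uv)
qed

lemma relation_sum: "(u, v) \<in> S \<Longrightarrow> e \<in> {(1, 0), (0, 1)} \<Longrightarrow>
    (restrict_letters S (gen (u, v)), restrict_letters S (\<Sum>w\<in>steps e (word_end u). gen (mul u w, mul v w)))
      \<in> ck_relations R M1 M2"
proof -
  assume uv: "(u, v) \<in> S" and e: "e \<in> {(1, 0), (0, 1)}"
  have eq: "(restrict_letters S (gen (u, v)), restrict_letters S (\<Sum>w\<in>steps e (word_end u). gen (mul u w, mul v w)))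
      = (free_gen (u, v), (\<lambda>z. \<Sum>w\<in>{w \<in> W. word_shape w = e \<and> word_origin w = word_end u}.
          free_gen (mul u w, mul v w) z))"
    unfolding steps_def[symmetric] by (simp only: restrict_gen[OF uv] restrict_steps[OF e uv])
  show ?thesis unfolding eq ck_relations_def Let_def ck_free_def
    by (rule UnI1, rule UnI2, intro CollectI exI conjI, rule HOL.refl, rule uv, rule e)
qed

lemma relation_orth: "\<lbrakk>u \<in> W; v \<in> W; word_shape u = 0; word_shape v = 0; u \<noteq> v\<rbrakk> \<Longrightarrow>
    (restrict_letters S (gen (u, u) * gen (v, v)), restrict_letters S 0) \<in> ck_relations R M1 M2"
proof -
  assume uv: "u \<in> W" "v \<in> W" "word_shape u = 0" "word_shape v = 0" "u \<noteq> v"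
  have eq: "(restrict_letters S (gen (u, u) * gen (v, v)), restrict_letters S 0)
      = (stimes (free_star_algebra S) (free_gen (u, u)) (free_gen (v, v)), (\<lambda>_. 0))"
    using uv restrict_zero by (simp add: restrict_letters_ops restrict_gen S_iff)
  have "u \<in> ck_words_of_shape R M1 M2 (0, 0)" "v \<in> ck_words_of_shape R M1 M2 (0, 0)"
    using uv unfolding words_of_shape_iff by (simp_all add: zero_prod_def)
  then show ?thesis unfolding eq ck_relations_def Let_def ck_free_def
    by (intro UnI2 CollectI exI conjI) (rule HOL.refl, assumption, assumption, rule uv(5))
qed

text \<open>
  Working modulo this kernel as well as modulo the null space of a seminorm keeps the image in the crossed product
  unchanged when an element is rewritten.
\<close>

lemma lift_ideal: "star_ideal {y. lift y = (\<lambda>_ _. 0)}"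
proof
  fix y z c
  have zero: "stimes P (\<lambda>_ _. 0) (lift z) = (\<lambda>_ _. 0)" "stimes P (lift z) (\<lambda>_ _. 0) = (\<lambda>_ _. 0)"
    using scale_mult[of "lift z" "lift z" 0] mult_scale[of "lift z" "lift z" 0] lift_closed[of z]
    by (simp_all add: P_scale)
  assume y: "y \<in> {y. lift y = (\<lambda>_ _. 0)}"
  then show "y * z \<in> {y. lift y = (\<lambda>_ _. 0)}" "z * y \<in> {y. lift y = (\<lambda>_ _. 0)}"
    using zero by (simp_all add: lift_mult)
  show "c *\<^sub>C y \<in> {y. lift y = (\<lambda>_ _. 0)}" "adj y \<in> {y. lift y = (\<lambda>_ _. 0)}"
    using y by (simp_all add: lift_scC lift_adj P_star fun_eq_iff)
  assume "z \<in> {y. lift y = (\<lambda>_ _. 0)}"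
  then show "y + z \<in> {y. lift y = (\<lambda>_ _. 0)}" using y by (simp add: lift_add)
qed (simp add: lift_zero)

lemma word_prefamily:
  assumes J: "star_ideal J"
    and rel: "\<And>y z. (restrict_letters S y, restrict_letters S z) \<in> ck_relations R M1 M2 \<Longrightarrow> y - z \<in> J"
  shows "ck_prefamily J W word_shape word_end steps mul U (\<lambda>u v. gen (u, v))"
proof -
  interpret star_ideal J by (rule J)
  show ?thesis
  proof
    fix e u w assume e: "e \<in> {(1, 0), (0, 1)}" and u: "u \<in> W" and w: "w \<in> steps e (word_end u)"
    show "mul u w \<in> W" "word_shape (mul u w) = word_shape u + e" "word_end (mul u w) = word_end w"
      by (rule mul_facts[OF e u w])+
    show "U (mul u w) \<subseteq> U u" by (rule U_mul_subset[OF e u w])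
  next
    fix u v assume uv: "u \<in> W" "v \<in> W" "word_end u = word_end v"
    then have S: "(u, v) \<in> S" by (simp add: S_iff)
    show "eqv (adj (gen (u, v))) (gen (v, u))" unfolding eqv_def by (rule rel[OF relation_star[OF S]])
    show "eqv (gen (u, v)) (\<Sum>w\<in>steps e (word_end u). gen (mul u w, mul v w))"
      if "e \<in> {(1, 0), (0, 1)}" for e
      unfolding eqv_def by (rule rel[OF relation_sum[OF S that]])
    fix w assume "w \<in> W" "word_end v = word_end w"
    then have S': "(v, w) \<in> S" using uv by (simp add: S_iff)
    show "eqv (gen (u, v) * gen (v, w)) (gen (u, w))" unfolding eqv_def by (rule rel[OF relation_mult[OF S S']])
  qed (rule U_nonempty)
qed

lemma word_split:
  assumes "u \<in> W" "e \<in> {(1, 0), (0, 1)}" "word_shape u = k + e"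
  shows "\<exists>u'\<in>W. \<exists>w\<in>steps e (word_end u'). word_shape u' = k \<and> u = mul u' w"
proof -
  obtain e1 e2 i j where ek: "e = (e1, e2)" "k = (i, j)" by fastforce
  obtain z i' j' where z: "z \<in> ends" "u = word z i' j'" using assms(1) by (rule W_cases)
  have u: "u = word z (i + e1) (j + e2)" using z(2) assms(3) ek by simp
  have w: "word (pos z i j) e1 e2 \<in> steps e (word_end (word z i j))"
    using word_W[OF pos_ends[OF z(1)]] ek by (simp add: steps_def)
  have "u = mul (word z i j) (word (pos z i j) e1 e2)"
    using word_mult_word[of e1 e2 z i j] assms(2) z(1) ek u by simp
  then show ?thesis using w word_W[OF z(1), of i j] ek by (intro bexI[of _ "word z i j"] bexI[OF _ w]) auto
qed

section \<open>The norm estimate\<close>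

text \<open>
  For pairs with equal shapes of the second words, group the sum by the element \<open>quot u v\<close> of the group. Within
  a group the cylinder sets of the words \<open>u\<close> are disjoint and nonempty, so every coefficient is a value of
  the function that the crossed product element takes at \<open>quot u v\<close>.
\<close>

lemma combination_bound:
  assumes q: "cstar_ring q" and fam: "ck_family {y. q y = 0} W word_shape word_end steps mul U (\<lambda>u v. gen (u, v))"
    and F: "finite F" "F \<subseteq> S" and sh: "\<And>u v. (u, v) \<in> F \<Longrightarrow> word_shape v = k"
  shows "q (\<Sum>(u, v)\<in>F. c u v *\<^sub>C gen (u, v)) \<le> l1_norm (\<lambda>g \<omega>. \<Sum>(u, v)\<in>F. c u v * V (u, v) g \<omega>)"
    (is "_ \<le> l1_norm ?H")
proof -
  interpret q: cstar_ring q by (rule q)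
  let ?K = "(\<lambda>(u, v). quot u v) ` F" and ?Fg = "\<lambda>g. {r \<in> F. (\<lambda>(u, v). quot u v) r = g}"
  have W: "u \<in> W \<and> v \<in> W \<and> word_end u = word_end v" if "(u, v) \<in> F" for u v
    using subsetD[OF F(2) that] by (simp add: S_iff)
  have Hg: "?H g \<omega> = (\<Sum>(u, v)\<in>?Fg g. c u v * ind u \<omega>)" for g \<omega>
  proof -
    have "?H g \<omega> = (\<Sum>r\<in>F. if (\<lambda>(u, v). quot u v) r = g then (\<lambda>(u, v). c u v * ind u \<omega>) r else 0)"
    proof (rule sum.cong[OF HOL.refl])
      fix r assume "r \<in> F"
      obtain u v where r: "r = (u, v)" by (rule prod.exhaust)
      show "(\<lambda>(u, v). c u v * V (u, v) g \<omega>) r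
          = (if (\<lambda>(u, v). quot u v) r = g then (\<lambda>(u, v). c u v * ind u \<omega>) r else 0)"
        unfolding r by (simp add: V_def single_def eq_commute)
    qed
    then show ?thesis by (simp only: sum.inter_filter[OF F(1)])
  qed
  have VF: "V (fst r, snd r) \<in> carrier P" if "r \<in> F" for r using V_closed[OF subsetD[OF F(2) that]] by simp
  have closed: "?H \<in> carrier P" unfolding case_prod_beta by (rule P_lincomb_closed) (rule VF)
  have apart: "v \<noteq> v' \<and> word_shape v = word_shape v' \<and> U u \<inter> U u' = {}"
    if r: "(u, v) \<in> ?Fg g" "(u', v') \<in> ?Fg g" "(u, v) \<noteq> (u', v')" for u v u' v' g
  proof -
    have m: "(u, v) \<in> F" "(u', v') \<in> F" and g: "quot u v = quot u' v'" using r by auto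
    note w = W[OF m(1)] W[OF m(2)]
    have S: "(u, v) \<in> S" "(u', v') \<in> S" using m F(2) by auto
    have "v \<noteq> v'"
    proof
      assume v: "v = v'"
      have "base u = base u'" using g w base_closed unfolding quot_def v by simp
      then have "u = u'" using w v by (intro base_end_inj) auto
      then show False using v r(3) by simp
    qed
    moreover have shv: "word_shape v = word_shape v'" using sh m by simp
    moreover have "U u \<inter> U u' = {}"
    proof (rule equals0I)
      fix y assume y: "y \<in> U u \<inter> U u'"
      then have ye: "y \<in> ends" using U_ends[of y u] by simp
      have "quot v u = quot v' u'" using g w quot_inv[of u v] quot_inv[of u' v'] by simp
      then have "gact (quot v u) y \<in> U v \<inter> U v'"
        using y U_quot[OF S(1) ye] U_quot[OF S(2) ye] by simp
      then show False using U_disjoint[of v v'] w shv \<open>v \<noteq> v'\<close> by simp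
    qed
    ultimately show ?thesis by simp
  qed
  have part: "q (\<Sum>(u, v)\<in>?Fg g. c u v *\<^sub>C gen (u, v)) \<le> sup_norm (?H g)" for g
  proof (rule q.ck_sum_norm_le[OF fam])
    show "finite (?Fg g)" using F(1) by simp
    show "u \<in> W \<and> v \<in> W \<and> word_end u = word_end v" if "(u, v) \<in> ?Fg g" for u v
      using that W[of u v] by simp
    show "v \<noteq> v' \<and> word_shape v = word_shape v' \<and> U u \<inter> U u' = {}"
      if "(u, v) \<in> ?Fg g" "(u', v') \<in> ?Fg g" "(u, v) \<noteq> (u', v')" for u v u' v'
      by (rule apart[OF that])
    show "0 \<le> sup_norm (?H g)" by (rule sup_norm_nonneg[OF P_cont[OF closed]])
    fix u v assume uv: "(u, v) \<in> ?Fg g"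
    then have "u \<in> W" using W[of u v] by simp
    from iffD2[OF ex_in_conv U_nonempty[OF this]] obtain y where y: "y \<in> U u" ..
    have ye: "y \<in> ends" by (rule U_ends[OF y])
    have "?H g (end_class y) = (\<Sum>r\<in>?Fg g. if r = (u, v) then c u v else 0)"
      unfolding Hg
    proof (rule sum.cong[OF HOL.refl])
      fix r assume r: "r \<in> ?Fg g"
      obtain u' v' where r': "r = (u', v')" by (rule prod.exhaust)
      show "(\<lambda>(u, v). c u v * ind u (end_class y)) r = (if r = (u, v) then c u v else 0)"
      proof (cases "r = (u, v)")
        case True
        then show ?thesis using y ye by (simp add: ind_def boundary_eq end_of_class)
      next
        case False
        then have "U u \<inter> U u' = {}" using apart[OF uv, of u' v'] r r' by auto
        then have "y \<notin> U u'" using y by auto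
        then show ?thesis unfolding if_not_P[OF False] unfolding r' using ye by (simp add: ind_def end_of_class)
      qed
    qed
    also have "\<dots> = c u v" using uv F(1) by (simp add: sum.delta)
    finally show "cmod (c u v) \<le> sup_norm (?H g)"
      using sup_norm_upper[OF P_cont[OF closed], of g "end_class y"] by simp
  qed
  have "(\<Sum>(u, v)\<in>F. c u v *\<^sub>C gen (u, v)) = (\<Sum>g\<in>?K. \<Sum>(u, v)\<in>?Fg g. c u v *\<^sub>C gen (u, v))"
    by (rule sum.image_gen[OF F(1)])
  then have "q (\<Sum>(u, v)\<in>F. c u v *\<^sub>C gen (u, v)) \<le> (\<Sum>g\<in>?K. q (\<Sum>(u, v)\<in>?Fg g. c u v *\<^sub>C gen (u, v)))"
    using q.p_sum_le by simp
  also have "\<dots> \<le> (\<Sum>g\<in>?K. sup_norm (?H g))" by (rule sum_mono) (rule part)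
  also have "\<dots> = l1_norm ?H"
  proof (rule l1_norm_eq[symmetric])
    show "finite ?K" using F(1) by simp
    have "?H g = (\<lambda>_. 0)" if "g \<notin> ?K" for g
    proof (rule ext)
      have empty: "?Fg g = {}" using that by auto
      show "?H g \<omega> = 0" for \<omega> unfolding Hg empty by simp
    qed
    then show "supp ?H \<subseteq> ?K" by auto
  qed
  finally show ?thesis .
qed

text \<open>
  The reduction to one shape is carried out modulo the intersection of the two ideals, so that it changes neither the
  seminorm nor the image. After it, \<open>combination_bound\<close> applies.
\<close>

theorem seminorm_dominated:
  assumes p: "cstar_seminorm (free_star_algebra S) p"
    and rel: "\<forall>(y, z)\<in>ck_relations R M1 M2. p (sdiff (free_star_algebra S) y z) = 0"
    and y: "y \<in> carrier (free_star_algebra S)"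
  shows "p y \<le> l1_norm (free_lift V y)"
proof -
  define q where "q = (\<lambda>y. p (restrict_letters S y))"
  interpret q: cstar_ring q unfolding q_def by (rule restricted_cstar_ring[OF p])
  let ?N = "{y. q y = 0}" and ?L = "{y. lift y = (\<lambda>_ _. 0)}"
  have relN: "y - z \<in> ?N" if "(restrict_letters S y, restrict_letters S z) \<in> ck_relations R M1 M2" for y z
    using bspec[OF rel that] by (simp add: q_def restrict_letters_diff)
  have relL: "y - z \<in> ?L" if r: "(restrict_letters S y, restrict_letters S z) \<in> ck_relations R M1 M2" for y z
  proof -
    obtain y' z' where "restrict_letters S y = restrict_letters S y'" "restrict_letters S z = restrict_letters S z'"
      "lift y' = lift z'" using relation_cases[OF r] by blast
    then have "lift y = lift z" by (simp add: lift_def)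
    then show ?thesis by (simp add: lift_diff)
  qed
  have preN: "ck_prefamily ?N W word_shape word_end steps mul U (\<lambda>u v. gen (u, v))"
    by (rule word_prefamily[OF q.null.star_ideal_axioms relN])
  have orthN: "gen (u, u) * gen (v, v) \<in> ?N"
    if "u \<in> W" "v \<in> W" "word_shape u = word_shape v" "u \<noteq> v" for u v
  proof -
    have "q.null.eqv (gen (u, u) * gen (v, v)) 0"
    proof (rule q.same_shape_orth[OF preN _ _ _ that])
      show "finite (steps e r)" for e r by (rule finite_steps)
      show "\<exists>u'\<in>W. \<exists>w\<in>steps e (word_end u'). word_shape u' = k \<and> u = mul u' w"
        if "u \<in> W" "e \<in> {(1, 0), (0, 1)}" "word_shape u = k + e" for u k e by (rule word_split[OF that])
      show "q.null.eqv (gen (u, u) * gen (v, v)) 0"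
        if "u \<in> W" "v \<in> W" "word_shape u = 0" "word_shape v = 0" "u \<noteq> v" for u v
        unfolding q.null.eqv_def by (rule relN[OF relation_orth[OF that]])
    qed
    then show ?thesis by (simp add: q.null.eqv_zero_iff)
  qed
  have orthL: "gen (u, u) * gen (v, v) \<in> ?L"
    if "u \<in> W" "v \<in> W" "word_shape u = word_shape v" "u \<noteq> v" for u v
    using V_orth[OF that] that by (simp add: lift_mult lift_gen S_iff)
  have famN: "ck_family ?N W word_shape word_end steps mul U (\<lambda>u v. gen (u, v))"
  proof (intro ck_family.intro[OF preN] ck_family_axioms.intro)
    fix u v assume uv: "u \<in> W" "v \<in> W" "word_shape u = word_shape v" "u \<noteq> v"
    show "q.null.eqv (gen (u, u) * gen (v, v)) 0" unfolding q.null.eqv_zero_iff by (rule orthN[OF uv])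
  qed
  have J: "star_ideal (?N \<inter> ?L)" by (rule star_ideal_Int[OF q.null.star_ideal_axioms lift_ideal])
  have preJ: "ck_prefamily (?N \<inter> ?L) W word_shape word_end steps mul U (\<lambda>u v. gen (u, v))"
    by (rule word_prefamily[OF J]) (rule IntI[OF relN relL])
  interpret f: ck_family "?N \<inter> ?L" W word_shape word_end steps mul U "\<lambda>u v. gen (u, v)"
  proof (intro ck_family.intro[OF preJ] ck_family_axioms.intro)
    fix u v assume uv: "u \<in> W" "v \<in> W" "word_shape u = word_shape v" "u \<noteq> v"
    show "star_ideal.eqv (?N \<inter> ?L) (gen (u, u) * gen (v, v)) 0"
      unfolding star_ideal.eqv_zero_iff[OF J] by (rule IntI[OF orthN[OF uv] orthL[OF uv]])
  qed
  have letter: "f.spanned f.good (monomial [(s, b)])" if s: "s \<in> S" for s b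
  proof -
    obtain u v where uv: "s = (u, v)" by (rule prod.exhaust)
    have good: "f.good u v" "f.good v u" using s uv by (auto simp: S_iff f.good_def)
    show ?thesis
    proof (cases b)
      case True
      have "f.eqv (adj (gen (u, v))) (gen (v, u))" using good(1) by (intro f.s_adj) (auto simp: f.good_def)
      from f.spanned_eqv[OF this f.spanned_gen[of f.good, OF good(2)]] show ?thesis
        using True uv by (simp add: monomial_single)
    next
      case False
      from f.spanned_gen[of f.good, OF good(1)] show ?thesis using False uv by (simp add: monomial_single)
    qed
  qed
  have mono: "f.spanned f.good (monomial z)" if "z \<in> lists (S \<times> UNIV)" "z \<noteq> []" for z
    using that(2,1)
  proof (induction z rule: list_nonempty_induct)
    case (single l)
    then show ?case using letter[of "fst l" "snd l"] by (cases l) auto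
  next
    case (cons l z)
    have "monomial (l # z) = monomial [l] * monomial z" using monomial_append[of "[l]" z] cons(1) by simp
    moreover have "f.spanned f.good (monomial [l])" using letter[of "fst l" "snd l"] cons(3) by (cases l) auto
    moreover have "f.spanned f.good (monomial z)" using cons by simp
    ultimately show ?case using f.spanned_mult[of f.good _ f.good _ f.good] f.gen_mult_spanned by simp
  qed
  have ry: "restrict_letters S (Abs_fsa y) = y" by (rule restrict_letters_Abs[OF y])
  have Ry: "Rep_fsa (Abs_fsa y) = y" by (rule Abs_fsa_inverse[OF free_carrier_mono[OF y]])
  have "f.spanned f.good (\<Sum>z | y z \<noteq> 0. y z *\<^sub>C monomial z)"
    using y by (intro f.spanned_sum f.spanned_scC mono) (simp_all add: free_carrier)
  then have "f.spanned f.good (Abs_fsa y)" using fsa_expansion[of "Abs_fsa y"] Ry by simp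
  then obtain y1 where y1: "y1 \<in> lin (\<lambda>u v. gen (u, v)) f.good" "f.eqv (Abs_fsa y) y1" by (rule bexE)
  from f.common_shape[OF y1(1)] obtain k0 where
    "\<forall>k. f.spanned (\<lambda>u v. f.good u v \<and> word_shape v = k0 + k) y1" ..
  from spec[OF this, of 0] obtain y2 where
    y2: "y2 \<in> lin (\<lambda>u v. gen (u, v)) (\<lambda>u v. f.good u v \<and> word_shape v = k0 + 0)" "f.eqv y1 y2" by (rule bexE)
  from lin_finite_sum[OF y2(1)] obtain F c where F: "finite F" "\<forall>(u, v)\<in>F. f.good u v \<and> word_shape v = k0 + 0"
    "y2 = (\<Sum>(u, v)\<in>F. c u v *\<^sub>C gen (u, v))" by (elim exE conjE)
  have FS: "F \<subseteq> S" using F(2) by (auto simp: f.good_def S_iff)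
  have shF: "word_shape v = k0" if "(u, v) \<in> F" for u v using bspec[OF F(2) that] by simp
  have eq: "Abs_fsa y - y2 \<in> ?N \<inter> ?L" using f.eqv_trans[OF y1(2) y2(2)] unfolding f.eqv_def .
  have lift_eq: "lift (Abs_fsa y) = lift y2" using eq by (simp add: lift_diff fun_eq_iff)
  have "lift y2 = (\<lambda>g \<omega>. \<Sum>(u, v)\<in>F. c u v * V (u, v) g \<omega>)"
    unfolding F(3) case_prod_beta lift_sum
    by (intro ext sum.cong HOL.refl) (use FS in \<open>auto simp: lift_gen\<close>)
  then have lift_y: "free_lift V y = (\<lambda>g \<omega>. \<Sum>(u, v)\<in>F. c u v * V (u, v) g \<omega>)"
    using lift_eq by (simp add: lift_def ry)
  have "p y = q (Abs_fsa y)" by (simp add: q_def ry)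
  also have "\<dots> = q y2" by (rule q.p_cong) (use eq in \<open>simp add: q.null.eqv_def\<close>)
  also have "\<dots> \<le> l1_norm (\<lambda>g \<omega>. \<Sum>(u, v)\<in>F. c u v * V (u, v) g \<omega>)"
    unfolding F(3) by (rule combination_bound[OF q.cstar_ring_axioms famN F(1) FS shF])
  finally show ?thesis by (simp add: lift_y)
qed

section \<open>Density\<close>

text \<open>
  Far out, a translate of a rectangle based at \<open>x\<close> is the last part of a rectangle based at \<open>x\<close>, since the
  sector of an end at \<open>g x\<close> and its sector at \<open>x\<close> have a common subsector.
\<close>

lemma translated_cylinders:
  assumes g: "g \<in> carrier \<Gamma>" and f: "f \<in> cont_fun X" and e: "e > 0"
  shows "\<exists>k0. \<forall>k\<ge>k0. \<forall>v\<in>W. word_shape v = (k, k) \<longrightarrow> (\<exists>u. (u, v) \<in> S \<and> quot u v = g \<and>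
    (\<forall>y\<in>U u. \<forall>y'\<in>U u. cmod (f (end_class y) - f (end_class y')) < e))"
proof -
  \<comment> \<open>Sectors at \<open>x\<close> are described by sequences as seen from \<open>x\<close>, where \<open>g\<close> becomes its conjugate.\<close>
  define d where "d = ginv x \<cdot> (g \<cdot> x)"
  have d: "d \<in> carrier \<Gamma>" and gx: "g \<cdot> x \<in> carrier \<Gamma>" using g x by (simp_all add: d_def)
  have xd: "x \<cdot> d = g \<cdot> x" unfolding d_def using g x by (simp flip: \<Gamma>.m_assoc)
  from translate_vert[OF d] obtain N1 where N1: "\<forall>z\<in>ends. \<forall>i\<ge>N1. \<forall>j\<ge>N1. \<exists>i' j'. i \<le> i' + N1 \<and> j \<le> j' + N1 \<and>
    d \<cdot> vert z i j = vert (gact d z) i' j'" ..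
  from agree_translate[OF gx] obtain N2 where N2: "\<forall>z\<in>red_pairs. \<forall>z'\<in>red_pairs. \<forall>m n.
    agree (m + N2) (n + N2) z z' \<longrightarrow> agree m n (gact (g \<cdot> x) z) (gact (g \<cdot> x) z')" ..
  from cont_fun_uniform[OF f e] obtain n where n: "\<forall>y\<in>ends. \<forall>y'\<in>ends. agree n n y y' \<longrightarrow>
    cmod (f (end_class y) - f (end_class y')) < e" ..
  have "\<exists>u. (u, v) \<in> S \<and> quot u v = g \<and>
      (\<forall>y\<in>U u. \<forall>y'\<in>U u. cmod (f (end_class y) - f (end_class y')) < e)"
    if k: "k \<ge> N1 + (N2 + n)" and v: "v \<in> W" "word_shape v = (k, k)" for k v
  proof -
    obtain z i j where "z \<in> ends" "v = word z i j" using v(1) by (rule W_cases)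
    then have z: "z \<in> ends" "v = word z k k" using v(2) by simp_all
    have "\<exists>i' j'. k \<le> i' + N1 \<and> k \<le> j' + N1 \<and> d \<cdot> vert z k k = vert (gact d z) i' j'"
      using bspec[OF N1 z(1)] k by simp
    then obtain i' j' where ij: "d \<cdot> vert z k k = vert (gact d z) i' j'" by blast
    define u where "u = word (gact d z) i' j'"
    have dz: "gact d z \<in> ends" by (rule gact_ends[OF d z(1)])
    have vc: "vert z k k \<in> carrier \<Gamma>" using z(1) by simp
    have uW: "u \<in> W" unfolding u_def by (rule word_W[OF dz])
    have "pos (gact d z) i' j' = gact (ginv (d \<cdot> vert z k k)) (gact d z)"
      using pos_vert[OF dz, of i' j'] ij by simp
    also have "\<dots> = gact (ginv (vert z k k)) (gact (ginv d) (gact d z))"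
      using d vc ends_red[OF dz] by (simp add: \<Gamma>.inv_mult_group gact_mult)
    also have "\<dots> = pos z k k" using pos_vert[OF z(1), of k k] ends_red[OF z(1)] d by (simp add: gact_inv_cancel)
    finally have "word_end u = word_end v" using z(2) by (simp add: u_def)
    then have uv: "(u, v) \<in> S" using uW v(1) by (simp add: S_iff)
    have "base u = x \<cdot> (d \<cdot> vert z k k)" using base_word[OF dz, of i' j'] ij by (simp add: u_def)
    also have "\<dots> = g \<cdot> x \<cdot> vert z k k" using x d vc by (simp add: xd flip: \<Gamma>.m_assoc)
    also have "\<dots> = g \<cdot> base v" using base_word[OF z(1), of k k] z(2) g x vc by (simp add: \<Gamma>.m_assoc)
    finally have quot: "quot u v = g" using base_closed[OF v(1)] g by (simp add: quot_def \<Gamma>.m_assoc)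
    have inv: "quot v u = ginv g" using quot_inv[OF uW v(1)] quot by simp
    have near: "agree (Suc k) (Suc k) (gact (ginv (g \<cdot> x)) y) z" if y: "y \<in> U u" for y
    proof -
      have ye: "y \<in> ends" by (rule U_ends[OF y])
      have "gact (ginv g) y \<in> U v" using U_quot[OF uv ye] y inv by simp
      then have "agree (Suc k) (Suc k) (gact (ginv x) (gact (ginv g) y)) z"
        using U_word[OF z(1) gact_ends[OF \<Gamma>.inv_closed[OF g] ye], of k k] z(2) by simp
      then show ?thesis using g x ends_red[OF ye] by (simp add: \<Gamma>.inv_mult_group gact_mult)
    qed
    have "cmod (f (end_class y) - f (end_class y')) < e" if y: "y \<in> U u" "y' \<in> U u" for y y'
    proof -
      let ?t = "gact (ginv (g \<cdot> x))"
      have ye: "y \<in> ends" "y' \<in> ends" using U_ends[OF y(1)] U_ends[OF y(2)] .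
      have "agree (Suc k) (Suc k) (?t y) (?t y')"
        by (rule agree_trans[OF near[OF y(1)] agree_sym[OF near[OF y(2)]]])
      then have "agree (n + N2) (n + N2) (?t y) (?t y')" by (rule agree_mono) (use k in simp_all)
      moreover have "?t y \<in> red_pairs" "?t y' \<in> red_pairs"
        using gact_red[OF \<Gamma>.inv_closed[OF gx]] ends_red[OF ye(1)] ends_red[OF ye(2)] by auto
      ultimately have "agree n n (gact (g \<cdot> x) (?t y)) (gact (g \<cdot> x) (?t y'))"
        using N2[rule_format, of "?t y" "?t y'" n n] by simp
      then have "agree n n y y'"
        using gact_inv_cancel(2)[OF gx] ends_red[OF ye(1)] ends_red[OF ye(2)] by simp
      then show ?thesis by (rule n[rule_format, OF ye])
    qed
    then show ?thesis using uv quot by (intro exI[of _ u] conjI ballI)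
  qed
  then show ?thesis by (intro exI[of _ "N1 + (N2 + n)"] allI impI ballI)
qed

text \<open>
  Only finitely many group elements carry a coefficient, so one shape \<open>(k, k)\<close> serves for all of them. The sets
  \<open>U u\<close> with \<open>quot u v = g\<close> are the translates by \<open>g\<close> of the cylinder sets of the words \<open>v\<close> of this shape and so
  partition the boundary.
\<close>

theorem free_lift_dense:
  assumes F: "F \<in> carrier P" and e: "e > 0"
  shows "\<exists>a\<in>carrier (free_star_algebra S). l1_norm (sdiff P F (free_lift V a)) < e"
proof -
  let ?K = "supp F"
  \<comment> \<open>The summand 1 covers the case of empty support.\<close>
  define e' where "e' = e / (real (card ?K) + 1)"
  have e': "e' > 0" using e by (simp add: e'_def)
  have fin: "finite ?K" and K: "?K \<subseteq> carrier \<Gamma>" using supp_finite[OF F] supp_subset[OF F] .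
  have "\<forall>g\<in>?K. \<exists>k0. \<forall>k\<ge>k0. \<forall>v\<in>W. word_shape v = (k, k) \<longrightarrow> (\<exists>u. (u, v) \<in> S \<and> quot u v = g \<and>
    (\<forall>y\<in>U u. \<forall>y'\<in>U u. cmod (F g (end_class y) - F g (end_class y')) < e'))"
    using K by (intro ballI translated_cylinders[OF _ P_cont[OF F] e']) (rule subsetD)
  from bchoice[OF this] obtain k0 where k0: "\<forall>g\<in>?K. \<forall>k\<ge>k0 g. \<forall>v\<in>W. word_shape v = (k, k) \<longrightarrow>
    (\<exists>u. (u, v) \<in> S \<and> quot u v = g \<and>
    (\<forall>y\<in>U u. \<forall>y'\<in>U u. cmod (F g (end_class y) - F g (end_class y')) < e'))" ..
  define k where "k = (\<Sum>g\<in>?K. k0 g)"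
  let ?Wk = "{v \<in> W. word_shape v = (k, k)}"
  have finW: "finite ?Wk" by (rule finite_words)
  have "\<forall>r\<in>?K \<times> ?Wk. \<exists>u. (u, snd r) \<in> S \<and> quot u (snd r) = fst r \<and>
    (\<forall>y\<in>U u. \<forall>y'\<in>U u. cmod (F (fst r) (end_class y) - F (fst r) (end_class y')) < e')"
  proof
    fix r assume r: "r \<in> ?K \<times> ?Wk"
    then have g: "fst r \<in> ?K" and v: "snd r \<in> W" "word_shape (snd r) = (k, k)" by (simp_all add: mem_Times_iff)
    have "k0 (fst r) \<le> k" unfolding k_def using fin g by (intro member_le_sum) simp_all
    from k0[rule_format, OF g this v] show "\<exists>u. (u, snd r) \<in> S \<and> quot u (snd r) = fst r \<and>
      (\<forall>y\<in>U u. \<forall>y'\<in>U u. cmod (F (fst r) (end_class y) - F (fst r) (end_class y')) < e')" .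
  qed
  from bchoice[OF this] obtain t where t: "\<forall>r\<in>?K \<times> ?Wk. (t r, snd r) \<in> S \<and> quot (t r) (snd r) = fst r \<and>
    (\<forall>y\<in>U (t r). \<forall>y'\<in>U (t r). cmod (F (fst r) (end_class y) - F (fst r) (end_class y')) < e')" ..
  define c where "c r = F (fst r) (end_class (SOME y. y \<in> U (t r)))" for r
  have c: "cmod (F g (end_class y) - c (g, v)) < e'" if "g \<in> ?K" "v \<in> ?Wk" "y \<in> U (t (g, v))" for g v y
  proof -
    have "(g, v) \<in> ?K \<times> ?Wk" using that by simp
    from bspec[OF t this]
    have osc: "\<forall>y\<in>U (t (g, v)). \<forall>y'\<in>U (t (g, v)). cmod (F g (end_class y) - F g (end_class y')) < e'" by simp
    have "(SOME y. y \<in> U (t (g, v))) \<in> U (t (g, v))" using that(3) by (rule someI)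
    from bspec[OF bspec[OF osc that(3)] this] show ?thesis unfolding c_def fst_conv .
  qed
  define a where "a = (\<Sum>r\<in>?K \<times> ?Wk. c r *\<^sub>C gen (t r, snd r))"
  define H where "H = free_lift V (restrict_letters S a)"
  have "lift (gen (t r, snd r)) = V (t r, snd r)" if "r \<in> ?K \<times> ?Wk" for r
    by (rule lift_gen) (rule conjunct1[OF bspec[OF t that]])
  then have Ha: "H = (\<lambda>g \<omega>. \<Sum>r\<in>?K \<times> ?Wk. c r * V (t r, snd r) g \<omega>)"
    unfolding H_def lift_def[symmetric] a_def lift_sum by (intro ext sum.cong HOL.refl) (simp only:)
  have V: "V (t (g', v), v) g \<omega> = (if g' = g then ind (t (g', v)) \<omega> else 0)" if "g' \<in> ?K" "v \<in> ?Wk" for g' v g \<omega>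
  proof -
    have "(g', v) \<in> ?K \<times> ?Wk" using that by simp
    from bspec[OF t this] show ?thesis by (simp add: V_def single_def eq_commute)
  qed
  have H: "H g \<omega> = (if g \<in> ?K then \<Sum>v\<in>?Wk. c (g, v) * ind (t (g, v)) \<omega> else 0)" for g \<omega>
  proof -
    have "H g \<omega> = (\<Sum>g'\<in>?K. \<Sum>v\<in>?Wk. c (g', v) * V (t (g', v), v) g \<omega>)"
      unfolding Ha sum.cartesian_product by (rule sum.cong) (simp_all add: case_prod_beta)
    also have "\<dots> = (\<Sum>g'\<in>?K. if g' = g then \<Sum>v\<in>?Wk. c (g, v) * ind (t (g, v)) \<omega> else 0)"
      by (intro sum.cong HOL.refl) (simp add: V)
    finally show ?thesis using fin by (simp add: sum.delta)
  qed
  have near: "cmod (F g \<omega> - H g \<omega>) \<le> e'" if g: "g \<in> ?K" for g \<omega>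
  proof (cases "\<omega> \<in> boundary D")
    case False
    then have "F g \<omega> = 0" using P_outside[OF F, of g \<omega>] topspace_boundary[OF x] by simp
    moreover have "H g \<omega> = 0" unfolding H using False by (simp add: ind_outside)
    ultimately show ?thesis using e' by simp
  next
    case True
    define y where "y = end_of \<omega>"
    have y: "y \<in> ends" "end_class y = \<omega>" unfolding y_def using True by (simp_all add: end_of_ends class_end_of)
    have gc: "g \<in> carrier \<Gamma>" using g K by (rule_tac subsetD)
    have gy: "gact (ginv g) y \<in> ends" by (rule gact_ends[OF \<Gamma>.inv_closed[OF gc] y(1)])
    define v0 where "v0 = word (gact (ginv x) (gact (ginv g) y)) k k"
    have v0: "v0 \<in> ?Wk" unfolding v0_def using word_W[OF gact_ends[OF \<Gamma>.inv_closed[OF x] gy]] by simp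
    have iff: "y \<in> U (t (g, v)) \<longleftrightarrow> v = v0" if v: "v \<in> ?Wk" for v
    proof -
      have "(g, v) \<in> ?K \<times> ?Wk" using g v by simp
      from bspec[OF t this] have uv: "(t (g, v), v) \<in> S" and q: "quot (t (g, v)) v = g" by simp_all
      have "quot v (t (g, v)) = ginv g" using quot_inv[of "t (g, v)" v] uv q by (simp add: S_iff)
      then have 1: "y \<in> U (t (g, v)) \<longleftrightarrow> gact (ginv g) y \<in> U v" using U_quot[OF uv y(1)] by simp
      have "v \<in> W" using v by simp
      then obtain z i j where "z \<in> ends" "v = word z i j" by (rule W_cases)
      then have z: "z \<in> ends" "v = word z k k" using v by simp_all
      show ?thesis unfolding 1 unfolding z(2) unfolding U_word_iff[OF z(1) gy] v0_def by (rule eq_commute)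
    qed
    have "H g \<omega> = (\<Sum>v\<in>?Wk. if v = v0 then c (g, v0) else 0)"
      unfolding H if_P[OF g]
    proof (rule sum.cong[OF HOL.refl])
      fix v assume "v \<in> ?Wk"
      from iff[OF this] show "c (g, v) * ind (t (g, v)) \<omega> = (if v = v0 then c (g, v0) else 0)"
        using True by (simp add: ind_def y_def)
    qed
    also have "\<dots> = c (g, v0)" using v0 finW by (simp add: sum.delta)
    finally show ?thesis using c[OF g v0 iffD2[OF iff[OF v0] HOL.refl]] y(2) by simp
  qed
  have "supp (sdiff P F H) \<subseteq> ?K"
  proof
    fix g assume "g \<in> supp (sdiff P F H)"
    then obtain \<omega> where "F g \<omega> - H g \<omega> \<noteq> 0" by (auto simp: P_diff fun_eq_iff)
    then show "g \<in> ?K" using H[of g \<omega>] by (cases "g \<in> ?K") (auto simp: fun_eq_iff)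
  qed
  then have "l1_norm (sdiff P F H) = (\<Sum>g\<in>?K. sup_norm (sdiff P F H g))" by (rule l1_norm_eq[OF fin])
  also have "\<dots> \<le> (\<Sum>g\<in>?K. e')"
    by (rule sum_mono, rule sup_norm_le) (simp only: P_diff near)
  also have "\<dots> < e" using e by (simp add: e'_def field_simps)
  finally show ?thesis unfolding H_def by (intro bexI[OF _ restrict_letters_closed])
qed

theorem crossed_product_iso:
  "cstar_isomorphic (boundary_crossed_product D x) (rank2_cuntz_krieger R M1 M2)"
  unfolding boundary_crossed_product_def full_crossed_product_def rank2_cuntz_krieger_def ck_free_def
proof (rule enveloping_iso_of_dominated[OF free_star_alg l1_star_seminorm free_lift_hom])
  show "q F \<le> l1_norm F" if "cstar_seminorm P q" "F \<in> carrier P" for q F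
    by (rule cstar_seminorm_le_l1[OF that])
  show "\<exists>a\<in>carrier (free_star_algebra S). l1_norm (sdiff P F (free_lift V a)) < e"
    if "F \<in> carrier P" "e > 0" for F e by (rule free_lift_dense[OF that])
  show "ck_relations R M1 M2 \<subseteq> carrier (free_star_algebra S) \<times> carrier (free_star_algebra S)"
  proof (rule subrelI)
    fix a b assume "(a, b) \<in> ck_relations R M1 M2"
    from relation_cases[OF this]
    show "(a, b) \<in> carrier (free_star_algebra S) \<times> carrier (free_star_algebra S)"
      using restrict_letters_closed by auto
  qed
  show "free_lift V a = free_lift V b" if "(a, b) \<in> ck_relations R M1 M2" for a b
    using relation_cases[OF that] by (auto simp: lift_def)
  show "p y \<le> l1_norm (free_lift V y)"
    if "cstar_seminorm (free_star_algebra S) p"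
      "\<forall>(y, z)\<in>ck_relations R M1 M2. p (sdiff (free_star_algebra S) y z) = 0"
      "y \<in> carrier (free_star_algebra S)" for p y
    by (rule seminorm_dominated[OF that])
qed

end

theorem theorem5p1:
  fixes D :: "('a, 'b) bm_data" and x :: "('a, 'b) bm_elt"
  assumes "BM_data D"
    and "x \<in> carrier (bm_group D)"
  shows "cstar_isomorphic (boundary_crossed_product D x)
           (rank2_cuntz_krieger (Rset D) (trans1 D) (trans2 D))"
proof -
  interpret BM_boundary D x
    using assms by (simp add: BM_boundary_def BM_boundary_axioms_def)
  show ?thesis by (rule crossed_product_iso)
qed

end
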